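(* Let $d\ge4$ be an integer, let $\Omega\subset\mathbb{R}^d$ be an open bounded domain, let $a,b>0$ be two fixed numbers such that $a^{\frac{d-4}{2}}b>\mathtt{PS}_d$, and let $p\in(2,2^* )$. Then there exists $\lambda^*>0$ such that for each compact interval $[\alpha,\beta]\subset(\lambda^*,+\infty)$ there exists $r>0$ with the following property: for every $\lambda\in[\alpha,\beta]$ and for every $g\in\mathcal{A}$ there exists $\mu^*>0$ such that for each $\mu\in[0,\mu^*]$ the problem $$-\left(a+b\int_\Omega|\nabla u|^2\right)\Delta u=|u|^{2^*-2}u+\lambda|u|^{p-2}u+\mu g(x,u)\ \text{ in }\Omega,\qquad u=0\ \text{ on }\partial\Omega$$ has at least three weak solutions in $H_0^1(\Omega)$ whose norms $\|\cdot\|$ are less than $r$.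
   Context: Here $2^*=\frac{2d}{d-2}$; $H_0^1(\Omega)$ is the usual Sobolev space of real-valued functions with norm $\|u\|=\left(\int_\Omega|\nabla u|^2\right)^{1/2}$, and $\|u\|_q=\left(\int_\Omega|u|^q\right)^{1/q}$. The sharp Sobolev constant is $$\mathtt{S}_d=\inf_{u\in H_0^1(\Omega)\setminus\{0\}}\frac{\|u\|^2}{\|u\|_{2^*}^2},$$ which depends only on $d$. The constant $\mathtt{PS}_d$ is $$\mathtt{PS}_d=\frac{2(d-4)^{\frac{d-4}{2}}}{(d-2)^{\frac{d-2}{2}}\mathtt{S}_d^{\frac d2}}\ \text{ if } d>4,\qquad \mathtt{PS}_4=\frac{1}{\mathtt{S}_4^2}.$$ $\mathcal{A}$ is the class of Carathéodory functions $\varphi:\Omega\times\mathbb{R}\to\mathbb{R}$ such that $$\sup_{(x,t)\in\Omega\times\mathbb{R}}\frac{|\varphi(x,t)|}{1+|t|^{q-1}}<+\infty$$ for some $1<q<2^*$ ($q$ may depend on $\varphi$). A weak solution of the problem is a function $u\in H_0^1(\Omega)$ such that $$(a+b\|u\|^2)\int_\Omega\nabla u\cdot\nabla v=\int_\Omega|u|^{2^*-2}uv+\lambda\int_\Omega|u|^{p-2}uv+\mu\int_\Omega g(x,u)v\qquad\text{for all }v\in H_0^1(\Omega).$$ *)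

theory Defs
  imports "HOL-Analysis.Analysis"
begin

text \<open>
  Throughout, \<open>\<Omega>\<close> is a subset of a Euclidean space \<open>'a\<close> of dimension \<open>d = DIM('a)\<close>.
  Elements of Lebesgue and Sobolev spaces on \<open>\<Omega>\<close> are represented by functions on the whole
  type, whose values outside \<open>\<Omega>\<close> are irrelevant; two functions represent the same element iff
  they are equal almost everywhere in \<open>\<Omega>\<close>.
\<close>

definition ae_eq :: "'a::euclidean_space set \<Rightarrow> ('a \<Rightarrow> real) \<Rightarrow> ('a \<Rightarrow> real) \<Rightarrow> bool" where
  "ae_eq \<Omega> u v \<longleftrightarrow> (AE x in lebesgue_on \<Omega>. u x = v x)"

definition L2 :: "'a::euclidean_space set \<Rightarrow> ('a \<Rightarrow> 'b::euclidean_space) set" where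
  "L2 \<Omega> = {f \<in> borel_measurable (lebesgue_on \<Omega>). integrable (lebesgue_on \<Omega>) (\<lambda>x. (norm (f x))\<^sup>2)}"

abbreviation partial_deriv :: "'a::euclidean_space \<Rightarrow> ('a \<Rightarrow> real) \<Rightarrow> 'a \<Rightarrow> real" where
  "partial_deriv i f \<equiv> (\<lambda>x. frechet_derivative f (at x) i)"

definition gradient :: "('a::euclidean_space \<Rightarrow> real) \<Rightarrow> 'a \<Rightarrow> 'a" where
  "gradient f x = (\<Sum>i\<in>Basis. partial_deriv i f x *\<^sub>R i)"

primrec Ck :: "nat \<Rightarrow> ('a::euclidean_space \<Rightarrow> real) \<Rightarrow> bool" where
  "Ck 0 f \<longleftrightarrow> continuous_on UNIV f"
| "Ck (Suc k) f \<longleftrightarrow> (\<forall>x. f differentiable (at x)) \<and> (\<forall>i\<in>Basis. Ck k (partial_deriv i f))"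

text \<open>The space of infinitely differentiable functions with compact support in \<open>\<Omega>\<close>
  (extended by zero to the whole space).\<close>

definition test_functions :: "'a::euclidean_space set \<Rightarrow> ('a \<Rightarrow> real) set" where
  "test_functions \<Omega> =
     {f. (\<forall>k. Ck k f) \<and> compact (closure {x. f x \<noteq> 0}) \<and> closure {x. f x \<noteq> 0} \<subseteq> \<Omega>}"

definition is_weak_gradient ::
    "'a::euclidean_space set \<Rightarrow> ('a \<Rightarrow> real) \<Rightarrow> ('a \<Rightarrow> 'a) \<Rightarrow> bool" where
  "is_weak_gradient \<Omega> u G \<longleftrightarrow>
     (\<forall>f\<in>test_functions \<Omega>. \<forall>i\<in>Basis.
        (LINT x|lebesgue_on \<Omega>. u x * partial_deriv i f x) =
        - (LINT x|lebesgue_on \<Omega>. (G x \<bullet> i) * f x))"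

definition H1 :: "'a::euclidean_space set \<Rightarrow> ('a \<Rightarrow> real) set" where
  "H1 \<Omega> = {u \<in> L2 \<Omega>. \<exists>G\<in>L2 \<Omega>. is_weak_gradient \<Omega> u G}"

text \<open>For \<open>u\<close> in \<open>H1 \<Omega>\<close> with \<open>\<Omega>\<close> open, the weak gradient is unique up to a null set, so
  the choice below does not affect any integral.\<close>

definition weak_gradient :: "'a::euclidean_space set \<Rightarrow> ('a \<Rightarrow> real) \<Rightarrow> 'a \<Rightarrow> 'a" where
  "weak_gradient \<Omega> u = (SOME G. G \<in> L2 \<Omega> \<and> is_weak_gradient \<Omega> u G)"

text \<open>The closure of the test functions in \<open>H1 \<Omega>\<close>.\<close>

definition H01 :: "'a::euclidean_space set \<Rightarrow> ('a \<Rightarrow> real) set" where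
  "H01 \<Omega> = {u \<in> H1 \<Omega>. \<exists>f. (\<forall>n::nat. f n \<in> test_functions \<Omega>) \<and>
     (\<lambda>n. (LINT x|lebesgue_on \<Omega>. (f n x - u x)\<^sup>2) +
          (LINT x|lebesgue_on \<Omega>. (norm (gradient (f n) x - weak_gradient \<Omega> u x))\<^sup>2))
       \<longlonglongrightarrow> 0}"

definition H01_norm :: "'a::euclidean_space set \<Rightarrow> ('a \<Rightarrow> real) \<Rightarrow> real" where
  "H01_norm \<Omega> u = (LINT x|lebesgue_on \<Omega>. (norm (weak_gradient \<Omega> u x))\<^sup>2) powr (1/2)"

definition Lq_norm :: "'a::euclidean_space set \<Rightarrow> real \<Rightarrow> ('a \<Rightarrow> real) \<Rightarrow> real" where
  "Lq_norm \<Omega> q u = (LINT x|lebesgue_on \<Omega>. \<bar>u x\<bar> powr q) powr (1/q)"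

definition crit_exp :: "nat \<Rightarrow> real" where
  "crit_exp d = 2 * real d / (real d - 2)"

text \<open>The sharp Sobolev constant; its value is independent of the nonempty open set \<open>\<Omega>\<close>.\<close>

definition sobolev_const :: "'a::euclidean_space set \<Rightarrow> real" where
  "sobolev_const \<Omega> =
     (INF u\<in>{u \<in> H01 \<Omega>. \<not> ae_eq \<Omega> u (\<lambda>x. 0)}.
        (H01_norm \<Omega> u)\<^sup>2 / (Lq_norm \<Omega> (crit_exp DIM('a)) u)\<^sup>2)"

text \<open>Only meaningful for \<open>DIM('a) \<ge> 4\<close>.\<close>

definition PS_const :: "'a::euclidean_space set \<Rightarrow> real" where
  "PS_const \<Omega> =
     (let d = real DIM('a); S = sobolev_const \<Omega> in
      if DIM('a) = 4 then 1 / S\<^sup>2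
      else 2 * (d - 4) powr ((d - 4) / 2) / ((d - 2) powr ((d - 2) / 2) * S powr (d / 2)))"

definition caratheodory :: "'a::euclidean_space set \<Rightarrow> ('a \<Rightarrow> real \<Rightarrow> real) \<Rightarrow> bool" where
  "caratheodory \<Omega> g \<longleftrightarrow>
     (\<forall>t. (\<lambda>x. g x t) \<in> borel_measurable (lebesgue_on \<Omega>)) \<and>
     (AE x in lebesgue_on \<Omega>. continuous_on UNIV (g x))"

definition class_A :: "'a::euclidean_space set \<Rightarrow> ('a \<Rightarrow> real \<Rightarrow> real) set" where
  "class_A \<Omega> = {g. caratheodory \<Omega> g \<and>
     (\<exists>q. 1 < q \<and> q < crit_exp DIM('a) \<and>
        bdd_above ((\<lambda>(x, t). \<bar>g x t\<bar> / (1 + \<bar>t\<bar> powr (q - 1))) ` (\<Omega> \<times> UNIV)))}"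

definition weak_solution ::
    "'a::euclidean_space set \<Rightarrow> real \<Rightarrow> real \<Rightarrow> real \<Rightarrow> real \<Rightarrow> real \<Rightarrow>
     ('a \<Rightarrow> real \<Rightarrow> real) \<Rightarrow> ('a \<Rightarrow> real) \<Rightarrow> bool" where
  "weak_solution \<Omega> a b p lam mu g u \<longleftrightarrow>
     u \<in> H01 \<Omega> \<and>
     (\<forall>v\<in>H01 \<Omega>.
        (a + b * (H01_norm \<Omega> u)\<^sup>2) *
          (LINT x|lebesgue_on \<Omega>. weak_gradient \<Omega> u x \<bullet> weak_gradient \<Omega> v x) =
        (LINT x|lebesgue_on \<Omega>. \<bar>u x\<bar> powr (crit_exp DIM('a) - 2) * u x * v x) +
        lam * (LINT x|lebesgue_on \<Omega>. \<bar>u x\<bar> powr (p - 2) * u x * v x) +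
        mu * (LINT x|lebesgue_on \<Omega>. g x (u x) * v x))"

end

theory Submission imports Defs "HOL-Library.Diagonal_Subsequence" begin

text \<open>Solutions are critical points of
  \<open>J u = a/2 * |u|^2 + b/4 * |u|^4 - \<integral> (|u|^q/q + \<lambda> * |u|^p/p + \<mu> * G(x,u))\<close>, where \<open>|u|\<close> is the norm
  of the gradient in \<open>L^2\<close> and \<open>q\<close> is the critical exponent. By Sobolev's inequality and the weighted
  AM-GM inequality, the assumption on \<open>PS_const\<close> says exactly that \<open>a + b * x - S powr (-q/2) * x powr ((q-2)/2)\<close>
  is bounded below by a positive constant for \<open>x \<ge> 0\<close>. Along a Palais--Smale sequence with weak limit \<open>u\<close>
  and differences \<open>v\<close> from it, the Brezis--Lieb lemma leaves this expression with \<open>x = |v|^2\<close>, times \<open>|v|^2\<close>,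
  as the only surviving term; hence \<open>v\<close> tends to \<open>0\<close> strongly and no energy is lost at any level.
  \<open>J\<close> is coercive, since \<open>q \<le> 4\<close> (with \<open>b\<close> dominating if \<open>q = 4\<close>). For large \<open>\<lambda>\<close> and \<open>\<mu> = 0\<close> there is a
  point beyond a small sphere at which \<open>J\<close> is negative, whereas \<open>J\<close> is nonnegative inside the sphere and bounded below
  by a positive number on it. These strict inequalities persist for small \<open>\<mu>\<close> and yield a global minimum
  outside the sphere, a local minimum inside and a mountain pass point. All three lie below a level that is
  uniform on \<open>[\<alpha>, \<beta>]\<close>, whence the bound \<open>r\<close>.\<close>

section \<open>Hilbert space preliminaries\<close>

text \<open>The critical power is not compact, so Rellich's theorem alone yields neither the uniform
  continuity of the derivative nor the Palais--Smale condition. For the former, the critical part is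
  estimated pointwise by a small multiple of \<open>|v|^q\<close> plus a large multiple of the q-th
  power of the difference, and only the subcritical part uses almost everywhere convergence. Two
  Sobolev constants occur: a crude one, from truncation at dyadic heights, which shows that
  \<open>sobolev_const\<close> is positive, and \<open>S powr (- q / 2)\<close>, read off the
  infimum, which enters the energy estimates. The order of the quantifiers rests on sign and growth.
  At \<mu> = 0 the power terms only lower the energy, so the mountain pass level is bounded by the
  Kirchhoff part along one fixed segment, for all \<lambda> at once. The \<mu>-term is at most a
  multiple of \<open>1 + |u|^4\<close>, because q \<le> 4, and is absorbed by the quartic
  coercivity. Hence the threshold for \<mu> depends on g, while r does not.\<close>

lemma quadratic_linear_eq_zero:
  fixes c d :: real
  assumes "\<And>t. 0 \<le> t * c + t\<^sup>2 * d"
  shows "c = 0"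
proof (rule ccontr)
  assume "c \<noteq> 0"
  \<comment> \<open>With \<open>e\<close> above \<open>d\<close>, the choice
    \<open>t = - c / e\<close> makes the linear term outweigh the quadratic one.\<close>
  define e where "e = \<bar>d\<bar> + 1"
  have e: "e > 0" "d < e" unfolding e_def by auto
  have "0 \<le> (- c / e) * c + (- c / e)\<^sup>2 * d" using assms .
  also have "\<dots> = (c\<^sup>2 / e) * (d / e - 1)"
    using e by (simp add: power2_eq_square field_simps)
  also have "\<dots> < 0"
    using e \<open>c \<noteq> 0\<close> by (intro mult_pos_neg) (auto simp: field_simps)
  finally show False by simp
qed

text \<open>The representing vector minimizes \<open>\<lambda>x. (norm x)\<^sup>2 / 2 - L x\<close>.\<close>

lemma riesz_representation:
  fixes X :: "'h::{real_inner,complete_space} set" and L :: "'h \<Rightarrow> real"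
  assumes X: "subspace X" "closed X"
    and add: "\<And>x y. x \<in> X \<Longrightarrow> y \<in> X \<Longrightarrow> L (x + y) = L x + L y"
    and scale: "\<And>c x. x \<in> X \<Longrightarrow> L (c *\<^sub>R x) = c * L x"
    and bdd: "\<And>x. x \<in> X \<Longrightarrow> \<bar>L x\<bar> \<le> C * norm x"
  shows "\<exists>z\<in>X. \<forall>x\<in>X. L x = z \<bullet> x"
proof -
  define Q where "Q x = (norm x)\<^sup>2 / 2 - L x" for x
  have Q_ge: "Q x \<ge> - C\<^sup>2 / 2" if "x \<in> X" for x
  proof -
    have "(norm x - C)\<^sup>2 \<ge> 0" by simp
    then have "C * norm x \<le> (norm x)\<^sup>2 / 2 + C\<^sup>2 / 2"
      by (simp add: power2_eq_square algebra_simps)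
    then show ?thesis using bdd[OF that] unfolding Q_def by linarith
  qed
  define m where "m = (INF x\<in>X. Q x)"
  have bb: "bdd_below (Q ` X)" using Q_ge by (auto intro!: bdd_belowI)
  have ne: "X \<noteq> {}" using X(1) subspace_0 by blast
  have m_le: "m \<le> Q x" if "x \<in> X" for x
    unfolding m_def using bb that by (rule cINF_lower)
  have "\<exists>x\<in>X. Q x < m + 1 / real (Suc n)" for n
    using cINF_less_iff[OF ne bb, of "m + 1 / real (Suc n)"] unfolding m_def by simp
  then obtain s where s: "\<And>n. s n \<in> X" "\<And>n. Q (s n) < m + 1 / real (Suc n)"
    by metis
  \<comment> \<open>The parallelogram identity at the midpoint, where \<open>Q\<close> is still at
    least \<open>m\<close>, bounds the distance of two near-minimizers by their excess; minimizing
    sequences are therefore Cauchy.\<close>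
  have par: "(norm (x - y))\<^sup>2 \<le> 4 * (Q x + Q y - 2 * m)" if "x \<in> X" "y \<in> X" for x y
  proof -
    have mem: "(1/2) *\<^sub>R (x + y) \<in> X" using X(1) that by (simp add: subspace_add subspace_scale)
    have "L ((1/2) *\<^sub>R (x + y)) = (L x + L y) / 2"
      using scale[of "x + y" "1/2"] add[OF that] subspace_add[OF X(1) that] by simp
    then have "Q ((1/2) *\<^sub>R (x + y)) = (norm (x + y))\<^sup>2 / 8 - (L x + L y) / 2"
      unfolding Q_def by (simp add: power_mult_distrib power2_eq_square)
    moreover have "(norm (x + y))\<^sup>2 + (norm (x - y))\<^sup>2 = 2 * (norm x)\<^sup>2 + 2 * (norm y)\<^sup>2"
      by (simp add: power2_norm_eq_inner inner_simps inner_commute)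
    ultimately have "Q ((1/2) *\<^sub>R (x + y)) = (Q x + Q y) / 2 - (norm (x - y))\<^sup>2 / 8"
      unfolding Q_def by (simp add: field_simps)
    with m_le[OF mem] show ?thesis by (simp add: field_simps)
  qed
  have "Cauchy s"
  proof (rule metric_CauchyI)
    fix e :: real assume e: "e > 0"
    obtain N where N: "1 / real (Suc N) < e\<^sup>2 / 8"
      using nat_approx_posE[of "e\<^sup>2 / 8"] e by (metis divide_pos_pos zero_less_power zero_less_numeral)
    show "\<exists>M. \<forall>m\<ge>M. \<forall>n\<ge>M. dist (s m) (s n) < e"
    proof (intro exI[of _ N] allI impI)
      fix i j assume ij: "N \<le> i" "N \<le> j"
      have "1 / real (Suc i) \<le> 1 / real (Suc N)" "1 / real (Suc j) \<le> 1 / real (Suc N)"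
        using ij by (auto intro!: divide_left_mono)
      then have "Q (s i) < m + e\<^sup>2 / 8" "Q (s j) < m + e\<^sup>2 / 8"
        using s(2)[of i] s(2)[of j] N by auto
      then have "(norm (s i - s j))\<^sup>2 < e\<^sup>2"
        using par[OF s(1)[of i] s(1)[of j]] by argo
      then show "dist (s i) (s j) < e" using e by (simp add: dist_norm power_less_imp_less_base)
    qed
  qed
  then obtain z where z: "s \<longlonglongrightarrow> z" using Cauchy_convergent convergent_def by blast
  have zX: "z \<in> X" using closed_sequentially[OF X(2) _ z] s(1) by blast
  have Llim: "(\<lambda>n. L (s n)) \<longlonglongrightarrow> L z"
  proof (rule LIM_zero_cancel, rule Lim_null_comparison)
    have "L (s n) - L z = L (s n - z)" for n
      using add[of "s n - z" z] s(1) zX X(1) by (simp add: subspace_diff)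
    then show "\<forall>\<^sub>F n in sequentially. norm (L (s n) - L z) \<le> C * norm (s n - z)"
      using bdd s(1) zX X(1) by (simp add: subspace_diff)
    show "(\<lambda>n. C * norm (s n - z)) \<longlonglongrightarrow> 0"
      using z by (intro tendsto_mult_right_zero tendsto_norm_zero LIM_zero)
  qed
  have "(\<lambda>n. Q (s n)) \<longlonglongrightarrow> Q z"
    unfolding Q_def by (intro tendsto_intros z Llim) auto
  moreover have "(\<lambda>n. m + 1 / real (Suc n)) \<longlonglongrightarrow> m"
    using tendsto_add[OF tendsto_const[of m] LIMSEQ_inverse_real_of_nat] by (simp add: inverse_eq_divide)
  ultimately have Qz: "Q z \<le> m" using s(2) by (meson LIMSEQ_le less_imp_le)
  show ?thesis
  proof (intro bexI[of _ z] ballI)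
    fix x assume x: "x \<in> X"
    \<comment> \<open>Minimality of \<open>z\<close> along the line in direction \<open>x\<close>;
      the linear coefficient has to vanish.\<close>
    have "0 \<le> t * (z \<bullet> x - L x) + t\<^sup>2 * ((norm x)\<^sup>2 / 2)" for t
    proof -
      have mem: "z + t *\<^sub>R x \<in> X" using zX x X(1) by (simp add: subspace_add subspace_scale)
      have "Q z \<le> Q (z + t *\<^sub>R x)" using Qz m_le[OF mem] by simp
      also have "L (z + t *\<^sub>R x) = L z + t * L x"
        using add[of z "t *\<^sub>R x"] scale[of x t] zX x X(1) by (simp add: subspace_scale)
      then have "Q (z + t *\<^sub>R x) = Q z + t * (z \<bullet> x - L x) + t\<^sup>2 * ((norm x)\<^sup>2 / 2)"
        unfolding Q_def power2_norm_eq_inner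
        by (simp add: inner_add_left inner_add_right inner_commute[of x z] power2_eq_square[of t] algebra_simps)
      finally show ?thesis by simp
    qed
    from quadratic_linear_eq_zero[OF this] show "L x = z \<bullet> x" by simp
  qed (fact zX)
qed

lemma subspace_closure:
  fixes S :: "'h::real_normed_vector set"
  assumes "subspace S"
  shows "subspace (closure S)"
  unfolding subspace_def
proof (intro conjI ballI allI)
  show "0 \<in> closure S" using assms closure_subset subspace_0 by blast
next
  fix x y assume "x \<in> closure S" "y \<in> closure S"
  then obtain f g where "\<forall>n. f n \<in> S" "f \<longlonglongrightarrow> x" "\<forall>n. g n \<in> S" "g \<longlonglongrightarrow> y"
    unfolding closure_sequential by blast
  then have "\<forall>n. f n + g n \<in> S" "(\<lambda>n. f n + g n) \<longlonglongrightarrow> x + y"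
    using assms by (auto intro: tendsto_add simp: subspace_add)
  then show "x + y \<in> closure S"
    unfolding closure_sequential by (intro exI[of _ "\<lambda>n. f n + g n"]) simp
next
  fix c x assume "x \<in> closure S"
  then obtain f where "\<forall>n. f n \<in> S" "f \<longlonglongrightarrow> x"
    unfolding closure_sequential by blast
  then have "\<forall>n. c *\<^sub>R f n \<in> S" "(\<lambda>n. c *\<^sub>R f n) \<longlonglongrightarrow> c *\<^sub>R x"
    using assms by (auto intro: tendsto_scaleR simp: subspace_scale)
  then show "c *\<^sub>R x \<in> closure S"
    unfolding closure_sequential by (intro exI[of _ "\<lambda>n. c *\<^sub>R f n"]) simp
qed

text \<open>The closed span \<open>Z\<close> of the sequence takes the place of a separable space: a
  diagonal subsequence makes the inner products with each \<open>u k\<close> converge, hence those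
  with every vector of \<open>Z\<close>. The limit functional on \<open>Z\<close> is represented by
  \<open>z\<close>, and a general \<open>v\<close> acts on \<open>Z\<close> through its orthogonal
  projection, itself obtained as a Riesz representative.\<close>

lemma bounded_imp_weakly_convergent_subseq:
  fixes X :: "'h::{real_inner,complete_space} set" and u :: "nat \<Rightarrow> 'h"
  assumes X: "subspace X" "closed X" and u: "\<And>n. u n \<in> X" and B: "\<And>n. norm (u n) \<le> B"
  shows "\<exists>r z. strict_mono (r::nat\<Rightarrow>nat) \<and> z \<in> X \<and> (\<forall>v. (\<lambda>n. u (r n) \<bullet> v) \<longlonglongrightarrow> z \<bullet> v)"
proof -
  interpret subseqs "\<lambda>k s. convergent (\<lambda>n. u (s n) \<bullet> u k)"
  proof
    fix k and s :: "nat \<Rightarrow> nat" assume "strict_mono s"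
    have "\<bar>u (s n) \<bullet> u k\<bar> \<le> B * B" for n
      by (rule order.trans[OF Cauchy_Schwarz_ineq2])
        (intro mult_mono B order.trans[OF norm_ge_zero B[of 0]] norm_ge_zero)
    then have "Bseq (\<lambda>n. u (s n) \<bullet> u k)" by (intro BseqI') auto
    then have "bounded (range (\<lambda>n. u (s n) \<bullet> u k))" by (simp add: Bseq_eq_bounded)
    from bounded_imp_convergent_subsequence[OF this]
    obtain l r where "strict_mono r" "((\<lambda>n. u (s n) \<bullet> u k) \<circ> r) \<longlonglongrightarrow> l" by blast
    then have "strict_mono r \<and> convergent (\<lambda>n. u ((s \<circ> r) n) \<bullet> u k)"
      by (auto simp: convergent_def o_def)
    then show "\<exists>r'. strict_mono r' \<and> convergent (\<lambda>n. u ((s \<circ> r') n) \<bullet> u k)" by (intro exI[of _ r])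
  qed
  define r where "r = diagseq"
  have r: "strict_mono r" unfolding r_def by (rule subseq_diagseq)
  have conv_k: "convergent (\<lambda>n. u (r n) \<bullet> u k)" for k
  proof -
    have "convergent (\<lambda>n. u ((diagseq \<circ> ((+) (Suc k))) n) \<bullet> u k)"
    proof (rule diagseq_holds)
      fix k and s t :: "nat \<Rightarrow> nat"
      assume "strict_mono t" "convergent (\<lambda>n. u (s n) \<bullet> u k)" 
      then show "convergent (\<lambda>n. u ((s \<circ> t) n) \<bullet> u k)"
        using convergent_subseq_convergent[of "\<lambda>n. u (s n) \<bullet> u k" t] by (simp only: o_def)
    qed
    then have "convergent (\<lambda>n. u (diagseq (n + Suc k)) \<bullet> u k)"
      by (simp only: add.commute[of "Suc k"] o_def)
    then show ?thesis unfolding r_def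
      by (rule iffD1[OF convergent_ignore_initial_segment[of "\<lambda>n. u (diagseq n) \<bullet> u k" "Suc k"]])
  qed
  define Z where "Z = closure (span (range u))"
  have Zs: "subspace Z" unfolding Z_def by (rule subspace_closure) simp
  have Zc: "closed Z" unfolding Z_def by simp
  have uZ: "u n \<in> Z" for n
    unfolding Z_def using closure_subset[of "span (range u)"] span_base[of "u n" "range u"] by auto
  have ZX: "Z \<subseteq> X" unfolding Z_def
    by (intro closure_minimal span_minimal X) (use u in auto)
  have convspan: "convergent (\<lambda>n. u (r n) \<bullet> v)" if "v \<in> span (range u)" for v
    using that
  proof (induction rule: span_induct_alt)
    case base show ?case by (simp add: convergent_const)
  next
    case (step c x y)
    then obtain k where "x = u k" by auto
    then have "convergent (\<lambda>n. c * (u (r n) \<bullet> x) + u (r n) \<bullet> y)"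
      using step conv_k[of k] by (intro convergent_add convergent_mult convergent_const) simp_all
    then show ?case by (simp add: inner_add_right)
  qed
  have Bnn: "B \<ge> 0" by (rule order.trans[OF norm_ge_zero B[of 0]])
  have convZ: "convergent (\<lambda>n. u (r n) \<bullet> v)" if "v \<in> Z" for v
  proof (rule Cauchy_convergent, rule metric_CauchyI)
    fix e :: real assume e: "e > 0"
    define e' where "e' = e / (3 * (B + 1))"
    have e': "e' > 0" using e Bnn by (simp add: e'_def)
    have "\<exists>y\<in>span (range u). dist y v < e'"
      using that e' unfolding Z_def closure_approachable by simp
    then obtain y where y: "y \<in> span (range u)" "dist y v < e'" by blast
    have "Cauchy (\<lambda>n. u (r n) \<bullet> y)" using convspan[OF y(1)] convergent_Cauchy by blast
    then obtain M where M: "\<And>m n. m \<ge> M \<Longrightarrow> n \<ge> M \<Longrightarrow> dist (u (r m) \<bullet> y) (u (r n) \<bullet> y) < e / 3"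
      using metric_CauchyD[of "\<lambda>n. u (r n) \<bullet> y" "e/3"] e by auto
    have near: "\<bar>u (r n) \<bullet> v - u (r n) \<bullet> y\<bar> \<le> e / 3" for n
    proof -
      have "\<bar>u (r n) \<bullet> (v - y)\<bar> \<le> norm (u (r n)) * norm (v - y)" by (rule Cauchy_Schwarz_ineq2)
      also have "\<dots> \<le> (B + 1) * e'"
        using B[of "r n"] y(2) Bnn by (intro mult_mono) (auto simp: dist_norm norm_minus_commute)
      also have "\<dots> = e / 3" unfolding e'_def using Bnn by (simp add: field_simps)
      finally show ?thesis by (simp add: inner_diff_right)
    qed
    show "\<exists>M. \<forall>m\<ge>M. \<forall>n\<ge>M. dist (u (r m) \<bullet> v) (u (r n) \<bullet> v) < e"
    proof (intro exI[of _ M] allI impI)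
      fix m n assume "M \<le> m" "M \<le> n"
      then show "dist (u (r m) \<bullet> v) (u (r n) \<bullet> v) < e"
        using M[of m n] near[of m] near[of n] unfolding dist_real_def by linarith
    qed
  qed
  define L where "L v = lim (\<lambda>n. u (r n) \<bullet> v)" for v
  have L: "(\<lambda>n. u (r n) \<bullet> v) \<longlonglongrightarrow> L v" if "v \<in> Z" for v
    using convZ[OF that] unfolding L_def by (simp add: convergent_LIMSEQ_iff)
  have "\<exists>z\<in>Z. \<forall>v\<in>Z. L v = z \<bullet> v"
  proof (rule riesz_representation[OF Zs Zc])
    fix x y assume xy: "x \<in> Z" "y \<in> Z"
    have "(\<lambda>n. u (r n) \<bullet> (x + y)) \<longlonglongrightarrow> L x + L y"
      using tendsto_add[OF L L, OF xy] by (simp add: inner_add_right)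
    then show "L (x + y) = L x + L y"
      using L[OF subspace_add[OF Zs xy]] LIMSEQ_unique by blast
  next
    fix c x assume x: "x \<in> Z"
    have "(\<lambda>n. u (r n) \<bullet> (c *\<^sub>R x)) \<longlonglongrightarrow> c * L x"
      using tendsto_mult[OF tendsto_const L[OF x]] by simp
    then show "L (c *\<^sub>R x) = c * L x"
      using L[OF subspace_scale[OF Zs x]] LIMSEQ_unique by blast
  next
    fix x assume x: "x \<in> Z"
    have "\<bar>u (r n) \<bullet> x\<bar> \<le> B * norm x" for n
      by (rule order.trans[OF Cauchy_Schwarz_ineq2]) (simp add: B mult_right_mono)
    then show "\<bar>L x\<bar> \<le> B * norm x"
      using tendsto_rabs[OF L[OF x]] by (intro LIMSEQ_le_const2[of _ "\<bar>L x\<bar>"]) auto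
  qed
  then obtain z where z: "z \<in> Z" "\<And>v. v \<in> Z \<Longrightarrow> L v = z \<bullet> v" by blast
  have "(\<lambda>n. u (r n) \<bullet> v) \<longlonglongrightarrow> z \<bullet> v" for v
  proof -
    have "\<exists>p\<in>Z. \<forall>x\<in>Z. v \<bullet> x = p \<bullet> x"
      by (rule riesz_representation[OF Zs Zc, where C="norm v"])
        (auto simp: inner_simps Cauchy_Schwarz_ineq2)
    then obtain p where p: "p \<in> Z" "\<And>x. x \<in> Z \<Longrightarrow> x \<bullet> v = x \<bullet> p"
      by (auto simp: inner_commute)
    show ?thesis using L[OF p(1)] z(2)[OF p(1)] p(2) uZ z(1) by simp
  qed
  then show ?thesis using r z(1) ZX by blast
qed

section \<open>Three critical points\<close>

text \<open>The derivative is only required to be uniformly continuous on bounded sets; then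
  descending along \<open>- D u\<close> by a uniform step size replaces the deformation flow.\<close>

locale uniform_C1_functional =
  fixes X :: "'h::real_inner set" and J :: "'h \<Rightarrow> real" and D :: "'h \<Rightarrow> 'h"
  assumes subspace: "subspace X"
    and D_in: "\<And>u. u \<in> X \<Longrightarrow> D u \<in> X"
    and J_deriv: "\<And>u w t. u \<in> X \<Longrightarrow> w \<in> X \<Longrightarrow>
      ((\<lambda>t. J (u + t *\<^sub>R w)) has_real_derivative D (u + t *\<^sub>R w) \<bullet> w) (at t)"
    and D_unif: "\<And>R e. e > 0 \<Longrightarrow> \<exists>d>0. \<forall>u\<in>X. \<forall>w\<in>X.
      norm u \<le> R \<longrightarrow> norm w \<le> R \<longrightarrow> norm (u - w) < d \<longrightarrow> norm (D u - D w) < e"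
begin

lemma mean_value:
  assumes "u \<in> X" "w \<in> X"
  shows "\<exists>t\<in>{0<..<1}. J (u + w) - J u = D (u + t *\<^sub>R w) \<bullet> w"
proof -
  have "\<exists>t. 0 < t \<and> t < 1 \<and> J (u + 1 *\<^sub>R w) - J (u + 0 *\<^sub>R w) = (1 - 0) * (D (u + t *\<^sub>R w) \<bullet> w)"
    using J_deriv[OF assms] by (intro MVT2) auto
  then show ?thesis by auto
qed

lemma D_near:
  assumes "u \<in> X" "e > 0"
  shows "\<exists>d>0. \<forall>w\<in>X. norm (w - u) < d \<longrightarrow> norm (D w - D u) < e"
proof -
  obtain d where d: "d > 0" "\<And>v w. v \<in> X \<Longrightarrow> w \<in> X \<Longrightarrow>
      norm v \<le> norm u + 1 \<Longrightarrow> norm w \<le> norm u + 1 \<Longrightarrow> norm (v - w) < d \<Longrightarrow> norm (D v - D w) < e"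
    using D_unif[OF assms(2), of "norm u + 1"] by blast
  show ?thesis
  proof (intro exI[of _ "min d 1"] conjI ballI impI)
    fix w assume w: "w \<in> X" "norm (w - u) < min d 1"
    have "norm w \<le> norm (w - u) + norm u" using norm_triangle_ineq[of "w - u" u] by simp
    then show "norm (D w - D u) < e" using w assms by (intro d(2)) auto
  qed (use d in auto)
qed

lemma continuous_D: "continuous_on X D"
  unfolding continuous_on_iff dist_norm using D_near by blast

lemma continuous_J: "continuous_on X J"
  unfolding continuous_on_iff dist_norm
proof (intro ballI allI impI)
  fix u and e :: real assume u: "u \<in> X" and e: "e > 0"
  obtain d where d: "d > 0" "\<And>w. w \<in> X \<Longrightarrow> norm (w - u) < d \<Longrightarrow> norm (D w - D u) < 1"
    using D_near[OF u, of 1] by auto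
  define K where "K = norm (D u) + 1"
  have K: "K > 0" by (simp add: K_def add_nonneg_pos)
  show "\<exists>d>0. \<forall>w\<in>X. norm (w - u) < d \<longrightarrow> norm (J w - J u) < e"
  proof (intro exI[of _ "min d (e / K)"] conjI ballI impI)
    fix w assume w: "w \<in> X" "norm (w - u) < min d (e / K)"
    have wu: "w - u \<in> X" using w u subspace by (simp add: subspace_diff)
    obtain t where t: "0 < t" "t < 1" "J w - J u = D (u + t *\<^sub>R (w - u)) \<bullet> (w - u)"
      using mean_value[OF u wu] by auto
    have mem: "u + t *\<^sub>R (w - u) \<in> X" using u wu subspace by (simp add: subspace_add subspace_scale)
    have "norm (t *\<^sub>R (w - u)) \<le> norm (w - u)" using t by (simp add: mult_left_le_one_le)
    then have "norm (D (u + t *\<^sub>R (w - u)) - D u) < 1"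
      using w by (intro d(2)[OF mem]) auto
    then have "norm (D (u + t *\<^sub>R (w - u))) \<le> K"
      unfolding K_def using norm_triangle_sub[of "D (u + t *\<^sub>R (w - u))" "D u"] by linarith
    then have "\<bar>J w - J u\<bar> \<le> K * norm (w - u)"
      unfolding t(3) by (intro order.trans[OF Cauchy_Schwarz_ineq2] mult_right_mono) auto
    also have "\<dots> < e" using w K by (simp add: field_simps)
    finally show "norm (J w - J u) < e" by simp
  qed (use d e K in auto)
qed

text \<open>The direction \<open>- D u / (1 + norm (D u))\<close> has length below \<open>1\<close>
  but at least \<open>\<delta> / (1 + \<delta>)\<close>, so \<open>s\<close> is comparable with the
  distance covered. By uniform continuity \<open>D\<close> changes by less than
  \<open>\<delta> / 2\<close> over that distance, which leaves a slope of at least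
  \<open>\<delta> / 2\<close>; \<open>\<kappa>\<close> is the product of the two lower bounds and
  does not depend on \<open>u\<close>.\<close>

lemma gradient_step:
  assumes \<delta>: "\<delta> > 0"
  shows "\<exists>h>0. \<exists>\<kappa>>0. \<forall>u\<in>X. norm u \<le> R \<longrightarrow> \<delta> \<le> norm (D u) \<longrightarrow>
    (\<forall>s\<in>{0..h}. J (u - (s / (1 + norm (D u))) *\<^sub>R D u) \<le> J u - s * \<kappa>)"
proof -
  obtain d where d: "d > 0" "\<And>v w. v \<in> X \<Longrightarrow> w \<in> X \<Longrightarrow>
      norm v \<le> R + 1 \<Longrightarrow> norm w \<le> R + 1 \<Longrightarrow> norm (v - w) < d \<Longrightarrow> norm (D v - D w) < \<delta> / 2"
    using D_unif[of "\<delta>/2" "R+1"] \<delta> by (metis half_gt_zero)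
  define h where "h = min 1 (d / 2)"
  define \<kappa> where "\<kappa> = (\<delta> / 2) * (\<delta> / (1 + \<delta>))"
  show ?thesis
  proof (intro exI conjI ballI impI)
    show "h > 0" using d by (simp add: h_def)
    show "\<kappa> > 0" using \<delta> by (simp add: \<kappa>_def)
    fix u s assume u: "u \<in> X" "norm u \<le> R" "\<delta> \<le> norm (D u)" and s: "s \<in> {0..h}"
    define c where "c = s / (1 + norm (D u))"
    define w where "w = - (c *\<^sub>R D u)"
    have c: "c \<ge> 0" using s by (simp add: c_def)
    have "s * norm (D u) \<le> s * (1 + norm (D u))" using s by (intro mult_left_mono) auto
    moreover have pos: "1 + norm (D u) > 0" by (simp add: add_pos_nonneg)
    ultimately have nw: "norm w = c * norm (D u)" "norm w \<le> s"
      using s by (auto simp: w_def c_def pos_divide_le_eq)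
    have "\<delta> / (1 + \<delta>) \<le> norm (D u) / (1 + norm (D u))"
      using \<delta> u(3) by (simp add: divide_le_eq le_divide_eq field_simps add_nonneg_pos)
    then have "s * (\<delta> / (1 + \<delta>)) \<le> s * (norm (D u) / (1 + norm (D u)))"
      using s by (intro mult_left_mono) auto
    then have nw2: "s * (\<delta> / (1 + \<delta>)) \<le> norm w"
      unfolding nw c_def by simp
    have wX: "w \<in> X" using D_in[OF u(1)] subspace by (simp add: w_def subspace_neg subspace_scale)
    obtain t where t: "0 < t" "t < 1" "J (u + w) - J u = D (u + t *\<^sub>R w) \<bullet> w"
      using mean_value[OF u(1) wX] by auto
    have mem: "u + t *\<^sub>R w \<in> X" using u wX subspace by (simp add: subspace_add subspace_scale)
    have nt: "norm (t *\<^sub>R w) \<le> norm w" using t by (simp add: mult_left_le_one_le)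
    have "norm (u + t *\<^sub>R w) \<le> R + 1"
      using norm_triangle_ineq[of u "t *\<^sub>R w"] nt nw s u by (auto simp: h_def)
    then have "norm (D (u + t *\<^sub>R w) - D u) < \<delta> / 2"
      using nt nw s u d(1) by (intro d(2)[OF mem]) (auto simp: h_def)
    then have "(D (u + t *\<^sub>R w) - D u) \<bullet> w \<le> (\<delta> / 2) * norm w"
      by (intro order.trans[OF norm_cauchy_schwarz] mult_right_mono) auto
    moreover have "D u \<bullet> w = - (norm (D u) * norm w)"
      unfolding nw by (simp add: w_def power2_norm_eq_inner[symmetric] power2_eq_square)
    moreover have "\<delta> * norm w \<le> norm (D u) * norm w" using u by (intro mult_right_mono) auto
    ultimately have "J (u + w) - J u \<le> - ((\<delta> / 2) * norm w)"
      unfolding t(3) by (simp add: inner_diff_left)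
    moreover have "s * \<kappa> \<le> (\<delta> / 2) * norm w"
      using mult_left_mono[OF nw2, of "\<delta>/2"] \<delta> by (simp add: \<kappa>_def mult_ac)
    ultimately show "J (u - (s / (1 + norm (D u))) *\<^sub>R D u) \<le> J u - s * \<kappa>"
      by (simp add: w_def c_def)
  qed
qed

text \<open>\<open>\<eta>\<close> performs one gradient step of size \<open>h\<close>, switched off
  at low levels by the cutoff \<open>\<theta>\<close>. Monotonicity along the whole segment from
  \<open>u\<close> to \<open>\<eta> u\<close> is recorded for the sake of the local minimum: a
  segment that leaves a region must meet the barrier around it.\<close>

lemma deformation:
  assumes bdd: "\<And>u. u \<in> X \<Longrightarrow> J u \<le> c + \<epsilon>0 \<Longrightarrow> norm u \<le> R"
    and \<epsilon>0: "\<epsilon>0 > 0" and \<delta>: "\<delta> > 0"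
    and no_crit: "\<And>u. u \<in> X \<Longrightarrow> \<bar>J u - c\<bar> < \<epsilon>0 \<Longrightarrow> \<delta> \<le> norm (D u)"
  shows "\<exists>\<epsilon>>0. \<exists>\<eta>. continuous_on X \<eta> \<and> \<eta> ` X \<subseteq> X \<and>
    (\<forall>u\<in>X. J u \<le> c - \<epsilon>0 \<longrightarrow> \<eta> u = u) \<and>
    (\<forall>u\<in>X. J u \<le> c + \<epsilon> \<longrightarrow> J (\<eta> u) \<le> c - \<epsilon> \<and> (\<forall>s\<in>{0..1}. J (u + s *\<^sub>R (\<eta> u - u)) \<le> J u))"
proof -
  obtain h \<kappa> where h: "h > 0" "\<kappa> > 0" and step: "\<And>u s. u \<in> X \<Longrightarrow> norm u \<le> R \<Longrightarrow> \<delta> \<le> norm (D u) \<Longrightarrow>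
      0 \<le> s \<Longrightarrow> s \<le> h \<Longrightarrow> J (u - (s / (1 + norm (D u))) *\<^sub>R D u) \<le> J u - s * \<kappa>"
    using gradient_step[OF \<delta>, of R] by force
  \<comment> \<open>Piecewise linear in \<open>J u\<close>: \<open>0\<close> for
    \<open>J u \<le> c - \<epsilon>0\<close> and \<open>1\<close> for
    \<open>J u \<ge> c - \<epsilon>0 / 2\<close>.\<close>
  define \<theta> where "\<theta> u = min 1 (max 0 (2 * (J u - c + \<epsilon>0) / \<epsilon>0))" for u
  define \<eta> where "\<eta> u = u - (h * \<theta> u / (1 + norm (D u))) *\<^sub>R D u" for u
  \<comment> \<open>Within \<open>\<epsilon>\<close> of \<open>c\<close> the cutoff equals
    \<open>1\<close>, and a full step gains \<open>h * \<kappa> \<ge> 2 * \<epsilon>\<close>, enough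
    to pass from \<open>c + \<epsilon>\<close> to \<open>c - \<epsilon>\<close>.\<close>
  define \<epsilon> where "\<epsilon> = min (\<epsilon>0 / 2) (h * \<kappa> / 2)"
  have \<theta>: "0 \<le> \<theta> u" "\<theta> u \<le> 1" for u by (auto simp: \<theta>_def)
  have drop: "J (u + s *\<^sub>R (\<eta> u - u)) \<le> J u - s * h * \<theta> u * \<kappa>"
    if u: "u \<in> X" "J u \<le> c + \<epsilon>" and s: "0 \<le> s" "s \<le> 1" for u s
  proof (cases "\<theta> u = 0")
    case False
    have "2 * (J u - c + \<epsilon>0) / \<epsilon>0 > 0"
      using False unfolding \<theta>_def by (metis max_absorb1 min.absorb2 not_less zero_le_one)
    then have "J u > c - \<epsilon>0" using \<epsilon>0 by (simp add: zero_less_divide_iff)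
    moreover have "J u < c + \<epsilon>0" using u(2) \<epsilon>0 by (auto simp: \<epsilon>_def min_def split: if_splits)
    ultimately have "norm u \<le> R" "\<delta> \<le> norm (D u)" using u bdd no_crit by auto
    moreover have "s * (h * \<theta> u) \<le> 1 * (h * 1)"
      using s \<theta>[of u] h by (intro mult_mono) auto
    ultimately have "J (u - (s * (h * \<theta> u) / (1 + norm (D u))) *\<^sub>R D u) \<le> J u - (s * (h * \<theta> u)) * \<kappa>"
      using s \<theta>[of u] h by (intro step u) auto
    then show ?thesis by (simp add: \<eta>_def mult_ac)
  qed (simp add: \<eta>_def)
  show ?thesis
  proof (intro exI conjI ballI impI)
    show "\<epsilon> > 0" using \<epsilon>0 h by (simp add: \<epsilon>_def)
    show "continuous_on X \<eta>"
      unfolding \<eta>_def \<theta>_def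
      by (intro continuous_intros continuous_D continuous_J)
        (use \<epsilon>0 in \<open>auto simp: add_nonneg_eq_0_iff\<close>)
    show "\<eta> ` X \<subseteq> X" using D_in subspace by (auto simp: \<eta>_def subspace_diff subspace_scale)
    fix u assume u: "u \<in> X"
    show "\<eta> u = u" if "J u \<le> c - \<epsilon>0"
    proof -
      have "2 * (J u - c + \<epsilon>0) / \<epsilon>0 \<le> 0" using that \<epsilon>0 by (simp add: divide_le_0_iff)
      then show ?thesis by (simp add: \<eta>_def \<theta>_def)
    qed
    assume Ju: "J u \<le> c + \<epsilon>"
    show "J (u + s *\<^sub>R (\<eta> u - u)) \<le> J u" if "s \<in> {0..1}" for s
    proof -
      have "0 \<le> s * h * \<theta> u * \<kappa>" using that h \<theta>[of u] by auto
      then show ?thesis using drop[OF u Ju, of s] that by auto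
    qed
    have d1: "J (\<eta> u) \<le> J u - h * \<theta> u * \<kappa>" using drop[OF u Ju, of 1] by simp
    show "J (\<eta> u) \<le> c - \<epsilon>"
    proof (cases "J u \<ge> c - \<epsilon>")
      case True
      then have "\<epsilon>0 \<le> 2 * (J u - c + \<epsilon>0)" by (auto simp: \<epsilon>_def min_def split: if_splits)
      then have "2 * (J u - c + \<epsilon>0) / \<epsilon>0 \<ge> 1" using \<epsilon>0 by (simp add: le_divide_eq)
      then have "\<theta> u = 1" by (simp add: \<theta>_def)
      moreover have "\<epsilon> \<le> h * \<kappa> / 2" by (simp add: \<epsilon>_def)
      ultimately show ?thesis using d1 Ju by simp
    next
      case False
      moreover have "0 \<le> h * \<theta> u * \<kappa>" using h \<theta>[of u] by auto
      ultimately show ?thesis using d1 by linarith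
    qed
  qed
qed

text \<open>The three values are the infimum over \<open>X\<close>, the infimum over
  \<open>\<nu> u \<le> \<rho>\<close> and a minimax value over connected sets joining
  \<open>e0\<close> to \<open>e1\<close>. The chain \<open>c1 \<le> J e1 < m1 \<le> c2 \<le> J e0 <
  \<kappa> \<le> c3 \<le> M\<close> separates them. Compactness enters only through
  \<open>PS\<close>, which provides a critical point at the given level instead of a convergent
  sequence.\<close>

theorem three_critical_points:
  fixes \<nu> :: "'h \<Rightarrow> real"
  assumes bdd_sub: "\<And>m. \<exists>R. \<forall>u\<in>X. J u \<le> m \<longrightarrow> norm u \<le> R"
    and bdd_below: "\<And>u. u \<in> X \<Longrightarrow> m0 \<le> J u"
    and PS: "\<And>c. (\<And>e. e > 0 \<Longrightarrow> \<exists>u\<in>X. \<bar>J u - c\<bar> < e \<and> norm (D u) < e) \<Longrightarrow> \<exists>u\<in>X. J u = c \<and> D u = 0"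
    and e: "e0 \<in> X" "e1 \<in> X"
    and \<nu>: "continuous_on X \<nu>" "\<nu> e0 < \<rho>" "\<rho> < \<nu> e1"
    and barrier: "\<And>u. u \<in> X \<Longrightarrow> \<nu> u = \<rho> \<Longrightarrow> \<kappa> \<le> J u"
    and ends: "J e0 < \<kappa>" 
    and low: "J e1 < m1" "\<And>u. u \<in> X \<Longrightarrow> \<nu> u \<le> \<rho> \<Longrightarrow> m1 \<le> J u"
    and path: "\<And>t. t \<in> {0..1} \<Longrightarrow> J (e0 + t *\<^sub>R (e1 - e0)) \<le> M"
  shows "\<exists>u1\<in>X. \<exists>u2\<in>X. \<exists>u3\<in>X. D u1 = 0 \<and> D u2 = 0 \<and> D u3 = 0 \<and>
    J u1 < J u2 \<and> J u2 < J u3 \<and> J u3 \<le> M"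
proof -
  \<comment> \<open>If there is no critical point at level \<open>c\<close>, the premise of
    \<open>PS\<close> fails for some \<open>e\<close>, which bounds \<open>norm (D u)\<close> from
    below near that level; with bounded sublevel sets the deformation lemma applies.\<close>
  have def: "\<exists>\<epsilon>>0. \<exists>\<eta>. continuous_on X \<eta> \<and> \<eta> ` X \<subseteq> X \<and>
    (\<forall>u\<in>X. J u \<le> c - \<epsilon>0 \<longrightarrow> \<eta> u = u) \<and>
    (\<forall>u\<in>X. J u \<le> c + \<epsilon> \<longrightarrow> J (\<eta> u) \<le> c - \<epsilon> \<and> (\<forall>s\<in>{0..1}. J (u + s *\<^sub>R (\<eta> u - u)) \<le> J u))"
    if nc: "\<not> (\<exists>u\<in>X. J u = c \<and> D u = 0)" and \<epsilon>0: "\<epsilon>0 > 0" for c \<epsilon>0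
  proof -
    obtain e where e: "e > 0" "\<And>u. u \<in> X \<Longrightarrow> \<bar>J u - c\<bar> < e \<Longrightarrow> e \<le> norm (D u)"
      using PS[of c] nc by (meson not_le)
    define e' where "e' = min e \<epsilon>0"
    obtain R where "\<And>u. u \<in> X \<Longrightarrow> J u \<le> c + e' \<Longrightarrow> norm u \<le> R" using bdd_sub by meson
    moreover have "e' > 0" "\<And>u. u \<in> X \<Longrightarrow> \<bar>J u - c\<bar> < e' \<Longrightarrow> e \<le> norm (D u)"
      using e \<epsilon>0 unfolding e'_def by auto
    ultimately obtain \<epsilon> \<eta> where "\<epsilon> > 0" "continuous_on X \<eta>" "\<eta> ` X \<subseteq> X"
      "\<forall>u\<in>X. J u \<le> c - e' \<longrightarrow> \<eta> u = u"
      "\<forall>u\<in>X. J u \<le> c + \<epsilon> \<longrightarrow> J (\<eta> u) \<le> c - \<epsilon> \<and> (\<forall>s\<in>{0..1}. J (u + s *\<^sub>R (\<eta> u - u)) \<le> J u)"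
      using deformation[of c e' R e] e(1) by auto
    then show ?thesis by (intro exI[of _ \<epsilon>] conjI exI[of _ \<eta>]) (auto simp: e'_def min_def)
  qed
  define c1 where "c1 = (INF u\<in>X. J u)"
  have bb: "bdd_below (J ` A)" if "A \<subseteq> X" for A using bdd_below that by (auto intro!: bdd_belowI)
  have "\<exists>u\<in>X. J u = c1 \<and> D u = 0"
  proof (rule ccontr)
    assume "\<not> ?thesis"
    from def[OF this, of 1] obtain \<epsilon> \<eta> where \<epsilon>: "\<epsilon> > 0" "\<eta> ` X \<subseteq> X"
      "\<forall>u\<in>X. J u \<le> c1 + \<epsilon> \<longrightarrow> J (\<eta> u) \<le> c1 - \<epsilon>" by force
    obtain u where u: "u \<in> X" "J u < c1 + \<epsilon>"
      using cINF_less_iff[OF _ bb[OF order.refl], of "c1 + \<epsilon>"] e \<epsilon>(1) unfolding c1_def by auto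
    then have "c1 \<le> J (\<eta> u)" unfolding c1_def using \<epsilon>(2) bb by (intro cINF_lower) auto
    then show False using \<epsilon> u by fastforce
  qed
  then obtain u1 where u1: "u1 \<in> X" "J u1 = c1" "D u1 = 0" by blast
  have c1: "c1 \<le> J e1" unfolding c1_def using e bb by (intro cINF_lower) auto
  define B where "B = {u\<in>X. \<nu> u \<le> \<rho>}"
  have BX: "B \<subseteq> X" and e0B: "e0 \<in> B" using e \<nu> by (auto simp: B_def)
  define c2 where "c2 = (INF u\<in>B. J u)"
  have c2_le: "c2 \<le> J u" if "u \<in> B" for u unfolding c2_def using that bb[OF BX] by (intro cINF_lower)
  \<comment> \<open>A near-minimizer on \<open>B\<close> would be deformed below \<open>c2\<close>,
    hence to a point outside \<open>B\<close>. The segment leading there crosses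
    \<open>\<nu> = \<rho>\<close>, where \<open>J \<ge> \<kappa>\<close>, although \<open>J\<close>
    never exceeds its initial value on it, and that value is below \<open>\<kappa>\<close>.\<close>
  have "\<exists>u\<in>X. J u = c2 \<and> D u = 0"
  proof (rule ccontr)
    assume "\<not> ?thesis"
    from def[OF this, of 1] obtain \<epsilon> \<eta> where \<epsilon>: "\<epsilon> > 0" "\<eta> ` X \<subseteq> X"
      "\<forall>u\<in>X. J u \<le> c2 + \<epsilon> \<longrightarrow> J (\<eta> u) \<le> c2 - \<epsilon> \<and> (\<forall>s\<in>{0..1}. J (u + s *\<^sub>R (\<eta> u - u)) \<le> J u)" by force
    have "c2 < min (c2 + \<epsilon>) \<kappa>" using \<epsilon>(1) c2_le[OF e0B] ends by auto
    then obtain u where u: "u \<in> B" "J u < c2 + \<epsilon>" "J u < \<kappa>"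
      using cINF_less_iff[OF _ bb[OF BX], of "min (c2 + \<epsilon>) \<kappa>"] e0B unfolding c2_def by auto
    then have uX: "u \<in> X" and \<eta>uX: "\<eta> u \<in> X" using BX \<epsilon>(2) by auto
    have "J (\<eta> u) < c2" using \<epsilon> u uX by fastforce
    then have "\<eta> u \<notin> B" using c2_le by fastforce
    then have out: "\<rho> < \<nu> (\<eta> u)" using \<eta>uX by (auto simp: B_def)
    define f where "f s = \<nu> (u + s *\<^sub>R (\<eta> u - u))" for s
    have seg: "u + s *\<^sub>R (\<eta> u - u) \<in> X" for s
      using uX \<eta>uX subspace by (simp add: subspace_add subspace_diff subspace_scale)
    have "continuous_on {0..1} f" unfolding f_def
      by (rule continuous_on_compose2[OF \<nu>(1)]) (auto intro!: continuous_intros seg)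
    moreover have "f 0 \<le> \<rho>" "\<rho> \<le> f 1" using u out by (auto simp: f_def B_def)
    ultimately obtain s where s: "0 \<le> s" "s \<le> 1" "f s = \<rho>" using IVT'[of f 0 \<rho> 1] by auto
    then have "\<kappa> \<le> J (u + s *\<^sub>R (\<eta> u - u))" using barrier[OF seg] by (simp add: f_def)
    also have "\<dots> \<le> J u" using \<epsilon>(3) uX u s by auto
    finally show False using u by simp
  qed
  then obtain u2 where u2: "u2 \<in> X" "J u2 = c2" "D u2 = 0" by blast
  have c2: "m1 \<le> c2" unfolding c2_def using e0B low(2) by (intro cINF_greatest) (auto simp: B_def)
  have c2': "c2 < \<kappa>" using c2_le[OF e0B] ends by simp
  \<comment> \<open>Connected sets in place of paths: continuous images stay connected, and the
    image under \<open>\<nu>\<close> contains \<open>\<rho>\<close> because it has values on both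
    sides, so every competitor meets the barrier.\<close>
  define S where "S = {m. \<exists>C\<subseteq>X. connected C \<and> e0 \<in> C \<and> e1 \<in> C \<and> (\<forall>u\<in>C. J u \<le> m)}"
  define c3 where "c3 = Inf S"
  have S_ge: "\<kappa> \<le> m" if "m \<in> S" for m
  proof -
    obtain C where C: "C \<subseteq> X" "connected C" "e0 \<in> C" "e1 \<in> C" "\<forall>u\<in>C. J u \<le> m"
      using \<open>m \<in> S\<close> unfolding S_def by blast
    have "connected (\<nu> ` C)" using C \<nu> continuous_on_subset by (blast intro: connected_continuous_image)
    then have "\<rho> \<in> \<nu> ` C"
      using C \<nu> connectedD_interval[of "\<nu> ` C" "\<nu> e0" "\<nu> e1" \<rho>] by auto
    then obtain u where "u \<in> C" "\<nu> u = \<rho>" by auto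
    then show ?thesis using barrier[of u] C by force
  qed
  have MS: "M \<in> S"
  proof -
    let ?C = "(\<lambda>t. e0 + t *\<^sub>R (e1 - e0)) ` {0..1::real}"
    have "connected ?C" by (intro connected_continuous_image continuous_intros) auto
    moreover have "e0 \<in> ?C" "e1 \<in> ?C" by (force intro: image_eqI[of _ _ 0], force intro: image_eqI[of _ _ 1])
    moreover have "?C \<subseteq> X" using e subspace by (auto simp: subspace_add subspace_diff subspace_scale)
    ultimately show ?thesis unfolding S_def using path by (auto intro!: exI[of _ ?C])
  qed
  have bS: "bdd_below S" using S_ge by (auto intro!: bdd_belowI)
  have c3: "\<kappa> \<le> c3" "c3 \<le> M" unfolding c3_def
    using MS S_ge bS by (auto intro: cInf_greatest cInf_lower)
  have e1k: "J e1 < \<kappa>" using low(1) c2 c2' by linarith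
  have "\<exists>u\<in>X. J u = c3 \<and> D u = 0"
  proof (rule ccontr)
    assume nc: "\<not> ?thesis"
    \<comment> \<open>Both endpoints lie at or below \<open>c3 - \<epsilon>0\<close>; the
      deformation fixes them and thus maps competitors to competitors.\<close>
    define \<epsilon>0 where "\<epsilon>0 = min (\<kappa> - J e0) (\<kappa> - J e1)"
    have "\<epsilon>0 > 0" using ends e1k by (simp add: \<epsilon>0_def)
    from def[OF nc this] obtain \<epsilon> \<eta> where \<epsilon>: "\<epsilon> > 0" "continuous_on X \<eta>" "\<eta> ` X \<subseteq> X"
      "\<forall>u\<in>X. J u \<le> c3 - \<epsilon>0 \<longrightarrow> \<eta> u = u"
      "\<forall>u\<in>X. J u \<le> c3 + \<epsilon> \<longrightarrow> J (\<eta> u) \<le> c3 - \<epsilon>" by force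
    have "J e0 \<le> c3 - \<epsilon>0" "J e1 \<le> c3 - \<epsilon>0" using c3 by (auto simp: \<epsilon>0_def)
    then have fix0: "\<eta> e0 = e0" "\<eta> e1 = e1" using \<epsilon>(4) e by auto
    have "\<exists>m\<in>S. m < c3 + \<epsilon>"
      using cInf_less_iff[OF _ bS, of "c3 + \<epsilon>"] MS \<epsilon>(1) unfolding c3_def by auto
    then obtain m C where C: "m < c3 + \<epsilon>" "C \<subseteq> X" "connected C" "e0 \<in> C" "e1 \<in> C" "\<forall>u\<in>C. J u \<le> m"
      unfolding S_def by blast
    have "connected (\<eta> ` C)" using C \<epsilon>(2) continuous_on_subset by (blast intro: connected_continuous_image)
    moreover have "\<eta> ` C \<subseteq> X" using C \<epsilon>(3) by blast
    moreover have "e0 \<in> \<eta> ` C" "e1 \<in> \<eta> ` C" using fix0 C by (metis imageI)+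
    moreover have "\<forall>u\<in>\<eta> ` C. J u \<le> c3 - \<epsilon>" using C \<epsilon>(5) by fastforce
    ultimately have "c3 - \<epsilon> \<in> S" unfolding S_def by blast
    then have "c3 \<le> c3 - \<epsilon>" unfolding c3_def using bS by (intro cInf_lower)
    then show False using \<epsilon>(1) by simp
  qed
  then obtain u3 where "u3 \<in> X" "J u3 = c3" "D u3 = 0" by blast
  then show ?thesis using u1 u2 c1 c2 c2' c3 low(1)
    by (intro bexI[of _ u1] bexI[of _ u2] bexI[of _ u3] conjI) auto
qed

end

section \<open>The Hilbert space of square integrable fields\<close>

definition square_integrable :: "('a::euclidean_space \<Rightarrow> 'b::euclidean_space) \<Rightarrow> bool" where
  "square_integrable f \<longleftrightarrow> f \<in> borel_measurable lebesgue \<and> integrable lebesgue (\<lambda>x. (norm (f x))\<^sup>2)"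

lemma square_integrable_0: "square_integrable (\<lambda>x. 0)"
  by (simp add: square_integrable_def)

lemma square_integrable_scaleR:
  "square_integrable f \<Longrightarrow> square_integrable (\<lambda>x. c *\<^sub>R f x)"
  by (auto simp: square_integrable_def power_mult_distrib)

lemma norm_add_sq_le: "(norm (x + y))\<^sup>2 \<le> 2 * (norm x)\<^sup>2 + 2 * (norm (y::'b::real_inner))\<^sup>2"
proof -
  have "(norm (x + y))\<^sup>2 + (norm (x - y))\<^sup>2 = 2 * (norm x)\<^sup>2 + 2 * (norm y)\<^sup>2"
    by (simp add: power2_norm_eq_inner inner_simps inner_commute)
  then show ?thesis using zero_le_power2[of "norm (x - y)"] by linarith
qed

lemma square_integrable_add:
  assumes "square_integrable f" "square_integrable g"
  shows "square_integrable (\<lambda>x. f x + g x)"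
  unfolding square_integrable_def
proof
  show m: "(\<lambda>x. f x + g x) \<in> borel_measurable lebesgue"
    using assms by (auto simp: square_integrable_def)
  show "integrable lebesgue (\<lambda>x. (norm (f x + g x))\<^sup>2)"
  proof (rule Bochner_Integration.integrable_bound)
    show "integrable lebesgue (\<lambda>x. 2 * (norm (f x))\<^sup>2 + 2 * (norm (g x))\<^sup>2)"
      using assms by (auto simp: square_integrable_def)
    show "AE x in lebesgue. norm ((norm (f x + g x))\<^sup>2) \<le> norm (2 * (norm (f x))\<^sup>2 + 2 * (norm (g x))\<^sup>2)"
      using norm_add_sq_le by (intro AE_I2) auto
  qed (use m in measurable)
qed

lemma square_integrable_minus:
  "square_integrable f \<Longrightarrow> square_integrable g \<Longrightarrow> square_integrable (\<lambda>x. f x - g x)"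
  using square_integrable_add[of f "\<lambda>x. (-1) *\<^sub>R g x"] square_integrable_scaleR[of g "-1"] by simp

lemma square_integrable_uminus:
  "square_integrable f \<Longrightarrow> square_integrable (\<lambda>x. - f x)"
  using square_integrable_scaleR[of f "-1"] by simp

lemma square_integrable_inner:
  assumes "square_integrable f" "square_integrable g"
  shows "integrable lebesgue (\<lambda>x. f x \<bullet> g x)"
proof (rule Bochner_Integration.integrable_bound)
  show "integrable lebesgue (\<lambda>x. (norm (f x))\<^sup>2 + (norm (g x))\<^sup>2)"
    using assms by (auto simp: square_integrable_def)
  show "(\<lambda>x. f x \<bullet> g x) \<in> borel_measurable lebesgue"
    using assms by (auto simp: square_integrable_def)
  have "\<bar>f x \<bullet> g x\<bar> \<le> (norm (f x))\<^sup>2 + (norm (g x))\<^sup>2" for x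
    using Cauchy_Schwarz_ineq2[of "f x" "g x"] sum_squares_bound[of "norm (f x)" "norm (g x)"]
      mult_nonneg_nonneg[of "norm (f x)" "norm (g x)"] norm_ge_zero[of "f x"] norm_ge_zero[of "g x"]
    by linarith
  then show "AE x in lebesgue. norm (f x \<bullet> g x) \<le> norm ((norm (f x))\<^sup>2 + (norm (g x))\<^sup>2)"
    by (intro AE_I2) auto
qed

text \<open>A partial equivalence relation: it is reflexive exactly on the square integrable
  functions, so the quotient contains no other classes.\<close>

definition l2_rel :: "('a::euclidean_space \<Rightarrow> 'b::euclidean_space) \<Rightarrow> ('a \<Rightarrow> 'b) \<Rightarrow> bool" where
  "l2_rel f g \<longleftrightarrow> square_integrable f \<and> square_integrable g \<and> (AE x in lebesgue. f x = g x)"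

quotient_type (overloaded) ('a, 'b) l2 = "'a::euclidean_space \<Rightarrow> 'b::euclidean_space" / partial: l2_rel
proof (rule part_equivpI)
  show "\<exists>x. l2_rel x x" using square_integrable_0 unfolding l2_rel_def by auto
  show "symp l2_rel" by (auto simp: symp_def l2_rel_def)
  show "transp l2_rel"
    unfolding transp_def l2_rel_def by (auto elim: AE_mp)
qed

lemma l2_relD:
  "l2_rel f g \<Longrightarrow> square_integrable f" "l2_rel f g \<Longrightarrow> square_integrable g"
  "l2_rel f g \<Longrightarrow> AE x in lebesgue. f x = g x"
  by (auto simp: l2_rel_def)

instantiation l2 :: (euclidean_space, euclidean_space) real_inner
begin

lift_definition zero_l2 :: "('a, 'b) l2" is "\<lambda>x. 0"
  by (simp add: l2_rel_def square_integrable_0)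

lift_definition plus_l2 :: "('a, 'b) l2 \<Rightarrow> ('a, 'b) l2 \<Rightarrow> ('a, 'b) l2" is "\<lambda>f g x. f x + g x"
  unfolding l2_rel_def by (auto intro: square_integrable_add)

lift_definition minus_l2 :: "('a, 'b) l2 \<Rightarrow> ('a, 'b) l2 \<Rightarrow> ('a, 'b) l2" is "\<lambda>f g x. f x - g x"
  unfolding l2_rel_def by (auto intro: square_integrable_minus)

lift_definition uminus_l2 :: "('a, 'b) l2 \<Rightarrow> ('a, 'b) l2" is "\<lambda>f x. - f x"
  unfolding l2_rel_def by (auto intro: square_integrable_uminus)

lift_definition scaleR_l2 :: "real \<Rightarrow> ('a, 'b) l2 \<Rightarrow> ('a, 'b) l2" is "\<lambda>c f x. c *\<^sub>R f x"
  unfolding l2_rel_def by (auto intro: square_integrable_scaleR)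

lift_definition inner_l2 :: "('a, 'b) l2 \<Rightarrow> ('a, 'b) l2 \<Rightarrow> real" is "\<lambda>f g. LINT x|lebesgue. f x \<bullet> g x"
proof -
  fix f f' g g' :: "'a \<Rightarrow> 'b"
  assume *: "l2_rel f f'" "l2_rel g g'"
  have "AE x in lebesgue. f x \<bullet> g x = f' x \<bullet> g' x" using l2_relD(3)[OF *(1)] l2_relD(3)[OF *(2)] by auto
  then show "(LINT x|lebesgue. f x \<bullet> g x) = (LINT x|lebesgue. f' x \<bullet> g' x)"
    using * l2_relD(1,2)
    by (intro integral_cong_AE) (auto simp: square_integrable_def intro!: borel_measurable_inner)
qed

definition norm_l2 :: "('a, 'b) l2 \<Rightarrow> real" where "norm_l2 f = sqrt (f \<bullet> f)"
definition dist_l2 :: "('a, 'b) l2 \<Rightarrow> ('a, 'b) l2 \<Rightarrow> real" where "dist_l2 f g = norm (f - g)"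
definition sgn_l2 :: "('a, 'b) l2 \<Rightarrow> ('a, 'b) l2" where "sgn_l2 f = scaleR (inverse (norm f)) f"
definition uniformity_l2 :: "(('a, 'b) l2 \<times> ('a, 'b) l2) filter" where
  "uniformity_l2 = (INF e\<in>{0<..}. principal {(f, g). dist f g < e})"
definition open_l2 :: "('a, 'b) l2 set \<Rightarrow> bool" where
  "open_l2 U = (\<forall>x\<in>U. eventually (\<lambda>(x', y). x' = x \<longrightarrow> y \<in> U) uniformity)"

instance
proof
  fix a b c :: "('a, 'b) l2" and s t :: real
  show "a + b + c = a + (b + c)"
    by transfer (auto simp: l2_rel_def add.assoc intro!: square_integrable_add)
  show "a + b = b + a"
    by transfer (auto simp: l2_rel_def add.commute intro!: square_integrable_add)
  show "0 + a = a"
    by transfer (auto simp: l2_rel_def)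
  show "- a + a = 0"
    by transfer (auto simp: l2_rel_def square_integrable_0)
  show "a - b = a + - b"
    by transfer (auto simp: l2_rel_def intro!: square_integrable_minus)
  show "s *\<^sub>R (a + b) = s *\<^sub>R a + s *\<^sub>R b"
    by transfer (auto simp: l2_rel_def scaleR_add_right intro!: square_integrable_add square_integrable_scaleR)
  show "(s + t) *\<^sub>R a = s *\<^sub>R a + t *\<^sub>R a"
    by transfer (auto simp: l2_rel_def scaleR_add_left intro!: square_integrable_add square_integrable_scaleR)
  show "s *\<^sub>R t *\<^sub>R a = (s * t) *\<^sub>R a"
    by transfer (auto simp: l2_rel_def intro!: square_integrable_scaleR)
  show "1 *\<^sub>R a = a"
    by transfer (auto simp: l2_rel_def)
  show "sgn a = inverse (norm a) *\<^sub>R a" by (rule sgn_l2_def)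
  show "dist a b = norm (a - b)" by (rule dist_l2_def)
  show "uniformity = (INF e\<in>{0<..}. principal {(f::('a, 'b) l2, g). dist f g < e})"
    by (rule uniformity_l2_def)
  show "open U = (\<forall>x\<in>U. \<forall>\<^sub>F (x', y) in uniformity. x' = x \<longrightarrow> y \<in> U)" for U :: "('a, 'b) l2 set"
    by (rule open_l2_def)
  show "a \<bullet> b = b \<bullet> a" by transfer (simp add: inner_commute)
  show "(a + b) \<bullet> c = a \<bullet> c + b \<bullet> c"
    by transfer (auto simp: inner_add_left l2_rel_def square_integrable_inner)
  show "s *\<^sub>R a \<bullet> b = s * (a \<bullet> b)" by transfer simp
  show "0 \<le> a \<bullet> a" by transfer simp
  show "a \<bullet> a = 0 \<longleftrightarrow> a = 0"
  proof transfer
    fix f :: "'a \<Rightarrow> 'b" assume "l2_rel f f"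
    then have f: "square_integrable f" by (simp add: l2_rel_def)
    have "(LINT x|lebesgue. f x \<bullet> f x) = 0 \<longleftrightarrow> (AE x in lebesgue. f x \<bullet> f x = 0)"
      using square_integrable_inner[OF f f] by (intro integral_nonneg_eq_0_iff_AE) auto
    then show "((LINT x|lebesgue. f x \<bullet> f x) = 0) = l2_rel f (\<lambda>x. 0)"
      using f by (simp add: l2_rel_def square_integrable_0)
  qed
  show "norm a = sqrt (a \<bullet> a)" by (rule norm_l2_def)
qed

end

lemma square_integrable_rep [simp]: "square_integrable (rep_l2 a)"
  using Quotient3_rep_reflp[OF Quotient3_l2] by (auto simp: l2_rel_def)

lemma abs_rep_l2 [simp]: "abs_l2 (rep_l2 a) = a"
  by (rule Quotient3_abs_rep[OF Quotient3_l2])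

lemma abs_l2_eq_iff:
  "square_integrable f \<Longrightarrow> square_integrable g \<Longrightarrow> abs_l2 f = abs_l2 g \<longleftrightarrow> (AE x in lebesgue. f x = g x)"
  using Quotient3_rel[OF Quotient3_l2, of f g] by (auto simp: l2_rel_def)

lemma rep_abs_l2: "square_integrable f \<Longrightarrow> AE x in lebesgue. rep_l2 (abs_l2 f) x = f x"
  using abs_l2_eq_iff[of "rep_l2 (abs_l2 f)" f] by simp

lemma abs_l2_add:
  "square_integrable f \<Longrightarrow> square_integrable g \<Longrightarrow> abs_l2 f + abs_l2 g = abs_l2 (\<lambda>x. f x + g x)"
  by (simp add: plus_l2.abs_eq l2_rel_def)

lemma abs_l2_minus:
  "square_integrable f \<Longrightarrow> square_integrable g \<Longrightarrow> abs_l2 f - abs_l2 g = abs_l2 (\<lambda>x. f x - g x)"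
  by (simp add: minus_l2.abs_eq l2_rel_def)

lemma abs_l2_scaleR: "square_integrable f \<Longrightarrow> c *\<^sub>R abs_l2 f = abs_l2 (\<lambda>x. c *\<^sub>R f x)"
  by (simp add: scaleR_l2.abs_eq l2_rel_def)

lemma abs_l2_inner:
  "square_integrable f \<Longrightarrow> square_integrable g \<Longrightarrow> abs_l2 f \<bullet> abs_l2 g = (LINT x|lebesgue. f x \<bullet> g x)"
  by (simp add: inner_l2.abs_eq l2_rel_def)

lemma abs_l2_norm:
  "square_integrable f \<Longrightarrow> (norm (abs_l2 f))\<^sup>2 = (LINT x|lebesgue. (norm (f x))\<^sup>2)"
  by (simp add: power2_norm_eq_inner abs_l2_inner)

lemma rep_l2_add: "AE x in lebesgue. rep_l2 (a + b) x = rep_l2 a x + rep_l2 b x"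
  using rep_abs_l2[of "\<lambda>x. rep_l2 a x + rep_l2 b x"] abs_l2_add[of "rep_l2 a" "rep_l2 b"]
  by (simp add: square_integrable_add)

lemma rep_l2_scaleR: "AE x in lebesgue. rep_l2 (c *\<^sub>R a) x = c *\<^sub>R rep_l2 a x"
  using rep_abs_l2[of "\<lambda>x. c *\<^sub>R rep_l2 a x"] abs_l2_scaleR[of "rep_l2 a" c]
  by (simp add: square_integrable_scaleR)

lemma inner_l2_rep: "a \<bullet> b = (LINT x|lebesgue. rep_l2 a x \<bullet> rep_l2 b x)"
  using abs_l2_inner[of "rep_l2 a" "rep_l2 b"] by simp

lemma norm_l2_rep: "(norm a)\<^sup>2 = (LINT x|lebesgue. (norm (rep_l2 a x))\<^sup>2)"
  using abs_l2_norm[of "rep_l2 a"] by simp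

lemma measurable_rep_l2 [measurable, simp]: "rep_l2 a \<in> borel_measurable lebesgue"
  using square_integrable_rep[of a] unfolding square_integrable_def by blast

lemma integrable_rep_l2 [simp]: "integrable lebesgue (\<lambda>x. (norm (rep_l2 a x))\<^sup>2)"
  using square_integrable_rep[of a] unfolding square_integrable_def by blast

lemma dist_l2_rep: "(dist a b)\<^sup>2 = (LINT x|lebesgue. (norm (rep_l2 a x - rep_l2 b x))\<^sup>2)"
  using abs_l2_norm[of "\<lambda>x. rep_l2 a x - rep_l2 b x"] abs_l2_minus[of "rep_l2 a" "rep_l2 b"]
  by (simp add: dist_norm square_integrable_minus)

lemma nn_integral_l2_rep:
  "(\<integral>\<^sup>+x. ennreal ((norm (rep_l2 a x - rep_l2 b x))\<^sup>2) \<partial>lebesgue) = ennreal ((dist a b)\<^sup>2)"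
  unfolding dist_l2_rep
  using square_integrable_minus[OF square_integrable_rep[of a] square_integrable_rep[of b]]
  by (intro nn_integral_eq_integral) (auto simp: square_integrable_def)

text \<open>The weighted squares \<open>4^n * |X (n + 1) - X n|^2\<close> have integrals at most
  \<open>(1/4)^n\<close>, hence a finite sum almost everywhere. At such points the increments are at
  most a constant times \<open>(1/2)^n\<close>, and the sequence is the partial sum of a convergent
  series.\<close>

lemma l2_geometric_AE_convergent:
  fixes X :: "nat \<Rightarrow> ('a::euclidean_space, 'b::euclidean_space) l2"
  assumes step: "\<And>n. dist (X (Suc n)) (X n) \<le> (1/4)^n"
  shows "AE x in lebesgue. convergent (\<lambda>n. rep_l2 (X n) x)"
proof -
  define d where "d n x = 4^n * (norm (rep_l2 (X (Suc n)) x - rep_l2 (X n) x))\<^sup>2" for n x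
  have d_meas [measurable]: "d n \<in> borel_measurable lebesgue" for n unfolding d_def by measurable
  have "(\<integral>\<^sup>+x. (\<Sum>n. ennreal (d n x)) \<partial>lebesgue) = (\<Sum>n. \<integral>\<^sup>+x. ennreal (d n x) \<partial>lebesgue)"
    by (rule nn_integral_suminf) measurable
  also have "\<dots> \<le> (\<Sum>n. ennreal ((1/4)^n))"
  proof (intro suminf_le allI)
    fix n
    have "(\<integral>\<^sup>+x. ennreal (d n x) \<partial>lebesgue) = ennreal (4^n) * ennreal ((dist (X (Suc n)) (X n))\<^sup>2)"
      unfolding d_def nn_integral_l2_rep[symmetric]
      by (subst nn_integral_cmult[symmetric]) (auto simp: ennreal_mult)
    also have "\<dots> = ennreal (4^n * (dist (X (Suc n)) (X n))\<^sup>2)" by (simp add: ennreal_mult)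
    also have "\<dots> \<le> ennreal (4^n * ((1/4)^n)\<^sup>2)"
      using step[of n] by (intro ennreal_leI mult_left_mono power_mono) auto
    also have "4^n * ((1/4)^n)\<^sup>2 = (1/4::real)^n"
      by (simp add: power2_eq_square power_mult_distrib[symmetric] mult.assoc[symmetric])
    finally show "(\<integral>\<^sup>+x. ennreal (d n x) \<partial>lebesgue) \<le> ennreal ((1/4)^n)" .
  qed auto
  also have "\<dots> = ennreal (\<Sum>n. (1/4)^n)"
    by (intro suminf_ennreal2) (auto intro: summable_geometric)
  also have "\<dots> < \<infinity>" by simp
  finally have "AE x in lebesgue. (\<Sum>n. ennreal (d n x)) \<noteq> \<infinity>"
    by (intro nn_integral_PInf_AE) (auto intro!: borel_measurable_suminf)
  then show ?thesis
  proof eventually_elim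
    case (elim x)
    have "summable (\<lambda>n. d n x)"
      using elim by (intro summable_suminf_not_top) (auto simp: d_def)
    then have "Bseq (\<lambda>n. d n x)"
      by (intro convergent_imp_Bseq convergentI[OF summable_LIMSEQ_zero])
    then obtain K where K: "\<And>n. norm (d n x) \<le> K" using BseqE by metis
    have "norm (rep_l2 (X (Suc n)) x - rep_l2 (X n) x) \<le> sqrt K * (1/2)^n" for n
    proof (rule power2_le_imp_le)
      have "4^n * (norm (rep_l2 (X (Suc n)) x - rep_l2 (X n) x))\<^sup>2 \<le> K"
        using K[of n] by (simp add: d_def)
      then have "(norm (rep_l2 (X (Suc n)) x - rep_l2 (X n) x))\<^sup>2 \<le> K / 4^n"
        by (simp add: field_simps)
      also have "K / 4^n = (sqrt K * (1/2)^n)\<^sup>2"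
        using K[of 0] norm_ge_zero order_trans
        by (subst power_mult_distrib, subst real_sqrt_pow2)
          (blast, simp add: power_divide power_mult[symmetric] mult.commute[of n] power_mult)
      finally show "(norm (rep_l2 (X (Suc n)) x - rep_l2 (X n) x))\<^sup>2 \<le> (sqrt K * (1/2)^n)\<^sup>2" .
      show "0 \<le> sqrt K * (1/2)^n" using K[of 0] norm_ge_zero order_trans by (metis mult_nonneg_nonneg real_sqrt_ge_zero zero_le_power zero_le_divide_1_iff zero_le_numeral)
    qed
    moreover have "summable (\<lambda>n. sqrt K * (1/2)^n)"
      by (rule summable_mult) (simp add: summable_geometric)
    ultimately have "summable (\<lambda>n. rep_l2 (X (Suc n)) x - rep_l2 (X n) x)"
      using summable_comparison_test'[of "\<lambda>n. sqrt K * (1/2)^n" 0 "\<lambda>n. rep_l2 (X (Suc n)) x - rep_l2 (X n) x"]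
      by blast
    then have "convergent (\<lambda>n. \<Sum>i<n. rep_l2 (X (Suc i)) x - rep_l2 (X i) x)"
      by (simp add: summable_iff_convergent)
    then have "convergent (\<lambda>n. rep_l2 (X n) x - rep_l2 (X 0) x)"
      by (simp only: sum_lessThan_telescope[of "\<lambda>n. rep_l2 (X n) x"])
    then show ?case
      using convergent_add[OF _ convergent_const, of "\<lambda>n. rep_l2 (X n) x - rep_l2 (X 0) x" "rep_l2 (X 0) x"]
      by simp
  qed
qed

text \<open>Riesz--Fischer argument: the pointwise limit is the candidate, and Fatou's lemma bounds
  its distance to \<open>X m\<close> by an upper bound for the distances from \<open>X m\<close> to
  all later members.\<close>

lemma l2_geometric_convergent:
  fixes X :: "nat \<Rightarrow> ('a::euclidean_space, 'b::euclidean_space) l2"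
  assumes step: "\<And>n. dist (X (Suc n)) (X n) \<le> (1/4)^n" and X: "Cauchy X"
  shows "\<exists>a. X \<longlonglongrightarrow> a"
proof -
  define f where "f x = lim (\<lambda>n. rep_l2 (X n) x)" for x
  have [measurable]: "f \<in> borel_measurable lebesgue"
    unfolding f_def by (rule borel_measurable_lim_metric) simp
  have conv: "AE x in lebesgue. (\<lambda>n. rep_l2 (X n) x) \<longlonglongrightarrow> f x"
    using l2_geometric_AE_convergent[OF step] by eventually_elim (simp add: f_def convergent_LIMSEQ_iff)
  have fatou: "(\<integral>\<^sup>+x. ennreal ((norm (f x - rep_l2 (X m) x))\<^sup>2) \<partial>lebesgue) \<le> ennreal (e\<^sup>2)"
    if "e > 0" "\<And>n. n \<ge> N \<Longrightarrow> dist (X n) (X m) \<le> e" for e m N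
  proof -
    have "(\<integral>\<^sup>+x. ennreal ((norm (f x - rep_l2 (X m) x))\<^sup>2) \<partial>lebesgue)
      = (\<integral>\<^sup>+x. liminf (\<lambda>n. ennreal ((norm (rep_l2 (X n) x - rep_l2 (X m) x))\<^sup>2)) \<partial>lebesgue)"
    proof (rule nn_integral_cong_AE, use conv in eventually_elim)
      case (elim x)
      have "(\<lambda>n. ennreal ((norm (rep_l2 (X n) x - rep_l2 (X m) x))\<^sup>2)) \<longlonglongrightarrow> ennreal ((norm (f x - rep_l2 (X m) x))\<^sup>2)"
        by (intro tendsto_ennrealI tendsto_power tendsto_norm tendsto_diff elim tendsto_const)
      from lim_imp_Liminf[OF _ this] show ?case by simp
    qed
    also have "\<dots> \<le> liminf (\<lambda>n. \<integral>\<^sup>+x. ennreal ((norm (rep_l2 (X n) x - rep_l2 (X m) x))\<^sup>2) \<partial>lebesgue)"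
      by (rule nn_integral_liminf) measurable
    also have "\<dots> = liminf (\<lambda>n. ennreal ((dist (X n) (X m))\<^sup>2))" by (simp add: nn_integral_l2_rep)
    also have "\<dots> \<le> limsup (\<lambda>n. ennreal ((dist (X n) (X m))\<^sup>2))" by (rule Liminf_le_Limsup) simp
    also have "\<dots> \<le> ennreal (e\<^sup>2)"
      using that by (intro Limsup_bounded) (auto simp: eventually_sequentially intro!: exI[of _ N] ennreal_leI power_mono)
    finally show ?thesis .
  qed
  have sq: "square_integrable f"
  proof -
    obtain N where N: "\<And>n. n \<ge> N \<Longrightarrow> dist (X n) (X N) \<le> 1"
      using metric_CauchyD[OF X, of 1] less_imp_le by (metis order_refl zero_less_one)
    have "integrable lebesgue (\<lambda>x. (norm (f x - rep_l2 (X N) x))\<^sup>2)"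
      using fatou[of 1 N N, OF _ N] by (intro integrableI_bounded) (auto simp: order.strict_trans1)
    then have "square_integrable (\<lambda>x. f x - rep_l2 (X N) x)" by (simp add: square_integrable_def)
    from square_integrable_add[OF this square_integrable_rep[of "X N"]] show ?thesis by simp
  qed
  have "X \<longlonglongrightarrow> abs_l2 f"
  proof (rule metric_LIMSEQ_I)
    fix r :: real assume r: "r > 0"
    obtain N where N: "\<And>m n. m \<ge> N \<Longrightarrow> n \<ge> N \<Longrightarrow> dist (X n) (X m) < r / 2"
      using metric_CauchyD[OF X, of "r/2"] r by auto
    have "dist (X m) (abs_l2 f) < r" if "m \<ge> N" for m
    proof -
      have "ennreal ((dist (abs_l2 f) (X m))\<^sup>2) = (\<integral>\<^sup>+x. ennreal ((norm (rep_l2 (abs_l2 f) x - rep_l2 (X m) x))\<^sup>2) \<partial>lebesgue)"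
        by (rule nn_integral_l2_rep[symmetric])
      also have "\<dots> = (\<integral>\<^sup>+x. ennreal ((norm (f x - rep_l2 (X m) x))\<^sup>2) \<partial>lebesgue)"
        using rep_abs_l2[OF sq] by (intro nn_integral_cong_AE) auto
      also have "\<dots> \<le> ennreal ((r/2)\<^sup>2)"
        using r N[OF that] by (intro fatou[of _ N]) (auto intro: less_imp_le)
      finally have "(dist (abs_l2 f) (X m))\<^sup>2 \<le> (r/2)\<^sup>2" by simp
      then have "dist (abs_l2 f) (X m) \<le> r / 2" using r by (simp add: power2_le_iff_abs_le)
      then show ?thesis using r by (simp add: dist_commute)
    qed
    then show "\<exists>no. \<forall>n\<ge>no. dist (X n) (abs_l2 f) < r" by blast
  qed
  then show ?thesis ..
qed

lemma Cauchy_geometric_subseq: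
  fixes X :: "nat \<Rightarrow> 'h::metric_space"
  assumes "Cauchy X"
  shows "\<exists>r. strict_mono r \<and> (\<forall>n. dist (X (r (Suc n))) (X (r n)) \<le> (1/4)^n)"
proof -
  have "\<exists>N. \<forall>m\<ge>N. \<forall>n\<ge>N. dist (X m) (X n) < (1/4)^k" for k :: nat
    using metric_CauchyD[OF assms, of "(1/4)^k"] by simp
  then obtain N where N: "\<And>k m n. m \<ge> N k \<Longrightarrow> n \<ge> N k \<Longrightarrow> dist (X m) (X n) < (1/4)^k" by metis
  \<comment> \<open>The sum dominates \<open>N n\<close>, and the summand \<open>n\<close> makes the
    sequence strictly increasing.\<close>
  define r where "r n = (\<Sum>k\<le>n. N k) + n" for n
  have "N n \<le> r n" for n
    unfolding r_def using member_le_sum[of n "{..n}" N] by simp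
  moreover have mono: "strict_mono r" by (rule strict_mono_Suc_iff[THEN iffD2]) (simp add: r_def)
  ultimately show ?thesis
    by (intro exI[of _ r] conjI allI less_imp_le[OF N]) (meson order.trans lessI less_imp_le strict_monoD)+
qed

instance l2 :: (euclidean_space, euclidean_space) complete_space
proof
  fix X :: "nat \<Rightarrow> ('a, 'b) l2" assume X: "Cauchy X"
  obtain r where r: "strict_mono r" "\<And>n. dist (X (r (Suc n))) (X (r n)) \<le> (1/4)^n"
    using Cauchy_geometric_subseq[OF X] by blast
  have "Cauchy (X \<circ> r)" using X r(1) by (rule Cauchy_subseq_Cauchy)
  with l2_geometric_convergent[of "X \<circ> r"] r(2) obtain a where "(X \<circ> r) \<longlonglongrightarrow> a" by auto
  then show "convergent X"
    using Cauchy_converges_subseq[OF X r(1)] by (auto simp: convergent_def o_def)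
qed

text \<open>Norm convergence says that the squared differences tend to \<open>0\<close> in
  \<open>L^1\<close>, which forces convergence almost everywhere along a subsequence.\<close>

lemma l2_convergent_AE_subseq:
  fixes X :: "nat \<Rightarrow> ('a::euclidean_space, 'b::euclidean_space) l2"
  assumes "X \<longlonglongrightarrow> a"
  shows "\<exists>r. strict_mono r \<and> (AE x in lebesgue. (\<lambda>n. rep_l2 (X (r n)) x) \<longlonglongrightarrow> rep_l2 a x)"
proof -
  have int: "integrable lebesgue (\<lambda>x. (norm (rep_l2 (X n) x - rep_l2 a x))\<^sup>2)" for n
    using square_integrable_minus[of "rep_l2 (X n)" "rep_l2 a"] by (simp add: square_integrable_def)
  have "(\<lambda>n. LINT x|lebesgue. norm ((norm (rep_l2 (X n) x - rep_l2 a x))\<^sup>2)) \<longlonglongrightarrow> 0"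
  proof -
    have "(\<lambda>n. (dist (X n) a)\<^sup>2) \<longlonglongrightarrow> 0\<^sup>2"
      using assms by (intro tendsto_power) (simp add: tendsto_dist_iff[symmetric])
    then show ?thesis by (simp add: dist_l2_rep)
  qed
  then obtain r where r: "strict_mono r" "AE x in lebesgue. (\<lambda>n. (norm (rep_l2 (X (r n)) x - rep_l2 a x))\<^sup>2) \<longlonglongrightarrow> 0"
    using tendsto_L1_AE_subseq[of lebesgue "\<lambda>n x. (norm (rep_l2 (X n) x - rep_l2 a x))\<^sup>2", OF int] by blast
  have "AE x in lebesgue. (\<lambda>n. rep_l2 (X (r n)) x) \<longlonglongrightarrow> rep_l2 a x"
    using r(2)
  proof eventually_elim
    case (elim x)
    have "(\<lambda>n. sqrt ((norm (rep_l2 (X (r n)) x - rep_l2 a x))\<^sup>2)) \<longlonglongrightarrow> sqrt 0"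
      by (rule tendsto_real_sqrt[OF elim])
    then have "(\<lambda>n. norm (rep_l2 (X (r n)) x - rep_l2 a x)) \<longlonglongrightarrow> 0" by simp
    then show ?case by (rule LIM_zero_cancel[OF tendsto_norm_zero_cancel])
  qed
  then show ?thesis using r(1) by blast
qed

section \<open>Test functions and the fundamental lemma\<close>

text \<open>For \<open>m = 0\<close> the usual smooth cutoff of the half-line. The negative powers
  of \<open>t\<close> make the family closed under differentiation up to linear combinations, and
  \<open>c\<close> is a parameter because \<open>bump 0 c\<close> tends to the indicator of the
  positive numbers as \<open>c\<close> tends to \<open>0\<close>.\<close>

definition bump :: "nat \<Rightarrow> real \<Rightarrow> real \<Rightarrow> real" where
  "bump m c t = (if t > 0 then (1/t)^m * exp (- (c/t)) else 0)"

text \<open>In the variable \<open>s = 1 / t\<close> this is the decay of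
  \<open>s^m / exp (c * s)\<close> at infinity.\<close>

lemma bump_tendsto_0:
  assumes "c > 0"
  shows "(bump m c \<longlongrightarrow> 0) (at 0)"
proof -
  have "((\<lambda>s::real. s ^ m / exp s) \<longlongrightarrow> 0) at_top" by (rule tendsto_power_div_exp_0)
  moreover have "filterlim (\<lambda>s. c * s) at_top at_top"
    using assms by (intro filterlim_tendsto_pos_mult_at_top[OF tendsto_const]) (auto simp: filterlim_ident)
  ultimately have "((\<lambda>s. (c * s) ^ m / exp (c * s)) \<longlongrightarrow> 0) at_top" by (rule filterlim_compose)
  then have "((\<lambda>s. (1/c^m) * ((c * s) ^ m / exp (c * s))) \<longlongrightarrow> 0) at_top" by (rule tendsto_mult_right_zero)
  then have "((\<lambda>s. s ^ m / exp (c * s)) \<longlongrightarrow> 0) at_top"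
    using assms by (simp add: power_mult_distrib)
  then have "((\<lambda>t. (1/t) ^ m / exp (c*(1/t))) \<longlongrightarrow> 0) (at_right 0)"
    using filterlim_compose[OF _ filterlim_inverse_at_top_right, of "\<lambda>s. s ^ m / exp (c * s)"]
    by (simp add: inverse_eq_divide)
  then have right: "(bump m c \<longlongrightarrow> 0) (at_right 0)"
    by (rule Lim_transform_eventually)
      (auto simp: bump_def exp_minus field_simps eventually_at_right_less eventually_at_filter)
  have "(bump m c \<longlongrightarrow> 0) (at_left 0)"
    by (rule Lim_transform_eventually[OF tendsto_const]) (auto simp: bump_def eventually_at_filter)
  with right show ?thesis by (simp add: filterlim_split_at)
qed

text \<open>Only \<open>t = 0\<close> needs an argument: the difference quotient there is
  \<open>bump (m + 1) c\<close>, which tends to \<open>0\<close>.\<close>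

lemma bump_has_derivative:
  assumes "c > 0"
  shows "(bump m c has_real_derivative (c * bump (m + 2) c t - real m * bump (m + 1) c t)) (at t)"
proof -
  consider "t > 0" | "t = 0" | "t < 0" by linarith
  then show ?thesis
  proof cases
    case 1
    have "((\<lambda>t. (1/t)^m * exp (- (c/t))) has_real_derivative (c * bump (m + 2) c t - real m * bump (m + 1) c t)) (at t)"
    proof -
      define s where "s = 1 / t"
      have s: "((\<lambda>t. 1 / t) has_real_derivative - (s * s)) (at t)"
        using 1 by (auto intro!: derivative_eq_intros simp: s_def)
      have e: "((\<lambda>t. exp (- (c / t))) has_real_derivative exp (- (c / t)) * (c * (s * s))) (at t)"
        using 1 by (auto intro!: derivative_eq_intros simp: s_def power2_eq_square)
      show ?thesis
      proof (cases m)
        case 0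
        then show ?thesis using 1 e by (simp add: bump_def s_def[symmetric] algebra_simps)
      next
        case (Suc k)
        have "((\<lambda>t. (1/t)^Suc k * exp (- (c/t))) has_real_derivative
          (1 + real k) * (- (s * s) * (1/t)^k) * exp (- (c / t)) + exp (- (c / t)) * (c * (s * s)) * (1/t)^Suc k) (at t)"
          by (rule DERIV_mult[OF DERIV_power_Suc[OF s] e])
        moreover have "(1 + real k) * (- (s * s) * (1/t)^k) * exp (- (c / t)) + exp (- (c / t)) * (c * (s * s)) * (1/t)^Suc k
          = c * bump (m + 2) c t - real m * bump (m + 1) c t"
          using 1 by (simp add: Suc bump_def s_def[symmetric] algebra_simps)
        ultimately show ?thesis by (simp add: Suc)
      qed
    qed
    then show ?thesis
      by (rule has_field_derivative_transform_within_open[where S="{0<..}"]) (use 1 in \<open>auto simp: bump_def\<close>)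
  next
    case 2
    have "((\<lambda>h. bump (m + 1) c h) \<longlongrightarrow> 0) (at 0)" using bump_tendsto_0[OF assms] .
    then have "((\<lambda>h. (bump m c h - bump m c 0) / (h - 0)) \<longlongrightarrow> 0) (at 0)"
      by (rule Lim_transform_eventually) (auto simp: bump_def eventually_at_filter)
    then show ?thesis using 2 by (simp add: has_field_derivative_iff bump_def)
  next
    case 3
    have "((\<lambda>t. 0) has_real_derivative (c * bump (m + 2) c t - real m * bump (m + 1) c t)) (at t)"
      using 3 by (auto simp: bump_def)
    then show ?thesis
      by (rule has_field_derivative_transform_within_open[where S="{..<0}"]) (use 3 in \<open>auto simp: bump_def\<close>)
  qed
qed

text \<open>The class contains its own directional derivatives, so membership alone yields
  \<open>Ck k\<close> for every \<open>k\<close> and products of bumps need no computation.\<close>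

inductive bump_algebra :: "('a::euclidean_space \<Rightarrow> real) \<Rightarrow> bool" where
  const: "bump_algebra (\<lambda>x. k)"
| bump: "c > 0 \<Longrightarrow> bump_algebra (\<lambda>x. bump m c (x \<bullet> v + k))"
| add: "bump_algebra f \<Longrightarrow> bump_algebra g \<Longrightarrow> bump_algebra (\<lambda>x. f x + g x)"
| mult: "bump_algebra f \<Longrightarrow> bump_algebra g \<Longrightarrow> bump_algebra (\<lambda>x. f x * g x)"

lemma bump_algebra_prod:
  "finite I \<Longrightarrow> (\<And>i. i \<in> I \<Longrightarrow> bump_algebra (f i)) \<Longrightarrow> bump_algebra (\<lambda>x. \<Prod>i\<in>I. f i x)"
  by (induction I rule: finite_induct) (auto intro: bump_algebra.const bump_algebra.mult)

lemma bump_algebra_derivative: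
  "bump_algebra f \<Longrightarrow> \<exists>f'. (\<forall>x. (f has_derivative f' x) (at x)) \<and> (\<forall>h. bump_algebra (\<lambda>x. f' x h))"
proof (induction rule: bump_algebra.induct)
  case (const k)
  show ?case by (intro exI[of _ "\<lambda>x h. 0"]) (auto intro: bump_algebra.const)
next
  case (bump c m v k)
  let ?d = "\<lambda>x h. (c * bump (m + 2) c (x \<bullet> v + k) + - real m * bump (m + 1) c (x \<bullet> v + k)) * (h \<bullet> v)"
  have "((\<lambda>x. bump m c (x \<bullet> v + k)) has_derivative ?d x) (at x)" for x
  proof -
    have "((\<lambda>x. x \<bullet> v + k) has_derivative (\<lambda>h. h \<bullet> v)) (at x)"
      by (auto intro!: derivative_eq_intros)
    from has_derivative_compose[OF this bump_has_derivative[OF bump, THEN has_field_derivative_imp_has_derivative]]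
    show ?thesis by simp
  qed
  moreover have "bump_algebra (\<lambda>x. ?d x h)" for h
    using bump by (intro bump_algebra.intros) 
  ultimately show ?case by (intro exI[of _ ?d]) simp
next
  case (add f g)
  then obtain f' g' where "\<And>x. (f has_derivative f' x) (at x)" "\<And>x. (g has_derivative g' x) (at x)"
    "\<And>h. bump_algebra (\<lambda>x. f' x h)" "\<And>h. bump_algebra (\<lambda>x. g' x h)" by blast
  then show ?case
    by (intro exI[of _ "\<lambda>x h. f' x h + g' x h"]) (auto intro: bump_algebra.intros has_derivative_add)
next
  case (mult f g)
  then obtain f' g' where "\<And>x. (f has_derivative f' x) (at x)" "\<And>x. (g has_derivative g' x) (at x)"
    "\<And>h. bump_algebra (\<lambda>x. f' x h)" "\<And>h. bump_algebra (\<lambda>x. g' x h)" by blast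
  then show ?case using mult.hyps
    by (intro exI[of _ "\<lambda>x h. f x * g' x h + f' x h * g x"] conjI allI bump_algebra.add
        bump_algebra.mult has_derivative_mult)
qed

lemma bump_algebra_Ck: "bump_algebra f \<Longrightarrow> Ck k f"
proof (induction k arbitrary: f)
  case 0
  then obtain f' where "\<And>x. (f has_derivative f' x) (at x)" using bump_algebra_derivative by blast
  then have "continuous_on UNIV f"
    by (auto simp: continuous_on_eq_continuous_at intro: has_derivative_continuous)
  then show ?case by simp
next
  case (Suc k)
  then obtain f' where f': "\<And>x. (f has_derivative f' x) (at x)" "\<And>h. bump_algebra (\<lambda>x. f' x h)"
    using bump_algebra_derivative by blast
  have "partial_deriv i f = (\<lambda>x. f' x i)" for i
    using frechet_derivative_at[OF f'(1)] by (intro ext) simp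
  then show ?case using f' Suc.IH by (auto simp: differentiable_def)
qed

text \<open>One factor for each face of the box, so the support is the closed box; as
  \<open>c\<close> tends to \<open>0\<close> the functions approach the indicator of the open box
  from below.\<close>

definition box_bump :: "real \<Rightarrow> 'a::euclidean_space \<Rightarrow> 'a \<Rightarrow> 'a \<Rightarrow> real" where
  "box_bump c a b x = (\<Prod>i\<in>Basis. bump 0 c (x \<bullet> i + - (a \<bullet> i)) * bump 0 c (x \<bullet> (- i) + b \<bullet> i))"

lemma box_bump_pos: "x \<in> box a b \<Longrightarrow> 0 < box_bump c a b x"
  unfolding box_bump_def by (intro prod_pos) (auto simp: bump_def mem_box)

lemma box_bump_eq_0: 
  assumes "x \<notin> box a b"
  shows "box_bump c a b x = 0"
proof -
  from assms obtain i where "i \<in> Basis" "\<not> (a \<bullet> i < x \<bullet> i \<and> x \<bullet> i < b \<bullet> i)" by (auto simp: mem_box)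
  then show ?thesis unfolding box_bump_def by (intro prod_zero bexI[of _ i]) (auto simp: bump_def)
qed

lemma box_bump_bounds:
  assumes "c > 0"
  shows "0 \<le> box_bump c a b x" "box_bump c a b x \<le> 1"
proof -
  have *: "0 \<le> bump 0 c t" "bump 0 c t \<le> 1" for t using assms by (auto simp: bump_def)
  show "0 \<le> box_bump c a b x" unfolding box_bump_def by (intro prod_nonneg) (auto simp: *)
  show "box_bump c a b x \<le> 1" unfolding box_bump_def by (intro prod_le_1) (auto simp: * mult_le_one)
qed

lemma box_bump_tendsto:
  "(\<lambda>n. box_bump (1 / real (Suc n)) a b x) \<longlonglongrightarrow> indicator (box a b) x"
proof (cases "x \<in> box a b")
  case True
  have b: "(\<lambda>n. bump 0 (1 / real (Suc n)) t) \<longlonglongrightarrow> 1" if "t > 0" for t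
  proof -
    have "(\<lambda>n. exp (- ((1 / real (Suc n)) / t))) \<longlonglongrightarrow> exp (- (0 / t))"
      using LIMSEQ_inverse_real_of_nat that
      by (intro tendsto_exp tendsto_minus tendsto_divide tendsto_const) (auto simp: inverse_eq_divide)
    then show ?thesis using that by (simp add: bump_def)
  qed
  have "(\<lambda>n. box_bump (1 / real (Suc n)) a b x) \<longlonglongrightarrow> (\<Prod>i\<in>(Basis::'a set). 1 * 1)"
    unfolding box_bump_def using True by (intro tendsto_prod tendsto_mult b) (auto simp: mem_box)
  then show ?thesis using True by simp
next
  case False
  then show ?thesis by (simp add: box_bump_eq_0)
qed

lemma box_bump_test_function:
  assumes "c > 0" "cbox a b \<subseteq> \<Omega>"
  shows "box_bump c a b \<in> test_functions \<Omega>"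
proof -
  have "bump_algebra (box_bump c a b)"
    unfolding box_bump_def[abs_def] using assms(1)
    by (intro bump_algebra_prod bump_algebra.intros) auto
  moreover have "closure {x. box_bump c a b x \<noteq> 0} \<subseteq> cbox a b"
    using box_bump_eq_0 box_subset_cbox by (intro closure_minimal) fastforce+
  moreover then have "compact (closure {x. box_bump c a b x \<noteq> 0})"
    by (meson bounded_cbox bounded_subset closed_closure compact_eq_bounded_closed)
  ultimately show ?thesis using assms(2) bump_algebra_Ck by (auto simp: test_functions_def)
qed

text \<open>Bumps converge boundedly to indicators, so \<open>H\<close> has integral zero over every
  open box whose closed box lies in \<open>\<Omega>\<close>. Open boxes are an intersection-stable
  generator of the Borel sets; a Dynkin argument extends this to all Borel subsets of
  \<open>box p q\<close>, and an integrable function whose set integrals vanish is zero.\<close>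

lemma AE_zero_box:
  fixes H :: "'a::euclidean_space \<Rightarrow> real"
  assumes H: "integrable lebesgue H"
    and test: "\<And>f. f \<in> test_functions \<Omega> \<Longrightarrow> (LINT x|lebesgue. H x * f x) = 0"
    and p: "cbox p q \<subseteq> \<Omega>"
  shows "AE x in lebesgue. x \<in> box p q \<longrightarrow> H x = 0"
proof -
  have [measurable]: "H \<in> borel_measurable lebesgue" using H by auto
  have box0: "(LINT x|lebesgue. H x * indicator (box a b) x) = 0" if ab: "cbox a b \<subseteq> \<Omega>" for a b
  proof -
    have meas: "box_bump (1 / real (Suc n)) a b \<in> borel_measurable lebesgue" for n
    proof -
      have "continuous_on UNIV (box_bump (1 / real (Suc n)) a b)"
        using box_bump_test_function[of "1 / real (Suc n)", OF _ ab]
        unfolding test_functions_def by (auto dest: spec[of _ 0])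
      then show ?thesis by (simp add: borel_measurable_continuous_onI measurable_completion)
    qed
    have "(\<lambda>n. LINT x|lebesgue. H x * box_bump (1 / real (Suc n)) a b x) \<longlonglongrightarrow> (LINT x|lebesgue. H x * indicator (box a b) x)"
    proof (rule integral_dominated_convergence[where w="\<lambda>x. \<bar>H x\<bar>"])
      show "AE x in lebesgue. (\<lambda>n. H x * box_bump (1 / real (Suc n)) a b x) \<longlonglongrightarrow> H x * indicator (box a b) x"
        by (intro AE_I2 tendsto_mult tendsto_const box_bump_tendsto)
      show "AE x in lebesgue. norm (H x * box_bump (1 / real (Suc n)) a b x) \<le> \<bar>H x\<bar>" for n
        using box_bump_bounds[of "1 / real (Suc n)" a b]
        by (intro AE_I2) (auto simp: abs_mult intro!: mult_left_le)
    next
      show "(\<lambda>x. H x * indicator (box a b) x) \<in> borel_measurable lebesgue"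
        by (intro borel_measurable_times borel_measurable_indicator) auto
    qed (use H meas in auto)
    moreover have "(LINT x|lebesgue. H x * box_bump (1 / real (Suc n)) a b x) = 0" for n
      by (intro test box_bump_test_function ab) simp
    ultimately show ?thesis by (simp add: LIMSEQ_const_iff)
  qed
  \<comment> \<open>The restriction to \<open>box p q\<close> makes every box admissible, since its
    intersection with \<open>box p q\<close> has its closure inside \<open>\<Omega>\<close>.\<close>
  define K where "K x = H x * indicator (box p q) x" for x
  have Kint: "integrable lebesgue K"
    unfolding K_def using integrable_mult_indicator[of "box p q" lebesgue H] H
    by (simp add: mult.commute)
  have K0: "(LINT x:A|lebesgue. K x) = 0" if "A \<in> sets borel" for A
  proof -
    have "Int_stable (range (\<lambda>(a, b). box a b :: 'a set))"
      by (auto simp: Int_stable_def box_Int_box)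
    moreover have "range (\<lambda>(a, b). box a b :: 'a set) \<subseteq> Pow UNIV" by simp
    moreover have "A \<in> sigma_sets UNIV (range (\<lambda>(a, b). box a b :: 'a set))"
      using that borel_eq_box by (metis sets_measure_of subset_UNIV Pow_UNIV)
    ultimately show ?thesis
    proof (induction rule: sigma_sets_induct_disjoint)
      case (basic A)
      then obtain a b where A: "A = box a b" by auto
      define a' where "a' = (\<Sum>i\<in>Basis. max (a\<bullet>i) (p\<bullet>i) *\<^sub>R i)"
      define b' where "b' = (\<Sum>i\<in>Basis. min (b\<bullet>i) (q\<bullet>i) *\<^sub>R i)"
      have eq: "box a b \<inter> box p q = box a' b'" unfolding a'_def b'_def by (rule box_Int_box)
      have "(LINT x:A|lebesgue. K x) = (LINT x|lebesgue. H x * indicator (box a' b') x)"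
        unfolding set_lebesgue_integral_def K_def A eq[symmetric]
        by (intro Bochner_Integration.integral_cong) (auto simp: indicator_def)
      also have "\<dots> = 0"
      proof (cases "box a' b' = {}")
        case False
        then have "cbox a' b' = closure (box a' b')" by (simp add: closure_box)
        also have "\<dots> \<subseteq> cbox p q"
          using eq box_subset_cbox[of p q] by (intro closure_minimal) auto
        finally show ?thesis using p by (intro box0) auto
      qed simp
      finally show ?case .
    next
      case empty show ?case by (simp add: set_lebesgue_integral_def)
    next
      case (compl A)
      have "A \<in> sets borel" using compl(1) borel_eq_box by (metis sets_measure_of subset_UNIV Pow_UNIV)
      then have A: "A \<in> sets lebesgue" by simp
      have "(LINT x:UNIV|lebesgue. K x) = (LINT x:A|lebesgue. K x) + (LINT x:UNIV - A|lebesgue. K x)"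
        using set_integral_Un[of A "UNIV - A" lebesgue K] integrable_mult_indicator[OF A Kint]
          integrable_mult_indicator[OF sets.compl_sets[OF A] Kint]
        by (auto simp: set_integrable_def)
      moreover have "(LINT x:UNIV|lebesgue. K x) = 0"
        using box0[OF p] by (simp add: set_lebesgue_integral_def K_def)
      ultimately show ?case using compl by simp
    next
      case (union A)
      have "A i \<in> sets borel" for i
        using union(2) borel_eq_box by (metis sets_measure_of subset_UNIV Pow_UNIV range_subsetD)
      then have A: "A i \<in> sets lebesgue" for i by simp
      have "(LINT x:(\<Union>i. A i)|lebesgue. K x) = (\<Sum>i. (LINT x:(A i)|lebesgue. K x))"
        using A union(1) integrable_mult_indicator[OF sets.countable_UN'' Kint, of UNIV A]
        by (intro lebesgue_integral_countable_add)
          (auto simp: disjoint_family_on_def set_integrable_def)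
      then show ?case using union by simp
    qed
  qed
  \<comment> \<open>A Borel version of \<open>K\<close> is taken because the conclusion from
    vanishing set integrals is drawn with respect to \<open>lborel\<close>.\<close>
  obtain K' where K': "K' \<in> borel_measurable lborel" "AE x in lborel. K x = K' x"
    using completion_ex_borel_measurable_real[of K lborel] Kint by auto
  then have AE': "AE x in lebesgue. K x = K' x" by (simp add: AE_completion)
  have K'm: "K' \<in> borel_measurable lebesgue" using K'(1) by (simp add: measurable_completion)
  have "integrable lebesgue K'"
    using integrable_cong_AE[OF _ K'm AE'] Kint by auto
  then have K'int: "integrable lborel K'" using K'(1) by (simp add: integrable_completion)
  have "AE x in lborel. K' x = 0"
  proof (rule sigma_finite_measure.density_zero[OF sigma_finite_lborel K'int])
    fix A :: "'a set" assume A: "A \<in> sets lborel"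
    have "(LINT x:A|lborel. K' x) = (LINT x:A|lebesgue. K' x)"
      unfolding set_lebesgue_integral_def using A K'(1) by (subst integral_completion) auto
    also have "\<dots> = (LINT x:A|lebesgue. K x)"
      unfolding set_lebesgue_integral_def using A K'm Kint AE'
      by (intro integral_cong_AE) (auto intro!: borel_measurable_times borel_measurable_indicator)
    also have "\<dots> = 0" using A by (intro K0) auto
    finally show "(LINT x:A|lborel. K' x) = 0" .
  qed
  then have "AE x in lebesgue. K' x = 0" by (simp add: AE_completion)
  with AE' show ?thesis by eventually_elim (auto simp: K_def indicator_def split: if_splits)
qed

text \<open>Countably many closed boxes exhaust \<open>\<Omega>\<close>, and their boundaries are
  null sets.\<close>

lemma fundamental_lemma_AE_zero:
  fixes h :: "'a::euclidean_space \<Rightarrow> real"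
  assumes \<Omega>: "open \<Omega>" and h: "integrable (lebesgue_on \<Omega>) h"
    and test: "\<And>f. f \<in> test_functions \<Omega> \<Longrightarrow> (LINT x|lebesgue_on \<Omega>. h x * f x) = 0"
  shows "AE x in lebesgue_on \<Omega>. h x = 0"
proof -
  have \<Omega>s: "\<Omega> \<inter> space lebesgue \<in> sets lebesgue" using \<Omega> by auto
  define H where "H x = indicator \<Omega> x * h x" for x
  have H: "integrable lebesgue H"
    using h integrable_restrict_space[OF \<Omega>s, of h] unfolding H_def by simp
  have H0: "(LINT x|lebesgue. H x * f x) = 0" if "f \<in> test_functions \<Omega>" for f
    using test[OF that] integral_restrict_space[OF \<Omega>s, of "\<lambda>x. h x * f x"]
    by (simp add: H_def mult.assoc)
  obtain \<D> where \<D>: "countable \<D>" "\<And>X. X \<in> \<D> \<Longrightarrow> \<exists>a b. X = cbox a b" "\<Union>\<D> = \<Omega>"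
    using open_countable_Union_open_cbox[OF \<Omega>] by (metis (no_types, lifting))
  have "AE x in lebesgue. \<forall>X\<in>\<D>. x \<in> X \<longrightarrow> H x = 0"
  proof (subst AE_ball_countable[OF \<D>(1)], intro ballI)
    fix X assume X: "X \<in> \<D>"
    then obtain a b where ab: "X = cbox a b" using \<D> by blast
    have "AE x in lebesgue. x \<in> box a b \<longrightarrow> H x = 0"
      using X \<D>(3) ab by (intro AE_zero_box[OF H H0]) auto
    moreover have "AE x in lebesgue. x \<notin> cbox a b - box a b"
      using negligible_frontier_interval[of a b] by (intro AE_not_in) (simp add: negligible_iff_null_sets)
    ultimately show "AE x in lebesgue. x \<in> X \<longrightarrow> H x = 0"
      by eventually_elim (auto simp: ab)
  qed
  then have "AE x in lebesgue. x \<in> \<Omega> \<longrightarrow> h x = 0"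
    by eventually_elim (use \<D>(3) in \<open>auto simp: H_def indicator_def\<close>)
  then show ?thesis using \<Omega>s by (simp add: AE_restrict_space_iff)
qed

section \<open>Poincare, Sobolev and Rellich inequalities\<close>

text \<open>A larger class than the test functions: truncation by a \<open>C^1\<close> profile does
  not leave it, and the proof of the Sobolev inequality is based on such truncations.\<close>

definition C1c :: "('a::euclidean_space \<Rightarrow> real) \<Rightarrow> bool" where
  "C1c f \<longleftrightarrow> (\<forall>x. (f has_derivative (\<lambda>h. gradient f x \<bullet> h)) (at x)) \<and>
     continuous_on UNIV (gradient f) \<and> bounded {x. f x \<noteq> 0}"

lemma gradient_eqI:
  assumes "(f has_derivative (\<lambda>h. g \<bullet> h)) (at x)"
  shows "gradient f x = g"
proof -
  have "frechet_derivative f (at x) = (\<lambda>h. g \<bullet> h)" using frechet_derivative_at[OF assms] by simp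
  then show ?thesis by (simp add: gradient_def euclidean_representation)
qed

lemma has_derivative_gradient:
  assumes "f differentiable (at x)"
  shows "(f has_derivative (\<lambda>h. gradient f x \<bullet> h)) (at x)"
proof -
  have D: "(f has_derivative frechet_derivative f (at x)) (at x)"
    using assms frechet_derivative_works by blast
  interpret linear "frechet_derivative f (at x)"
    using has_derivative_linear[OF D] .
  have "frechet_derivative f (at x) h = gradient f x \<bullet> h" for h
  proof -
    have "frechet_derivative f (at x) h = frechet_derivative f (at x) (\<Sum>i\<in>Basis. (h \<bullet> i) *\<^sub>R i)"
      by (simp add: euclidean_representation)
    also have "\<dots> = gradient f x \<bullet> h"
      unfolding gradient_def by (simp add: sum scale inner_sum_left inner_sum_right inner_commute mult.commute)
    finally show ?thesis .
  qed
  then show ?thesis using D by (metis (no_types, lifting) ext)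
qed

lemma C1cI:
  assumes "\<And>x. (f has_derivative (\<lambda>h. g x \<bullet> h)) (at x)" "continuous_on UNIV g" "bounded {x. f x \<noteq> 0}"
  shows "C1c f" "gradient f = g"
proof -
  show "gradient f = g" using gradient_eqI[OF assms(1)] by auto
  then show "C1c f" using assms by (simp add: C1c_def)
qed

lemma partial_deriv_eq: "f differentiable (at x) \<Longrightarrow> partial_deriv i f x = gradient f x \<bullet> i"
  using frechet_derivative_at[OF has_derivative_gradient] by metis

lemma test_function_C1c:
  assumes "f \<in> test_functions \<Omega>"
  shows "C1c f"
proof -
  have "Ck (Suc 0) f" and c: "compact (closure {x. f x \<noteq> 0})"
    using assms unfolding test_functions_def by blast+
  then have d: "\<And>x. f differentiable (at x)" and p: "\<And>i. i \<in> Basis \<Longrightarrow> continuous_on UNIV (partial_deriv i f)"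
    by auto
  have "continuous_on UNIV (gradient f)"
    unfolding gradient_def by (intro continuous_intros p)
  moreover have "bounded {x. f x \<noteq> 0}"
    using c closure_subset bounded_subset compact_imp_bounded by metis
  ultimately show ?thesis using has_derivative_gradient[OF d] by (simp add: C1c_def)
qed

lemma C1c_continuous: "C1c f \<Longrightarrow> continuous_on A f"
  unfolding C1c_def
  by (meson continuous_at_imp_continuous_on has_derivative_continuous)

lemma C1c_gradient_continuous: "C1c f \<Longrightarrow> continuous_on A (gradient f)"
  unfolding C1c_def using continuous_on_subset by blast

lemma gradient_eq_0:
  assumes "x \<notin> closure {x. f x \<noteq> 0}"
  shows "gradient f x = 0"
proof (rule gradient_eqI)
  have "((\<lambda>x. 0) has_derivative (\<lambda>h. 0 \<bullet> h)) (at x)" by simp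
  then show "(f has_derivative (\<lambda>h. 0 \<bullet> h)) (at x)"
    by (rule has_derivative_transform_within_open[where s="- closure {x. f x \<noteq> 0}"])
      (use assms closure_subset[of "{x. f x \<noteq> 0}"] in auto)
qed

lemma C1c_bounded_gradient: "C1c f \<Longrightarrow> bounded {x. gradient f x \<noteq> 0}"
  unfolding C1c_def by (metis (mono_tags, lifting) bounded_closure bounded_subset gradient_eq_0 mem_Collect_eq subsetI)

lemma C1c_line_derivative:
  assumes "C1c f"
  shows "((\<lambda>t. f (x + t *\<^sub>R v)) has_real_derivative gradient f (x + t *\<^sub>R v) \<bullet> v) (at t)"
proof -
  have 1: "(f has_derivative (\<lambda>k. gradient f (x + t *\<^sub>R v) \<bullet> k)) (at (x + t *\<^sub>R v))"
    using assms by (simp add: C1c_def)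
  have "((\<lambda>t. x + t *\<^sub>R v) has_derivative (\<lambda>s. s *\<^sub>R v)) (at t)"
    by (auto intro!: derivative_eq_intros)
  from has_derivative_compose[OF this 1] show ?thesis
    by (simp add: has_field_derivative_def mult_commute_abs)
qed

lemma integrable_continuous_bounded_support:
  fixes g :: "'a::euclidean_space \<Rightarrow> 'b::euclidean_space"
  assumes "continuous_on UNIV g" "bounded {x. g x \<noteq> 0}"
  shows "integrable lborel g"
proof -
  obtain B where B: "\<And>x. g x \<noteq> 0 \<Longrightarrow> norm x \<le> B" using assms(2) unfolding bounded_iff by auto
  have "integrable lborel (\<lambda>x. indicator (cball 0 B) x *\<^sub>R g x)"
    using assms(1) continuous_on_subset by (intro borel_integrable_compact) auto
  moreover have "indicator (cball 0 B) x *\<^sub>R g x = g x" for x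
    using B by (auto simp: indicator_def)
  ultimately show ?thesis by simp
qed

lemma C1c_integrable_power:
  assumes "C1c f" "k > 0"
  shows "integrable lborel (\<lambda>x. (f x)^k)"
  using assms by (intro integrable_continuous_bounded_support continuous_intros C1c_continuous)
    (auto simp: C1c_def)

lemma C1c_integrable_gradient:
  assumes "C1c f"
  shows "integrable lborel (\<lambda>x. (norm (gradient f x))\<^sup>2)"
  using assms C1c_bounded_gradient
  by (intro integrable_continuous_bounded_support continuous_intros C1c_gradient_continuous) auto

section \<open>Translations, the Poincare inequality and integration by parts\<close>

lemma nn_integral_lborel_translation:
  fixes g :: "'a::euclidean_space \<Rightarrow> ennreal"
  assumes [measurable]: "g \<in> borel_measurable borel"
  shows "(\<integral>\<^sup>+x. g (x + c) \<partial>lborel) = (\<integral>\<^sup>+x. g x \<partial>lborel)"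
proof -
  have "(\<integral>\<^sup>+x. g x \<partial>lborel) = (\<integral>\<^sup>+x. g x \<partial>distr lborel borel ((+) c))"
    by (simp add: lborel_distr_plus)
  also have "\<dots> = (\<integral>\<^sup>+x. g (c + x) \<partial>lborel)" by (subst nn_integral_distr) auto
  finally show ?thesis by (simp add: add.commute)
qed

lemma integral_lborel_translation:
  fixes g :: "'a::euclidean_space \<Rightarrow> real"
  assumes [measurable]: "g \<in> borel_measurable borel"
  shows "(LINT x|lborel. g (x + c)) = (LINT x|lborel. g x)"
proof -
  have "(LINT x|lborel. g x) = (LINT x|distr lborel borel ((+) c). g x)"
    by (simp add: lborel_distr_plus)
  also have "\<dots> = (LINT x|lborel. g (c + x))" by (subst integral_distr) auto
  finally show ?thesis by (simp add: add.commute)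
qed

lemma integrable_lborel_translation:
  fixes g :: "'a::euclidean_space \<Rightarrow> real"
  assumes "integrable lborel g"
  shows "integrable lborel (\<lambda>x. g (x + c))"
proof -
  have [measurable]: "g \<in> borel_measurable borel" using assms by auto
  have "integrable (distr lborel borel ((+) c)) g" using assms by (simp add: lborel_distr_plus)
  then have "integrable lborel (\<lambda>x. g (c + x))" by (subst (asm) integrable_distr_eq) auto
  then show ?thesis by (simp add: add.commute)
qed

text \<open>The integral of \<open>(m - \<phi>')^2\<close> over the unit interval is nonnegative,
  where \<open>m\<close> is the mean of \<open>\<phi>'\<close> by the fundamental theorem of
  calculus.\<close>

lemma sq_increment_le:
  fixes \<phi> \<phi>' :: "real \<Rightarrow> real"
  assumes d: "\<And>t. (\<phi> has_real_derivative \<phi>' t) (at t)" and c: "continuous_on UNIV \<phi>'"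
  shows "ennreal ((\<phi> 1 - \<phi> 0)\<^sup>2) \<le> (\<integral>\<^sup>+t. ennreal ((\<phi>' t)\<^sup>2) * indicator {0..1} t \<partial>lborel)"
proof -
  define m where "m = \<phi> 1 - \<phi> 0"
  have "(\<phi>' has_integral m) {0..1}"
    unfolding m_def using d
    by (intro fundamental_theorem_of_calculus)
      (auto simp: has_real_derivative_iff_has_vector_derivative[symmetric] intro: has_field_derivative_at_within)
  then have "((\<lambda>t. m\<^sup>2 - 2 * m * \<phi>' t) has_integral (1 - 0) *\<^sub>R m\<^sup>2 - 2 * m * m) {0..1}"
    using has_integral_const_real[of "m\<^sup>2" 0 1] by (intro has_integral_diff has_integral_mult_right) auto
  moreover have si: "set_integrable lborel {0..1} (\<lambda>t. (\<phi>' t)\<^sup>2)"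
    using c continuous_on_subset by (intro borel_integrable_atLeastAtMost' continuous_intros) auto
  then have "((\<lambda>t. (\<phi>' t)\<^sup>2) has_integral integral {0..1} (\<lambda>t. (\<phi>' t)\<^sup>2)) {0..1}"
    using set_borel_integral_eq_integral(1) by blast
  ultimately have "((\<lambda>t. (m\<^sup>2 - 2 * m * \<phi>' t) + (\<phi>' t)\<^sup>2) has_integral
      ((1 - 0) *\<^sub>R m\<^sup>2 - 2 * m * m) + integral {0..1} (\<lambda>t. (\<phi>' t)\<^sup>2)) {0..1}"
    by (rule has_integral_add)
  moreover have "0 \<le> (m\<^sup>2 - 2 * m * \<phi>' t) + (\<phi>' t)\<^sup>2" for t
    using zero_le_power2[of "m - \<phi>' t"] by (simp add: power2_diff)
  ultimately have "0 \<le> ((1 - 0) *\<^sub>R m\<^sup>2 - 2 * m * m) + integral {0..1} (\<lambda>t. (\<phi>' t)\<^sup>2)"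
    by (rule has_integral_nonneg) 
  then have "m\<^sup>2 \<le> integral {0..1} (\<lambda>t. (\<phi>' t)\<^sup>2)" by (simp add: power2_eq_square)
  also have "\<dots> = (LINT t:{0..1}|lborel. (\<phi>' t)\<^sup>2)"
    using set_borel_integral_eq_integral(2)[OF si] by simp
  finally have "ennreal (m\<^sup>2) \<le> ennreal (LINT t:{0..1}|lborel. (\<phi>' t)\<^sup>2)" by (rule ennreal_leI)
  also have "\<dots> = (\<integral>\<^sup>+t. ennreal (indicator {0..1} t * (\<phi>' t)\<^sup>2) \<partial>lborel)"
    using si unfolding set_lebesgue_integral_def set_integrable_def
    by (subst nn_integral_eq_integral) auto
  also have "\<dots> = (\<integral>\<^sup>+t. ennreal ((\<phi>' t)\<^sup>2) * indicator {0..1} t \<partial>lborel)"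
    by (intro nn_integral_cong) (auto simp: indicator_def)
  finally show ?thesis by (simp add: m_def)
qed

text \<open>The squared increment is at most an integral over the segment from \<open>x\<close> to
  \<open>x + h\<close>; after exchanging the integrals, translation invariance makes the inner one
  independent of the point on the segment.\<close>

lemma translation_estimate:
  fixes f :: "'a::euclidean_space \<Rightarrow> real"
  assumes f: "C1c f"
  shows "(\<integral>\<^sup>+x. ennreal ((f (x + h) - f x)\<^sup>2) \<partial>lborel)
    \<le> ennreal ((norm h)\<^sup>2 * (LINT x|lborel. (norm (gradient f x))\<^sup>2))"
proof -
  have gm [measurable]: "gradient f \<in> borel_measurable borel"
    by (intro borel_measurable_continuous_onI C1c_gradient_continuous f)
  have pw: "ennreal ((f (x + h) - f x)\<^sup>2) \<le>
      (\<integral>\<^sup>+t. ennreal ((norm h)\<^sup>2 * (norm (gradient f (x + t *\<^sub>R h)))\<^sup>2) * indicator {0..1} t \<partial>lborel)" for x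
  proof -
    have "continuous_on UNIV (\<lambda>t. gradient f (x + t *\<^sub>R h) \<bullet> h)"
      by (intro continuous_intros continuous_on_compose2[OF C1c_gradient_continuous[OF f, of UNIV]]) auto
    then have "ennreal ((f (x + 1 *\<^sub>R h) - f (x + 0 *\<^sub>R h))\<^sup>2)
       \<le> (\<integral>\<^sup>+t. ennreal ((gradient f (x + t *\<^sub>R h) \<bullet> h)\<^sup>2) * indicator {0..1} t \<partial>lborel)"
      by (rule sq_increment_le[OF C1c_line_derivative[OF f]])
    also have "\<dots> \<le> (\<integral>\<^sup>+t. ennreal ((norm h)\<^sup>2 * (norm (gradient f (x + t *\<^sub>R h)))\<^sup>2) * indicator {0..1} t \<partial>lborel)"
    proof (intro nn_integral_mono mult_right_mono ennreal_leI)
      fix t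
      have "\<bar>gradient f (x + t *\<^sub>R h) \<bullet> h\<bar>\<^sup>2 \<le> (norm (gradient f (x + t *\<^sub>R h)) * norm h)\<^sup>2"
        by (intro power_mono Cauchy_Schwarz_ineq2) auto
      then show "(gradient f (x + t *\<^sub>R h) \<bullet> h)\<^sup>2 \<le> (norm h)\<^sup>2 * (norm (gradient f (x + t *\<^sub>R h)))\<^sup>2"
        by (simp add: power_mult_distrib mult.commute)
    qed auto
    finally show ?thesis by simp
  qed
  have "(\<integral>\<^sup>+x. ennreal ((f (x + h) - f x)\<^sup>2) \<partial>lborel) \<le>
     (\<integral>\<^sup>+x. (\<integral>\<^sup>+t. ennreal ((norm h)\<^sup>2 * (norm (gradient f (x + t *\<^sub>R h)))\<^sup>2) * indicator {0..1::real} t \<partial>lborel) \<partial>lborel)"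
    by (intro nn_integral_mono pw)
  also have "\<dots> = (\<integral>\<^sup>+t. (\<integral>\<^sup>+x. ennreal ((norm h)\<^sup>2 * (norm (gradient f (x + t *\<^sub>R h)))\<^sup>2) * indicator {0..1::real} t \<partial>lborel) \<partial>lborel)"
    by (rule lborel_pair.Fubini') measurable
  also have "\<dots> = (\<integral>\<^sup>+t. (\<integral>\<^sup>+x. ennreal ((norm h)\<^sup>2 * (norm (gradient f x))\<^sup>2) \<partial>lborel) * indicator {0..1::real} t \<partial>lborel)"
  proof (intro nn_integral_cong)
    fix t :: real
    have "(\<integral>\<^sup>+x. ennreal ((norm h)\<^sup>2 * (norm (gradient f (x + t *\<^sub>R h)))\<^sup>2) * indicator {0..1::real} t \<partial>lborel) =
      (\<integral>\<^sup>+x. ennreal ((norm h)\<^sup>2 * (norm (gradient f (x + t *\<^sub>R h)))\<^sup>2) \<partial>lborel) * indicator {0..1::real} t"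
      by (rule nn_integral_multc) measurable
    also have "(\<integral>\<^sup>+x. ennreal ((norm h)\<^sup>2 * (norm (gradient f (x + t *\<^sub>R h)))\<^sup>2) \<partial>lborel) =
      (\<integral>\<^sup>+x. ennreal ((norm h)\<^sup>2 * (norm (gradient f x))\<^sup>2) \<partial>lborel)"
      by (rule nn_integral_lborel_translation) measurable
    finally show "(\<integral>\<^sup>+x. ennreal ((norm h)\<^sup>2 * (norm (gradient f (x + t *\<^sub>R h)))\<^sup>2) * indicator {0..1::real} t \<partial>lborel)
      = (\<integral>\<^sup>+x. ennreal ((norm h)\<^sup>2 * (norm (gradient f x))\<^sup>2) \<partial>lborel) * indicator {0..1::real} t" .
  qed
  also have "\<dots> = (\<integral>\<^sup>+x. ennreal ((norm h)\<^sup>2 * (norm (gradient f x))\<^sup>2) \<partial>lborel)"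
    by (subst nn_integral_cmult_indicator) auto
  also have "\<dots> = ennreal (LINT x|lborel. (norm h)\<^sup>2 * (norm (gradient f x))\<^sup>2)"
    using C1c_integrable_gradient[OF f] by (intro nn_integral_eq_integral) auto
  finally show ?thesis by simp
qed

text \<open>A translation by more than the diameter of the support separates \<open>f\<close> from
  its translate, so the increment has at least the square norm of \<open>f\<close>. The constant is
  the squared length of that translation.\<close>

lemma poincare_C1c:
  fixes f :: "'a::euclidean_space \<Rightarrow> real"
  assumes f: "C1c f" and B: "\<And>x. f x \<noteq> 0 \<Longrightarrow> norm x \<le> B" "B \<ge> 0"
  shows "(LINT x|lborel. (f x)\<^sup>2) \<le> (2 * B + 1)\<^sup>2 * (LINT x|lborel. (norm (gradient f x))\<^sup>2)"
proof -
  obtain i :: 'a where i: "i \<in> Basis" using nonempty_Basis by blast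
  define h where "h = (2 * B + 1) *\<^sub>R i"
  have nh: "norm h = 2 * B + 1" using i B by (simp add: h_def)
  have fm [measurable]: "f \<in> borel_measurable borel"
    by (intro borel_measurable_continuous_onI C1c_continuous f)
  have disj: "f (x + h) * f x = 0" for x
  proof (rule ccontr)
    assume "f (x + h) * f x \<noteq> 0"
    then have "norm (x + h) \<le> B" "norm x \<le> B" using B by auto
    then have "norm h \<le> 2 * B" using norm_triangle_ineq4[of "x + h" x] by simp
    then show False using nh by simp
  qed
  have int: "integrable lborel (\<lambda>x. (f x)\<^sup>2)" using C1c_integrable_power[OF f] by simp
  have "ennreal (LINT x|lborel. (f x)\<^sup>2) = (\<integral>\<^sup>+x. ennreal ((f x)\<^sup>2) \<partial>lborel)"
    using int by (subst nn_integral_eq_integral) auto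
  also have "\<dots> \<le> (\<integral>\<^sup>+x. ennreal ((f (x + h) - f x)\<^sup>2) \<partial>lborel)"
  proof (intro nn_integral_mono ennreal_leI)
    fix x
    have "(f (x + h) - f x)\<^sup>2 = (f (x + h))\<^sup>2 + (f x)\<^sup>2"
      using disj[of x] by (simp add: power2_diff mult.assoc)
    then show "(f x)\<^sup>2 \<le> (f (x + h) - f x)\<^sup>2" by simp
  qed
  also have "\<dots> \<le> ennreal ((norm h)\<^sup>2 * (LINT x|lborel. (norm (gradient f x))\<^sup>2))"
    by (rule translation_estimate[OF f])
  finally show ?thesis by (subst (asm) ennreal_le_iff) (auto simp: nh)
qed

text \<open>Difference quotients of \<open>f\<close> integrate to zero by translation invariance;
  with small steps they are bounded and vanish outside a fixed ball, so dominated convergence gives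
  the derivative.\<close>

lemma integral_gradient_eq_0:
  fixes f :: "'a::euclidean_space \<Rightarrow> real"
  assumes f: "C1c f"
  shows "(LINT x|lborel. gradient f x \<bullet> v) = 0"
proof -
  have fm [measurable]: "f \<in> borel_measurable borel"
    by (intro borel_measurable_continuous_onI C1c_continuous f)
  have gm [measurable]: "gradient f \<in> borel_measurable borel"
    by (intro borel_measurable_continuous_onI C1c_gradient_continuous f)
  obtain B where B: "B > 0" "\<And>x. f x \<noteq> 0 \<Longrightarrow> norm x \<le> B"
    using f unfolding C1c_def bounded_pos by auto
  have intf: "integrable lborel f" using C1c_integrable_power[OF f, of 1] by simp
  have "bounded (gradient f ` cball 0 (B + 1 + norm v))"
    by (intro compact_imp_bounded compact_continuous_image C1c_gradient_continuous f) auto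
  then obtain K where K: "K > 0" "\<And>x. norm x \<le> B + 1 + norm v \<Longrightarrow> norm (gradient f x) \<le> K"
    unfolding bounded_pos by auto
  have gK: "norm (gradient f x) \<le> K" for x
  proof (cases "norm x \<le> B + 1 + norm v")
    case False
    then have "x \<notin> cball 0 B" using norm_ge_zero[of v] by (simp, linarith)
    moreover have "closure {x. f x \<noteq> 0} \<subseteq> cball 0 B" using B by (intro closure_minimal) auto
    ultimately have "gradient f x = 0" by (intro gradient_eq_0) auto
    then show ?thesis using K by simp
  qed (use K in auto)
  define e where "e n = 1 / real (Suc n)" for n
  have e: "e n > 0" "e n \<le> 1" for n by (auto simp: e_def)
  have elim: "e \<longlonglongrightarrow> 0" unfolding e_def using LIMSEQ_inverse_real_of_nat by (simp add: inverse_eq_divide)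
  note line = C1c_line_derivative[OF f, of _ v]
  have "(\<lambda>n. LINT x|lborel. (f (x + e n *\<^sub>R v) - f x) / e n) \<longlonglongrightarrow> (LINT x|lborel. gradient f x \<bullet> v)"
  proof (rule integral_dominated_convergence[where w="\<lambda>x. indicator (cball 0 (B + 1 + norm v)) x * (K * norm v)"])
    show "integrable lborel (\<lambda>x. indicator (cball 0 (B + 1 + norm v)) x * (K * norm v))"
      using integrable_real_indicator[of "cball 0 (B + 1 + norm v)" lborel] emeasure_bounded_finite[of "cball 0 (B + 1 + norm v)"]
      by (intro integrable_mult_left) (auto simp: less_top[symmetric])
    show "AE x in lborel. (\<lambda>n. (f (x + e n *\<^sub>R v) - f x) / e n) \<longlonglongrightarrow> gradient f x \<bullet> v"
    proof (rule AE_I2)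
      fix x
      have "((\<lambda>h. (f (x + (0 + h) *\<^sub>R v) - f (x + 0 *\<^sub>R v)) / h) \<longlongrightarrow> gradient f (x + 0 *\<^sub>R v) \<bullet> v) (at 0)"
        using line[of x 0] unfolding DERIV_def .
      then have "((\<lambda>h. (f (x + h *\<^sub>R v) - f x) / h) \<longlongrightarrow> gradient f x \<bullet> v) (at 0)" by simp
      moreover have "filterlim e (at 0) sequentially"
        using elim e by (intro filterlim_atI) (auto intro!: always_eventually simp: less_imp_neq[symmetric])
      ultimately show "(\<lambda>n. (f (x + e n *\<^sub>R v) - f x) / e n) \<longlonglongrightarrow> gradient f x \<bullet> v"
        by (rule filterlim_compose)
    qed
    show "AE x in lborel. norm ((f (x + e n *\<^sub>R v) - f x) / e n) \<le> indicator (cball 0 (B + 1 + norm v)) x * (K * norm v)" for n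
    proof (rule AE_I2)
      fix x
      show "norm ((f (x + e n *\<^sub>R v) - f x) / e n) \<le> indicator (cball 0 (B + 1 + norm v)) x * (K * norm v)"
      proof (cases "norm x \<le> B + 1 + norm v")
        case True
        have "\<exists>t. 0 < t \<and> t < e n \<and> f (x + e n *\<^sub>R v) - f (x + 0 *\<^sub>R v) = (e n - 0) * (gradient f (x + t *\<^sub>R v) \<bullet> v)"
          using e(1) line by (intro MVT2) auto
        then obtain t where "f (x + e n *\<^sub>R v) - f x = e n * (gradient f (x + t *\<^sub>R v) \<bullet> v)" by auto
        then have "\<bar>(f (x + e n *\<^sub>R v) - f x) / e n\<bar> = \<bar>gradient f (x + t *\<^sub>R v) \<bullet> v\<bar>"
          using e(1)[of n] by simp
        also have "\<dots> \<le> K * norm v"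
          by (intro order.trans[OF Cauchy_Schwarz_ineq2] mult_right_mono gK) auto
        finally show ?thesis using True by simp
      next
        case False
        then have "f x = 0" using B(2)[of x] norm_ge_zero[of v] by (cases "f x = 0") auto
        moreover have "norm (e n *\<^sub>R v) \<le> norm v" using e[of n] by (simp add: mult_left_le_one_le)
        then have "norm (x + e n *\<^sub>R v) > B"
          using False norm_triangle_ineq4[of "x + e n *\<^sub>R v" "e n *\<^sub>R v"] by simp
        then have "f (x + e n *\<^sub>R v) = 0" using B(2)[of "x + e n *\<^sub>R v"] by (cases "f (x + e n *\<^sub>R v) = 0") auto
        ultimately show ?thesis using False by simp
      qed
    qed
  qed measurable
  moreover have "(LINT x|lborel. (f (x + e n *\<^sub>R v) - f x) / e n) = 0" for n
  proof -
    have "integrable lborel (\<lambda>x. f (x + e n *\<^sub>R v))"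
      by (rule integrable_lborel_translation[OF intf])
    then have "(LINT x|lborel. f (x + e n *\<^sub>R v) - f x) = 0"
      using intf integral_lborel_translation[OF fm, of "e n *\<^sub>R v"] by simp
    then show ?thesis by simp
  qed
  ultimately have "(\<lambda>n::nat. 0) \<longlonglongrightarrow> (LINT x|lborel. gradient f x \<bullet> v)" by (simp only:)
  then show ?thesis by (simp add: LIMSEQ_const_iff)
qed

lemma C1c_mult:
  fixes f g :: "'a::euclidean_space \<Rightarrow> real"
  assumes "C1c f" "C1c g"
  shows "C1c (\<lambda>x. f x * g x)" "gradient (\<lambda>x. f x * g x) = (\<lambda>x. f x *\<^sub>R gradient g x + g x *\<^sub>R gradient f x)"
proof -
  have 1: "((\<lambda>x. f x * g x) has_derivative (\<lambda>h. (f x *\<^sub>R gradient g x + g x *\<^sub>R gradient f x) \<bullet> h)) (at x)" for x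
    using assms unfolding C1c_def
    by (auto intro!: derivative_eq_intros simp: inner_add_left)
  have 2: "continuous_on UNIV (\<lambda>x. f x *\<^sub>R gradient g x + g x *\<^sub>R gradient f x)"
    by (intro continuous_intros C1c_continuous C1c_gradient_continuous assms)
  have "bounded {x. f x \<noteq> 0}" using assms by (simp add: C1c_def)
  then have 3: "bounded {x. f x * g x \<noteq> 0}" by (rule bounded_subset) auto
  show "C1c (\<lambda>x. f x * g x)" "gradient (\<lambda>x. f x * g x) = (\<lambda>x. f x *\<^sub>R gradient g x + g x *\<^sub>R gradient f x)"
    using C1cI[OF 1 2 3] by auto
qed

lemma integration_by_parts_C1c:
  fixes f g :: "'a::euclidean_space \<Rightarrow> real"
  assumes "C1c f" "C1c g"
  shows "(LINT x|lborel. f x * (gradient g x \<bullet> v)) = - (LINT x|lborel. (gradient f x \<bullet> v) * g x)"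
proof -
  have bf: "bounded {x. f x \<noteq> 0}" and bg: "bounded {x. g x \<noteq> 0}" using assms by (auto simp: C1c_def)
  have "integrable lborel (\<lambda>x. f x * (gradient g x \<bullet> v))"
    by (intro integrable_continuous_bounded_support continuous_intros C1c_continuous
        C1c_gradient_continuous assms bounded_subset[OF bf]) auto
  moreover have "integrable lborel (\<lambda>x. (gradient f x \<bullet> v) * g x)"
    by (intro integrable_continuous_bounded_support continuous_intros C1c_continuous
        C1c_gradient_continuous assms bounded_subset[OF bg]) auto
  moreover have "(LINT x|lborel. f x * (gradient g x \<bullet> v) + (gradient f x \<bullet> v) * g x) = 0"
    using integral_gradient_eq_0[OF C1c_mult(1)[OF assms], of v]
    by (simp add: C1c_mult(2)[OF assms] inner_add_left mult.commute)
  ultimately show ?thesis by simp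
qed

lemma emeasure_lborel_translation:
  assumes "B \<in> sets (borel :: 'a::euclidean_space measure)"
  shows "emeasure lborel {y. x + y \<in> B} = emeasure lborel B"
proof -
  have "emeasure lborel {y. x + y \<in> B} = (\<integral>\<^sup>+y. indicator {y. x + y \<in> B} y \<partial>lborel)"
    using assms by (subst nn_integral_indicator) auto
  also have "\<dots> = (\<integral>\<^sup>+y. indicator B (y + x) \<partial>lborel)"
    by (intro nn_integral_cong) (auto simp: indicator_def add.commute)
  also have "\<dots> = (\<integral>\<^sup>+y. indicator B y \<partial>lborel)"
    using assms by (intro nn_integral_lborel_translation) auto
  finally show ?thesis using assms by simp
qed

text \<open>The translation estimate integrated over displacements in a ball. Both the weak-type
  estimate and the compactness theorem come from lower bounds for this double integral.\<close>

lemma ball_average_increment: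
  fixes g :: "'a::euclidean_space \<Rightarrow> real"
  assumes g: "C1c g" and r: "r > 0"
  shows "(\<integral>\<^sup>+x. (\<integral>\<^sup>+y. indicator (ball 0 r) y * ennreal ((g (x + y) - g x)\<^sup>2) \<partial>lborel) \<partial>lborel)
    \<le> ennreal (r\<^sup>2 * (LINT x|lborel. (norm (gradient g x))\<^sup>2) * measure lborel (ball (0::'a) r))"
proof -
  have gm [measurable]: "g \<in> borel_measurable borel"
    by (intro borel_measurable_continuous_onI C1c_continuous g)
  have [measurable]: "ball (0::'a) r \<in> sets borel" by simp
  define D where "D = (LINT x|lborel. (norm (gradient g x))\<^sup>2)"
  have D: "D \<ge> 0" by (simp add: D_def)
  have "(\<integral>\<^sup>+x. (\<integral>\<^sup>+y. indicator (ball 0 r) y * ennreal ((g (x + y) - g x)\<^sup>2) \<partial>lborel) \<partial>lborel)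
      = (\<integral>\<^sup>+y. (\<integral>\<^sup>+x. indicator (ball 0 r) y * ennreal ((g (x + y) - g x)\<^sup>2) \<partial>lborel) \<partial>lborel)"
    by (rule lborel_pair.Fubini') measurable
  also have "\<dots> \<le> (\<integral>\<^sup>+y. ennreal (r\<^sup>2 * D) * indicator (ball (0::'a) r) y \<partial>lborel)"
  proof (rule nn_integral_mono)
    fix y :: 'a
    have "(\<integral>\<^sup>+x. ennreal ((g (x + y) - g x)\<^sup>2) \<partial>lborel) \<le> ennreal (r\<^sup>2 * D)" if "y \<in> ball 0 r"
    proof -
      have "(\<integral>\<^sup>+x. ennreal ((g (x + y) - g x)\<^sup>2) \<partial>lborel) \<le> ennreal ((norm y)\<^sup>2 * D)"
        unfolding D_def by (rule translation_estimate[OF g])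
      also have "\<dots> \<le> ennreal (r\<^sup>2 * D)"
        using that D by (intro ennreal_leI mult_right_mono power_mono) auto
      finally show ?thesis .
    qed
    then show "(\<integral>\<^sup>+x. indicator (ball 0 r) y * ennreal ((g (x + y) - g x)\<^sup>2) \<partial>lborel)
      \<le> ennreal (r\<^sup>2 * D) * indicator (ball 0 r) y"
      by (cases "y \<in> ball 0 r") auto
  qed
  also have "\<dots> = ennreal (r\<^sup>2 * D) * emeasure lborel (ball (0::'a) r)"
    by (rule nn_integral_cmult_indicator) auto
  also have "\<dots> = ennreal (r\<^sup>2 * D) * ennreal (measure lborel (ball (0::'a) r))"
    using emeasure_bounded_finite[of "ball (0::'a) r"] by (simp add: emeasure_eq_ennreal_measure)
  also have "\<dots> = ennreal (r\<^sup>2 * D * measure lborel (ball (0::'a) r))"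
    using D by (subst ennreal_mult) auto
  finally show ?thesis by (simp add: D_def)
qed

section \<open>Weak-type estimate, truncation and decay of level sets\<close>

text \<open>For \<open>x\<close> in \<open>A\<close> the ball of radius \<open>r\<close> around
  \<open>x\<close> has at least twice the measure of \<open>B\<close>, so on at least half of it
  \<open>g\<close> vanishes and the increment has modulus \<open>t\<close>. This bounds the double
  integral of squared increments from below.\<close>

lemma weak_type_estimate:
  fixes g :: "'a::euclidean_space \<Rightarrow> real"
  assumes g: "C1c g" and t: "t > 0" and A: "A \<in> sets borel" "\<And>x. x \<in> A \<Longrightarrow> g x = t"
    and B: "B \<in> sets borel" "bounded B" "\<And>x. g x \<noteq> 0 \<Longrightarrow> x \<in> B"
    and r: "r > 0" "2 * measure lborel B \<le> measure lborel (ball (0::'a) r)"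
  shows "t\<^sup>2 * measure lborel A \<le> 2 * r\<^sup>2 * (LINT x|lborel. (norm (gradient g x))\<^sup>2)"
proof -
  have gm [measurable]: "g \<in> borel_measurable borel"
    by (intro borel_measurable_continuous_onI C1c_continuous g)
  define D where "D = (LINT x|lborel. (norm (gradient g x))\<^sup>2)"
  define b where "b = measure lborel (ball (0::'a) r)"
  have b: "b > 0" unfolding b_def using content_ball[of r "0::'a"] r(1) by (simp add: unit_ball_vol_pos)
  have "A \<subseteq> B" using A B t by fastforce
  then have fA: "emeasure lborel A < \<infinity>" using B(2) bounded_subset emeasure_bounded_finite by blast
  have inner: "ennreal (t\<^sup>2 * (b / 2)) * indicator A x \<le> (\<integral>\<^sup>+y. indicator (ball 0 r) y * ennreal ((g (x + y) - g x)\<^sup>2) \<partial>lborel)" for x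
  proof (cases "x \<in> A")
    case True
    \<comment> \<open>The displacements that lead from \<open>x\<close> into \<open>B\<close>; their
      measure is at most half of that of the ball.\<close>
    define S where "S = {y. x + y \<in> B}"
    have S: "S \<in> sets borel" unfolding S_def using B(1) by measurable
    have eS: "emeasure lborel S = emeasure lborel B" unfolding S_def by (rule emeasure_lborel_translation[OF B(1)])
    have fS: "S \<in> fmeasurable lborel" using S eS emeasure_bounded_finite[OF B(2)] by (intro fmeasurableI) auto
    have fBr: "ball (0::'a) r \<in> fmeasurable lborel" using emeasure_bounded_finite[of "ball (0::'a) r"] by (intro fmeasurableI) auto
    have "b \<le> measure lborel ((ball 0 r - S) \<union> S)"
      unfolding b_def using fS fBr by (intro measure_mono_fmeasurable) auto
    also have "\<dots> \<le> measure lborel (ball 0 r - S) + measure lborel S"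
      using fS fBr by (intro measure_Un_le) auto
    also have "measure lborel S = measure lborel B" using eS by (simp add: measure_def)
    finally have half: "b / 2 \<le> measure lborel (ball 0 r - S)" using r(2) by (simp add: b_def)
    have "ennreal (t\<^sup>2 * (b / 2)) \<le> ennreal (t\<^sup>2) * ennreal (measure lborel (ball 0 r - S))"
      using half t b by (subst ennreal_mult[symmetric]) (auto intro!: ennreal_leI mult_left_mono)
    also have "\<dots> = ennreal (t\<^sup>2) * emeasure lborel (ball 0 r - S)"
      using fmeasurable.Diff[OF fBr, of S] fS by (subst emeasure_eq_measure2) auto
    also have "\<dots> = (\<integral>\<^sup>+y. ennreal (t\<^sup>2) * indicator (ball 0 r - S) y \<partial>lborel)"
      using S by (subst nn_integral_cmult_indicator) auto
    also have "\<dots> \<le> (\<integral>\<^sup>+y. indicator (ball 0 r) y * ennreal ((g (x + y) - g x)\<^sup>2) \<partial>lborel)"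
    proof (intro nn_integral_mono)
      fix y
      have "g (x + y) = 0" if "y \<notin> S" using B(3)[of "x + y"] that by (auto simp: S_def)
      then show "ennreal (t\<^sup>2) * indicator (ball 0 r - S) y \<le> indicator (ball 0 r) y * ennreal ((g (x + y) - g x)\<^sup>2)"
        using A(2)[OF True] by (auto simp: indicator_def)
    qed
    finally show ?thesis using True by simp
  qed auto
  have "ennreal (t\<^sup>2 * (b / 2) * measure lborel A) = ennreal (t\<^sup>2 * (b / 2)) * emeasure lborel A"
    using fA b by (subst ennreal_mult) (auto simp: emeasure_eq_ennreal_measure)
  also have "\<dots> = (\<integral>\<^sup>+x. ennreal (t\<^sup>2 * (b / 2)) * indicator A x \<partial>lborel)"
    using A by (subst nn_integral_cmult_indicator) auto
  also have "\<dots> \<le> (\<integral>\<^sup>+x. (\<integral>\<^sup>+y. indicator (ball 0 r) y * ennreal ((g (x + y) - g x)\<^sup>2) \<partial>lborel) \<partial>lborel)"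
    by (intro nn_integral_mono inner)
  also have "\<dots> \<le> ennreal (r\<^sup>2 * D * b)"
    unfolding D_def b_def by (rule ball_average_increment[OF g r(1)])
  finally have "t\<^sup>2 * (b / 2) * measure lborel A \<le> r\<^sup>2 * D * b"
    using b by (subst (asm) ennreal_le_iff) (auto simp: D_def)
  then have "b * (t\<^sup>2 * measure lborel A) \<le> b * (2 * r\<^sup>2 * D)" by (simp add: algebra_simps)
  then show ?thesis using b unfolding D_def by simp
qed

text \<open>A quadratic spline with knots \<open>0\<close>, \<open>1/2\<close> and \<open>1\<close>:
  a \<open>C^1\<close> step from \<open>0\<close> to \<open>1\<close> whose slope never exceeds
  \<open>2\<close>.\<close>

definition spline :: "real \<Rightarrow> real" where
  "spline y = 2 * (max 0 y)\<^sup>2 - 4 * (max 0 (y - 1/2))\<^sup>2 + 2 * (max 0 (y - 1))\<^sup>2"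

definition spline' :: "real \<Rightarrow> real" where
  "spline' y = 4 * max 0 y - 8 * max 0 (y - 1/2) + 4 * max 0 (y - 1)"

lemma max_0_sq_has_derivative: "((\<lambda>y::real. (max 0 y)\<^sup>2) has_real_derivative 2 * max 0 y) (at y)"
proof -
  consider "y > 0" | "y = 0" | "y < 0" by linarith
  then show ?thesis
  proof cases
    case 1
    have "((\<lambda>y::real. y\<^sup>2) has_real_derivative 2 * max 0 y) (at y)"
      using 1 by (auto intro!: derivative_eq_intros)
    then show ?thesis
      by (rule has_field_derivative_transform_within_open[where S="{0<..}"]) (use 1 in auto)
  next
    case 2
    have eq: "max 0 h = ((max 0 h)\<^sup>2 - (max 0 0)\<^sup>2) / (h - 0)" if "h \<noteq> 0" for h :: real
      using that by (cases "h > 0") (simp_all add: power2_eq_square)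
    have "((\<lambda>h::real. max 0 h) \<longlongrightarrow> max 0 0) (at 0)" by (intro tendsto_intros)
    then have "((\<lambda>h::real. ((max 0 h)\<^sup>2 - (max 0 0)\<^sup>2) / (h - 0)) \<longlongrightarrow> max 0 0) (at 0)"
      by (rule Lim_transform_eventually) (rule eventually_mono[OF eventually_neq_at_within], rule eq)
    then show ?thesis using 2 by (simp add: has_field_derivative_iff)
  next
    case 3
    have "((\<lambda>y::real. 0) has_real_derivative 2 * max 0 y) (at y)" using 3 by auto
    then show ?thesis
      by (rule has_field_derivative_transform_within_open[where S="{..<0}"]) (use 3 in auto)
  qed
qed

lemma spline_has_derivative: "(spline has_real_derivative spline' y) (at y)"
proof -
  have s: "((\<lambda>y. (max 0 (y - c))\<^sup>2) has_real_derivative 2 * max 0 (y - c)) (at y)" for c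
  proof -
    have "((\<lambda>y. y - c) has_real_derivative 1) (at y)" by (auto intro!: derivative_eq_intros)
    from DERIV_chain2[where f="\<lambda>y. (max 0 y)\<^sup>2", OF max_0_sq_has_derivative this] show ?thesis by simp
  qed
  have "((\<lambda>y. 2 * (max 0 (y - 0))\<^sup>2 - 4 * (max 0 (y - 1/2))\<^sup>2 + 2 * (max 0 (y - 1))\<^sup>2) has_real_derivative
     2 * (2 * max 0 (y - 0)) - 4 * (2 * max 0 (y - 1/2)) + 2 * (2 * max 0 (y - 1))) (at y)"
    by (intro DERIV_add DERIV_diff DERIV_cmult s)
  then show ?thesis by (simp add: spline_def[abs_def] spline'_def)
qed

lemma spline_values: "y \<le> 0 \<Longrightarrow> spline y = 0" "y \<ge> 1 \<Longrightarrow> spline y = 1"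
  by (auto simp: spline_def max_def power2_eq_square algebra_simps)

lemma spline'_bounds: "0 \<le> spline' y" "spline' y \<le> 2" "y \<le> 0 \<or> 1 \<le> y \<Longrightarrow> spline' y = 0"
  by (auto simp: spline'_def max_def)

text \<open>One spline term acts on the positive and one on the negative values of \<open>f\<close>,
  and both plateaus have the value \<open>+ t\<close>. The factor \<open>2\<close> in front of the
  gradient is the maximal slope of the spline.\<close>

lemma C1c_truncation:
  fixes f :: "'a::euclidean_space \<Rightarrow> real"
  assumes f: "C1c f" and t: "t > 0"
  shows "\<exists>g. C1c g \<and> (\<forall>x. 2 * t \<le> \<bar>f x\<bar> \<longrightarrow> g x = t) \<and> (\<forall>x. \<bar>f x\<bar> \<le> t \<longrightarrow> g x = 0) \<and>
    (\<forall>x. norm (gradient g x) \<le> 2 * norm (gradient f x) * indicator {x. t < \<bar>f x\<bar> \<and> \<bar>f x\<bar> < 2 * t} x)"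
proof -
  define g where "g x = t * (spline (f x / t - 1) + spline (- (f x / t) - 1))" for x
  define c where "c x = spline' (f x / t - 1) - spline' (- (f x / t) - 1)" for x
  have d: "(g has_derivative (\<lambda>h. (c x *\<^sub>R gradient f x) \<bullet> h)) (at x)" for x
  proof -
    have "((\<lambda>s. t * (spline (s / t - 1) + spline (- (s / t) - 1))) has_real_derivative
        t * (spline' (f x / t - 1) * (1 / t) + spline' (- (f x / t) - 1) * (- (1 / t)))) (at (f x))"
      using t by (intro DERIV_cmult DERIV_add DERIV_chain2[OF spline_has_derivative])
        (auto intro!: derivative_eq_intros)
    moreover have "t * (spline' (f x / t - 1) * (1 / t) + spline' (- (f x / t) - 1) * (- (1 / t))) = c x"
      using t by (simp add: c_def field_simps)
    ultimately have 1: "((\<lambda>s. t * (spline (s / t - 1) + spline (- (s / t) - 1))) has_derivative (*) (c x)) (at (f x))"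
      by (simp add: has_field_derivative_def)
    have 2: "(f has_derivative (\<lambda>h. gradient f x \<bullet> h)) (at x)" using f by (simp add: C1c_def)
    show ?thesis using has_derivative_compose[OF 2 1] by (simp add: g_def[abs_def])
  qed
  have sc: "continuous_on UNIV spline'" unfolding spline'_def by (intro continuous_intros)
  have cc: "continuous_on UNIV (\<lambda>x. c x *\<^sub>R gradient f x)"
    unfolding c_def
    by (intro continuous_intros continuous_on_compose2[OF sc] C1c_continuous C1c_gradient_continuous f) (use t in auto)
  have g0: "g x = 0" if "\<bar>f x\<bar> \<le> t" for x
    using that t by (simp add: g_def spline_values field_simps)
  then have "{x. g x \<noteq> 0} \<subseteq> {x. f x \<noteq> 0}" using t by fastforce
  then have bd: "bounded {x. g x \<noteq> 0}" using f bounded_subset by (auto simp: C1c_def)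
  note G = C1cI[OF d cc bd]
  have gt: "g x = t" if "2 * t \<le> \<bar>f x\<bar>" for x
  proof (cases "f x \<ge> 0")
    case True
    then have "f x / t \<ge> 2" using that t by (simp add: le_divide_eq)
    then show ?thesis by (simp add: g_def spline_values)
  next
    case False
    then have "- (f x / t) \<ge> 2" using that t by (simp add: le_divide_eq minus_divide_left del: minus_divide_left[symmetric])
    then show ?thesis by (simp add: g_def spline_values)
  qed
  have "norm (gradient g x) \<le> 2 * norm (gradient f x) * indicator {x. t < \<bar>f x\<bar> \<and> \<bar>f x\<bar> < 2 * t} x" for x
  proof (cases "t < \<bar>f x\<bar> \<and> \<bar>f x\<bar> < 2 * t")
    case True
    have "\<bar>c x\<bar> \<le> 2" unfolding c_def
      using spline'_bounds(1,2)[of "f x / t - 1"] spline'_bounds(1,2)[of "- (f x / t) - 1"] by linarith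
    then show ?thesis using True by (simp add: G mult_right_mono)
  next
    case False
    then have "f x / t - 1 \<le> 0 \<or> 1 \<le> f x / t - 1" "- (f x / t) - 1 \<le> 0 \<or> 1 \<le> - (f x / t) - 1"
      using t by (auto simp: field_simps abs_le_iff not_less)
    then have "c x = 0" by (simp add: c_def spline'_bounds(3))
    then show ?thesis by (simp add: G)
  qed
  then show ?thesis using G g0 gt by blast
qed

text \<open>A ball of volume \<open>2 * m\<close> has squared radius
  \<open>(2 * m / unit_ball_vol d) powr (2 / d)\<close>. The factor \<open>8\<close> is the
  \<open>2\<close> of the weak-type estimate times the square of the gradient factor
  \<open>2\<close> of the truncation.\<close>

definition level_const :: "'a::euclidean_space itself \<Rightarrow> real" where
  "level_const _ = 8 * (2 / unit_ball_vol DIM('a)) powr (2 / DIM('a))"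

text \<open>The weak-type estimate for the truncation of \<open>f\<close> to a range of values. Summing over the dyadic
  values of \<open>t\<close> upgrades it to the Sobolev inequality, because the energies of the truncations add up.\<close>

lemma level_set_decay:
  fixes f :: "'a::euclidean_space \<Rightarrow> real"
  assumes f: "C1c f" and t: "t > 0"
  shows "t\<^sup>2 * measure lborel {x. 2 * t \<le> \<bar>f x\<bar>} \<le> level_const TYPE('a) * measure lborel {x. t \<le> \<bar>f x\<bar>} powr (2 / DIM('a)) *
    (LINT x|lborel. (norm (gradient f x))\<^sup>2 * indicator {x. t < \<bar>f x\<bar> \<and> \<bar>f x\<bar> < 2 * t} x)"
proof -
  have fm [measurable]: "f \<in> borel_measurable borel"
    by (intro borel_measurable_continuous_onI C1c_continuous f)
  have gm [measurable]: "gradient f \<in> borel_measurable borel"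
    by (intro borel_measurable_continuous_onI C1c_gradient_continuous f)
  define A where "A s = {x. s \<le> \<bar>f x\<bar>}" for s
  have bA: "bounded (A s)" if "s > 0" for s
  proof -
    have "bounded {x. f x \<noteq> 0}" using f by (simp add: C1c_def)
    then show ?thesis unfolding A_def by (rule bounded_subset) (use that in auto)
  qed
  have Am [measurable]: "A s \<in> sets borel" for s unfolding A_def by measurable
  define I where "I = {x. t < \<bar>f x\<bar> \<and> \<bar>f x\<bar> < 2 * t}"
  have Im [measurable]: "I \<in> sets borel" unfolding I_def by measurable
  define E where "E = (LINT x|lborel. (norm (gradient f x))\<^sup>2 * indicator I x)"
  have intE: "integrable lborel (\<lambda>x. (norm (gradient f x))\<^sup>2 * indicator I x)"
    using C1c_integrable_gradient[OF f] by (intro integrable_real_mult_indicator) auto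
  have E0: "E \<ge> 0" by (simp add: E_def)
  define m where "m = measure lborel (A t)"
  show ?thesis
  proof (cases "m = 0")
    case True
    \<comment> \<open>The radius used in the other case would be \<open>0\<close>; here the
      left-hand side vanishes.\<close>
    have "measure lborel (A (2 * t)) \<le> m" unfolding m_def
    proof (rule measure_mono_fmeasurable)
      show "A (2 * t) \<subseteq> A t" using t by (auto simp: A_def)
      show "A t \<in> fmeasurable lborel"
        using bA[OF t] emeasure_bounded_finite[of "A t"] by (intro fmeasurableI) auto
    qed simp
    then have "measure lborel (A (2 * t)) = 0" using True measure_nonneg[of lborel "A (2 * t)"] by linarith
    then show ?thesis by (simp add: A_def m_def flip: E_def I_def) (simp add: E0 level_const_def)
  next
    case False
    then have m: "m > 0" unfolding m_def using measure_nonneg[of lborel "A t"] by linarith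
    define c where "c = unit_ball_vol (real DIM('a))"
    have c: "c > 0" by (simp add: c_def unit_ball_vol_pos)
    \<comment> \<open>The radius of a ball of measure \<open>2 * m\<close>, twice the measure of the
      set \<open>A t\<close> off which the truncation vanishes.\<close>
    define r where "r = (2 * m / c) powr (1 / DIM('a))"
    have r: "r > 0" using m c by (simp add: r_def)
    have "r ^ DIM('a) = r powr DIM('a)" using r by (simp add: powr_realpow)
    also have "\<dots> = 2 * m / c" using m c by (simp add: r_def powr_powr)
    finally have "measure lborel (ball (0::'a) r) = 2 * m"
      using content_ball[of r "0::'a"] r c by (simp flip: c_def)
    obtain g where g: "C1c g" "\<And>x. 2 * t \<le> \<bar>f x\<bar> \<Longrightarrow> g x = t" "\<And>x. \<bar>f x\<bar> \<le> t \<Longrightarrow> g x = 0"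
      "\<And>x. norm (gradient g x) \<le> 2 * norm (gradient f x) * indicator I x"
      using C1c_truncation[OF f t] unfolding I_def by auto
    have "t\<^sup>2 * measure lborel (A (2 * t)) \<le> 2 * r\<^sup>2 * (LINT x|lborel. (norm (gradient g x))\<^sup>2)"
    proof (rule weak_type_estimate[OF g(1) t Am _ Am bA[OF t] _ r])
      show "2 * measure lborel (A t) \<le> measure lborel (ball (0::'a) r)"
        using \<open>measure lborel (ball (0::'a) r) = 2 * m\<close> by (simp add: m_def)
      show "g x = t" if "x \<in> A (2 * t)" for x using that g(2) by (simp add: A_def)
      show "x \<in> A t" if "g x \<noteq> 0" for x using that g(3)[of x] by (cases "\<bar>f x\<bar> \<le> t") (auto simp: A_def)
    qed
    also have "(LINT x|lborel. (norm (gradient g x))\<^sup>2) \<le> (LINT x|lborel. 4 * ((norm (gradient f x))\<^sup>2 * indicator I x))"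
    proof (intro integral_mono C1c_integrable_gradient g integrable_mult_right intE)
      fix x
      have "(norm (gradient g x))\<^sup>2 \<le> (2 * norm (gradient f x) * indicator I x)\<^sup>2"
        by (intro power_mono g) auto
      then show "(norm (gradient g x))\<^sup>2 \<le> 4 * ((norm (gradient f x))\<^sup>2 * indicator I x)"
        by (auto simp: power_mult_distrib indicator_def split: if_splits)
    qed
    also have "(LINT x|lborel. 4 * ((norm (gradient f x))\<^sup>2 * indicator I x)) = 4 * E" by (simp add: E_def)
    finally have "t\<^sup>2 * measure lborel (A (2 * t)) \<le> 8 * r\<^sup>2 * E" by (simp add: mult_left_mono)
    moreover have "r\<^sup>2 = (2 / c * m) powr (2 / DIM('a))"
    proof -
      have "r\<^sup>2 = r powr 2" using r by simp
      then show ?thesis using m c by (simp add: r_def powr_powr)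
    qed
    then have "8 * r\<^sup>2 = level_const TYPE('a) * m powr (2 / DIM('a))"
      using m c powr_mult[of "2 / c" m "2 / DIM('a)"] by (simp add: level_const_def c_def mult.assoc)
    ultimately show ?thesis by (simp add: A_def m_def E_def I_def)
  qed
qed

section \<open>Dyadic summation and the Sobolev inequality\<close>

text \<open>The open dyadic shells are pairwise disjoint. The right-hand side records the upper end
  of the range because the induction needs it.\<close>

lemma sum_dyadic_indicator_le:
  fixes s \<epsilon> :: real
  assumes "\<epsilon> > 0"
  shows "(\<Sum>k<M. of_bool (\<epsilon> * 2^k < s \<and> s < 2 * (\<epsilon> * 2^k)) :: real) \<le> of_bool (s < \<epsilon> * 2^M)"
proof (induction M)
  case (Suc M)
  have "\<epsilon> * 2^M < \<epsilon> * 2^Suc M" using assms by simp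
  moreover define S where "S = (\<Sum>k<M. of_bool (\<epsilon> * 2^k < s \<and> s < 2 * (\<epsilon> * 2^k)) :: real)"
  moreover have "S \<le> of_bool (s < \<epsilon> * 2^M)" unfolding S_def by (rule Suc)
  ultimately show ?case
    unfolding sum.lessThan_Suc S_def[symmetric] of_bool_def by (auto split: if_splits)
qed simp

text \<open>A layer-cake bound: if \<open>\<epsilon> * 2^k \<le> s < 2 * (\<epsilon> * 2^k)\<close>,
  the term of this \<open>k\<close> alone is at least \<open>s powr q\<close>; values below
  \<open>\<epsilon>\<close> are covered by the last term.\<close>

lemma dyadic_majorant:
  fixes s \<epsilon> q :: real
  assumes e: "\<epsilon> > 0" and q: "q > 0" and s: "0 \<le> s" "s < \<epsilon> * 2^M"
  shows "s powr q \<le> (\<Sum>k<M. (2 * (\<epsilon> * 2^k)) powr q * of_bool (\<epsilon> * 2^k \<le> s)) + \<epsilon> powr q * of_bool (s > 0)"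
  using s(2)
proof (induction M)
  case 0
  then show ?case using s(1) e q by (auto intro: powr_mono2)
next
  case (Suc M)
  show ?case
  proof (cases "s < \<epsilon> * 2^M")
    case True
    have "0 \<le> (2 * (\<epsilon> * 2^M)) powr q * of_bool (\<epsilon> * 2^M \<le> s)" by simp
    then show ?thesis using Suc.IH[OF True] unfolding sum.lessThan_Suc by linarith
  next
    case False
    have "s powr q \<le> (2 * (\<epsilon> * 2^M)) powr q * of_bool (\<epsilon> * 2^M \<le> s)"
      using False Suc.prems s(1) q by (simp add: powr_mono2)
    moreover have "0 \<le> (\<Sum>k<M. (2 * (\<epsilon> * 2^k)) powr q * of_bool (\<epsilon> * 2^k \<le> s))" by (intro sum_nonneg) auto
    moreover have "0 \<le> \<epsilon> powr q * of_bool (s > 0)" by simp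
    ultimately show ?thesis unfolding sum.lessThan_Suc by linarith
  qed
qed

text \<open>Let \<open>a k\<close> be \<open>t k powr q\<close> times the measure of the level set
  at height \<open>t k\<close>. Decay of level sets becomes the recursion
  \<open>a (Suc k) \<le> C2 * a k powr (2 / d) * E k\<close>, in which the shell energies
  \<open>E k\<close> add up to at most \<open>D\<close>. Summation bounds the sum \<open>Y\<close>
  by \<open>a 0 + C2 * Y powr (2 / d) * D\<close>, and since \<open>2 / d < 1\<close> this can be
  solved for \<open>Y\<close>. Starting at height \<open>\<epsilon>\<close> keeps the sum finite at
  the cost of the term with \<open>V\<close>.\<close>

lemma sobolev_dyadic:
  fixes f :: "'a::euclidean_space \<Rightarrow> real"
  defines "q \<equiv> crit_exp DIM('a)"
  defines "C2 \<equiv> 2 powr q * level_const TYPE('a)"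
  assumes dim: "DIM('a) \<ge> 3" and f: "C1c f" and e: "\<epsilon> > 0"
  defines "D \<equiv> (LINT x|lborel. (norm (gradient f x))\<^sup>2)"
  defines "V \<equiv> measure lborel {x. f x \<noteq> 0}"
  shows "(LINT x|lborel. \<bar>f x\<bar> powr q) \<le> 2 powr q * (2 * C2 * D) powr (q / 2) + (2 * 2 powr q + 1) * V * \<epsilon> powr q"
proof -
  define d where "d = real DIM('a)"
  have d: "d \<ge> 3" using dim by (simp add: d_def)
  have q: "q = 2 * d / (d - 2)" by (simp add: q_def d_def crit_exp_def)
  have q2: "q > 2" using d by (simp add: q field_simps)
  have qd: "q * (2 / d) = q - 2" using d by (simp add: q field_simps)
  have lc: "level_const TYPE('a) \<ge> 0" by (simp add: level_const_def)
  have C2: "C2 \<ge> 0" using lc by (simp add: C2_def)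
  have fm [measurable]: "f \<in> borel_measurable borel"
    by (intro borel_measurable_continuous_onI C1c_continuous f)
  have gm [measurable]: "gradient f \<in> borel_measurable borel"
    by (intro borel_measurable_continuous_onI C1c_gradient_continuous f)
  have D0: "D \<ge> 0" by (simp add: D_def)
  have bs: "bounded {x. f x \<noteq> 0}" using f by (simp add: C1c_def)
  define A where "A s = {x. s \<le> \<bar>f x\<bar>}" for s
  have AV: "A s \<subseteq> {x. f x \<noteq> 0}" if "s > 0" for s using that by (auto simp: A_def)
  have Am [measurable]: "A s \<in> sets borel" for s unfolding A_def by measurable
  have fV: "{x. f x \<noteq> 0} \<in> fmeasurable lborel"
    using emeasure_bounded_finite[OF bs] by (intro fmeasurableI) auto
  have fA: "A s \<in> fmeasurable lborel" if "s > 0" for s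
    using emeasure_bounded_finite[OF bounded_subset[OF bs AV[OF that]]] by (intro fmeasurableI) auto
  define t where "t k = \<epsilon> * 2^k" for k :: nat
  have t: "t k > 0" "t (Suc k) = 2 * t k" for k using e by (auto simp: t_def)
  define a where "a k = t k powr q * measure lborel (A (t k))" for k
  have a0: "a k \<ge> 0" for k by (simp add: a_def)
  define I where "I k = {x. t k < \<bar>f x\<bar> \<and> \<bar>f x\<bar> < 2 * t k}" for k
  have Im [measurable]: "I k \<in> sets borel" for k unfolding I_def by measurable
  define E where "E k = (LINT x|lborel. (norm (gradient f x))\<^sup>2 * indicator (I k) x)" for k
  have intE: "integrable lborel (\<lambda>x. (norm (gradient f x))\<^sup>2 * indicator (I k) x)" for k
    using C1c_integrable_gradient[OF f] by (intro integrable_real_mult_indicator) auto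
  have E0: "E k \<ge> 0" for k by (simp add: E_def)
  obtain K where K: "\<And>x. \<bar>f x\<bar> \<le> K"
  proof -
    obtain B where B: "\<And>x. f x \<noteq> 0 \<Longrightarrow> norm x \<le> B" using bs unfolding bounded_iff by auto
    have "bounded (f ` cball 0 B)"
      by (intro compact_imp_bounded compact_continuous_image C1c_continuous f) auto
    then obtain K where "\<forall>y\<in>f ` cball 0 B. norm y \<le> K" unfolding bounded_iff by blast
    then have K: "\<And>x. norm x \<le> B \<Longrightarrow> \<bar>f x\<bar> \<le> K" by simp
    have "\<bar>f x\<bar> \<le> max K 0" for x using B[of x] K[of x] by (cases "f x = 0") auto
    then show ?thesis by (rule that)
  qed
  \<comment> \<open>As \<open>f\<close> is bounded, finitely many dyadic heights suffice.\<close>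
  obtain M where M: "K / \<epsilon> < 2^M" using real_arch_pow[of 2 "K / \<epsilon>"] by auto
  have fM: "\<bar>f x\<bar> < \<epsilon> * 2^Suc M" for x
  proof -
    have "K < \<epsilon> * 2^M" using M e by (simp add: field_simps)
    also have "\<dots> < \<epsilon> * 2^Suc M" using e by simp
    finally show ?thesis using K[of x] by simp
  qed
  \<comment> \<open>The critical exponent satisfies \<open>q * (2 / d) = q - 2\<close>, so the
    powers of \<open>t k\<close> match and no height remains in the recursion.\<close>
  have rec: "a (Suc k) \<le> C2 * a k powr (2 / d) * E k" for k
  proof -
    have "a (Suc k) = 2 powr q * t k powr (q - 2) * ((t k)\<^sup>2 * measure lborel (A (2 * t k)))"
    proof -
      have "t k powr q = t k powr (q - 2) * (t k)\<^sup>2"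
        using t(1)[of k] powr_add[of "t k" "q - 2" 2] by simp
      then show ?thesis using t by (simp add: a_def powr_mult)
    qed
    also have "\<dots> \<le> 2 powr q * t k powr (q - 2) *
       (level_const TYPE('a) * measure lborel (A (t k)) powr (2 / d) * E k)"
      using level_set_decay[OF f t(1)[of k]] unfolding A_def d_def E_def I_def
      by (intro mult_left_mono) auto
    also have "\<dots> = C2 * a k powr (2 / d) * E k"
    proof -
      have "a k powr (2 / d) = t k powr (q - 2) * measure lborel (A (t k)) powr (2 / d)"
        unfolding a_def using t(1)[of k] qd by (subst powr_mult) (auto simp: powr_powr)
      then show ?thesis by (simp add: C2_def)
    qed
    finally show ?thesis .
  qed
  have sumE: "(\<Sum>k<M. E k) \<le> D"
  proof -
    have "(\<Sum>k<M. E k) = (LINT x|lborel. (\<Sum>k<M. (norm (gradient f x))\<^sup>2 * indicator (I k) x))"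
      unfolding E_def using intE by (subst Bochner_Integration.integral_sum) auto
    also have "\<dots> \<le> D"
      unfolding D_def
    proof (intro integral_mono C1c_integrable_gradient f Bochner_Integration.integrable_sum intE)
      fix x
      have "(\<Sum>k<M. (norm (gradient f x))\<^sup>2 * indicator (I k) x) =
          (norm (gradient f x))\<^sup>2 * (\<Sum>k<M. of_bool (\<epsilon> * 2^k < \<bar>f x\<bar> \<and> \<bar>f x\<bar> < 2 * (\<epsilon> * 2^k)))"
        unfolding sum_distrib_left by (intro sum.cong) (auto simp: I_def t_def indicator_def)
      also have "\<dots> \<le> (norm (gradient f x))\<^sup>2 * 1"
        by (intro mult_left_mono order.trans[OF sum_dyadic_indicator_le[OF e]]) simp_all
      finally show "(\<Sum>k<M. (norm (gradient f x))\<^sup>2 * indicator (I k) x) \<le> (norm (gradient f x))\<^sup>2" by simp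
    qed
    finally show ?thesis .
  qed
  define Y where "Y = (\<Sum>k<Suc M. a k)"
  have Y0: "Y \<ge> 0" unfolding Y_def by (intro sum_nonneg a0)
  have aY: "a k \<le> Y" if "k < Suc M" for k
    unfolding Y_def using that a0 by (intro member_le_sum) auto
  have "Y - a 0 = (\<Sum>k<M. a (Suc k))" unfolding Y_def by (subst sum.lessThan_Suc_shift) simp
  also have "\<dots> \<le> (\<Sum>k<M. C2 * Y powr (2 / d) * E k)"
  proof (rule sum_mono)
    fix k assume "k \<in> {..<M}"
    then have "a k powr (2 / d) \<le> Y powr (2 / d)" using a0 aY[of k] d by (intro powr_mono2) auto
    then show "a (Suc k) \<le> C2 * Y powr (2 / d) * E k"
      using rec[of k] C2 E0[of k] by (meson mult_left_mono mult_right_mono order_trans)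
  qed
  also have "\<dots> = C2 * Y powr (2 / d) * (\<Sum>k<M. E k)" by (simp add: sum_distrib_left)
  also have "\<dots> \<le> C2 * Y powr (2 / d) * D" using sumE C2 by (intro mult_left_mono) auto
  finally have Yrec: "Y - a 0 \<le> C2 * Y powr (2 / d) * D" .
  \<comment> \<open>Either \<open>a 0\<close> makes up half of \<open>Y\<close>, or
    \<open>Y \<le> 2 * (Y - a 0)\<close>. In the second case one divides by
    \<open>Y powr (2 / d)\<close> and raises to the power \<open>q / 2\<close>, where
    \<open>(1 - 2 / d) * (q / 2) = 1\<close>.\<close>
  have Y_le: "Y \<le> (2 * C2 * D) powr (q / 2) + 2 * a 0"
  proof (cases "Y \<le> 2 * a 0")
    case False
    then have Yp: "Y > 0" using a0[of 0] by linarith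
    have "Y \<le> 2 * C2 * D * Y powr (2 / d)" using Yrec False by (simp add: algebra_simps)
    then have "Y powr (1 - 2 / d) \<le> 2 * C2 * D"
      using Yp by (simp add: powr_diff pos_divide_le_eq)
    then have "(Y powr (1 - 2 / d)) powr (q / 2) \<le> (2 * C2 * D) powr (q / 2)"
      using q2 by (intro powr_mono2) auto
    moreover have "(1 - 2 / d) * (q / 2) = 1" using d by (simp add: q field_simps)
    ultimately have "Y \<le> (2 * C2 * D) powr (q / 2)" using Yp by (simp add: powr_powr)
    then show ?thesis using a0[of 0] by simp
  qed (use a0[of 0] in \<open>simp add: add_increasing\<close>)
  have a0V: "a 0 \<le> \<epsilon> powr q * V"
    unfolding a_def V_def using fV AV[OF e] Am[of \<epsilon>]
    by (auto simp: t_def intro!: mult_left_mono measure_mono_fmeasurable)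
  have A_ind: "(\<lambda>x. of_bool (t k \<le> \<bar>f x\<bar>)) = (indicator (A (t k)) :: 'a \<Rightarrow> real)" for k
    by (auto simp: fun_eq_iff A_def indicator_def)
  have indA: "integrable lborel (\<lambda>x. of_bool (t k \<le> \<bar>f x\<bar>) :: real)" for k
    using fA[OF t(1)[of k]] unfolding A_ind by (intro integrable_real_indicator) (auto simp: fmeasurable_def)
  have intA: "(LINT x|lborel. of_bool (t k \<le> \<bar>f x\<bar>)) = measure lborel (A (t k))" for k
    unfolding A_ind by simp
  have V_ind: "(\<lambda>x. of_bool (\<bar>f x\<bar> > 0)) = (indicator {x. f x \<noteq> 0} :: 'a \<Rightarrow> real)"
    by (auto simp: fun_eq_iff indicator_def)
  have indV: "integrable lborel (\<lambda>x. of_bool (\<bar>f x\<bar> > 0) :: real)"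
    using fV unfolding V_ind by (intro integrable_real_indicator) (auto simp: fmeasurable_def)
  have intV: "(LINT x|lborel. of_bool (\<bar>f x\<bar> > 0)) = V"
    unfolding V_ind by (simp add: V_def)
  have cq: "integrable lborel (\<lambda>x. \<bar>f x\<bar> powr q)"
    using q2 by (intro integrable_continuous_bounded_support bounded_subset[OF bs] continuous_on_powr'
        continuous_intros C1c_continuous f) auto
  have "(LINT x|lborel. \<bar>f x\<bar> powr q) \<le>
     (LINT x|lborel. (\<Sum>k<Suc M. (2 * t k) powr q * of_bool (t k \<le> \<bar>f x\<bar>)) + \<epsilon> powr q * of_bool (\<bar>f x\<bar> > 0))"
  proof (intro integral_mono cq Bochner_Integration.integrable_add Bochner_Integration.integrable_sum integrable_mult_right indA indV)
    fix x
    show "\<bar>f x\<bar> powr q \<le> (\<Sum>k<Suc M. (2 * t k) powr q * of_bool (t k \<le> \<bar>f x\<bar>)) + \<epsilon> powr q * of_bool (\<bar>f x\<bar> > 0)"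
      unfolding t_def using q2 fM[of x] e by (intro dyadic_majorant) auto
  qed
  also have "\<dots> = (\<Sum>k<Suc M. (2 * t k) powr q * measure lborel (A (t k))) + \<epsilon> powr q * V"
    by (subst Bochner_Integration.integral_add, intro Bochner_Integration.integrable_sum integrable_mult_right indA,
        intro integrable_mult_right indV, subst Bochner_Integration.integral_sum, intro integrable_mult_right indA)
       (simp only: intA intV integral_mult_right_zero)
  also have "(\<Sum>k<Suc M. (2 * t k) powr q * measure lborel (A (t k))) = 2 powr q * Y"
    unfolding Y_def sum_distrib_left a_def using t(1) by (intro sum.cong) (auto simp: powr_mult less_imp_le)
  also have "2 powr q * Y + \<epsilon> powr q * V \<le> 2 powr q * ((2 * C2 * D) powr (q / 2) + 2 * (\<epsilon> powr q * V)) + \<epsilon> powr q * V"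
    using Y_le a0V by (intro add_mono mult_left_mono) auto
  finally show ?thesis by (simp add: algebra_simps)
qed

text \<open>Letting \<open>\<epsilon>\<close> tend to \<open>0\<close> removes the term with the
  measure of the support, so the constant depends on the dimension only.\<close>

lemma sobolev_C1c:
  assumes dim: "DIM('a::euclidean_space) \<ge> 3"
  shows "\<exists>C>0. \<forall>f::'a \<Rightarrow> real. C1c f \<longrightarrow>
    (LINT x|lborel. \<bar>f x\<bar> powr crit_exp DIM('a)) \<le>
    C * (LINT x|lborel. (norm (gradient f x))\<^sup>2) powr (crit_exp DIM('a) / 2)"
proof -
  define q where "q = crit_exp DIM('a)"
  define C2 where "C2 = 2 powr q * level_const TYPE('a)"
  have q: "q > 0" using dim by (simp add: q_def crit_exp_def)
  have "unit_ball_vol (real DIM('a)) > 0" by (simp add: unit_ball_vol_pos)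
  then have "unit_ball_vol (real DIM('a)) \<noteq> 0" by linarith
  then have lc: "level_const TYPE('a) > 0" by (simp add: level_const_def)
  have C2: "C2 > 0" using lc by (simp add: C2_def)
  show ?thesis
  proof (intro exI[of _ "2 powr q * (2 * C2) powr (q / 2)"] conjI allI impI)
    show "2 powr q * (2 * C2) powr (q / 2) > 0" using C2 by simp
    fix f :: "'a \<Rightarrow> real" assume f: "C1c f"
    define D where "D = (LINT x|lborel. (norm (gradient f x))\<^sup>2)"
    define V where "V = measure lborel {x. f x \<noteq> 0}"
    have "(\<lambda>n. 2 powr q * (2 * C2 * D) powr (q / 2) + (2 * 2 powr q + 1) * V * (1 / real (Suc n)) powr q)
       \<longlonglongrightarrow> 2 powr q * (2 * C2 * D) powr (q / 2) + (2 * 2 powr q + 1) * V * 0 powr q"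
      using LIMSEQ_inverse_real_of_nat q
      by (intro tendsto_intros tendsto_powr') (auto simp: inverse_eq_divide)
    then have "(LINT x|lborel. \<bar>f x\<bar> powr q) \<le> 2 powr q * (2 * C2 * D) powr (q / 2) + (2 * 2 powr q + 1) * V * 0 powr q"
      using sobolev_dyadic[OF dim f] unfolding q_def C2_def D_def V_def
      by (intro LIMSEQ_le_const) auto
    also have "\<dots> = 2 powr q * (2 * C2) powr (q / 2) * D powr (q / 2)"
      using C2 by (simp add: powr_mult D_def)
    finally show "(LINT x|lborel. \<bar>f x\<bar> powr crit_exp DIM('a)) \<le> 2 powr q * (2 * C2) powr (q / 2) *
      (LINT x|lborel. (norm (gradient f x))\<^sup>2) powr (crit_exp DIM('a) / 2)"
      by (simp add: D_def q_def)
  qed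
qed

section \<open>Ball averages and Rellich compactness\<close>

lemma integrable_indicator_ball_mult:
  fixes h :: "'a::euclidean_space \<Rightarrow> real"
  assumes "continuous_on UNIV h"
  shows "integrable lborel (\<lambda>y. indicator (ball c r) y * h y)"
proof -
  have "integrable lborel (\<lambda>y. indicator (cball c r) y *\<^sub>R h y)"
    using assms continuous_on_subset by (intro borel_integrable_compact) auto
  then have "integrable lborel (\<lambda>y. indicator (ball c r) y *\<^sub>R (indicator (cball c r) y *\<^sub>R h y))"
    by (rule integrable_mult_indicator[rotated]) simp
  moreover have "(\<lambda>y. indicator (ball c r) y *\<^sub>R (indicator (cball c r) y *\<^sub>R h y)) = (\<lambda>y. indicator (ball c r) y * h y)"
    by (auto simp: indicator_def)
  ultimately show ?thesis by (simp only:)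
qed

text \<open>Expanding the square, the integral of \<open>(f (x + y) - f x)^2\<close> over the ball
  is at least \<open>b * (f x)^2 - 2 * f x * A\<close>, where \<open>A\<close> is the integral of
  \<open>f\<close> over the ball around \<open>x\<close>; Young's inequality splits the mixed
  term.\<close>

lemma ball_average_lower:
  fixes f :: "'a::euclidean_space \<Rightarrow> real"
  assumes f: "continuous_on UNIV f" and r: "r > 0"
  defines "b \<equiv> measure lborel (ball (0::'a) r)"
  shows "ennreal (b / 2 * (f x)\<^sup>2) \<le>
     (\<integral>\<^sup>+y. indicator (ball 0 r) y * ennreal ((f (x + y) - f x)\<^sup>2) \<partial>lborel) +
     ennreal (2 / b * (LINT y|lborel. indicator (ball 0 r) y * f (x + y))\<^sup>2)"
proof -
  have b: "b > 0" unfolding b_def using content_ball[of r "0::'a"] r by (simp add: unit_ball_vol_pos)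
  define A where "A = (LINT y|lborel. indicator (ball (0::'a) r) y * f (x + y))"
  have c: "continuous_on UNIV (\<lambda>y. f (x + y))"
    by (rule continuous_on_compose2[OF f]) (auto intro: continuous_intros)
  note I = integrable_indicator_ball_mult
  have i1: "integrable lborel (\<lambda>y. indicator (ball 0 r) y * (f (x + y))\<^sup>2)" by (intro I continuous_intros c)
  have i2: "integrable lborel (\<lambda>y. indicator (ball 0 r) y * f (x + y))" by (intro I c)
  have i3: "integrable lborel (\<lambda>y. indicator (ball 0 r) y * (f (x + y) - f x)\<^sup>2)" by (intro I continuous_intros c)
  have i4: "integrable lborel (\<lambda>y. indicator (ball (0::'a) r) y * (1::real))" by (intro I continuous_intros)
  define Q where "Q = (LINT y|lborel. indicator (ball (0::'a) r) y * (f (x + y) - f x)\<^sup>2)"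
  have "Q = (LINT y|lborel. indicator (ball 0 r) y * (f (x + y))\<^sup>2 + ((- 2 * f x) * (indicator (ball 0 r) y * f (x + y))
      + (f x)\<^sup>2 * (indicator (ball 0 r) y * 1)))"
    unfolding Q_def by (intro Bochner_Integration.integral_cong) (auto simp: power2_eq_square algebra_simps)
  also have "\<dots> = (LINT y|lborel. indicator (ball 0 r) y * (f (x + y))\<^sup>2) + ((- 2 * f x) * A + (f x)\<^sup>2 * b)"
    using i1 i2 i4 by (simp add: A_def b_def)
  finally have Q: "Q = (LINT y|lborel. indicator (ball 0 r) y * (f (x + y))\<^sup>2) + ((- 2 * f x) * A + (f x)\<^sup>2 * b)" .
  define P where "P = (LINT y|lborel. indicator (ball 0 r) y * (f (x + y))\<^sup>2)"
  have "0 \<le> P" unfolding P_def by (intro integral_nonneg_AE AE_I2) auto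
  moreover have "2 * f x * A \<le> b / 2 * (f x)\<^sup>2 + 2 / b * A\<^sup>2"
  proof -
    have "0 \<le> (b * f x - 2 * A)\<^sup>2 / (2 * b)" using b by simp
    also have "\<dots> = b / 2 * (f x)\<^sup>2 + 2 / b * A\<^sup>2 - 2 * f x * A"
      using b by (simp add: power2_eq_square field_simps)
    finally show ?thesis by simp
  qed
  ultimately have "b / 2 * (f x)\<^sup>2 \<le> Q + 2 / b * A\<^sup>2" unfolding Q P_def[symmetric] by (simp add: algebra_simps)
  then have "ennreal (b / 2 * (f x)\<^sup>2) \<le> ennreal (Q + 2 / b * A\<^sup>2)" by (rule ennreal_leI)
  also have "\<dots> = ennreal Q + ennreal (2 / b * A\<^sup>2)"
    using b by (intro ennreal_plus) (auto simp: Q_def intro!: integral_nonneg_AE AE_I2)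
  also have "ennreal Q = (\<integral>\<^sup>+y. ennreal (indicator (ball 0 r) y * (f (x + y) - f x)\<^sup>2) \<partial>lborel)"
    unfolding Q_def by (intro nn_integral_eq_integral[symmetric] i3) auto
  also have "\<dots> = (\<integral>\<^sup>+y. indicator (ball 0 r) y * ennreal ((f (x + y) - f x)\<^sup>2) \<partial>lborel)"
    by (intro nn_integral_cong) (auto simp: indicator_def)
  finally show ?thesis by (simp add: A_def)
qed

text \<open>Integrating the pointwise bound gives
  \<open>F n \<le> 2 * r^2 * K + 4 / b^2 * G n\<close>. The first term is small for small
  \<open>r\<close>, uniformly in \<open>n\<close>. For fixed \<open>r\<close> the second tends to
  \<open>0\<close> by dominated convergence, since the ball integrals tend to \<open>0\<close> and
  are bounded uniformly.\<close>

lemma rellich_C1c: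
  fixes f :: "nat \<Rightarrow> 'a::euclidean_space \<Rightarrow> real"
  assumes f: "\<And>n. C1c (f n)" and B: "\<And>n x. f n x \<noteq> 0 \<Longrightarrow> norm x \<le> B" "B \<ge> 0"
    and K: "\<And>n. (LINT x|lborel. (norm (gradient (f n) x))\<^sup>2) \<le> K"
    and weak: "\<And>x r. r > 0 \<Longrightarrow> (\<lambda>n. LINT y|lborel. indicator (ball x r) y * f n y) \<longlonglongrightarrow> 0"
  shows "(\<lambda>n. LINT x|lborel. (f n x)\<^sup>2) \<longlonglongrightarrow> 0"
proof -
  have fm [measurable]: "f n \<in> borel_measurable borel" for n
    by (intro borel_measurable_continuous_onI C1c_continuous f)
  have K0: "K \<ge> 0" using K[of 0] by (rule order.trans[rotated]) (intro integral_nonneg_AE AE_I2, simp)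
  define F where "F n = (LINT x|lborel. (f n x)\<^sup>2)" for n
  have F0: "F n \<ge> 0" for n by (simp add: F_def)
  have FK: "F n \<le> (2 * B + 1)\<^sup>2 * K" for n
    using poincare_C1c[OF f B, of n] K[of n] unfolding F_def
    by (meson mult_left_mono order_trans zero_le_power2)
  have i2: "integrable lborel (\<lambda>x. (f n x)\<^sup>2)" for n using C1c_integrable_power[OF f] by simp
  have i1: "integrable lborel (f n)" for n using C1c_integrable_power[OF f, of 1] by simp
  define V where "V = measure lborel (cball (0::'a) B)"
  have iV: "integrable lborel (indicator (cball (0::'a) B) :: 'a \<Rightarrow> real)"
    using emeasure_bounded_finite[of "cball (0::'a) B"] by (intro integrable_real_indicator) auto
  have F1: "(LINT x|lborel. \<bar>f n x\<bar>) \<le> V + (2 * B + 1)\<^sup>2 * K" for n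
  proof -
    have "(LINT x|lborel. \<bar>f n x\<bar>) \<le> (LINT x|lborel. indicator (cball 0 B) x + (f n x)\<^sup>2)"
    proof (intro integral_mono integrable_abs i1 Bochner_Integration.integrable_add iV i2)
      fix x
      have "\<bar>f n x\<bar> \<le> 1 + (f n x)\<^sup>2"
        using zero_le_power2[of "\<bar>f n x\<bar> - 1"] by (simp add: power2_diff)
      then show "\<bar>f n x\<bar> \<le> indicator (cball 0 B) x + (f n x)\<^sup>2"
        using B(1)[of n x] by (cases "f n x = 0") auto
    qed
    also have "\<dots> = V + F n" using iV i2 by (simp add: V_def F_def)
    finally show ?thesis using FK[of n] by simp
  qed
  have "\<exists>N. \<forall>n\<ge>N. F n < e" if e: "e > 0" for e
  proof -
    \<comment> \<open>Makes \<open>2 * r^2 * K\<close> smaller than \<open>e\<close>; the summand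
      \<open>1\<close> keeps the denominator positive.\<close>
    define r where "r = sqrt (e / (4 * (K + 1)))"
    have r: "r > 0" using e K0 by (simp add: r_def)
    have "r\<^sup>2 = e / (4 * (K + 1))" using e K0 by (simp add: r_def)
    then have "4 * r\<^sup>2 + 4 * (K * r\<^sup>2) = e" using K0 by (simp add: field_simps add_nonneg_eq_0_iff)
    moreover have "0 \<le> K * r\<^sup>2" "0 < r\<^sup>2" using K0 r by auto
    moreover have "2 * r\<^sup>2 * K = 2 * (K * r\<^sup>2)" by simp
    ultimately have rK: "2 * r\<^sup>2 * K < e" by linarith
    define b where "b = measure lborel (ball (0::'a) r)"
    have b: "b > 0" unfolding b_def using content_ball[of r "0::'a"] r by (simp add: unit_ball_vol_pos)
    have bm [measurable]: "ball (0::'a) r \<in> sets borel" by simp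
    have cm [measurable]: "cball (0::'a) B \<in> sets borel" by simp
    define A where "A n x = (LINT y|lborel. indicator (ball 0 r) y * f n (x + y))" for n x
    have Am [measurable]: "A n \<in> borel_measurable borel" for n
      unfolding A_def by measurable
    have A_eq: "A n x = (LINT y|lborel. indicator (ball x r) y * f n y)" for n x
    proof -
      have [measurable]: "ball x r \<in> sets borel" by simp
      have "A n x = (LINT y|lborel. indicator (ball x r) (y + x) * f n (y + x))"
        unfolding A_def by (intro Bochner_Integration.integral_cong) (auto simp: indicator_def dist_norm add.commute)
      also have "\<dots> = (LINT y|lborel. indicator (ball x r) y * f n y)"
        by (rule integral_lborel_translation) measurable
      finally show ?thesis .
    qed
    have A_bd: "\<bar>A n x\<bar> \<le> V + (2 * B + 1)\<^sup>2 * K" for n x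
    proof -
      have "\<bar>A n x\<bar> \<le> (LINT y|lborel. \<bar>indicator (ball x r) y * f n y\<bar>)"
        unfolding A_eq using integral_norm_bound[of lborel "\<lambda>y. indicator (ball x r) y * f n y"] by simp
      also have "\<dots> \<le> (LINT y|lborel. \<bar>f n y\<bar>)"
        by (intro integral_mono integrable_abs i1 integrable_indicator_ball_mult C1c_continuous f)
          (auto simp: indicator_def)
      finally show ?thesis using F1[of n] by simp
    qed
    define G where "G n = (LINT x|lborel. indicator (cball 0 B) x * (A n x)\<^sup>2)" for n
    have "G \<longlonglongrightarrow> (LINT x|lborel. indicator (cball (0::'a) B) x * 0\<^sup>2)"
      unfolding G_def
    proof (rule integral_dominated_convergence[where w="\<lambda>x. indicator (cball 0 B) x * (V + (2 * B + 1)\<^sup>2 * K)\<^sup>2"])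
      show "AE x in lborel. (\<lambda>n. indicator (cball 0 B) x * (A n x)\<^sup>2) \<longlonglongrightarrow> indicator (cball 0 B) x * 0\<^sup>2"
        unfolding A_eq by (intro AE_I2 tendsto_mult tendsto_const tendsto_power weak r)
      show "AE x in lborel. norm (indicator (cball 0 B) x * (A n x)\<^sup>2) \<le> indicator (cball 0 B) x * (V + (2 * B + 1)\<^sup>2 * K)\<^sup>2" for n
      proof (intro AE_I2)
        fix x
        have "(A n x)\<^sup>2 \<le> (V + (2 * B + 1)\<^sup>2 * K)\<^sup>2"
          using power_mono[OF A_bd[of n x], of 2] by simp
        then show "norm (indicator (cball 0 B) x * (A n x)\<^sup>2) \<le> indicator (cball 0 B) x * (V + (2 * B + 1)\<^sup>2 * K)\<^sup>2"
          by (simp add: indicator_def)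
      qed
    qed (use iV in \<open>auto intro!: integrable_mult_left\<close>)
    then have G: "G \<longlonglongrightarrow> 0" by simp
    have iA: "integrable lborel (\<lambda>x. indicator (cball 0 B) x * (A n x)\<^sup>2)" for n
    proof (rule Bochner_Integration.integrable_bound[where f="\<lambda>x. indicator (cball 0 B) x * (V + (2 * B + 1)\<^sup>2 * K)\<^sup>2"])
      show "AE x in lborel. norm (indicator (cball 0 B) x * (A n x)\<^sup>2) \<le> norm (indicator (cball 0 B) x * (V + (2 * B + 1)\<^sup>2 * K)\<^sup>2)"
      proof (intro AE_I2)
        fix x
        have "(A n x)\<^sup>2 \<le> (V + (2 * B + 1)\<^sup>2 * K)\<^sup>2"
          using power_mono[OF A_bd[of n x], of 2] by simp
        then show "norm (indicator (cball 0 B) x * (A n x)\<^sup>2) \<le> norm (indicator (cball 0 B) x * (V + (2 * B + 1)\<^sup>2 * K)\<^sup>2)"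
          by (simp add: indicator_def)
      qed
    qed (use iV in \<open>auto intro!: integrable_mult_left\<close>)
    have main: "F n \<le> 2 * r\<^sup>2 * K + 4 / b\<^sup>2 * G n" for n
    proof -
      have "ennreal (b / 2 * F n) = (\<integral>\<^sup>+x. ennreal (b / 2 * (f n x)\<^sup>2) \<partial>lborel)"
        unfolding F_def using i2[of n] b by (subst nn_integral_eq_integral) auto
      also have "\<dots> \<le> (\<integral>\<^sup>+x. (\<integral>\<^sup>+y. indicator (ball 0 r) y * ennreal ((f n (x + y) - f n x)\<^sup>2) \<partial>lborel) +
           ennreal (2 / b * (indicator (cball 0 B) x * (A n x)\<^sup>2)) \<partial>lborel)"
      proof (rule nn_integral_mono)
        fix x :: 'a
        show "ennreal (b / 2 * (f n x)\<^sup>2) \<le> (\<integral>\<^sup>+y. indicator (ball 0 r) y * ennreal ((f n (x + y) - f n x)\<^sup>2) \<partial>lborel) +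
           ennreal (2 / b * (indicator (cball 0 B) x * (A n x)\<^sup>2))"
        proof (cases "f n x = 0")
          case False
          then have "x \<in> cball 0 B" using B by simp
          then show ?thesis
            using ball_average_lower[OF C1c_continuous[OF f[of n]] r, of x] by (simp add: A_def b_def)
        qed simp
      qed
      also have "\<dots> = (\<integral>\<^sup>+x. (\<integral>\<^sup>+y. indicator (ball 0 r) y * ennreal ((f n (x + y) - f n x)\<^sup>2) \<partial>lborel) \<partial>lborel) +
           (\<integral>\<^sup>+x. ennreal (2 / b * (indicator (cball 0 B) x * (A n x)\<^sup>2)) \<partial>lborel)"
        by (rule nn_integral_add) measurable
      also have "(\<integral>\<^sup>+x. ennreal (2 / b * (indicator (cball 0 B) x * (A n x)\<^sup>2)) \<partial>lborel) = ennreal (2 / b * G n)"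
        unfolding G_def using iA[of n] b by (subst nn_integral_eq_integral) auto
      also have "(\<integral>\<^sup>+x. (\<integral>\<^sup>+y. indicator (ball 0 r) y * ennreal ((f n (x + y) - f n x)\<^sup>2) \<partial>lborel) \<partial>lborel)
          \<le> ennreal (r\<^sup>2 * (LINT x|lborel. (norm (gradient (f n) x))\<^sup>2) * b)"
        unfolding b_def by (rule ball_average_increment[OF f r])
      also have "\<dots> \<le> ennreal (r\<^sup>2 * K * b)"
        using K[of n] b by (intro ennreal_leI mult_right_mono mult_left_mono) auto
      also have "ennreal (r\<^sup>2 * K * b) + ennreal (2 / b * G n) = ennreal (r\<^sup>2 * K * b + 2 / b * G n)"
        using K0 b by (intro ennreal_plus[symmetric]) (auto simp: G_def intro!: integral_nonneg_AE AE_I2)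
      finally have "ennreal (b / 2 * F n) \<le> ennreal (r\<^sup>2 * K * b + 2 / b * G n)" by (simp add: add_right_mono)
      moreover have "0 \<le> r\<^sup>2 * K * b + 2 / b * G n"
        using K0 b by (auto simp: G_def intro!: add_nonneg_nonneg mult_nonneg_nonneg integral_nonneg_AE AE_I2)
      ultimately have "b / 2 * F n \<le> r\<^sup>2 * K * b + 2 / b * G n" by (simp add: ennreal_le_iff)
      then have "(2 / b) * (b / 2 * F n) \<le> (2 / b) * (r\<^sup>2 * K * b + 2 / b * G n)"
        using b by (intro mult_left_mono) auto
      then show ?thesis using b by (simp add: field_simps power2_eq_square)
    qed
    have "(\<lambda>n. 2 * r\<^sup>2 * K + 4 / b\<^sup>2 * G n) \<longlonglongrightarrow> 2 * r\<^sup>2 * K + 4 / b\<^sup>2 * 0"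
      by (intro tendsto_intros G)
    then have "\<forall>\<^sub>F n in sequentially. 2 * r\<^sup>2 * K + 4 / b\<^sup>2 * G n < e"
      using rK by (intro order_tendstoD(2)[where a=e]) auto
    then have "\<forall>\<^sub>F n in sequentially. F n < e"
      by eventually_elim (use main in \<open>auto intro: le_less_trans\<close>)
    then show ?thesis by (simp add: eventually_sequentially)
  qed
  then show ?thesis
    unfolding F_def[symmetric] using F0 by (intro LIMSEQ_I) (simp add: real_norm_def)
qed

section \<open>The Sobolev space with zero boundary values\<close>

lemma Ck_add: "Ck k f \<Longrightarrow> Ck k g \<Longrightarrow> Ck k (\<lambda>x. f x + g x)"
proof (induction k arbitrary: f g)
  case 0
  then show ?case by (auto intro: continuous_on_add)
next
  case (Suc k)
  have "partial_deriv i (\<lambda>x. f x + g x) = (\<lambda>x. partial_deriv i f x + partial_deriv i g x)" for i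
  proof
    fix x
    have "(f has_derivative frechet_derivative f (at x)) (at x)" "(g has_derivative frechet_derivative g (at x)) (at x)"
      using Suc.prems by (simp_all add: frechet_derivative_works[symmetric])
    from frechet_derivative_at[OF has_derivative_add[OF this]]
    show "partial_deriv i (\<lambda>x. f x + g x) x = partial_deriv i f x + partial_deriv i g x" by metis
  qed
  then show ?case using Suc by auto
qed

lemma Ck_scale: "Ck k f \<Longrightarrow> Ck k (\<lambda>x. c * f x)"
proof (induction k arbitrary: f)
  case 0
  then show ?case by (auto intro: continuous_on_mult_left)
next
  case (Suc k)
  have "partial_deriv i (\<lambda>x. c * f x) = (\<lambda>x. c * partial_deriv i f x)" for i
  proof
    fix x
    have "(f has_derivative frechet_derivative f (at x)) (at x)"
      using Suc.prems frechet_derivative_works by auto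
    then have "((\<lambda>x. c * f x) has_derivative (\<lambda>h. c * frechet_derivative f (at x) h)) (at x)"
      by (rule has_derivative_mult_right)
    from frechet_derivative_at[OF this] show "partial_deriv i (\<lambda>x. c * f x) x = c * partial_deriv i f x"
      by metis
  qed
  then show ?case using Suc by auto
qed

lemma test_functions_add:
  assumes "f \<in> test_functions \<Omega>" "g \<in> test_functions \<Omega>"
  shows "(\<lambda>x. f x + g x) \<in> test_functions \<Omega>"
proof -
  let ?S = "closure {x. f x \<noteq> 0} \<union> closure {x. g x \<noteq> 0}"
  have S: "compact ?S" "?S \<subseteq> \<Omega>" using assms by (auto simp: test_functions_def)
  have c: "closure {x. f x + g x \<noteq> 0} \<subseteq> ?S"
    unfolding closure_Un[symmetric] by (intro closure_mono) auto
  have "compact (closure {x. f x + g x \<noteq> 0})"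
    using bounded_subset[OF compact_imp_bounded[OF S(1)] c] by (simp add: compact_eq_bounded_closed)
  moreover have "closure {x. f x + g x \<noteq> 0} \<subseteq> \<Omega>" using c S(2) by (rule order.trans)
  ultimately have "closure {x. f x + g x \<noteq> 0} \<subseteq> \<Omega>" "compact (closure {x. f x + g x \<noteq> 0})" by blast+
  then show ?thesis using assms unfolding test_functions_def by (blast intro: Ck_add)
qed

lemma test_functions_scale:
  assumes "f \<in> test_functions \<Omega>"
  shows "(\<lambda>x. c * f x) \<in> test_functions \<Omega>"
proof -
  have "closure {x. c * f x \<noteq> 0} \<subseteq> closure {x. f x \<noteq> 0}" by (intro closure_mono) auto
  moreover have "compact (closure {x. f x \<noteq> 0})" using assms by (auto simp: test_functions_def)
  ultimately have "compact (closure {x. c * f x \<noteq> 0})" 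
    by (auto simp: compact_eq_bounded_closed bounded_subset)
  then show ?thesis
    using assms \<open>closure {x. c * f x \<noteq> 0} \<subseteq> closure {x. f x \<noteq> 0}\<close>
    unfolding test_functions_def by (blast intro: Ck_scale)
qed

lemma test_functions_zero: "(\<lambda>x. 0) \<in> test_functions \<Omega>"
proof -
  have "Ck k (\<lambda>x::'a. 0::real)" for k by (rule bump_algebra_Ck) (rule bump_algebra.const)
  then show ?thesis by (simp add: test_functions_def)
qed

lemma C1c_square_integrable:
  assumes "C1c f"
  shows "square_integrable f" "square_integrable (gradient f)"
proof -
  have [measurable]: "f \<in> borel_measurable borel" "gradient f \<in> borel_measurable borel"
    using assms by (auto intro!: borel_measurable_continuous_onI C1c_continuous C1c_gradient_continuous)
  have "integrable lebesgue (\<lambda>x. (f x)\<^sup>2)" "integrable lebesgue (\<lambda>x. (norm (gradient f x))\<^sup>2)"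
    using C1c_integrable_power[OF assms, of 2] C1c_integrable_gradient[OF assms]
    by (subst integrable_completion; simp)+
  then show "square_integrable f" "square_integrable (gradient f)"
    by (auto simp: square_integrable_def intro!: measurable_completion)
qed

section \<open>The Hilbert space of pairs of a gradient and its function\<close>

type_synonym 'a h1 = "('a, 'a) l2 \<times> ('a, real) l2"

definition test_pair :: "('a::euclidean_space \<Rightarrow> real) \<Rightarrow> 'a h1" where
  "test_pair f = (abs_l2 (gradient f), abs_l2 f)"

text \<open>\<open>H01 \<Omega>\<close> as a closed subspace of a Hilbert space: the element \<open>u\<close> is encoded as the pair
  \<open>(\<nabla>u, u)\<close>, both components extended by zero.\<close>

definition h01 :: "'a::euclidean_space set \<Rightarrow> 'a h1 set" where
  "h01 \<Omega> = closure (test_pair ` test_functions \<Omega>)"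

lemma test_pair_add:
  assumes "C1c f" "C1c g"
  shows "test_pair f + test_pair g = test_pair (\<lambda>x. f x + g x)"
proof -
  have "gradient (\<lambda>x. f x + g x) = (\<lambda>x. gradient f x + gradient g x)"
    using assms unfolding C1c_def
    by (intro ext gradient_eqI) (auto intro!: derivative_eq_intros simp: inner_add_left)
  then show ?thesis
    using abs_l2_add[OF C1c_square_integrable(1)[OF assms(1)] C1c_square_integrable(1)[OF assms(2)]]
      abs_l2_add[OF C1c_square_integrable(2)[OF assms(1)] C1c_square_integrable(2)[OF assms(2)]]
    by (simp add: test_pair_def)
qed

lemma test_pair_scale:
  assumes "C1c f"
  shows "c *\<^sub>R test_pair f = test_pair (\<lambda>x. c * f x)"
proof -
  have "gradient (\<lambda>x. c * f x) = (\<lambda>x. c *\<^sub>R gradient f x)"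
    using assms unfolding C1c_def
    by (intro ext gradient_eqI) (auto intro!: derivative_eq_intros)
  then show ?thesis
    using abs_l2_scaleR[OF C1c_square_integrable(1)[OF assms], of c] abs_l2_scaleR[OF C1c_square_integrable(2)[OF assms], of c]
    by (simp add: test_pair_def)
qed

lemma closed_h01: "closed (h01 \<Omega>)" by (simp add: h01_def)

lemma subspace_h01: "subspace (h01 \<Omega>)"
  unfolding h01_def
proof (rule subspace_closure, unfold subspace_def, intro conjI ballI allI)
  have "test_pair (\<lambda>x::'a. 0) = 0 *\<^sub>R test_pair (\<lambda>x. 0)"
    using test_pair_scale[OF test_function_C1c[OF test_functions_zero], of 0] by simp
  then show "0 \<in> test_pair ` test_functions \<Omega>" using test_functions_zero by (metis imageI scaleR_zero_left)
next
  fix x y assume "x \<in> test_pair ` test_functions \<Omega>" "y \<in> test_pair ` test_functions \<Omega>"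
  then show "x + y \<in> test_pair ` test_functions \<Omega>"
    by (auto simp: test_pair_add test_function_C1c intro!: imageI test_functions_add)
next
  fix c x assume "x \<in> test_pair ` test_functions \<Omega>"
  then show "c *\<^sub>R x \<in> test_pair ` test_functions \<Omega>"
    by (auto simp: test_pair_scale test_function_C1c intro!: imageI test_functions_scale)
qed

text \<open>Equations and inequalities between continuous expressions pass from test functions to
  the closure in this form.\<close>

lemma h01_closure_induct:
  assumes "U \<in> h01 \<Omega>" "closed {U. P U}" "\<And>f. f \<in> test_functions \<Omega> \<Longrightarrow> P (test_pair f)"
  shows "P U"
proof -
  have "h01 \<Omega> \<subseteq> {U. P U}" unfolding h01_def using assms(2,3) by (intro closure_minimal) auto
  then show ?thesis using assms(1) by blast
qed

lemma h01_approx: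
  assumes "U \<in> h01 \<Omega>"
  shows "\<exists>f. (\<forall>n. f n \<in> test_functions \<Omega>) \<and> (\<lambda>n. test_pair (f n)) \<longlonglongrightarrow> U"
proof -
  have "\<exists>x. (\<forall>n. x n \<in> test_pair ` test_functions \<Omega>) \<and> x \<longlonglongrightarrow> U"
    using assms unfolding h01_def closure_sequential .
  then obtain x where x: "\<forall>n. x n \<in> test_pair ` test_functions \<Omega>" "x \<longlonglongrightarrow> U"
    by (elim exE conjE)
  then have "\<forall>n. \<exists>f. f \<in> test_functions \<Omega> \<and> x n = test_pair f" by blast
  then obtain f where f: "\<And>n. f n \<in> test_functions \<Omega>" "\<And>n. x n = test_pair (f n)" by metis
  then have "x = (\<lambda>n. test_pair (f n))" by auto
  then show ?thesis using f(1) x(2) by (intro exI[of _ f]) simp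
qed

lemma lborel_lebesgue_integral:
  fixes f :: "'a::euclidean_space \<Rightarrow> real"
  assumes "f \<in> borel_measurable borel"
  shows "(LINT x|lebesgue. f x) = (LINT x|lborel. f x)"
  using assms by (intro integral_completion) simp

lemma norm_test_pair:
  assumes "C1c f"
  shows "(norm (fst (test_pair f)))\<^sup>2 = (LINT x|lborel. (norm (gradient f x))\<^sup>2)"
    "(norm (snd (test_pair f)))\<^sup>2 = (LINT x|lborel. (f x)\<^sup>2)"
proof -
  have [measurable]: "f \<in> borel_measurable borel" "gradient f \<in> borel_measurable borel"
    using assms by (auto intro!: borel_measurable_continuous_onI C1c_continuous C1c_gradient_continuous)
  show "(norm (fst (test_pair f)))\<^sup>2 = (LINT x|lborel. (norm (gradient f x))\<^sup>2)"
    "(norm (snd (test_pair f)))\<^sup>2 = (LINT x|lborel. (f x)\<^sup>2)"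
    using C1c_square_integrable[OF assms] by (simp_all add: test_pair_def abs_l2_norm lborel_lebesgue_integral)
qed

lemma poincare_h01:
  assumes "bounded (\<Omega> :: 'a::euclidean_space set)"
  shows "\<exists>P>0. \<forall>U\<in>h01 \<Omega>. norm (snd U) \<le> P * norm (fst U)"
proof -
  obtain B where B: "B > 0" "\<And>x. x \<in> \<Omega> \<Longrightarrow> norm x \<le> B" using assms unfolding bounded_pos by auto
  have "norm (snd U) \<le> (2 * B + 1) * norm (fst U)" if "U \<in> h01 \<Omega>" for U
    using that
  proof (rule h01_closure_induct)
    show "closed {U :: 'a h1. norm (snd U) \<le> (2 * B + 1) * norm (fst U)}"
      by (intro closed_Collect_le continuous_intros)
    fix f assume f: "f \<in> test_functions \<Omega>"
    have "norm x \<le> B" if "f x \<noteq> 0" for x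
      using f that closure_subset[of "{x. f x \<noteq> 0}"] B by (auto simp: test_functions_def)
    with poincare_C1c[OF test_function_C1c[OF f], of B] B
    have "(norm (snd (test_pair f)))\<^sup>2 \<le> ((2 * B + 1) * norm (fst (test_pair f)))\<^sup>2"
      by (simp add: norm_test_pair[OF test_function_C1c[OF f]] power_mult_distrib)
    then show "norm (snd (test_pair f)) \<le> (2 * B + 1) * norm (fst (test_pair f))"
      by (rule power2_le_imp_le) (use B in auto)
  qed
  then show ?thesis using B by (intro exI[of _ "2 * B + 1"]) auto
qed

lemma test_function_support:
  assumes "f \<in> test_functions \<Omega>" "x \<notin> \<Omega>"
  shows "f x = 0" "gradient f x = 0"
proof -
  have "x \<notin> closure {x. f x \<noteq> 0}" using assms by (auto simp: test_functions_def)
  then show "f x = 0" "gradient f x = 0"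
    using closure_subset[of "{x. f x \<noteq> 0}"] gradient_eq_0 by auto
qed

lemma square_integrable_indicator:
  assumes "square_integrable f" "S \<in> sets lebesgue"
  shows "square_integrable (\<lambda>x. indicator S x *\<^sub>R f x)"
proof -
  have "integrable lebesgue (\<lambda>x. indicator S x *\<^sub>R (norm (f x))\<^sup>2)"
    using assms by (intro integrable_mult_indicator) (auto simp: square_integrable_def)
  moreover have "(\<lambda>x. indicator S x *\<^sub>R (norm (f x))\<^sup>2) = (\<lambda>x. (norm (indicator S x *\<^sub>R f x))\<^sup>2)"
    by (auto simp: indicator_def)
  ultimately show ?thesis using assms
    by (auto simp: square_integrable_def intro!: borel_measurable_scaleR borel_measurable_indicator)
qed

text \<open>Tested with its own restriction to the complement of \<open>S\<close>, the vector shows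
  that this restriction has norm zero.\<close>

lemma l2_zero_off:
  fixes v :: "('a::euclidean_space, 'b::euclidean_space) l2"
  assumes S: "S \<in> sets lebesgue" and z: "\<And>z. (\<And>x. x \<in> S \<Longrightarrow> z x = 0) \<Longrightarrow> square_integrable z \<Longrightarrow> v \<bullet> abs_l2 z = 0"
  shows "AE x in lebesgue. x \<notin> S \<longrightarrow> rep_l2 v x = 0"
proof -
  define z where "z x = indicator (- S) x *\<^sub>R rep_l2 v x" for x
  have sz: "square_integrable z"
    unfolding z_def using S by (intro square_integrable_indicator) (auto simp: sets.compl_sets Compl_in_sets_lebesgue)
  have "0 = v \<bullet> abs_l2 z" using sz by (intro z[symmetric]) (auto simp: z_def)
  also have "\<dots> = (LINT x|lebesgue. rep_l2 v x \<bullet> z x)"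
    using abs_l2_inner[of "rep_l2 v" z] sz by simp
  also have "\<dots> = (LINT x|lebesgue. (norm (z x))\<^sup>2)"
    by (intro Bochner_Integration.integral_cong) (auto simp: z_def indicator_def power2_norm_eq_inner)
  finally have "AE x in lebesgue. (norm (z x))\<^sup>2 = 0"
    using sz by (subst integral_nonneg_eq_0_iff_AE[symmetric]) (auto simp: square_integrable_def)
  then show ?thesis by eventually_elim (auto simp: z_def indicator_def)
qed

text \<open>Allows integrals over \<open>\<Omega>\<close> and over the whole space to be exchanged.
  Orthogonality to all functions that vanish on \<open>\<Omega>\<close> is a closed condition, clear
  for test functions.\<close>

lemma h01_zero_off:
  assumes \<Omega>: "open \<Omega>" and U: "U \<in> h01 \<Omega>"
  shows "AE x in lebesgue. x \<notin> \<Omega> \<longrightarrow> rep_l2 (fst U) x = 0" "AE x in lebesgue. x \<notin> \<Omega> \<longrightarrow> rep_l2 (snd U) x = 0"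
proof -
  have \<Omega>s: "\<Omega> \<in> sets lebesgue" using \<Omega> by auto
  show "AE x in lebesgue. x \<notin> \<Omega> \<longrightarrow> rep_l2 (fst U) x = 0"
  proof (rule l2_zero_off[OF \<Omega>s])
    fix z :: "'a \<Rightarrow> 'a" assume z: "\<And>x. x \<in> \<Omega> \<Longrightarrow> z x = 0" "square_integrable z"
    show "fst U \<bullet> abs_l2 z = 0" using U
    proof (rule h01_closure_induct)
      show "closed {U :: 'a h1. fst U \<bullet> abs_l2 z = 0}" by (intro closed_Collect_eq continuous_intros)
      fix f assume f: "f \<in> test_functions \<Omega>"
      have "gradient f x \<bullet> z x = 0" for x using z(1) test_function_support(2)[OF f] by (cases "x \<in> \<Omega>") auto
      then show "fst (test_pair f) \<bullet> abs_l2 z = 0"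
        using z C1c_square_integrable[OF test_function_C1c[OF f]] by (simp add: test_pair_def abs_l2_inner)
    qed
  qed
  show "AE x in lebesgue. x \<notin> \<Omega> \<longrightarrow> rep_l2 (snd U) x = 0"
  proof (rule l2_zero_off[OF \<Omega>s])
    fix z :: "'a \<Rightarrow> real" assume z: "\<And>x. x \<in> \<Omega> \<Longrightarrow> z x = 0" "square_integrable z"
    show "snd U \<bullet> abs_l2 z = 0" using U
    proof (rule h01_closure_induct)
      show "closed {U :: 'a h1. snd U \<bullet> abs_l2 z = 0}" by (intro closed_Collect_eq continuous_intros)
      fix f assume f: "f \<in> test_functions \<Omega>"
      have "f x \<bullet> z x = 0" for x using z(1) test_function_support(1)[OF f] by (cases "x \<in> \<Omega>") auto
      then show "snd (test_pair f) \<bullet> abs_l2 z = 0"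
        unfolding test_pair_def snd_conv abs_l2_inner[OF C1c_square_integrable(1)[OF test_function_C1c[OF f]] z(2)]
        by (simp only: Bochner_Integration.integral_zero)
    qed
  qed
qed

lemma square_integrable_continuous_bounded_support:
  fixes g :: "'a::euclidean_space \<Rightarrow> 'b::euclidean_space"
  assumes "continuous_on UNIV g" "bounded {x. g x \<noteq> 0}"
  shows "square_integrable g"
proof -
  have [measurable]: "g \<in> borel_measurable borel" using assms by (auto intro!: borel_measurable_continuous_onI)
  have "integrable lborel (\<lambda>x. (norm (g x))\<^sup>2)"
    using assms by (intro integrable_continuous_bounded_support continuous_intros) auto
  then have "integrable lebesgue (\<lambda>x. (norm (g x))\<^sup>2)" by (subst integrable_completion) simp_all
  then show ?thesis by (auto simp: square_integrable_def intro!: measurable_completion)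
qed

text \<open>Both sides are continuous in \<open>U\<close>, so the formula for \<open>C^1\<close>
  functions of bounded support extends by density.\<close>

lemma h01_integration_by_parts:
  assumes U: "U \<in> h01 \<Omega>" and \<phi>: "C1c \<phi>"
  shows "snd U \<bullet> abs_l2 (\<lambda>x. gradient \<phi> x \<bullet> v) = - (fst U \<bullet> abs_l2 (\<lambda>x. \<phi> x *\<^sub>R v))"
  using U
proof (rule h01_closure_induct)
  have b\<phi>: "bounded {x. \<phi> x \<noteq> 0}" using \<phi> by (simp add: C1c_def)
  have s1: "square_integrable (\<lambda>x. gradient \<phi> x \<bullet> v)"
    by (intro square_integrable_continuous_bounded_support continuous_intros C1c_gradient_continuous \<phi>
        bounded_subset[OF C1c_bounded_gradient[OF \<phi>]]) auto
  have s2: "square_integrable (\<lambda>x. \<phi> x *\<^sub>R v)"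
    by (intro square_integrable_continuous_bounded_support continuous_intros C1c_continuous \<phi>
        bounded_subset[OF b\<phi>]) auto
  show "closed {U :: 'a h1. snd U \<bullet> abs_l2 (\<lambda>x. gradient \<phi> x \<bullet> v) = - (fst U \<bullet> abs_l2 (\<lambda>x. \<phi> x *\<^sub>R v))}"
    by (intro closed_Collect_eq continuous_intros)
  fix f assume "f \<in> test_functions \<Omega>"
  then have f: "C1c f" by (rule test_function_C1c)
  have [measurable]: "f \<in> borel_measurable borel" "gradient f \<in> borel_measurable borel"
    "\<phi> \<in> borel_measurable borel" "gradient \<phi> \<in> borel_measurable borel"
    using f \<phi> by (auto intro!: borel_measurable_continuous_onI C1c_continuous C1c_gradient_continuous)
  show "snd (test_pair f) \<bullet> abs_l2 (\<lambda>x. gradient \<phi> x \<bullet> v) = - (fst (test_pair f) \<bullet> abs_l2 (\<lambda>x. \<phi> x *\<^sub>R v))"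
    using s1 s2 C1c_square_integrable[OF f] integration_by_parts_C1c[OF f \<phi>, of v]
    by (simp add: test_pair_def abs_l2_inner lborel_lebesgue_integral mult.commute)
qed

text \<open>Approximating test functions converge almost everywhere along a subsequence, and Fatou's
  lemma transfers the inequality and the finiteness of the integral at once. The size of
  \<open>C\<close> is immaterial: it serves for integrability of the critical power and for
  positivity of the sharp constant.\<close>

lemma sobolev_h01:
  assumes dim: "DIM('a::euclidean_space) \<ge> 3"
  shows "\<exists>C>0. \<forall>\<Omega> :: 'a set. \<forall>U\<in>h01 \<Omega>. integrable lebesgue (\<lambda>x. \<bar>rep_l2 (snd U) x\<bar> powr crit_exp DIM('a)) \<and>
    (LINT x|lebesgue. \<bar>rep_l2 (snd U) x\<bar> powr crit_exp DIM('a)) \<le> C * norm (fst U) powr crit_exp DIM('a)"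
proof -
  define q where "q = crit_exp DIM('a)"
  have q: "q > 0" using dim by (simp add: q_def crit_exp_def)
  obtain C where C: "C > 0" "\<And>f::'a \<Rightarrow> real. C1c f \<Longrightarrow> (LINT x|lborel. \<bar>f x\<bar> powr q) \<le>
    C * (LINT x|lborel. (norm (gradient f x))\<^sup>2) powr (q / 2)"
    using sobolev_C1c[OF dim] unfolding q_def by blast
  have nn: "(\<integral>\<^sup>+x. ennreal (\<bar>rep_l2 (snd U) x\<bar> powr q) \<partial>lebesgue) \<le> ennreal (C * norm (fst U) powr q)"
    if U: "U \<in> h01 \<Omega>" for U and \<Omega> :: "'a set"
  proof -
    obtain f where f: "\<And>n. f n \<in> test_functions \<Omega>" "(\<lambda>n. test_pair (f n)) \<longlonglongrightarrow> U"
      using h01_approx[OF U] by blast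
    have f1: "C1c (f n)" for n using f(1) by (rule test_function_C1c)
    have fm [measurable]: "f n \<in> borel_measurable borel" for n
      by (intro borel_measurable_continuous_onI C1c_continuous f1)
    have "(\<lambda>n. snd (test_pair (f n))) \<longlonglongrightarrow> snd U" by (intro tendsto_snd f(2))
    then obtain r where r: "strict_mono r"
      "AE x in lebesgue. (\<lambda>n. rep_l2 (snd (test_pair (f (r n)))) x) \<longlonglongrightarrow> rep_l2 (snd U) x"
      using l2_convergent_AE_subseq by blast
    have rep: "AE x in lebesgue. \<forall>n. rep_l2 (snd (test_pair (f (r n)))) x = f (r n) x"
      unfolding AE_all_countable test_pair_def using rep_abs_l2[OF C1c_square_integrable(1)[OF f1]] by simp
    have conv: "AE x in lebesgue. (\<lambda>n. f (r n) x) \<longlonglongrightarrow> rep_l2 (snd U) x"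
      using r(2) rep by eventually_elim simp
    have flim: "(\<lambda>n. fst (test_pair (f (r n)))) \<longlonglongrightarrow> fst U"
      using LIMSEQ_subseq_LIMSEQ[OF f(2) r(1)] by (auto simp: o_def intro: tendsto_fst)
    have "(\<integral>\<^sup>+x. ennreal (\<bar>rep_l2 (snd U) x\<bar> powr q) \<partial>lebesgue)
      = (\<integral>\<^sup>+x. liminf (\<lambda>n. ennreal (\<bar>f (r n) x\<bar> powr q)) \<partial>lebesgue)"
    proof (rule nn_integral_cong_AE, use conv in eventually_elim)
      case (elim x)
      have "(\<lambda>n. ennreal (\<bar>f (r n) x\<bar> powr q)) \<longlonglongrightarrow> ennreal (\<bar>rep_l2 (snd U) x\<bar> powr q)"
        using q by (intro tendsto_ennrealI tendsto_powr' tendsto_rabs elim tendsto_const) auto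
      from lim_imp_Liminf[OF _ this] show ?case by simp
    qed
    also have "\<dots> \<le> liminf (\<lambda>n. \<integral>\<^sup>+x. ennreal (\<bar>f (r n) x\<bar> powr q) \<partial>lebesgue)"
      by (rule nn_integral_liminf) (auto intro!: measurable_completion)
    also have "\<dots> \<le> liminf (\<lambda>n. ennreal (C * norm (fst (test_pair (f (r n)))) powr q))"
    proof (intro Liminf_mono always_eventually allI)
      fix n
      define h where "h = f (r n)"
      have h: "C1c h" by (simp add: h_def f1)
      have [measurable]: "h \<in> borel_measurable borel" by (simp add: h_def)
      have int: "integrable lborel (\<lambda>x. \<bar>h x\<bar> powr q)"
        using q h unfolding C1c_def by (intro integrable_continuous_bounded_support continuous_on_powr'
            continuous_intros C1c_continuous h) auto
      have "(\<integral>\<^sup>+x. ennreal (\<bar>h x\<bar> powr q) \<partial>lebesgue) = ennreal (LINT x|lborel. \<bar>h x\<bar> powr q)"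
        using int by (simp add: nn_integral_completion nn_integral_eq_integral)
      also have "\<dots> \<le> ennreal (C * (LINT x|lborel. (norm (gradient h x))\<^sup>2) powr (q / 2))"
        by (intro ennreal_leI C h)
      also have "(LINT x|lborel. (norm (gradient h x))\<^sup>2) powr (q / 2) = norm (fst (test_pair h)) powr q"
        unfolding norm_test_pair(1)[OF h, symmetric]
        by (cases "norm (fst (test_pair h)) = 0") (auto simp: powr_powr simp flip: powr_numeral)
      finally show "(\<integral>\<^sup>+x. ennreal (\<bar>f (r n) x\<bar> powr q) \<partial>lebesgue) \<le> ennreal (C * norm (fst (test_pair (f (r n)))) powr q)"
        by (simp add: h_def)
    qed
    also have "\<dots> = ennreal (C * norm (fst U) powr q)"
      using q by (intro lim_imp_Liminf tendsto_ennrealI tendsto_mult tendsto_const tendsto_powr' tendsto_norm flim) auto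
    finally show ?thesis .
  qed
  show ?thesis
  proof (intro exI[of _ C] conjI allI ballI)
    fix \<Omega> :: "'a set" and U assume U: "U \<in> h01 \<Omega>"
    show int: "integrable lebesgue (\<lambda>x. \<bar>rep_l2 (snd U) x\<bar> powr crit_exp DIM('a))"
      using nn[OF U] unfolding q_def[symmetric] by (intro integrableI_bounded) (auto simp: order.strict_trans1)
    have "ennreal (LINT x|lebesgue. \<bar>rep_l2 (snd U) x\<bar> powr q) \<le> ennreal (C * norm (fst U) powr q)"
      using nn[OF U] int unfolding q_def[symmetric] by (subst nn_integral_eq_integral[symmetric]) auto
    then show "(LINT x|lebesgue. \<bar>rep_l2 (snd U) x\<bar> powr crit_exp DIM('a)) \<le> C * norm (fst U) powr crit_exp DIM('a)"
      using C(1) unfolding q_def[symmetric] by (subst (asm) ennreal_le_iff) auto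
  qed (rule C)
qed

lemma integrable_L2_bounded:
  fixes f :: "'a::euclidean_space \<Rightarrow> 'b::euclidean_space"
  assumes "bounded \<Omega>" "open \<Omega>" "f \<in> L2 \<Omega>"
  shows "integrable (lebesgue_on \<Omega>) f"
proof (rule Bochner_Integration.integrable_bound)
  have fin: "finite_measure (lebesgue_on \<Omega>)"
    using assms by (intro finite_measure_lebesgue_on) (simp add: bounded_set_imp_lmeasurable)
  show "integrable (lebesgue_on \<Omega>) (\<lambda>x. 1 + (norm (f x))\<^sup>2)"
    using assms finite_measure.integrable_const[OF fin, of "1::real"] by (auto simp: L2_def)
  show "f \<in> borel_measurable (lebesgue_on \<Omega>)" using assms by (simp add: L2_def)
  have "norm (f x) \<le> norm (1 + (norm (f x))\<^sup>2)" for x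
  proof -
    have "2 * norm (f x) \<le> (norm (f x))\<^sup>2 + 1"
      using zero_le_power2[of "norm (f x) - 1"] by (simp add: power2_diff)
    moreover have "0 \<le> norm (f x)" by simp
    ultimately have "norm (f x) \<le> 1 + (norm (f x))\<^sup>2" by linarith
    then show ?thesis by simp
  qed
  then show "AE x in lebesgue_on \<Omega>. norm (f x) \<le> norm (1 + (norm (f x))\<^sup>2)"
    by (intro AE_I2)
qed

text \<open>Each component of the difference integrates to zero against every test function, so the
  fundamental lemma applies. On a bounded set square integrable functions are integrable, as that
  lemma demands.\<close>

lemma weak_gradient_unique:
  fixes \<Omega> :: "'a::euclidean_space set"
  assumes \<Omega>: "bounded \<Omega>" "open \<Omega>"
    and G: "G1 \<in> L2 \<Omega>" "G2 \<in> L2 \<Omega>" "is_weak_gradient \<Omega> u G1" "is_weak_gradient \<Omega> u G2"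
  shows "AE x in lebesgue_on \<Omega>. G1 x = G2 x"
proof -
  have int: "integrable (lebesgue_on \<Omega>) (\<lambda>x. (G x \<bullet> i) * f x)"
    if "G \<in> L2 \<Omega>" "f \<in> test_functions \<Omega>" for G :: "'a \<Rightarrow> 'a" and i f
  proof -
    have C: "C1c f" using that by (intro test_function_C1c)
    obtain B where B: "\<And>x. f x \<noteq> 0 \<Longrightarrow> norm x \<le> B" using C unfolding C1c_def bounded_iff by auto
    have "bounded (f ` cball 0 B)"
      by (intro compact_imp_bounded compact_continuous_image C1c_continuous C) auto
    then obtain K where "\<forall>y\<in>f ` cball 0 B. norm y \<le> K" unfolding bounded_iff by blast
    then have K: "\<bar>f x\<bar> \<le> max K 0" for x using B[of x] by (cases "f x = 0") (auto simp: max.coboundedI1)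
    have i: "integrable (lebesgue_on \<Omega>) (\<lambda>x. G x \<bullet> i)"
      using integrable_L2_bounded[OF \<Omega> that(1)] by simp
    have fm: "f \<in> borel_measurable (lebesgue_on \<Omega>)"
      by (intro measurable_restrict_space1 measurable_completion)
        (simp add: borel_measurable_continuous_onI C1c_continuous C)
    show ?thesis
    proof (rule Bochner_Integration.integrable_bound[where f="\<lambda>x. max K 0 * (G x \<bullet> i)"])
      show "AE x in lebesgue_on \<Omega>. norm ((G x \<bullet> i) * f x) \<le> norm (max K 0 * (G x \<bullet> i))"
        using K by (intro AE_I2) (auto simp: abs_mult mult.commute[of "\<bar>_ \<bullet> _\<bar>"] intro!: mult_right_mono)
    qed (use i fm in auto)
  qed
  have "AE x in lebesgue_on \<Omega>. (G1 x - G2 x) \<bullet> i = 0" if i: "i \<in> Basis" for i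
  proof (rule fundamental_lemma_AE_zero[OF \<Omega>(2)])
    show "integrable (lebesgue_on \<Omega>) (\<lambda>x. (G1 x - G2 x) \<bullet> i)"
      using integrable_L2_bounded[OF \<Omega> G(1)] integrable_L2_bounded[OF \<Omega> G(2)] by simp
    fix f assume f: "f \<in> test_functions \<Omega>"
    have "(LINT x|lebesgue_on \<Omega>. ((G1 x - G2 x) \<bullet> i) * f x) =
      (LINT x|lebesgue_on \<Omega>. (G1 x \<bullet> i) * f x) - (LINT x|lebesgue_on \<Omega>. (G2 x \<bullet> i) * f x)"
      using int[OF G(1) f, of i] int[OF G(2) f, of i] by (simp add: inner_diff_left left_diff_distrib)
    then show "(LINT x|lebesgue_on \<Omega>. ((G1 x - G2 x) \<bullet> i) * f x) = 0"
      using G(3,4) f i unfolding is_weak_gradient_def by force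
  qed
  then have "AE x in lebesgue_on \<Omega>. \<forall>i\<in>Basis. (G1 x - G2 x) \<bullet> i = 0"
    by (intro AE_finite_allI) auto
  then show ?thesis by eventually_elim (auto simp: euclidean_eq_iff[of "G1 _"] inner_diff_left)
qed

section \<open>Identification of \<open>H01\<close> with the space of pairs\<close>

locale bounded_domain =
  fixes \<Omega> :: "'a::euclidean_space set"
  assumes open_\<Omega>: "open \<Omega>" and bounded_\<Omega>: "bounded \<Omega>"
begin

lemma \<Omega>_sets [simp]: "\<Omega> \<in> sets lebesgue" using open_\<Omega> by auto

lemma AE_\<Omega>: "(AE x in lebesgue_on \<Omega>. P x) \<longleftrightarrow> (AE x in lebesgue. x \<in> \<Omega> \<longrightarrow> P x)"
  by (simp add: AE_restrict_space_iff)

lemma integral_\<Omega>: "(LINT x|lebesgue_on \<Omega>. f x) = (LINT x|lebesgue. indicator \<Omega> x * (f x :: real))"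
  by (simp add: integral_restrict_space)

lemma square_integrable_extend:
  assumes "f \<in> L2 \<Omega>"
  shows "square_integrable (\<lambda>x. indicator \<Omega> x *\<^sub>R f x)"
proof -
  have "integrable lebesgue (\<lambda>x. indicator \<Omega> x *\<^sub>R (norm (f x))\<^sup>2)"
    using assms integrable_restrict_space[of \<Omega> lebesgue "\<lambda>x. (norm (f x))\<^sup>2"] by (simp add: L2_def)
  moreover have "(\<lambda>x. indicator \<Omega> x *\<^sub>R (norm (f x))\<^sup>2) = (\<lambda>x. (norm (indicator \<Omega> x *\<^sub>R f x))\<^sup>2)"
    by (auto simp: indicator_def)
  moreover have "(\<lambda>x. indicator \<Omega> x *\<^sub>R f x) \<in> borel_measurable lebesgue"
    using assms borel_measurable_restrict_space_iff[of \<Omega> lebesgue f] by (simp add: L2_def)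
  ultimately show ?thesis by (simp add: square_integrable_def)
qed

lemma L2_restrict:
  assumes "square_integrable f"
  shows "f \<in> L2 \<Omega>"
proof -
  have "integrable lebesgue (\<lambda>x. indicator \<Omega> x *\<^sub>R (norm (f x))\<^sup>2)"
    using assms by (intro integrable_mult_indicator) (auto simp: square_integrable_def)
  then show ?thesis
    using assms integrable_restrict_space[of \<Omega> lebesgue "\<lambda>x. (norm (f x))\<^sup>2"]
    by (auto simp: L2_def square_integrable_def intro: measurable_restrict_space1)
qed

lemma is_weak_gradient_rep:
  assumes U: "U \<in> h01 \<Omega>"
  shows "is_weak_gradient \<Omega> (rep_l2 (snd U)) (rep_l2 (fst U))"
  unfolding is_weak_gradient_def
proof (intro ballI)
  fix f :: "'a \<Rightarrow> real" and i :: 'a assume f: "f \<in> test_functions \<Omega>" and i: "i \<in> Basis"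
  have C: "C1c f" by (rule test_function_C1c[OF f])
  have p: "partial_deriv i f x = gradient f x \<bullet> i" for x
    using C by (intro partial_deriv_eq) (auto simp: C1c_def differentiable_def)
  have bf: "bounded {x. f x \<noteq> 0}" using C by (simp add: C1c_def)
  have s1: "square_integrable (\<lambda>x. gradient f x \<bullet> i)"
    by (intro square_integrable_continuous_bounded_support continuous_intros C1c_gradient_continuous C
        bounded_subset[OF C1c_bounded_gradient[OF C]]) auto
  have s2: "square_integrable (\<lambda>x. f x *\<^sub>R i)"
    by (intro square_integrable_continuous_bounded_support continuous_intros C1c_continuous C
        bounded_subset[OF bf]) auto
  have "(LINT x|lebesgue_on \<Omega>. rep_l2 (snd U) x * partial_deriv i f x) = (LINT x|lebesgue. rep_l2 (snd U) x \<bullet> (gradient f x \<bullet> i))"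
    unfolding integral_\<Omega> p using test_function_support(2)[OF f]
    by (intro Bochner_Integration.integral_cong) (auto simp: indicator_def)
  also have "\<dots> = snd U \<bullet> abs_l2 (\<lambda>x. gradient f x \<bullet> i)"
    using abs_l2_inner[OF square_integrable_rep s1, of "snd U"] by simp
  also have "\<dots> = - (fst U \<bullet> abs_l2 (\<lambda>x. f x *\<^sub>R i))" by (rule h01_integration_by_parts[OF U C])
  also have "fst U \<bullet> abs_l2 (\<lambda>x. f x *\<^sub>R i) = (LINT x|lebesgue. rep_l2 (fst U) x \<bullet> (f x *\<^sub>R i))"
    using abs_l2_inner[OF square_integrable_rep s2, of "fst U"] by simp
  also have "\<dots> = (LINT x|lebesgue_on \<Omega>. (rep_l2 (fst U) x \<bullet> i) * f x)"
    unfolding integral_\<Omega> using test_function_support(1)[OF f]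
    by (intro Bochner_Integration.integral_cong) (auto simp: indicator_def)
  finally show "(LINT x|lebesgue_on \<Omega>. rep_l2 (snd U) x * partial_deriv i f x) =
        - (LINT x|lebesgue_on \<Omega>. (rep_l2 (fst U) x \<bullet> i) * f x)" .
qed

lemma weak_gradient_spec:
  assumes "u \<in> H1 \<Omega>"
  shows "weak_gradient \<Omega> u \<in> L2 \<Omega>" "is_weak_gradient \<Omega> u (weak_gradient \<Omega> u)"
proof -
  have "\<exists>G. G \<in> L2 \<Omega> \<and> is_weak_gradient \<Omega> u G" using assms unfolding H1_def by blast
  from someI_ex[OF this] show "weak_gradient \<Omega> u \<in> L2 \<Omega>" "is_weak_gradient \<Omega> u (weak_gradient \<Omega> u)"
    unfolding weak_gradient_def by auto
qed

lemma rep_H1: "U \<in> h01 \<Omega> \<Longrightarrow> rep_l2 (snd U) \<in> H1 \<Omega>"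
  using is_weak_gradient_rep[of U] L2_restrict[OF square_integrable_rep, of "snd U"]
    L2_restrict[OF square_integrable_rep, of "fst U"]
  unfolding H1_def by (auto intro!: bexI[of _ "rep_l2 (fst U)"])

lemma weak_gradient_rep:
  assumes "U \<in> h01 \<Omega>"
  shows "AE x in lebesgue_on \<Omega>. weak_gradient \<Omega> (rep_l2 (snd U)) x = rep_l2 (fst U) x"
proof (rule weak_gradient_unique[OF bounded_\<Omega> open_\<Omega>])
  show "rep_l2 (fst U) \<in> L2 \<Omega>" by (rule L2_restrict) simp
  show "weak_gradient \<Omega> (rep_l2 (snd U)) \<in> L2 \<Omega>"
    "is_weak_gradient \<Omega> (rep_l2 (snd U)) (weak_gradient \<Omega> (rep_l2 (snd U)))"
    using weak_gradient_spec[OF rep_H1[OF assms]] by auto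
  show "is_weak_gradient \<Omega> (rep_l2 (snd U)) (rep_l2 (fst U))" by (rule is_weak_gradient_rep[OF assms])
qed

text \<open>The choice operator sees only the predicate, and functions equal almost everywhere have
  the same weak gradients; hence the chosen gradients are equal as functions.\<close>

lemma weak_gradient_cong:
  assumes "ae_eq \<Omega> u v" "u \<in> L2 \<Omega>" "v \<in> L2 \<Omega>"
  shows "weak_gradient \<Omega> u = weak_gradient \<Omega> v"
proof -
  have "(LINT x|lebesgue_on \<Omega>. u x * partial_deriv i f x) = (LINT x|lebesgue_on \<Omega>. v x * partial_deriv i f x)"
    if f: "f \<in> test_functions \<Omega>" for i f
  proof (rule integral_cong_AE)
    have C: "C1c f" by (rule test_function_C1c[OF f])
    have "partial_deriv i f = (\<lambda>x. gradient f x \<bullet> i)"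
      using C by (intro ext partial_deriv_eq) (auto simp: C1c_def differentiable_def)
    moreover have "continuous_on UNIV (\<lambda>x. gradient f x \<bullet> i)"
      by (intro continuous_intros C1c_gradient_continuous C)
    ultimately have m: "partial_deriv i f \<in> borel_measurable (lebesgue_on \<Omega>)"
      by (intro measurable_restrict_space1 measurable_completion) (simp add: borel_measurable_continuous_onI)
    show "(\<lambda>x. u x * partial_deriv i f x) \<in> borel_measurable (lebesgue_on \<Omega>)"
      "(\<lambda>x. v x * partial_deriv i f x) \<in> borel_measurable (lebesgue_on \<Omega>)"
      using assms m by (auto simp: L2_def)
    show "AE x in lebesgue_on \<Omega>. u x * partial_deriv i f x = v x * partial_deriv i f x"
      using assms(1) unfolding ae_eq_def by eventually_elim simp
  qed
  then have "is_weak_gradient \<Omega> u = is_weak_gradient \<Omega> v"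
    unfolding is_weak_gradient_def by (intro ext) auto
  then show ?thesis unfolding weak_gradient_def by simp
qed

text \<open>The quantity whose convergence to \<open>0\<close> defines \<open>H01\<close> is a
  squared distance in the space of pairs, since test functions and their gradients vanish off
  \<open>\<Omega>\<close>.\<close>

lemma dist_test_pair:
  assumes f: "f \<in> test_functions \<Omega>" and u: "u \<in> L2 \<Omega>" and W: "W \<in> L2 \<Omega>"
  shows "(dist (test_pair f) (abs_l2 (\<lambda>x. indicator \<Omega> x *\<^sub>R W x), abs_l2 (\<lambda>x. indicator \<Omega> x *\<^sub>R u x)))\<^sup>2 =
    (LINT x|lebesgue_on \<Omega>. (f x - u x)\<^sup>2) + (LINT x|lebesgue_on \<Omega>. (norm (gradient f x - W x))\<^sup>2)"
proof -
  note s = C1c_square_integrable[OF test_function_C1c[OF f]]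
  have "(dist (abs_l2 f) (abs_l2 (\<lambda>x. indicator \<Omega> x *\<^sub>R u x)))\<^sup>2 = (LINT x|lebesgue. (norm (f x - indicator \<Omega> x *\<^sub>R u x))\<^sup>2)"
    using s(1) square_integrable_extend[OF u] by (simp add: dist_norm abs_l2_minus abs_l2_norm square_integrable_minus)
  also have "\<dots> = (LINT x|lebesgue_on \<Omega>. (f x - u x)\<^sup>2)"
    unfolding integral_\<Omega> using test_function_support(1)[OF f]
    by (intro Bochner_Integration.integral_cong) (auto simp: indicator_def)
  finally have 1: "(dist (abs_l2 f) (abs_l2 (\<lambda>x. indicator \<Omega> x *\<^sub>R u x)))\<^sup>2 = \<dots>" .
  have "(dist (abs_l2 (gradient f)) (abs_l2 (\<lambda>x. indicator \<Omega> x *\<^sub>R W x)))\<^sup>2 = (LINT x|lebesgue. (norm (gradient f x - indicator \<Omega> x *\<^sub>R W x))\<^sup>2)"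
    using s(2) square_integrable_extend[OF W] by (simp add: dist_norm abs_l2_minus abs_l2_norm square_integrable_minus)
  also have "\<dots> = (LINT x|lebesgue_on \<Omega>. (norm (gradient f x - W x))\<^sup>2)"
    unfolding integral_\<Omega> using test_function_support(2)[OF f]
    by (intro Bochner_Integration.integral_cong) (auto simp: indicator_def)
  finally show ?thesis using 1 by (simp add: dist_prod_def test_pair_def)
qed

text \<open>The extensions by zero of the chosen gradient and of \<open>u\<close> form a pair that
  is the limit of the approximating test pairs.\<close>

lemma H01_imp_h01:
  assumes "u \<in> H01 \<Omega>"
  shows "\<exists>U\<in>h01 \<Omega>. (AE x in lebesgue_on \<Omega>. rep_l2 (snd U) x = u x) \<and>
    (AE x in lebesgue_on \<Omega>. rep_l2 (fst U) x = weak_gradient \<Omega> u x)"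
proof -
  have u: "u \<in> H1 \<Omega>" and "\<exists>f. (\<forall>n::nat. f n \<in> test_functions \<Omega>) \<and>
     (\<lambda>n. (LINT x|lebesgue_on \<Omega>. (f n x - u x)\<^sup>2) +
          (LINT x|lebesgue_on \<Omega>. (norm (gradient (f n) x - weak_gradient \<Omega> u x))\<^sup>2)) \<longlonglongrightarrow> 0"
    using assms by (auto simp: H01_def)
  then obtain f where f: "\<And>n::nat. f n \<in> test_functions \<Omega>"
     "(\<lambda>n. (LINT x|lebesgue_on \<Omega>. (f n x - u x)\<^sup>2) +
          (LINT x|lebesgue_on \<Omega>. (norm (gradient (f n) x - weak_gradient \<Omega> u x))\<^sup>2)) \<longlonglongrightarrow> 0" by blast
  have uL: "u \<in> L2 \<Omega>" using u by (simp add: H1_def)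
  note W = weak_gradient_spec[OF u]
  define U where "U = (abs_l2 (\<lambda>x. indicator \<Omega> x *\<^sub>R weak_gradient \<Omega> u x), abs_l2 (\<lambda>x. indicator \<Omega> x *\<^sub>R u x))"
  have "(\<lambda>n. (dist (test_pair (f n)) U)\<^sup>2) \<longlonglongrightarrow> 0"
    using f(2) unfolding U_def dist_test_pair[OF f(1) uL W(1)] .
  then have "(\<lambda>n. sqrt ((dist (test_pair (f n)) U)\<^sup>2)) \<longlonglongrightarrow> sqrt 0" by (rule tendsto_real_sqrt)
  then have "(\<lambda>n. test_pair (f n)) \<longlonglongrightarrow> U" by (simp add: tendsto_dist_iff[of _ U])
  then have "U \<in> h01 \<Omega>"
    unfolding h01_def closure_sequential using f(1) by (intro exI[of _ "\<lambda>n. test_pair (f n)"]) auto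
  moreover have "AE x in lebesgue. rep_l2 (snd U) x = indicator \<Omega> x *\<^sub>R u x"
    unfolding U_def snd_conv by (rule rep_abs_l2[OF square_integrable_extend[OF uL]])
  then have "AE x in lebesgue_on \<Omega>. rep_l2 (snd U) x = u x" unfolding AE_\<Omega> by eventually_elim simp
  moreover have "AE x in lebesgue. rep_l2 (fst U) x = indicator \<Omega> x *\<^sub>R weak_gradient \<Omega> u x"
    unfolding U_def fst_conv by (rule rep_abs_l2[OF square_integrable_extend[OF W(1)]])
  then have "AE x in lebesgue_on \<Omega>. rep_l2 (fst U) x = weak_gradient \<Omega> u x" unfolding AE_\<Omega> by eventually_elim simp
  ultimately show ?thesis by blast
qed

text \<open>By uniqueness the chosen weak gradient agrees almost everywhere with the first
  component, so approximation by test pairs is approximation in the sense of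
  \<open>H01\<close>.\<close>

lemma h01_imp_H01:
  assumes U: "U \<in> h01 \<Omega>"
  shows "rep_l2 (snd U) \<in> H01 \<Omega>"
proof -
  let ?u = "rep_l2 (snd U)"
  have u: "?u \<in> H1 \<Omega>" by (rule rep_H1[OF U])
  have uL: "?u \<in> L2 \<Omega>" using u by (simp add: H1_def)
  note W = weak_gradient_spec[OF u]
  obtain f where f: "\<And>n. f n \<in> test_functions \<Omega>" "(\<lambda>n. test_pair (f n)) \<longlonglongrightarrow> U"
    using h01_approx[OF U] by blast
  have "AE x in lebesgue. indicator \<Omega> x *\<^sub>R weak_gradient \<Omega> ?u x = rep_l2 (fst U) x"
    using weak_gradient_rep[OF U] h01_zero_off(1)[OF open_\<Omega> U] unfolding AE_\<Omega>
    by eventually_elim (auto simp: indicator_def)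
  then have "abs_l2 (\<lambda>x. indicator \<Omega> x *\<^sub>R weak_gradient \<Omega> ?u x) = fst U"
    using abs_l2_eq_iff[OF square_integrable_extend[OF W(1)] square_integrable_rep, of "fst U"] by simp
  moreover have "AE x in lebesgue. indicator \<Omega> x *\<^sub>R ?u x = ?u x"
    using h01_zero_off(2)[OF open_\<Omega> U] by eventually_elim (auto simp: indicator_def)
  then have "abs_l2 (\<lambda>x. indicator \<Omega> x *\<^sub>R ?u x) = snd U"
    using abs_l2_eq_iff[OF square_integrable_extend[OF uL] square_integrable_rep, of "snd U"] by simp
  ultimately have "(abs_l2 (\<lambda>x. indicator \<Omega> x *\<^sub>R weak_gradient \<Omega> ?u x), abs_l2 (\<lambda>x. indicator \<Omega> x *\<^sub>R ?u x)) = U"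
    by simp
  moreover have "(\<lambda>n. (dist (test_pair (f n)) U)\<^sup>2) \<longlonglongrightarrow> 0\<^sup>2"
    using f(2) by (intro tendsto_power) (simp add: tendsto_dist_iff[of _ U])
  ultimately have "(\<lambda>n. (LINT x|lebesgue_on \<Omega>. (f n x - ?u x)\<^sup>2) +
      (LINT x|lebesgue_on \<Omega>. (norm (gradient (f n) x - weak_gradient \<Omega> ?u x))\<^sup>2)) \<longlonglongrightarrow> 0"
    unfolding dist_test_pair[OF f(1) uL W(1), symmetric] by (simp only: zero_power2)
  then show ?thesis unfolding H01_def using u f(1) by blast
qed

lemma integral_norm_fst:
  assumes "U \<in> h01 \<Omega>"
  shows "(LINT x|lebesgue_on \<Omega>. (norm (rep_l2 (fst U) x))\<^sup>2) = (norm (fst U))\<^sup>2"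
  unfolding norm_l2_rep integral_\<Omega>
proof (rule integral_cong_AE)
  show "AE x in lebesgue. indicator \<Omega> x * (norm (rep_l2 (fst U) x))\<^sup>2 = (norm (rep_l2 (fst U) x))\<^sup>2"
    using h01_zero_off(1)[OF open_\<Omega> assms] by eventually_elim (auto simp: indicator_def)
qed (auto intro!: borel_measurable_times borel_measurable_indicator)

lemma H01_norm_h01:
  assumes U: "U \<in> h01 \<Omega>" and u: "AE x in lebesgue_on \<Omega>. rep_l2 (fst U) x = weak_gradient \<Omega> u x"
    "weak_gradient \<Omega> u \<in> L2 \<Omega>"
  shows "H01_norm \<Omega> u = norm (fst U)"
proof -
  have "(LINT x|lebesgue_on \<Omega>. (norm (weak_gradient \<Omega> u x))\<^sup>2) = (LINT x|lebesgue_on \<Omega>. (norm (rep_l2 (fst U) x))\<^sup>2)"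
    using u L2_restrict[OF square_integrable_rep[of "fst U"]]
    by (intro integral_cong_AE) (auto simp: L2_def elim: eventually_mono)
  then show ?thesis unfolding H01_norm_def integral_norm_fst[OF U]
    by (cases "norm (fst U) = 0") (auto simp: powr_powr simp flip: powr_numeral)
qed

lemma H01_norm_rep:
  assumes U: "U \<in> h01 \<Omega>"
  shows "H01_norm \<Omega> (rep_l2 (snd U)) = norm (fst U)"
  using weak_gradient_rep[OF U] weak_gradient_spec(1)[OF rep_H1[OF U]]
  by (intro H01_norm_h01[OF U]) (auto elim: eventually_mono)

lemma inner_fst_h01:
  assumes U: "U \<in> h01 \<Omega>" and Z: "Z \<in> h01 \<Omega>"
    and u: "AE x in lebesgue_on \<Omega>. rep_l2 (fst U) x = Wu x" "Wu \<in> L2 \<Omega>"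
    and z: "AE x in lebesgue_on \<Omega>. rep_l2 (fst Z) x = Wz x" "Wz \<in> L2 \<Omega>"
  shows "(LINT x|lebesgue_on \<Omega>. Wu x \<bullet> Wz x) = fst U \<bullet> fst Z"
proof -
  have "(LINT x|lebesgue_on \<Omega>. Wu x \<bullet> Wz x) = (LINT x|lebesgue_on \<Omega>. rep_l2 (fst U) x \<bullet> rep_l2 (fst Z) x)"
  proof (rule integral_cong_AE)
    show "AE x in lebesgue_on \<Omega>. Wu x \<bullet> Wz x = rep_l2 (fst U) x \<bullet> rep_l2 (fst Z) x"
      using u(1) z(1) by eventually_elim simp
  qed (use u z L2_restrict[OF square_integrable_rep] in \<open>auto simp: L2_def intro!: borel_measurable_inner\<close>)
  also have "\<dots> = fst U \<bullet> fst Z"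
    unfolding inner_l2_rep integral_\<Omega>
  proof (rule integral_cong_AE)
    show "AE x in lebesgue. indicator \<Omega> x * (rep_l2 (fst U) x \<bullet> rep_l2 (fst Z) x) = rep_l2 (fst U) x \<bullet> rep_l2 (fst Z) x"
      using h01_zero_off(1)[OF open_\<Omega> U] by eventually_elim (auto simp: indicator_def)
  qed (auto intro!: borel_measurable_times borel_measurable_indicator borel_measurable_inner)
  finally show ?thesis .
qed

text \<open>The differences \<open>U n - Z\<close> are replaced by test functions at distance less
  than \<open>1 / (n + 1)\<close>. These are bounded, have their supports in one ball and still
  converge weakly to \<open>0\<close>, so the compactness theorem for \<open>C^1\<close> functions
  applies to them.\<close>

lemma rellich_h01:
  assumes U: "\<And>n. U n \<in> h01 \<Omega>" "\<And>n. norm (U n) \<le> R" and Z: "Z \<in> h01 \<Omega>"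
    and weak: "\<And>z. (\<lambda>n. U n \<bullet> z) \<longlonglongrightarrow> Z \<bullet> z"
  shows "(\<lambda>n. snd (U n)) \<longlonglongrightarrow> snd Z"
proof -
  have "\<exists>f\<in>test_functions \<Omega>. dist (test_pair f) (U n - Z) < 1 / real (Suc n)" for n
  proof -
    have "U n - Z \<in> closure (test_pair ` test_functions \<Omega>)"
      using subspace_diff[OF subspace_h01 U(1) Z] by (simp add: h01_def)
    then show ?thesis unfolding closure_approachable by (auto dest!: spec[of _ "1 / real (Suc n)"])
  qed
  then obtain f where f: "\<And>n. f n \<in> test_functions \<Omega>" "\<And>n. dist (test_pair (f n)) (U n - Z) < 1 / real (Suc n)"
    by metis
  have C: "C1c (f n)" for n using f(1) by (rule test_function_C1c)
  have lim0: "(\<lambda>n. 1 / real (Suc n)) \<longlonglongrightarrow> 0" using LIMSEQ_inverse_real_of_nat by (simp add: inverse_eq_divide)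
  have d: "(\<lambda>n. test_pair (f n) - (U n - Z)) \<longlonglongrightarrow> 0"
    by (rule Lim_null_comparison[OF _ lim0]) (use f(2) in \<open>auto simp: dist_norm intro!: always_eventually less_imp_le\<close>)
  obtain B where B: "B > 0" "\<And>x. x \<in> \<Omega> \<Longrightarrow> norm x \<le> B" using bounded_\<Omega> unfolding bounded_pos by auto
  have weakf: "(\<lambda>n. test_pair (f n) \<bullet> z) \<longlonglongrightarrow> 0" for z
  proof -
    have "(\<lambda>n. (test_pair (f n) - (U n - Z)) \<bullet> z + (U n \<bullet> z - Z \<bullet> z)) \<longlonglongrightarrow> 0 \<bullet> z + (Z \<bullet> z - Z \<bullet> z)"
      by (intro tendsto_intros d weak)
    then show ?thesis by (simp add: inner_diff_left)
  qed
  have "(\<lambda>n. LINT x|lborel. (f n x)\<^sup>2) \<longlonglongrightarrow> 0"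
  proof (rule rellich_C1c[OF C, where B=B and K="(R + norm Z + 1)\<^sup>2"])
    show "norm x \<le> B" if "f n x \<noteq> 0" for n x
      using test_function_support(1)[OF f(1)] that B by blast
    show "B \<ge> 0" using B by simp
    show "(LINT x|lborel. (norm (gradient (f n) x))\<^sup>2) \<le> (R + norm Z + 1)\<^sup>2" for n
    proof -
      have "1 / real (Suc n) \<le> 1" by simp
      then have "norm (test_pair (f n) - (U n - Z)) \<le> 1" using f(2)[of n] unfolding dist_norm by linarith
      moreover have "norm (U n - Z) \<le> R + norm Z" using norm_triangle_ineq4[of "U n" Z] U(2)[of n] by simp
      ultimately have "norm (test_pair (f n)) \<le> R + norm Z + 1"
        using norm_triangle_sub[of "test_pair (f n)" "U n - Z"] by simp
      moreover have "norm (fst (test_pair (f n))) \<le> norm (test_pair (f n))" 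
        using norm_fst_le[of "fst (test_pair (f n))" "snd (test_pair (f n))"] by simp
      ultimately show ?thesis unfolding norm_test_pair(1)[OF C, symmetric] by (intro power_mono) auto
    qed
    fix x :: 'a and r :: real
    \<comment> \<open>Pairing with this vector extracts the ball integral of the function
      component.\<close>
    define z where "z = (0 :: ('a, 'a) l2, abs_l2 (indicator (ball x r) :: 'a \<Rightarrow> real))"
    have si: "square_integrable (indicator (ball x r) :: 'a \<Rightarrow> real)"
    proof -
      have "integrable lborel (indicator (ball x r) :: 'a \<Rightarrow> real)"
        using emeasure_bounded_finite[of "ball x r"] by (intro integrable_real_indicator) auto
      then have "integrable lebesgue (indicator (ball x r) :: 'a \<Rightarrow> real)" by (subst integrable_completion) auto
      moreover have "(\<lambda>y. (norm (indicator (ball x r) y :: real))\<^sup>2) = (indicator (ball x r) :: 'a \<Rightarrow> real)"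
        by (auto simp: indicator_def)
      ultimately show ?thesis by (simp add: square_integrable_def)
    qed
    have "test_pair (f n) \<bullet> z = (LINT y|lborel. indicator (ball x r) y * f n y)" for n
    proof -
      have [measurable]: "f n \<in> borel_measurable borel" by (intro borel_measurable_continuous_onI C1c_continuous C)
      have [measurable]: "ball x r \<in> sets borel" by simp
      have "test_pair (f n) \<bullet> z = (LINT y|lebesgue. f n y * indicator (ball x r) y)"
        using abs_l2_inner[OF C1c_square_integrable(1)[OF C] si, of n] by (simp add: z_def test_pair_def inner_prod_def)
      also have "\<dots> = (LINT y|lborel. f n y * indicator (ball x r) y)" by (rule lborel_lebesgue_integral) measurable
      finally show ?thesis by (simp add: mult.commute)
    qed
    then show "(\<lambda>n. LINT y|lborel. indicator (ball x r) y * f n y) \<longlonglongrightarrow> 0" using weakf[of z] by simp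
  qed
  then have "(\<lambda>n. (norm (snd (test_pair (f n))))\<^sup>2) \<longlonglongrightarrow> 0" by (simp add: norm_test_pair(2)[OF C])
  then have "(\<lambda>n. sqrt ((norm (snd (test_pair (f n))))\<^sup>2)) \<longlonglongrightarrow> sqrt 0" by (rule tendsto_real_sqrt)
  then have "(\<lambda>n. snd (test_pair (f n))) \<longlonglongrightarrow> 0" by (simp add: tendsto_norm_zero_iff)
  then have "(\<lambda>n. snd (test_pair (f n)) - snd (test_pair (f n) - (U n - Z)) + snd Z) \<longlonglongrightarrow> 0 - snd (0 :: 'a h1) + snd Z"
    by (intro tendsto_intros d)
  then show ?thesis by simp
qed

end

section \<open>Nemytskii operators\<close>

text \<open>The odd version of the power \<open>q - 1\<close>. Its multiplicativity is behind the
  homogeneous estimates below; it is used with the exponent \<open>p\<close> as well.\<close>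

definition crit_pow :: "real \<Rightarrow> real \<Rightarrow> real" where
  "crit_pow q t = \<bar>t\<bar> powr (q - 2) * t"

lemma crit_pow_mult: "crit_pow q (s * t) = crit_pow q s * crit_pow q t"
  by (simp add: crit_pow_def abs_mult powr_mult)

lemma abs_crit_pow: "\<bar>crit_pow q t\<bar> = \<bar>t\<bar> powr (q - 1)"
  using powr_add[of "\<bar>t\<bar>" "q - 2" 1] by (simp add: crit_pow_def abs_mult)

lemma crit_pow_mult_self: "crit_pow q t * t = \<bar>t\<bar> powr q"
  using powr_add[of "\<bar>t\<bar>" "q - 2" 2]
  by (cases "t = 0") (simp_all add: crit_pow_def power2_eq_square mult.assoc)

lemma continuous_crit_pow:
  assumes "q > 2"
  shows "continuous_on S (crit_pow q)"
  unfolding crit_pow_def[abs_def] using assms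
  by (intro continuous_intros continuous_on_powr') auto

lemma crit_pow_primitive:
  assumes "q > 2"
  shows "((\<lambda>t. \<bar>t\<bar> powr q / q) has_real_derivative crit_pow q t) (at t)"
proof -
  consider "t > 0" | "t = 0" | "t < 0" by linarith
  then show ?thesis
  proof cases
    case 1
    have "((\<lambda>t. t powr q / q) has_real_derivative crit_pow q t) (at t)"
      using 1 assms powr_add[of t "q - 2" 1]
      by (auto intro!: derivative_eq_intros simp: crit_pow_def powr_diff field_simps)
    then show ?thesis
      by (rule has_field_derivative_transform_within_open[where S="{0<..}"]) (use 1 in auto)
  next
    case 2
    have eq: "(1 / q) * crit_pow q h = (\<bar>h\<bar> powr q / q - \<bar>0\<bar> powr q / q) / (h - 0)" if "h \<noteq> 0" for h :: real
      using that assms crit_pow_mult_self[of q h] by (simp add: field_simps)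
    have "isCont (crit_pow q) 0"
      using continuous_crit_pow[OF assms, of UNIV] by (simp add: continuous_on_eq_continuous_at)
    then have "((\<lambda>h. (1 / q) * crit_pow q h) \<longlongrightarrow> (1 / q) * crit_pow q 0) (at 0)"
      unfolding isCont_def by (intro tendsto_intros)
    then have "((\<lambda>h. (\<bar>h\<bar> powr q / q - \<bar>0\<bar> powr q / q) / (h - 0)) \<longlongrightarrow> (1 / q) * crit_pow q 0) (at 0)"
      by (rule Lim_transform_eventually) (rule eventually_mono[OF eventually_neq_at_within], rule eq)
    then show ?thesis using 2 by (simp add: has_field_derivative_iff crit_pow_def)
  next
    case 3
    have "((\<lambda>t. (- t) powr q / q) has_real_derivative crit_pow q t) (at t)"
      using 3 assms
      by (auto intro!: derivative_eq_intros simp: crit_pow_def powr_diff field_simps power2_eq_square)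
    then show ?thesis
      by (rule has_field_derivative_transform_within_open[where S="{..<0}"]) (use 3 in auto)
  qed
qed

text \<open>The two estimates below are homogeneous: they reduce to the continuity of \<open>crit_pow q\<close>
  at \<open>1\<close> when \<open>u / v\<close> is small, and compare powers otherwise.\<close>

lemma crit_pow_near_one:
  assumes "q > 2" "e > 0"
  shows "\<exists>\<eta>>0. \<eta> \<le> 1 \<and> (\<forall>u v. \<bar>u\<bar> \<le> \<eta> * \<bar>v\<bar> \<longrightarrow> \<bar>crit_pow q (u + v) - crit_pow q v\<bar> \<le> e * \<bar>v\<bar> powr (q - 1))"
proof -
  have "isCont (crit_pow q) 1"
    using continuous_crit_pow[OF assms(1), of UNIV] by (simp add: continuous_on_eq_continuous_at)
  then obtain d where d: "d > 0" "\<And>x. \<bar>x - 1\<bar> < d \<Longrightarrow> \<bar>crit_pow q x - crit_pow q 1\<bar> < e"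
    using assms(2) unfolding continuous_at_eps_delta dist_real_def by metis
  show ?thesis
  proof (intro exI[of _ "min (d / 2) 1"] conjI allI impI)
    fix u v assume uv: "\<bar>u\<bar> \<le> min (d / 2) 1 * \<bar>v\<bar>"
    show "\<bar>crit_pow q (u + v) - crit_pow q v\<bar> \<le> e * \<bar>v\<bar> powr (q - 1)"
    proof (cases "v = 0")
      case False
      have "\<bar>u\<bar> / \<bar>v\<bar> \<le> min (d / 2) 1" using uv False by (subst pos_divide_le_eq) auto
      then have "\<bar>u\<bar> / \<bar>v\<bar> \<le> d / 2" by (rule min.boundedE)
      then have "\<bar>(u / v + 1) - 1\<bar> < d" using d(1) unfolding add_diff_cancel_right' abs_divide by linarith
      then have "\<bar>crit_pow q (u / v + 1) - crit_pow q 1\<bar> < e" by (rule d(2))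
      then have "\<bar>v\<bar> powr (q - 1) * \<bar>crit_pow q (u / v + 1) - crit_pow q 1\<bar> \<le> \<bar>v\<bar> powr (q - 1) * e"
        by (intro mult_left_mono) auto
      \<comment> \<open>Multiplicativity carries the estimate near \<open>1\<close> to the scale of
        \<open>v\<close>.\<close>
      moreover have "crit_pow q v * (crit_pow q (u / v + 1) - crit_pow q 1) = crit_pow q (v * (u / v + 1)) - crit_pow q (v * 1)"
        by (simp only: crit_pow_mult right_diff_distrib)
      moreover have "v * (u / v + 1) = u + v" using False by (simp add: field_simps)
      ultimately show ?thesis
        by (metis abs_crit_pow abs_mult mult.commute mult_1_right)
    qed (use uv in simp)
  qed (use d in auto)
qed

lemma brezis_lieb_pointwise:
  assumes q: "q > 2" and e: "e > 0"
  shows "\<exists>C\<ge>0. \<forall>u v. \<bar>crit_pow q (u + v) * v - \<bar>v\<bar> powr q\<bar> \<le> e * \<bar>v\<bar> powr q + C * \<bar>u\<bar> powr q"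
proof -
  obtain \<eta> where \<eta>: "\<eta> > 0" "\<eta> \<le> 1" "\<And>u v. \<bar>u\<bar> \<le> \<eta> * \<bar>v\<bar> \<Longrightarrow> \<bar>crit_pow q (u + v) - crit_pow q v\<bar> \<le> e * \<bar>v\<bar> powr (q - 1)"
    using crit_pow_near_one[OF q e] by blast
  define C where "C = 2 * (1 + 1 / \<eta>) powr q"
  have C: "C \<ge> 0" by (simp add: C_def)
  have "\<bar>crit_pow q (u + v) * v - \<bar>v\<bar> powr q\<bar> \<le> e * \<bar>v\<bar> powr q + C * \<bar>u\<bar> powr q" for u v
  proof (cases "\<bar>u\<bar> \<le> \<eta> * \<bar>v\<bar>")
    case True
    have "\<bar>crit_pow q (u + v) * v - \<bar>v\<bar> powr q\<bar> = \<bar>crit_pow q (u + v) - crit_pow q v\<bar> * \<bar>v\<bar>"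
      by (simp add: crit_pow_mult_self[symmetric] left_diff_distrib[symmetric] abs_mult)
    also have "\<dots> \<le> e * \<bar>v\<bar> powr (q - 1) * \<bar>v\<bar>" using \<eta>(3)[OF True] by (intro mult_right_mono) auto
    also have "\<dots> = e * \<bar>v\<bar> powr q" using powr_add[of "\<bar>v\<bar>" "q - 1" 1] by (cases "v = 0") simp_all
    also have "\<dots> \<le> e * \<bar>v\<bar> powr q + C * \<bar>u\<bar> powr q" using C by simp
    finally show ?thesis .
  next
    case False
    \<comment> \<open>Here \<open>|v| \<le> |u| / \<eta>\<close>, so this multiple of
      \<open>|u|\<close> bounds both \<open>|u + v|\<close> and \<open>|v|\<close>.\<close>
    define T where "T = (1 + 1 / \<eta>) * \<bar>u\<bar>"
    have "\<bar>v\<bar> \<le> (1 / \<eta>) * \<bar>u\<bar>" using False \<eta>(1) by (simp add: field_simps)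
    then have T: "\<bar>u + v\<bar> \<le> T" "\<bar>v\<bar> \<le> T" "0 \<le> T" using \<eta>(1) by (auto simp: T_def algebra_simps)
    have Tq: "T powr (q - 1) * T = T powr q" using T(3) powr_add[of T "q - 1" 1] by (cases "T = 0") simp_all
    have "\<bar>crit_pow q (u + v) * v\<bar> \<le> T powr (q - 1) * T"
      unfolding abs_mult abs_crit_pow using T q by (intro mult_mono powr_mono2) auto
    moreover have "\<bar>v\<bar> powr q \<le> T powr q" using T q by (intro powr_mono2) auto
    moreover have "0 \<le> \<bar>v\<bar> powr q" by simp
    ultimately have "\<bar>crit_pow q (u + v) * v - \<bar>v\<bar> powr q\<bar> \<le> 2 * T powr q" unfolding Tq by linarith
    also have "2 * T powr q = C * \<bar>u\<bar> powr q" using \<eta>(1) by (simp add: T_def C_def powr_mult)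
    finally show ?thesis using e by (simp add: add_increasing)
  qed
  then show ?thesis using C by blast
qed

lemma crit_pow_diff_pointwise:
  assumes q: "q > 2" and e: "e > 0"
  shows "\<exists>C\<ge>0. \<forall>u v. \<bar>crit_pow q (u + v) - crit_pow q v\<bar> powr (q / (q - 1)) \<le> e * \<bar>v\<bar> powr q + C * \<bar>u\<bar> powr q"
proof -
  define s where "s = q / (q - 1)"
  have s: "s > 0" "(q - 1) * s = q" using q by (auto simp: s_def)
  \<comment> \<open>The tolerance is \<open>e powr (1 / s)\<close> because it is raised to the
    conjugate exponent \<open>s\<close> afterwards.\<close>
  obtain \<eta> where \<eta>: "\<eta> > 0" "\<eta> \<le> 1" "\<And>u v. \<bar>u\<bar> \<le> \<eta> * \<bar>v\<bar> \<Longrightarrow> \<bar>crit_pow q (u + v) - crit_pow q v\<bar> \<le> e powr (1 / s) * \<bar>v\<bar> powr (q - 1)"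
    using crit_pow_near_one[OF q, of "e powr (1 / s)"] e by auto
  define C where "C = 2 powr s * (1 + 1 / \<eta>) powr q"
  have C: "C \<ge> 0" by (simp add: C_def)
  have "\<bar>crit_pow q (u + v) - crit_pow q v\<bar> powr s \<le> e * \<bar>v\<bar> powr q + C * \<bar>u\<bar> powr q" for u v
  proof (cases "\<bar>u\<bar> \<le> \<eta> * \<bar>v\<bar>")
    case True
    have "\<bar>crit_pow q (u + v) - crit_pow q v\<bar> powr s \<le> (e powr (1 / s) * \<bar>v\<bar> powr (q - 1)) powr s"
      using \<eta>(3)[OF True] s by (intro powr_mono2) auto
    also have "\<dots> = e * \<bar>v\<bar> powr q" using e s by (simp add: powr_mult powr_powr)
    also have "\<dots> \<le> e * \<bar>v\<bar> powr q + C * \<bar>u\<bar> powr q" using C by simp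
    finally show ?thesis .
  next
    case False
    define T where "T = (1 + 1 / \<eta>) * \<bar>u\<bar>"
    have "\<bar>v\<bar> \<le> (1 / \<eta>) * \<bar>u\<bar>" using False \<eta>(1) by (simp add: field_simps)
    then have T: "\<bar>u + v\<bar> \<le> T" "\<bar>v\<bar> \<le> T" "0 \<le> T" using \<eta>(1) by (auto simp: T_def algebra_simps)
    have "\<bar>crit_pow q (u + v)\<bar> \<le> T powr (q - 1)" "\<bar>crit_pow q v\<bar> \<le> T powr (q - 1)"
      unfolding abs_crit_pow using T q by (auto intro!: powr_mono2)
    then have "\<bar>crit_pow q (u + v) - crit_pow q v\<bar> \<le> 2 * T powr (q - 1)" by linarith
    then have "\<bar>crit_pow q (u + v) - crit_pow q v\<bar> powr s \<le> (2 * T powr (q - 1)) powr s"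
      using s by (intro powr_mono2) auto
    also have "\<dots> = C * \<bar>u\<bar> powr q"
      using \<eta>(1) s by (simp add: T_def C_def powr_mult powr_powr)
    finally show ?thesis using e by (simp add: add_increasing)
  qed
  then show ?thesis using C unfolding s_def by blast
qed

lemma powr_le_eps_powr:
  fixes s m \<eta> :: real
  assumes "0 \<le> s" "s < m" "\<eta> > 0"
  shows "\<exists>C\<ge>0. \<forall>t\<ge>0. t powr s \<le> \<eta> * t powr m + C"
proof -
  \<comment> \<open>The height at which \<open>\<eta> * t powr m\<close> overtakes
    \<open>t powr s\<close>.\<close>
  define T where "T = (1 / \<eta>) powr (1 / (m - s))"
  have T: "T > 0" "T powr (m - s) = 1 / \<eta>" using assms by (auto simp: T_def powr_powr)
  have "t powr s \<le> \<eta> * t powr m + T powr s" if t: "t \<ge> 0" for t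
  proof (cases "t \<le> T")
    case True
    then have "t powr s \<le> T powr s" using t assms by (intro powr_mono2) auto
    then show ?thesis using assms by (simp add: add_increasing)
  next
    case False
    then have "1 / \<eta> \<le> t powr (m - s)" unfolding T(2)[symmetric] using T assms by (intro powr_mono2) auto
    then have "1 \<le> \<eta> * t powr (m - s)" using assms by (simp add: field_simps)
    then have "t powr s * 1 \<le> t powr s * (\<eta> * t powr (m - s))" by (intro mult_left_mono) auto
    also have "\<dots> = \<eta> * t powr m" using powr_add[of t s "m - s"] by (simp add: mult_ac)
    finally show ?thesis by (simp add: add_increasing2)
  qed
  then show ?thesis by (intro exI[of _ "T powr s"]) auto
qed

text \<open>The larger one of \<open>|x|\<close> and \<open>\<eta> * |y| powr (q - 1)\<close>
  decides which of the two terms takes the product.\<close>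

lemma young_eps:
  fixes q \<eta> :: real
  assumes "q > 1" "\<eta> > 0"
  shows "\<exists>C\<ge>0. \<forall>x y. \<bar>x * y\<bar> \<le> \<eta> * \<bar>y\<bar> powr q + C * \<bar>x\<bar> powr (q / (q - 1))"
proof -
  define C where "C = (1 / \<eta>) powr (1 / (q - 1))"
  have C: "C \<ge> 0" by (simp add: C_def)
  have "\<bar>x * y\<bar> \<le> \<eta> * \<bar>y\<bar> powr q + C * \<bar>x\<bar> powr (q / (q - 1))" for x y
  proof (cases "\<bar>x\<bar> \<le> \<eta> * \<bar>y\<bar> powr (q - 1)")
    case True
    then have "\<bar>x * y\<bar> \<le> \<eta> * \<bar>y\<bar> powr (q - 1) * \<bar>y\<bar>" unfolding abs_mult by (intro mult_right_mono) auto
    also have "\<dots> = \<eta> * \<bar>y\<bar> powr q" using powr_add[of "\<bar>y\<bar>" "q - 1" 1] by (cases "y = 0") simp_all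
    finally show ?thesis using C by (simp add: add_increasing2)
  next
    case False
    then have "\<bar>y\<bar> powr (q - 1) \<le> \<bar>x\<bar> / \<eta>" using assms by (simp add: field_simps)
    then have "(\<bar>y\<bar> powr (q - 1)) powr (1 / (q - 1)) \<le> (\<bar>x\<bar> / \<eta>) powr (1 / (q - 1))"
      using assms by (intro powr_mono2) auto
    then have "\<bar>y\<bar> \<le> C * \<bar>x\<bar> powr (1 / (q - 1))"
      using assms powr_mult[of "1 / \<eta>" "\<bar>x\<bar>" "1 / (q - 1)"] by (simp add: C_def powr_powr)
    then have "\<bar>x * y\<bar> \<le> \<bar>x\<bar> * (C * \<bar>x\<bar> powr (1 / (q - 1)))"
      unfolding abs_mult by (intro mult_left_mono) auto
    also have "\<dots> = C * \<bar>x\<bar> powr (q / (q - 1))"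
    proof -
      have "q / (q - 1) = 1 + 1 / (q - 1)" using assms by (simp add: field_simps)
      then show ?thesis using powr_add[of "\<bar>x\<bar>" 1 "1 / (q - 1)"] by (cases "x = 0") simp_all
    qed
    finally show ?thesis using assms by (simp add: add_increasing)
  qed
  then show ?thesis using C by blast
qed

lemma powr_add_le:
  fixes q :: real
  assumes "q > 0" "x \<ge> 0" "y \<ge> 0"
  shows "(x + y) powr q \<le> 2 powr q * (x powr q + y powr q)"
proof -
  have "(x + y) powr q \<le> (2 * max x y) powr q" using assms by (intro powr_mono2) auto
  also have "\<dots> = 2 powr q * max x y powr q" using assms by (simp add: powr_mult)
  also have "max x y powr q \<le> x powr q + y powr q" by (simp add: max_def)
  finally show ?thesis by simp
qed

text \<open>With \<open>R = max T S\<close> the product is at most \<open>R + R powr q\<close>, and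
  \<open>R \<le> 1 + R powr q\<close>.\<close>

lemma growth_times_le:
  fixes q :: real
  assumes "q > 1" "T \<ge> 0" "S \<ge> 0"
  shows "(1 + T powr (q - 1)) * S \<le> 1 + 2 * (T powr q + S powr q)"
proof -
  define R where "R = max T S"
  have R: "R \<ge> 0" "T \<le> R" "S \<le> R" using assms by (auto simp: R_def)
  have RR: "R powr (q - 1) * R = R powr q" using R(1) powr_add[of R "q - 1" 1] by (cases "R = 0") simp_all
  have "(1 + T powr (q - 1)) * S \<le> (1 + R powr (q - 1)) * R"
    using R assms by (intro mult_mono add_left_mono powr_mono2) auto
  also have "\<dots> = R + R powr q" by (simp add: distrib_right RR)
  finally have "(1 + T powr (q - 1)) * S \<le> R + R powr q" .
  moreover have "R \<le> 1 + R powr q"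
  proof (cases "R \<le> 1")
    case False
    then have "R powr 1 \<le> R powr q" using assms by (intro powr_mono) auto
    then show ?thesis using R by simp
  qed (simp add: add_increasing2)
  moreover have "R powr q \<le> T powr q + S powr q" by (simp add: R_def max_def)
  ultimately have "R + R powr q \<le> 1 + 2 * (T powr q + S powr q)" by argo
  with \<open>_ \<le> R + R powr q\<close> show ?thesis by (rule order.trans)
qed

text \<open>Vitali's convergence theorem and the Brezis--Lieb lemma are both instances of this statement.\<close>

lemma integral_tendsto_0_eps_dominated:
  fixes h Y :: "nat \<Rightarrow> 'x \<Rightarrow> real"
  assumes h: "\<And>n. h n \<in> borel_measurable M" "\<And>n x. 0 \<le> h n x"
    and lim: "AE x in M. (\<lambda>n. h n x) \<longlonglongrightarrow> 0"
    and Y: "\<And>n. integrable M (Y n)" "\<And>n x. 0 \<le> Y n x" "\<And>n. (LINT x|M. Y n x) \<le> B"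
    and dom: "\<And>e. e > 0 \<Longrightarrow> \<exists>W. integrable M W \<and> (\<forall>n. AE x in M. h n x \<le> e * Y n x + W x)"
  shows "(\<lambda>n. LINT x|M. h n x) \<longlonglongrightarrow> 0"
proof -
  have B: "B \<ge> 0" using Y(3)[of 0] by (rule order.trans[rotated]) (intro integral_nonneg_AE AE_I2 Y)
  have Ym [measurable]: "Y n \<in> borel_measurable M" for n using Y(1) by auto
  note h(1) [measurable]
  have "\<exists>N. \<forall>n\<ge>N. (LINT x|M. h n x) < e" if e: "e > 0" for e
  proof -
    define d where "d = e / (2 * (B + 1))"
    have d: "d > 0" using e B by (simp add: d_def)
    have "e * B < e * (2 * (B + 1))" using e B by (intro mult_strict_left_mono) auto
    then have dB: "d * B < e" using B by (simp add: d_def pos_divide_less_eq)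
    obtain W where W: "integrable M W" "\<And>n. AE x in M. h n x \<le> d * Y n x + W x" using dom[OF d] by blast
    \<comment> \<open>The excess of \<open>h\<close> over \<open>d * Y\<close> is dominated by
      \<open>|W|\<close> and tends to \<open>0\<close> almost everywhere, so its integrals tend to
      \<open>0\<close>; the remainder is at most \<open>d * B < e\<close>.\<close>
    define g where "g n x = max 0 (h n x - d * Y n x)" for n x
    have gm [measurable]: "g n \<in> borel_measurable M" for n unfolding g_def by measurable
    have gW: "AE x in M. norm (g n x) \<le> \<bar>W x\<bar>" for n
      using W(2)[of n] by eventually_elim (auto simp: g_def)
    have gi: "integrable M (g n)" for n
    proof (rule Bochner_Integration.integrable_bound)
      show "integrable M (\<lambda>x. \<bar>W x\<bar>)" using W(1) by (rule integrable_abs)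
      show "AE x in M. norm (g n x) \<le> norm \<bar>W x\<bar>" using gW[of n] by simp
    qed (rule gm)
    have "(\<lambda>n. LINT x|M. g n x) \<longlonglongrightarrow> (LINT x|M. 0)"
    proof (rule integral_dominated_convergence[where w="\<lambda>x. \<bar>W x\<bar>"])
      show "AE x in M. (\<lambda>n. g n x) \<longlonglongrightarrow> 0"
        using lim
      proof eventually_elim
        case (elim x)
        have "0 \<le> d * Y n x" for n using d Y(2) by simp
        then have "norm (g n x) \<le> norm (h n x)" for n using h(2)[of n x] by (auto simp: g_def)
        then show ?case by (intro Lim_null_comparison[OF _ tendsto_norm_zero[OF elim]]) (auto intro: always_eventually)
      qed
    qed (use gW W(1) in auto)
    then have "(\<lambda>n. (LINT x|M. g n x) + d * B) \<longlonglongrightarrow> 0 + d * B" by (intro tendsto_intros) simp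
    then have ev: "\<forall>\<^sub>F n in sequentially. (LINT x|M. g n x) + d * B < e"
      using dB by (intro order_tendstoD(2)[where a=e]) auto
    have le: "(LINT x|M. h n x) \<le> (LINT x|M. g n x) + d * B" for n
    proof -
      have "(LINT x|M. h n x) \<le> (LINT x|M. g n x + d * Y n x)"
      proof (rule integral_mono_AE')
        show "integrable M (\<lambda>x. g n x + d * Y n x)" using gi Y(1) by auto
        show "AE x in M. h n x \<le> g n x + d * Y n x" by (intro AE_I2) (auto simp: g_def)
        show "AE x in M. 0 \<le> g n x + d * Y n x" using Y(2) d by (intro AE_I2) (auto simp: g_def)
      qed
      also have "\<dots> = (LINT x|M. g n x) + d * (LINT x|M. Y n x)" using gi Y(1) by simp
      also have "\<dots> \<le> (LINT x|M. g n x) + d * B" using d Y(3) by simp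
      finally show ?thesis .
    qed
    have "\<forall>\<^sub>F n in sequentially. (LINT x|M. h n x) < e"
      by (rule eventually_mono[OF ev]) (rule le_less_trans[OF le])
    then show ?thesis by (simp add: eventually_sequentially)
  qed
  moreover have "0 \<le> (LINT x|M. h n x)" for n by (intro integral_nonneg_AE AE_I2 h)
  ultimately show ?thesis by (intro LIMSEQ_I) (simp add: real_norm_def)
qed

text \<open>Rounding \<open>u\<close> down to multiples of \<open>1 / (n + 1)\<close> leaves
  countably many values, so the composition with \<open>k\<close> is measurable piece by piece;
  continuity in the second argument passes this to the limit.\<close>

lemma caratheodory_measurable:
  fixes k :: "'x \<Rightarrow> real \<Rightarrow> real"
  assumes k: "\<And>t. (\<lambda>x. k x t) \<in> borel_measurable M" "\<And>x. x \<in> space M \<Longrightarrow> continuous_on UNIV (k x)"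
    and u: "u \<in> borel_measurable M"
  shows "(\<lambda>x. k x (u x)) \<in> borel_measurable M"
proof (rule borel_measurable_LIMSEQ_real)
  define v where "v n x = real_of_int \<lfloor>u x * real (Suc n)\<rfloor> / real (Suc n)" for n x
  have v_near: "\<bar>v n x - u x\<bar> \<le> 1 / real (Suc n)" for n x
  proof -
    have "\<bar>real_of_int \<lfloor>u x * real (Suc n)\<rfloor> - u x * real (Suc n)\<bar> \<le> 1" by linarith
    then have "\<bar>real_of_int \<lfloor>u x * real (Suc n)\<rfloor> - u x * real (Suc n)\<bar> / real (Suc n) \<le> 1 / real (Suc n)"
      by (intro divide_right_mono) auto
    moreover have "\<bar>real_of_int \<lfloor>u x * real (Suc n)\<rfloor> - u x * real (Suc n)\<bar> / real (Suc n) = \<bar>v n x - u x\<bar>"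
      by (simp add: v_def field_simps flip: abs_divide)
    ultimately show ?thesis by simp
  qed
  have lim: "(\<lambda>n. v n x) \<longlonglongrightarrow> u x" for x
    by (rule LIM_zero_cancel, rule Lim_null_comparison[OF _ LIMSEQ_inverse_real_of_nat])
      (use v_near in \<open>auto simp: inverse_eq_divide\<close>)
  show "(\<lambda>n. k x (v n x)) \<longlonglongrightarrow> k x (u x)" if "x \<in> space M" for x
    using continuous_on_tendsto_compose[OF k(2)[OF that] lim] by auto
  show "(\<lambda>x. k x (v n x)) \<in> borel_measurable M" for n
  proof -
    have i: "(\<lambda>x. \<lfloor>u x * real (Suc n)\<rfloor>) \<in> measurable M (count_space UNIV)" using u by measurable
    show ?thesis unfolding v_def
      by (rule measurable_compose_countable[OF _ i, where f="\<lambda>j x. k x (real_of_int j / real (Suc n))"]) (rule k(1))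
  qed
qed

text \<open>Weak convergence of pairs, strong convergence of the functions and pointwise convergence
  are needed along one and the same subsequence.\<close>

lemma (in bounded_domain) h01_weak_AE_subseq:
  assumes U: "\<And>n. U n \<in> h01 \<Omega>" "\<And>n. norm (U n) \<le> R"
  shows "\<exists>r Z. strict_mono (r :: nat \<Rightarrow> nat) \<and> Z \<in> h01 \<Omega> \<and> (\<forall>z. (\<lambda>n. U (r n) \<bullet> z) \<longlonglongrightarrow> Z \<bullet> z) \<and>
    (\<lambda>n. snd (U (r n))) \<longlonglongrightarrow> snd Z \<and>
    (AE x in lebesgue. (\<lambda>n. rep_l2 (snd (U (r n))) x) \<longlonglongrightarrow> rep_l2 (snd Z) x)"
proof -
  obtain r Z where r: "strict_mono (r :: nat \<Rightarrow> nat)" and Z: "Z \<in> h01 \<Omega>"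
    and w: "\<And>z. (\<lambda>n. U (r n) \<bullet> z) \<longlonglongrightarrow> Z \<bullet> z"
    using bounded_imp_weakly_convergent_subseq[of "h01 \<Omega>" U R, OF subspace_h01 closed_h01 U] by blast
  have s: "(\<lambda>n. snd (U (r n))) \<longlonglongrightarrow> snd Z"
    by (rule rellich_h01[of "\<lambda>n. U (r n)" R Z, OF U(1) U(2) Z w])
  then obtain r' where r': "strict_mono r'"
    "AE x in lebesgue. (\<lambda>n. rep_l2 (snd (U (r (r' n)))) x) \<longlonglongrightarrow> rep_l2 (snd Z) x"
    using l2_convergent_AE_subseq[OF s] by blast
  show ?thesis
  proof (intro exI[of _ "r \<circ> r'"] exI[of _ Z] conjI allI)
    show "strict_mono (r \<circ> r')" using r r'(1) by (rule strict_mono_o)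
    show "(\<lambda>n. U ((r \<circ> r') n) \<bullet> z) \<longlonglongrightarrow> Z \<bullet> z" for z
      using LIMSEQ_subseq_LIMSEQ[OF w[of z] r'(1)] by (simp add: o_def)
    show "(\<lambda>n. snd (U ((r \<circ> r') n))) \<longlonglongrightarrow> snd Z"
      using LIMSEQ_subseq_LIMSEQ[OF s r'(1)] by (simp add: o_def)
  qed (use Z r'(2) in auto)
qed

lemma h01_add_scaleR: "U \<in> h01 \<Omega> \<Longrightarrow> Z \<in> h01 \<Omega> \<Longrightarrow> U + t *\<^sub>R Z \<in> h01 \<Omega>"
  by (intro subspace_add[OF subspace_h01] subspace_scale[OF subspace_h01])

text \<open>For estimates in which an \<epsilon>-version of Young's inequality leaves a small
  multiple of a bounded quantity and a large multiple of a vanishing one.\<close>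

lemma tendsto_0_eps_bound:
  fixes c d :: "nat \<Rightarrow> real"
  assumes c: "\<And>n. 0 \<le> c n" and d: "d \<longlonglongrightarrow> 0" and B: "B \<ge> 0"
    and est: "\<And>e. e > 0 \<Longrightarrow> \<exists>C. \<forall>n. c n \<le> e * B + C * d n"
  shows "c \<longlonglongrightarrow> 0"
proof (rule LIMSEQ_I)
  fix r :: real assume r: "r > 0"
  define e where "e = r / (2 * (B + 1))"
  have e: "e > 0" using r B by (simp add: e_def)
  have "r * B < r * (2 * (B + 1))" using r B by (intro mult_strict_left_mono) auto
  then have eB: "e * B < r" using B by (simp add: e_def pos_divide_less_eq)
  obtain C where C: "\<And>n. c n \<le> e * B + C * d n" using est[OF e] by blast
  have "(\<lambda>n. e * B + C * d n) \<longlonglongrightarrow> e * B + C * 0" by (intro tendsto_intros d)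
  then have "\<forall>\<^sub>F n in sequentially. e * B + C * d n < r" using eB by (intro order_tendstoD(2)) auto
  then have "\<forall>\<^sub>F n in sequentially. c n < r"
    by (rule eventually_mono) (rule le_less_trans[OF C])
  then show "\<exists>no. \<forall>n\<ge>no. norm (c n - 0) < r" using c by (simp add: eventually_sequentially)
qed

lemma (in bounded_domain) h01_powr_crit_int:
  assumes dim: "DIM('a) \<ge> 3" and U: "U \<in> h01 \<Omega>"
  shows "integrable (lebesgue_on \<Omega>) (\<lambda>x. \<bar>rep_l2 (snd U) x\<bar> powr crit_exp DIM('a))"
proof -
  have "integrable lebesgue (\<lambda>x. \<bar>rep_l2 (snd U) x\<bar> powr crit_exp DIM('a))"
    using sobolev_h01[OF dim] U by blast
  then have "integrable lebesgue (\<lambda>x. indicator \<Omega> x *\<^sub>R \<bar>rep_l2 (snd U) x\<bar> powr crit_exp DIM('a))"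
    by (rule integrable_mult_indicator[rotated]) simp
  then show ?thesis by (subst integrable_restrict_space) simp_all
qed

section \<open>The energy functional\<close>

text \<open>\<open>\<sigma>\<close> is a constant in Sobolev's inequality, and \<open>K\<close> is a primitive of the subcritical
  part \<open>k\<close> of the nonlinearity.\<close>

locale kirchhoff = bounded_domain \<Omega> for \<Omega> :: "'a::euclidean_space set" +
  fixes a b q \<sigma> m A :: real and k K :: "'a \<Rightarrow> real \<Rightarrow> real"
  assumes q: "q = crit_exp DIM('a)" "q > 2" and dim: "DIM('a) \<ge> 3"
    and ab: "a > 0" "b > 0" and \<sigma>: "\<sigma> \<ge> 0"
    and sobolev: "\<And>U. U \<in> h01 \<Omega> \<Longrightarrow> (LINT x|lebesgue_on \<Omega>. \<bar>rep_l2 (snd U) x\<bar> powr q) \<le> \<sigma> * norm (fst U) powr q"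
    and m: "1 < m" "m < q" and A: "A \<ge> 0"
    and k_meas: "\<And>t. (\<lambda>x. k x t) \<in> borel_measurable (lebesgue_on \<Omega>)"
    and k_cont: "\<And>x. x \<in> \<Omega> \<Longrightarrow> continuous_on UNIV (k x)"
    and k_bound: "\<And>x t. x \<in> \<Omega> \<Longrightarrow> \<bar>k x t\<bar> \<le> A * (1 + \<bar>t\<bar> powr (m - 1))"
    and K_meas: "\<And>t. (\<lambda>x. K x t) \<in> borel_measurable (lebesgue_on \<Omega>)"
    and K_deriv: "\<And>x t. x \<in> \<Omega> \<Longrightarrow> (K x has_real_derivative k x t) (at t)"
    and K_0: "\<And>x. x \<in> \<Omega> \<Longrightarrow> K x 0 = 0"
begin

abbreviation M :: "'a measure" where "M \<equiv> lebesgue_on \<Omega>"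

abbreviation fn :: "'a h1 \<Rightarrow> 'a \<Rightarrow> real" where "fn U \<equiv> rep_l2 (snd U)"

lemma finite_M: "finite_measure M"
  using bounded_\<Omega> open_\<Omega> by (intro finite_measure_lebesgue_on) (simp add: bounded_set_imp_lmeasurable)

lemma const_int [simp]: "integrable M (\<lambda>x. c :: real)"
  by (rule finite_measure.integrable_const[OF finite_M])

lemma fn_meas [measurable, simp]: "fn U \<in> borel_measurable M"
  by (intro measurable_restrict_space1) simp

lemma fn_int: "U \<in> h01 \<Omega> \<Longrightarrow> integrable M (\<lambda>x. \<bar>fn U x\<bar> powr q)"
  unfolding q(1) by (rule h01_powr_crit_int[OF dim])

lemma AE_M:
  assumes "AE x in lebesgue. P x"
  shows "AE x in M. P x"
  unfolding AE_\<Omega> using assms by (rule eventually_mono) simp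

lemma fn_add: "AE x in M. fn (U + t *\<^sub>R Z) x = fn U x + t * fn Z x"
proof (rule AE_M)
  show "AE x in lebesgue. fn (U + t *\<^sub>R Z) x = fn U x + t * fn Z x"
    using rep_l2_add[of "snd U" "t *\<^sub>R snd Z"] rep_l2_scaleR[of t "snd Z"]
    by eventually_elim simp
qed

lemma fn_diff: "AE x in M. fn (U - Z) x = fn U x - fn Z x"
  using fn_add[of U "-1" Z] by simp

lemma norm_fst: "norm (fst U) \<le> norm (U :: 'a h1)"
  using norm_fst_le[of "fst U" "snd U"] by simp

lemma norm_equiv: "\<exists>P>0. \<forall>U\<in>h01 \<Omega>. norm U \<le> P * norm (fst U)"
proof -
  obtain P where P: "P > 0" "\<And>U. U \<in> h01 \<Omega> \<Longrightarrow> norm (snd U) \<le> P * norm (fst U)"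
    using poincare_h01[OF bounded_\<Omega>] by blast
  have "norm U \<le> (1 + P) * norm (fst U)" if "U \<in> h01 \<Omega>" for U
    using norm_Pair_le[of "fst U" "snd U"] P(2)[OF that] by (simp add: distrib_right)
  then show ?thesis using P(1) by (intro exI[of _ "1 + P"]) auto
qed

definition f :: "'a \<Rightarrow> real \<Rightarrow> real" where "f x t = crit_pow q t + k x t"
definition F :: "'a \<Rightarrow> real \<Rightarrow> real" where "F x t = \<bar>t\<bar> powr q / q + K x t"
text \<open>\<open>1\<close> accounts for the critical power and \<open>2 * A\<close> for the
  subcritical part, whose power \<open>m - 1\<close> is at most \<open>1\<close> plus the power
  \<open>q - 1\<close>.\<close>

definition B :: real where "B = 1 + 2 * A"

lemma B: "B > 0" using A by (simp add: B_def)

lemma f_deriv: "x \<in> \<Omega> \<Longrightarrow> (F x has_real_derivative f x t) (at t)"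
  unfolding F_def[abs_def] f_def by (intro DERIV_add crit_pow_primitive q K_deriv)

lemma f_bound: 
  assumes "x \<in> \<Omega>"
  shows "\<bar>f x t\<bar> \<le> B * (1 + \<bar>t\<bar> powr (q - 1))"
proof -
  have "\<bar>t\<bar> powr (m - 1) \<le> 1 + \<bar>t\<bar> powr (q - 1)"
  proof (cases "\<bar>t\<bar> \<le> 1")
    case True
    then have "\<bar>t\<bar> powr (m - 1) \<le> 1 powr (m - 1)" using m by (intro powr_mono2) auto
    then show ?thesis by (simp add: add_increasing2)
  next
    case False
    then have "\<bar>t\<bar> powr (m - 1) \<le> \<bar>t\<bar> powr (q - 1)" using m by (intro powr_mono) auto
    then show ?thesis by simp
  qed
  then have "A * (1 + \<bar>t\<bar> powr (m - 1)) \<le> A * (2 + \<bar>t\<bar> powr (q - 1))"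
    using A by (intro mult_left_mono) auto
  then have "\<bar>f x t\<bar> \<le> \<bar>t\<bar> powr (q - 1) + A * (2 + \<bar>t\<bar> powr (q - 1))"
    using k_bound[OF assms, of t] abs_crit_pow[of q t] unfolding f_def by linarith
  also have "\<dots> \<le> B * (1 + \<bar>t\<bar> powr (q - 1))" using A by (simp add: B_def algebra_simps)
  finally show ?thesis .
qed

lemma f_meas: "u \<in> borel_measurable M \<Longrightarrow> (\<lambda>x. f x (u x)) \<in> borel_measurable M"
  unfolding f_def
proof (intro borel_measurable_add)
  assume u: "u \<in> borel_measurable M"
  show "(\<lambda>x. crit_pow q (u x)) \<in> borel_measurable M"
    using measurable_compose[OF u borel_measurable_continuous_onI[OF continuous_crit_pow[OF q(2)]]] .
  show "(\<lambda>x. k x (u x)) \<in> borel_measurable M"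
    by (rule caratheodory_measurable[where k=k, OF k_meas _ u]) (simp add: k_cont)
qed

lemma k_meas': "u \<in> borel_measurable M \<Longrightarrow> (\<lambda>x. k x (u x)) \<in> borel_measurable M"
  by (rule caratheodory_measurable[where k=k, OF k_meas]) (simp_all add: k_cont)

lemma K_cont: "x \<in> \<Omega> \<Longrightarrow> continuous_on UNIV (K x)"
  using K_deriv by (intro DERIV_continuous_on) (auto intro: has_field_derivative_at_within)

lemma F_meas: "u \<in> borel_measurable M \<Longrightarrow> (\<lambda>x. F x (u x)) \<in> borel_measurable M"
  unfolding F_def
proof (intro borel_measurable_add)
  assume u: "u \<in> borel_measurable M"
  show "(\<lambda>x. \<bar>u x\<bar> powr q / q) \<in> borel_measurable M" using u by measurable
  show "(\<lambda>x. K x (u x)) \<in> borel_measurable M"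
    by (rule caratheodory_measurable[where k=K, OF K_meas _ u]) (simp add: K_cont)
qed

text \<open>The majorant uses an upper bound \<open>T\<close> of \<open>|t|\<close>, so that it also
  applies at the unknown intermediate points of the mean value theorem.\<close>

lemma f_times:
  assumes "x \<in> \<Omega>" "\<bar>t\<bar> \<le> T"
  shows "\<bar>f x t * s\<bar> \<le> B * (1 + 2 * (T powr q + \<bar>s\<bar> powr q))"
proof -
  have "\<bar>f x t * s\<bar> \<le> B * (1 + \<bar>t\<bar> powr (q - 1)) * \<bar>s\<bar>"
    unfolding abs_mult by (intro mult_right_mono f_bound assms) auto
  also have "\<dots> \<le> B * ((1 + T powr (q - 1)) * \<bar>s\<bar>)"
    unfolding mult.assoc using assms q B
    by (intro mult_left_mono mult_right_mono add_left_mono powr_mono2) auto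
  also have "\<dots> \<le> B * (1 + 2 * (T powr q + \<bar>s\<bar> powr q))"
    using assms q B by (intro mult_left_mono growth_times_le) auto
  finally show ?thesis .
qed

lemma F_increment:
  assumes "x \<in> \<Omega>"
  shows "\<exists>\<xi>. \<bar>\<xi>\<bar> \<le> \<bar>t\<bar> + \<bar>s\<bar> \<and> F x (t + s) - F x t = f x \<xi> * s"
proof -
  have "\<exists>\<theta>. 0 < \<theta> \<and> \<theta> < 1 \<and> F x (t + 1 * s) - F x (t + 0 * s) = (1 - 0) * (f x (t + \<theta> * s) * s)"
  proof (intro MVT2)
    fix \<theta> :: real
    show "((\<lambda>\<theta>. F x (t + \<theta> * s)) has_real_derivative f x (t + \<theta> * s) * s) (at \<theta>)"
      by (rule DERIV_chain2[OF f_deriv[OF assms]]) (auto intro!: derivative_eq_intros)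
  qed simp
  then obtain \<theta> where \<theta>: "0 < \<theta>" "\<theta> < 1" "F x (t + s) - F x t = f x (t + \<theta> * s) * s" by auto
  have "\<bar>\<theta> * s\<bar> \<le> \<bar>s\<bar>" using \<theta> by (simp add: abs_mult mult_left_le_one_le)
  then have "\<bar>t + \<theta> * s\<bar> \<le> \<bar>t\<bar> + \<bar>s\<bar>" by linarith
  then show ?thesis using \<theta>(3) by blast
qed

lemma F_bound:
  assumes "x \<in> \<Omega>"
  shows "\<bar>F x t\<bar> \<le> B * (1 + 4 * \<bar>t\<bar> powr q)"
proof -
  obtain \<xi> where \<xi>: "\<bar>\<xi>\<bar> \<le> \<bar>t\<bar>" "F x t - F x 0 = f x \<xi> * t" using F_increment[OF assms, of 0 t] by auto
  have "F x 0 = 0" using K_0[OF assms] by (simp add: F_def)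
  then show ?thesis using f_times[OF assms \<xi>(1), of t] \<xi>(2) by simp
qed

lemma f_int:
  assumes "U \<in> h01 \<Omega>" "Z \<in> h01 \<Omega>"
  shows "integrable M (\<lambda>x. f x (fn U x) * fn Z x)"
proof (rule Bochner_Integration.integrable_bound)
  show "integrable M (\<lambda>x. B * (1 + 2 * (\<bar>fn U x\<bar> powr q + \<bar>fn Z x\<bar> powr q)))"
    using fn_int[OF assms(1)] fn_int[OF assms(2)] by simp
  show "(\<lambda>x. f x (fn U x) * fn Z x) \<in> borel_measurable M"
    by (intro borel_measurable_times f_meas) auto
  show "AE x in M. norm (f x (fn U x) * fn Z x) \<le> norm (B * (1 + 2 * (\<bar>fn U x\<bar> powr q + \<bar>fn Z x\<bar> powr q)))"
  proof (rule AE_I2)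
    fix x assume "x \<in> space M"
    then have "\<bar>f x (fn U x) * fn Z x\<bar> \<le> B * (1 + 2 * (\<bar>fn U x\<bar> powr q + \<bar>fn Z x\<bar> powr q))" by (intro f_times) auto
    then show "norm (f x (fn U x) * fn Z x) \<le> norm (B * (1 + 2 * (\<bar>fn U x\<bar> powr q + \<bar>fn Z x\<bar> powr q)))"
      unfolding real_norm_def by linarith
  qed
qed

lemma F_int:
  assumes "U \<in> h01 \<Omega>"
  shows "integrable M (\<lambda>x. F x (fn U x))"
proof (rule Bochner_Integration.integrable_bound)
  show "integrable M (\<lambda>x. B * (1 + 4 * \<bar>fn U x\<bar> powr q))" using fn_int[OF assms] by simp
  show "(\<lambda>x. F x (fn U x)) \<in> borel_measurable M" by (intro F_meas) auto
  show "AE x in M. norm (F x (fn U x)) \<le> norm (B * (1 + 4 * \<bar>fn U x\<bar> powr q))"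
  proof (rule AE_I2)
    fix x assume "x \<in> space M"
    then have "\<bar>F x (fn U x)\<bar> \<le> B * (1 + 4 * \<bar>fn U x\<bar> powr q)" by (intro F_bound) auto
    then show "norm (F x (fn U x)) \<le> norm (B * (1 + 4 * \<bar>fn U x\<bar> powr q))"
      unfolding real_norm_def by linarith
  qed
qed

text \<open>The directional derivative of \<open>J\<close>. The vector \<open>D U\<close> defined
  below represents it for the inner product of pairs, whose norm is equivalent on \<open>h01\<close>
  to the gradient norm by Poincare's inequality.\<close>

definition L :: "'a h1 \<Rightarrow> 'a h1 \<Rightarrow> real" where
  "L U Z = (a + b * (norm (fst U))\<^sup>2) * (fst U \<bullet> fst Z) - (LINT x|M. f x (fn U x) * fn Z x)"

definition J :: "'a h1 \<Rightarrow> real" where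
  "J U = a / 2 * (norm (fst U))\<^sup>2 + b / 4 * (norm (fst U))^4 - (LINT x|M. F x (fn U x))"

definition D :: "'a h1 \<Rightarrow> 'a h1" where
  "D U = (SOME d. d \<in> h01 \<Omega> \<and> (\<forall>Z\<in>h01 \<Omega>. L U Z = d \<bullet> Z))"

lemma L_add_scale:
  assumes U: "U \<in> h01 \<Omega>" and Z: "Z1 \<in> h01 \<Omega>" "Z2 \<in> h01 \<Omega>"
  shows "L U (Z1 + c *\<^sub>R Z2) = L U Z1 + c * L U Z2"
proof -
  have Z12: "Z1 + c *\<^sub>R Z2 \<in> h01 \<Omega>" using Z by (rule h01_add_scaleR)
  have "(LINT x|M. f x (fn U x) * fn (Z1 + c *\<^sub>R Z2) x) = (LINT x|M. f x (fn U x) * fn Z1 x + c * (f x (fn U x) * fn Z2 x))"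
  proof (rule integral_cong_AE)
    show "AE x in M. f x (fn U x) * fn (Z1 + c *\<^sub>R Z2) x = f x (fn U x) * fn Z1 x + c * (f x (fn U x) * fn Z2 x)"
      using fn_add[of Z1 c Z2] by eventually_elim (simp add: algebra_simps)
  qed (use f_int[OF U Z12] f_int[OF U Z(1)] f_int[OF U Z(2)] in auto)
  also have "\<dots> = (LINT x|M. f x (fn U x) * fn Z1 x) + c * (LINT x|M. f x (fn U x) * fn Z2 x)"
    using f_int[OF U Z(1)] f_int[OF U Z(2)] by simp
  finally show ?thesis by (simp add: L_def inner_add_right algebra_simps)
qed

text \<open>The majorant of the nonlinear term is not homogeneous in \<open>Z\<close>. It is
  therefore applied to unit vectors, where Sobolev's inequality bounds the integral of
  \<open>|Z|^q\<close> by \<open>\<sigma>\<close>, and the result is scaled by linearity.\<close>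

lemma L_bounded:
  assumes U: "U \<in> h01 \<Omega>"
  shows "\<exists>C. \<forall>Z\<in>h01 \<Omega>. \<bar>L U Z\<bar> \<le> C * norm Z"
proof -
  define C where "C = (a + b * (norm (fst U))\<^sup>2) * norm (fst U) +
     B * (measure M \<Omega> + 2 * ((LINT x|M. \<bar>fn U x\<bar> powr q) + \<sigma>))"
  have unit: "\<bar>L U Z\<bar> \<le> C" if Z: "Z \<in> h01 \<Omega>" "norm Z = 1" for Z
  proof -
    have "\<bar>fst U \<bullet> fst Z\<bar> \<le> norm (fst U) * 1"
      by (rule order.trans[OF Cauchy_Schwarz_ineq2]) (use norm_fst[of Z] Z in \<open>intro mult_left_mono, auto\<close>)
    then have "\<bar>(a + b * (norm (fst U))\<^sup>2) * (fst U \<bullet> fst Z)\<bar> \<le> (a + b * (norm (fst U))\<^sup>2) * norm (fst U)"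
      using ab by (simp add: abs_mult mult_left_mono)
    moreover have "\<bar>LINT x|M. f x (fn U x) * fn Z x\<bar> \<le> B * (measure M \<Omega> + 2 * ((LINT x|M. \<bar>fn U x\<bar> powr q) + \<sigma>))"
    proof -
      have "\<bar>LINT x|M. f x (fn U x) * fn Z x\<bar> \<le> (LINT x|M. \<bar>f x (fn U x) * fn Z x\<bar>)"
        using integral_norm_bound[of M "\<lambda>x. f x (fn U x) * fn Z x"] by simp
      also have "\<dots> \<le> (LINT x|M. B * (1 + 2 * (\<bar>fn U x\<bar> powr q + \<bar>fn Z x\<bar> powr q)))"
      proof (intro integral_mono integrable_abs f_int U Z)
        show "integrable M (\<lambda>x. B * (1 + 2 * (\<bar>fn U x\<bar> powr q + \<bar>fn Z x\<bar> powr q)))"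
          using fn_int[OF U] fn_int[OF Z(1)] by simp
        show "\<bar>f x (fn U x) * fn Z x\<bar> \<le> B * (1 + 2 * (\<bar>fn U x\<bar> powr q + \<bar>fn Z x\<bar> powr q))" if "x \<in> space M" for x
          using that by (intro f_times) auto
      qed
      also have "\<dots> = B * (measure M \<Omega> + 2 * ((LINT x|M. \<bar>fn U x\<bar> powr q) + (LINT x|M. \<bar>fn Z x\<bar> powr q)))"
        using fn_int[OF U] fn_int[OF Z(1)] by simp
      also have "\<dots> \<le> B * (measure M \<Omega> + 2 * ((LINT x|M. \<bar>fn U x\<bar> powr q) + \<sigma>))"
      proof -
        have "norm (fst Z) powr q \<le> 1 powr q" using norm_fst[of Z] Z q by (intro powr_mono2) auto
        then have "\<sigma> * norm (fst Z) powr q \<le> \<sigma> * 1" using \<sigma> by (intro mult_left_mono) auto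
        then have "(LINT x|M. \<bar>fn Z x\<bar> powr q) \<le> \<sigma>" using sobolev[OF Z(1)] by simp
        then show ?thesis using B by (intro mult_left_mono add_left_mono) auto
      qed
      finally show ?thesis .
    qed
    ultimately show ?thesis unfolding L_def C_def by linarith
  qed
  have "\<bar>L U Z\<bar> \<le> C * norm Z" if Z: "Z \<in> h01 \<Omega>" for Z
  proof (cases "Z = 0")
    case False
    define e where "e = (1 / norm Z) *\<^sub>R Z"
    have e: "e \<in> h01 \<Omega>" "norm e = 1" using Z False by (auto simp: e_def intro!: subspace_scale[OF subspace_h01])
    have "L U (0 + norm Z *\<^sub>R e) = L U 0 + norm Z * L U e"
      using subspace_0[OF subspace_h01] e U by (intro L_add_scale)
    moreover have "L U (0 + 0 *\<^sub>R e) = L U 0 + 0 * L U e"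
      using subspace_0[OF subspace_h01] e U by (intro L_add_scale)
    moreover have "L U (0 + (-1) *\<^sub>R 0) = L U 0 + (-1) * L U 0"
      using subspace_0[OF subspace_h01] U by (intro L_add_scale)
    ultimately have "L U Z = norm Z * L U e" using False by (simp add: e_def)
    then have "\<bar>L U Z\<bar> = norm Z * \<bar>L U e\<bar>" by (simp add: abs_mult)
    also have "\<dots> \<le> norm Z * C" using unit[OF e] by (intro mult_left_mono) auto
    finally show ?thesis by (simp add: mult.commute)
  next
    case True
    have "L U (0 + (-1) *\<^sub>R 0) = L U 0 + (-1) * L U 0"
      using subspace_0[OF subspace_h01] U by (intro L_add_scale)
    then show ?thesis using True by simp
  qed
  then show ?thesis by blast
qed

lemma D_spec:
  assumes U: "U \<in> h01 \<Omega>"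
  shows "D U \<in> h01 \<Omega>" "\<And>Z. Z \<in> h01 \<Omega> \<Longrightarrow> D U \<bullet> Z = L U Z"
proof -
  obtain C where C: "\<And>Z. Z \<in> h01 \<Omega> \<Longrightarrow> \<bar>L U Z\<bar> \<le> C * norm Z" using L_bounded[OF U] by blast
  have z0: "0 \<in> h01 \<Omega>" by (rule subspace_0[OF subspace_h01])
  have L0: "L U 0 = 0" using C[OF z0] by simp
  have "\<exists>d\<in>h01 \<Omega>. \<forall>Z\<in>h01 \<Omega>. L U Z = d \<bullet> Z"
  proof (rule riesz_representation[OF subspace_h01 closed_h01 _ _ C])
    show "L U (x + y) = L U x + L U y" if "x \<in> h01 \<Omega>" "y \<in> h01 \<Omega>" for x y
      using L_add_scale[OF U that, of 1] by simp
    show "L U (c *\<^sub>R x) = c * L U x" if "x \<in> h01 \<Omega>" for c x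
      using L_add_scale[OF U z0 that, of c] L0 by simp
  qed
  then have "\<exists>d. d \<in> h01 \<Omega> \<and> (\<forall>Z\<in>h01 \<Omega>. L U Z = d \<bullet> Z)" by blast
  from someI_ex[OF this] show "D U \<in> h01 \<Omega>" "\<And>Z. Z \<in> h01 \<Omega> \<Longrightarrow> D U \<bullet> Z = L U Z"
    unfolding D_def by auto
qed

text \<open>Difference quotients of the integrand are values of \<open>f\<close> at intermediate
  points times \<open>Z\<close>, with an integrable majorant as long as the step is at most
  \<open>1\<close>; dominated convergence is applied along sequences of steps.\<close>

lemma J_deriv_0:
  assumes U: "U \<in> h01 \<Omega>" and Z: "Z \<in> h01 \<Omega>"
  shows "((\<lambda>t. J (U + t *\<^sub>R Z)) has_real_derivative L U Z) (at 0)"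
proof -
  have mem: "U + t *\<^sub>R Z \<in> h01 \<Omega>" for t using U Z by (rule h01_add_scaleR)
  define N where "N t = (LINT x|M. F x (fn U x + t * fn Z x))" for t
  have N: "(LINT x|M. F x (fn (U + t *\<^sub>R Z) x)) = N t" for t
    unfolding N_def
  proof (rule integral_cong_AE)
    show "AE x in M. F x (fn (U + t *\<^sub>R Z) x) = F x (fn U x + t * fn Z x)"
      using fn_add[of U t Z] by eventually_elim simp
  qed (intro F_meas fn_meas borel_measurable_add borel_measurable_times borel_measurable_const)+
  have N_int: "integrable M (\<lambda>x. F x (fn U x + t * fn Z x))" for t
  proof (rule integrable_cong_AE_imp[OF F_int[OF mem[of t]]])
    show "AE x in M. F x (fn (U + t *\<^sub>R Z) x) = F x (fn U x + t * fn Z x)"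
      using fn_add[of U t Z] by eventually_elim simp
  qed (auto intro!: F_meas borel_measurable_add borel_measurable_times)
  have "(N has_real_derivative (LINT x|M. f x (fn U x) * fn Z x)) (at 0)"
    unfolding has_field_derivative_iff tendsto_at_iff_sequentially
  proof (intro allI impI)
    fix X :: "nat \<Rightarrow> real" assume X0: "\<forall>i. X i \<in> UNIV - {0}" and X: "X \<longlonglongrightarrow> 0"
    then obtain N0 where N0: "\<And>n. n \<ge> N0 \<Longrightarrow> \<bar>X n\<bar> < 1"
      using LIMSEQ_D[OF X, of 1] by auto
    have Xn: "X n \<noteq> 0" for n using X0 by auto
    \<comment> \<open>Dropping finitely many terms gives \<open>|X' n| \<le> 1\<close>, as the
      majorant requires.\<close>
    define X' where "X' n = X (n + N0)" for n
    have X': "X' \<longlonglongrightarrow> 0" "\<And>n. \<bar>X' n\<bar> \<le> 1" "\<And>n. X' n \<noteq> 0"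
      using LIMSEQ_ignore_initial_segment[OF X, of N0] N0 Xn by (auto simp: X'_def[abs_def] less_imp_le)
    have "(\<lambda>n. LINT x|M. (F x (fn U x + X' n * fn Z x) - F x (fn U x)) / X' n) \<longlonglongrightarrow> (LINT x|M. f x (fn U x) * fn Z x)"
    proof (rule integral_dominated_convergence[where w="\<lambda>x. B * (1 + 2 * (2 powr q * (\<bar>fn U x\<bar> powr q + \<bar>fn Z x\<bar> powr q) + \<bar>fn Z x\<bar> powr q))"])
      show "integrable M (\<lambda>x. B * (1 + 2 * (2 powr q * (\<bar>fn U x\<bar> powr q + \<bar>fn Z x\<bar> powr q) + \<bar>fn Z x\<bar> powr q)))"
        using fn_int[OF U] fn_int[OF Z] by simp
      show "(\<lambda>x. f x (fn U x) * fn Z x) \<in> borel_measurable M" using f_int[OF U Z] by auto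
      show "(\<lambda>x. (F x (fn U x + X' n * fn Z x) - F x (fn U x)) / X' n) \<in> borel_measurable M" for n
        using N_int[of "X' n"] F_int[OF U] by auto
      show "AE x in M. (\<lambda>n. (F x (fn U x + X' n * fn Z x) - F x (fn U x)) / X' n) \<longlonglongrightarrow> f x (fn U x) * fn Z x"
      proof (rule AE_I2)
        fix x assume "x \<in> space M"
        then have x: "x \<in> \<Omega>" by simp
        have "((\<lambda>t. F x (fn U x + t * fn Z x)) has_real_derivative f x (fn U x + 0 * fn Z x) * fn Z x) (at 0)"
          by (rule DERIV_chain2[OF f_deriv[OF x]]) (auto intro!: derivative_eq_intros)
        then have "((\<lambda>h. (F x (fn U x + h * fn Z x) - F x (fn U x)) / h) \<longlongrightarrow> f x (fn U x) * fn Z x) (at 0)"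
          by (simp add: has_field_derivative_iff)
        moreover have "filterlim X' (at 0) sequentially"
          using X' by (intro filterlim_atI) (auto intro: always_eventually)
        ultimately show "(\<lambda>n. (F x (fn U x + X' n * fn Z x) - F x (fn U x)) / X' n) \<longlonglongrightarrow> f x (fn U x) * fn Z x"
          by (rule filterlim_compose)
      qed
      show "AE x in M. norm ((F x (fn U x + X' n * fn Z x) - F x (fn U x)) / X' n) \<le>
        B * (1 + 2 * (2 powr q * (\<bar>fn U x\<bar> powr q + \<bar>fn Z x\<bar> powr q) + \<bar>fn Z x\<bar> powr q))" for n
      proof (rule AE_I2)
        fix x assume "x \<in> space M"
        then have x: "x \<in> \<Omega>" by simp
        obtain \<xi> where \<xi>: "\<bar>\<xi>\<bar> \<le> \<bar>fn U x\<bar> + \<bar>X' n * fn Z x\<bar>"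
          "F x (fn U x + X' n * fn Z x) - F x (fn U x) = f x \<xi> * (X' n * fn Z x)"
          using F_increment[OF x] by blast
        have "\<bar>X' n * fn Z x\<bar> \<le> \<bar>fn Z x\<bar>" using X'(2)[of n] by (simp add: abs_mult mult_left_le_one_le)
        then have \<xi>': "\<bar>\<xi>\<bar> \<le> \<bar>fn U x\<bar> + \<bar>fn Z x\<bar>" using \<xi>(1) by linarith
        have "norm ((F x (fn U x + X' n * fn Z x) - F x (fn U x)) / X' n) = \<bar>f x \<xi> * fn Z x\<bar>"
          unfolding \<xi>(2) using X'(3)[of n] by simp
        also have "\<dots> \<le> B * (1 + 2 * ((\<bar>fn U x\<bar> + \<bar>fn Z x\<bar>) powr q + \<bar>fn Z x\<bar> powr q))"
          by (rule f_times[OF x \<xi>'])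
        also have "\<dots> \<le> B * (1 + 2 * (2 powr q * (\<bar>fn U x\<bar> powr q + \<bar>fn Z x\<bar> powr q) + \<bar>fn Z x\<bar> powr q))"
          using B q by (intro mult_left_mono add_left_mono add_right_mono powr_add_le) auto
        finally show "norm ((F x (fn U x + X' n * fn Z x) - F x (fn U x)) / X' n) \<le>
          B * (1 + 2 * (2 powr q * (\<bar>fn U x\<bar> powr q + \<bar>fn Z x\<bar> powr q) + \<bar>fn Z x\<bar> powr q))" .
      qed
    qed
    moreover have "(LINT x|M. (F x (fn U x + X' n * fn Z x) - F x (fn U x)) / X' n) = (N (X' n) - N 0) / (X' n - 0)" for n
      using N_int[of "X' n"] F_int[OF U] by (simp add: N_def)
    ultimately have "(\<lambda>n. (N (X' n) - N 0) / (X' n - 0)) \<longlonglongrightarrow> (LINT x|M. f x (fn U x) * fn Z x)" by (simp only:)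
    then have "(\<lambda>n. (N (X n) - N 0) / (X n - 0)) \<longlonglongrightarrow> (LINT x|M. f x (fn U x) * fn Z x)"
      unfolding X'_def by (rule LIMSEQ_offset)
    then show "((\<lambda>y. (N y - N 0) / (y - 0)) \<circ> X) \<longlonglongrightarrow> (LINT x|M. f x (fn U x) * fn Z x)"
      by (simp add: o_def)
  qed
  moreover have "((\<lambda>t. a / 2 * (norm (fst (U + t *\<^sub>R Z)))\<^sup>2 + b / 4 * (norm (fst (U + t *\<^sub>R Z)))^4) has_real_derivative
     (a + b * (norm (fst U))\<^sup>2) * (fst U \<bullet> fst Z)) (at 0)"
  proof -
    \<comment> \<open>The squared norm is a quadratic polynomial in \<open>t\<close>, which makes
      both norm terms polynomials.\<close>
    define P where "P t = (norm (fst U))\<^sup>2 + 2 * t * (fst U \<bullet> fst Z) + t\<^sup>2 * (norm (fst Z))\<^sup>2" for t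
    have P: "(norm (fst (U + t *\<^sub>R Z)))\<^sup>2 = P t" for t
      unfolding P_def power2_norm_eq_inner
      by (simp add: inner_add_left inner_add_right inner_commute[of "fst Z" "fst U"] power2_eq_square algebra_simps)
    have P4: "(norm (fst (U + t *\<^sub>R Z)))^4 = (P t)\<^sup>2" for t unfolding P[symmetric] by (simp flip: power_mult)
    have "((\<lambda>t. a / 2 * P t + b / 4 * (P t)\<^sup>2) has_real_derivative (a + b * (norm (fst U))\<^sup>2) * (fst U \<bullet> fst Z)) (at 0)"
      unfolding P_def by (auto intro!: derivative_eq_intros simp: algebra_simps)
    then show ?thesis by (simp only: P P4)
  qed
  ultimately show ?thesis unfolding J_def N L_def by (intro DERIV_diff)
qed

lemma J_deriv:
  assumes U: "U \<in> h01 \<Omega>" and Z: "Z \<in> h01 \<Omega>"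
  shows "((\<lambda>t. J (U + t *\<^sub>R Z)) has_real_derivative D (U + t *\<^sub>R Z) \<bullet> Z) (at t)"
proof -
  have mem: "U + t *\<^sub>R Z \<in> h01 \<Omega>" using U Z by (rule h01_add_scaleR)
  have "((\<lambda>s. J ((U + t *\<^sub>R Z) + s *\<^sub>R Z)) has_real_derivative D (U + t *\<^sub>R Z) \<bullet> Z) (at 0)"
    using J_deriv_0[OF mem Z] D_spec(2)[OF mem Z] by simp
  then have "((\<lambda>s. J (U + (s + t) *\<^sub>R Z)) has_real_derivative D (U + t *\<^sub>R Z) \<bullet> Z) (at 0)"
    by (simp add: scaleR_add_left add_ac)
  then show ?thesis using DERIV_shift[of "\<lambda>t. J (U + t *\<^sub>R Z)" _ 0 t] by simp
qed

lemma conjugate_exponent: "q / (q - 1) > 0" "(q - 1) * (q / (q - 1)) = q"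
  using q by auto

section \<open>Uniform continuity of the derivative on bounded sets\<close>

text \<open>The pointwise estimate is integrated without any compactness: the small coefficient
  falls on \<open>W\<close>, which is bounded in the application, and the large one on
  \<open>U - W\<close>, which tends to \<open>0\<close> in norm there.\<close>

lemma crit_diff_bound:
  assumes "e > 0"
  shows "\<exists>C\<ge>0. \<forall>U\<in>h01 \<Omega>. \<forall>W\<in>h01 \<Omega>.
    integrable M (\<lambda>x. \<bar>crit_pow q (fn U x) - crit_pow q (fn W x)\<bar> powr (q / (q - 1))) \<and>
    (LINT x|M. \<bar>crit_pow q (fn U x) - crit_pow q (fn W x)\<bar> powr (q / (q - 1)))
      \<le> e * \<sigma> * norm (fst W) powr q + C * norm (fst (U - W)) powr q"
proof -
  obtain C where C: "C \<ge> 0" "\<And>u v. \<bar>crit_pow q (u + v) - crit_pow q v\<bar> powr (q / (q - 1)) \<le> e * \<bar>v\<bar> powr q + C * \<bar>u\<bar> powr q"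
    using crit_pow_diff_pointwise[OF q(2) assms] by blast
  show ?thesis
  proof (intro exI[of _ "C * \<sigma>"] conjI ballI)
    show "C * \<sigma> \<ge> 0" using C \<sigma> by simp
    fix U W assume U: "U \<in> h01 \<Omega>" and W: "W \<in> h01 \<Omega>"
    have UW: "U - W \<in> h01 \<Omega>" by (rule subspace_diff[OF subspace_h01 U W])
    have [measurable]: "crit_pow q \<in> borel_measurable borel"
      by (intro borel_measurable_continuous_onI continuous_crit_pow q)
    have meas: "(\<lambda>x. \<bar>crit_pow q (fn U x) - crit_pow q (fn W x)\<bar> powr (q / (q - 1))) \<in> borel_measurable M"
      by measurable
    have int: "integrable M (\<lambda>x. e * \<bar>fn W x\<bar> powr q + C * \<bar>fn (U - W) x\<bar> powr q)"
      using fn_int[OF W] fn_int[OF UW] by simp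
    have le: "AE x in M. \<bar>crit_pow q (fn U x) - crit_pow q (fn W x)\<bar> powr (q / (q - 1)) \<le> e * \<bar>fn W x\<bar> powr q + C * \<bar>fn (U - W) x\<bar> powr q"
      using fn_diff[of U W]
    proof eventually_elim
      case (elim x)
      have "fn U x = fn (U - W) x + fn W x" using elim by simp
      then show ?case using C(2)[of "fn (U - W) x" "fn W x"] by simp
    qed
    show "integrable M (\<lambda>x. \<bar>crit_pow q (fn U x) - crit_pow q (fn W x)\<bar> powr (q / (q - 1)))"
      by (rule Bochner_Integration.integrable_bound[OF int meas]) (use le in \<open>auto elim: eventually_mono\<close>)
    have "(LINT x|M. \<bar>crit_pow q (fn U x) - crit_pow q (fn W x)\<bar> powr (q / (q - 1)))
      \<le> (LINT x|M. e * \<bar>fn W x\<bar> powr q + C * \<bar>fn (U - W) x\<bar> powr q)"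
      using int le by (rule integral_mono_AE'[OF _ _ AE_I2]) (use assms C in simp)
    also have "\<dots> = e * (LINT x|M. \<bar>fn W x\<bar> powr q) + C * (LINT x|M. \<bar>fn (U - W) x\<bar> powr q)"
      using fn_int[OF W] fn_int[OF UW] by simp
    also have "\<dots> \<le> e * (\<sigma> * norm (fst W) powr q) + C * (\<sigma> * norm (fst (U - W)) powr q)"
      using assms C by (intro add_mono mult_left_mono sobolev W UW) auto
    finally show "(LINT x|M. \<bar>crit_pow q (fn U x) - crit_pow q (fn W x)\<bar> powr (q / (q - 1)))
      \<le> e * \<sigma> * norm (fst W) powr q + C * \<sigma> * norm (fst (U - W)) powr q" by (simp add: mult.assoc)
  qed
qed

text \<open>Subcriticality means that \<open>(m - 1) * q / (q - 1) < q\<close>, so this power lies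
  below any multiple of the critical one up to a constant. Constants are integrable on
  \<open>\<Omega>\<close>, which is the form of domination demanded by
  \<open>integral_tendsto_0_eps_dominated\<close>.\<close>

lemma k_powr_bound:
  assumes "e > 0"
  shows "\<exists>C\<ge>0. \<forall>x\<in>\<Omega>. \<forall>s t. \<bar>k x s - k x t\<bar> powr (q / (q - 1)) \<le> e * (\<bar>s\<bar> powr q + \<bar>t\<bar> powr q) + C"
proof -
  define p where "p = q / (q - 1)"
  have p: "p > 0" "(m - 1) * p < q"
  proof -
    show "p > 0" using conjugate_exponent by (simp add: p_def)
    then have "(m - 1) * p < (q - 1) * p" using m by (intro mult_strict_right_mono) auto
    then show "(m - 1) * p < q" using conjugate_exponent by (simp add: p_def)
  qed
  have "e / (2 powr p * (2 * A) powr p * 2 + 1) > 0"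
    using assms by (intro divide_pos_pos add_nonneg_pos) auto
  then obtain C where C: "C \<ge> 0" "\<And>t. t \<ge> 0 \<Longrightarrow> t powr ((m - 1) * p) \<le> e / (2 powr p * (2 * A) powr p * 2 + 1) * t powr q + C"
    using powr_le_eps_powr[of "(m - 1) * p" q "e / (2 powr p * (2 * A) powr p * 2 + 1)"] p m by auto
  define G where "G = 2 powr p * (2 * A) powr p * 2"
  have G: "G \<ge> 0" by (simp add: G_def)
  show ?thesis
  proof (intro exI[of _ "G * (1 + C)"] conjI ballI allI)
    show "G * (1 + C) \<ge> 0" using G C by simp
    fix x and s t :: real assume x: "x \<in> \<Omega>"
    define T where "T = max \<bar>s\<bar> \<bar>t\<bar>"
    have T: "T \<ge> 0" "\<bar>s\<bar> \<le> T" "\<bar>t\<bar> \<le> T" by (auto simp: T_def)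
    have kT: "\<bar>k x r\<bar> \<le> A * (1 + T powr (m - 1))" if "\<bar>r\<bar> \<le> T" for r
    proof -
      have "\<bar>r\<bar> powr (m - 1) \<le> T powr (m - 1)" using that m by (intro powr_mono2) auto
      then show ?thesis using k_bound[OF x, of r] A by (meson add_left_mono mult_left_mono order_trans)
    qed
    have "\<bar>k x s - k x t\<bar> \<le> 2 * A * (1 + T powr (m - 1))" using kT[OF T(2)] kT[OF T(3)] by linarith
    then have "\<bar>k x s - k x t\<bar> powr p \<le> (2 * A * (1 + T powr (m - 1))) powr p"
      using p by (intro powr_mono2) auto
    also have "\<dots> = (2 * A) powr p * (1 + T powr (m - 1)) powr p"
      using A by (intro powr_mult) 
    also have "\<dots> \<le> (2 * A) powr p * (2 powr p * (1 powr p + (T powr (m - 1)) powr p))"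
      using p by (intro mult_left_mono powr_add_le) auto
    also have "\<dots> = G / 2 * (1 + T powr ((m - 1) * p))" by (simp add: G_def powr_powr)
    also have "\<dots> \<le> G * (1 + T powr ((m - 1) * p))" using G by (intro mult_right_mono) auto
    also have "\<dots> \<le> G * (1 + (e / (G + 1) * T powr q + C))"
      using C(2)[OF T(1)] G unfolding G_def[symmetric] by (intro mult_left_mono add_left_mono) auto
    also have "\<dots> = G / (G + 1) * (e * T powr q) + G * (1 + C)" by (simp add: algebra_simps)
    also have "\<dots> \<le> 1 * (e * T powr q) + G * (1 + C)"
      using G assms by (intro add_right_mono mult_right_mono) auto
    also have "e * T powr q \<le> e * (\<bar>s\<bar> powr q + \<bar>t\<bar> powr q)"
      using assms by (intro mult_left_mono) (auto simp: T_def max_def)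
    finally show "\<bar>k x s - k x t\<bar> powr (q / (q - 1)) \<le> e * (\<bar>s\<bar> powr q + \<bar>t\<bar> powr q) + G * (1 + C)"
      by (simp add: p_def)
  qed
qed

text \<open>The counterpart for the pairing with a second function: the total powers are
  \<open>1\<close> and \<open>m\<close>, both below \<open>q\<close>.\<close>

lemma k_times_bound:
  assumes "e > 0"
  shows "\<exists>C\<ge>0. \<forall>x\<in>\<Omega>. \<forall>s t. \<bar>k x s * t\<bar> \<le> e * (\<bar>s\<bar> powr q + \<bar>t\<bar> powr q) + C"
proof -
  have e': "e / (2 * A + 1) > 0" using assms A by simp
  obtain C1 where C1: "C1 \<ge> 0" "\<And>t. t \<ge> 0 \<Longrightarrow> t powr 1 \<le> e / (2 * A + 1) * t powr q + C1"
    using powr_le_eps_powr[of 1 q "e / (2 * A + 1)"] q e' by auto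
  obtain C2 where C2: "C2 \<ge> 0" "\<And>t. t \<ge> 0 \<Longrightarrow> t powr m \<le> e / (2 * A + 1) * t powr q + C2"
    using powr_le_eps_powr[of m q "e / (2 * A + 1)"] m e' by auto
  show ?thesis
  proof (intro exI[of _ "A * (C1 + C2)"] conjI ballI allI)
    show "A * (C1 + C2) \<ge> 0" using A C1 C2 by simp
    fix x and s t :: real assume x: "x \<in> \<Omega>"
    define T where "T = max \<bar>s\<bar> \<bar>t\<bar>"
    have T: "T \<ge> 0" "\<bar>s\<bar> \<le> T" "\<bar>t\<bar> \<le> T" by (auto simp: T_def)
    have Tm: "T powr (m - 1) * T = T powr m" using T(1) powr_add[of T "m - 1" 1] by (cases "T = 0") simp_all
    have "\<bar>k x s\<bar> \<le> A * (1 + T powr (m - 1))"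
    proof -
      have "\<bar>s\<bar> powr (m - 1) \<le> T powr (m - 1)" using T m by (intro powr_mono2) auto
      then show ?thesis using k_bound[OF x, of s] A by (meson add_left_mono mult_left_mono order_trans)
    qed
    then have "\<bar>k x s * t\<bar> \<le> A * (1 + T powr (m - 1)) * T"
      unfolding abs_mult using T A by (intro mult_mono) auto
    also have "\<dots> = A * (T powr 1 + T powr m)" using T(1) by (simp add: distrib_right mult.assoc Tm)
    also have "\<dots> \<le> A * ((e / (2 * A + 1) * T powr q + C1) + (e / (2 * A + 1) * T powr q + C2))"
      using A by (intro mult_left_mono add_mono C1 C2 T)
    also have "\<dots> = 2 * A / (2 * A + 1) * (e * T powr q) + A * (C1 + C2)" by (simp add: algebra_simps)
    also have "\<dots> \<le> 1 * (e * T powr q) + A * (C1 + C2)"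
      using A assms by (intro add_right_mono mult_right_mono) auto
    also have "e * T powr q \<le> e * (\<bar>s\<bar> powr q + \<bar>t\<bar> powr q)"
      using assms by (intro mult_left_mono) (auto simp: T_def max_def)
    finally show "\<bar>k x s * t\<bar> \<le> e * (\<bar>s\<bar> powr q + \<bar>t\<bar> powr q) + A * (C1 + C2)" by simp
  qed
qed

lemma fn_powr_le:
  assumes "U \<in> h01 \<Omega>" "norm U \<le> R"
  shows "(LINT x|M. \<bar>fn U x\<bar> powr q) \<le> \<sigma> * R powr q"
proof -
  have "norm (fst U) \<le> R" using norm_fst[of U] assms(2) by simp
  then have "norm (fst U) powr q \<le> R powr q" using q by (intro powr_mono2) auto
  then show ?thesis using sobolev[OF assms(1)] \<sigma> by (meson mult_left_mono order_trans)
qed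

text \<open>Besides \<open>(a + b * |v|^2) (v - w)\<close> there remains the difference of the
  squared norms times \<open>w\<close>; the former contributes \<open>R^2\<close> once, the latter
  twice.\<close>

lemma kirchhoff_term_lipschitz:
  fixes v w :: "'v::real_inner"
  assumes "norm v \<le> R" "norm w \<le> R"
  shows "norm ((a + b * (norm v)\<^sup>2) *\<^sub>R v - (a + b * (norm w)\<^sup>2) *\<^sub>R w) \<le> (a + 3 * b * R\<^sup>2) * norm (v - w)"
proof -
  have R: "R \<ge> 0" using assms(1) norm_ge_zero order_trans by blast
  have "(a + b * (norm v)\<^sup>2) *\<^sub>R v - (a + b * (norm w)\<^sup>2) *\<^sub>R w =
     (a + b * (norm v)\<^sup>2) *\<^sub>R (v - w) + (b * ((norm v)\<^sup>2 - (norm w)\<^sup>2)) *\<^sub>R w"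
    by (simp add: algebra_simps)
  also have "norm \<dots> \<le> norm ((a + b * (norm v)\<^sup>2) *\<^sub>R (v - w)) + norm ((b * ((norm v)\<^sup>2 - (norm w)\<^sup>2)) *\<^sub>R w)"
    by (rule norm_triangle_ineq)
  also have "norm ((a + b * (norm v)\<^sup>2) *\<^sub>R (v - w)) \<le> (a + b * R\<^sup>2) * norm (v - w)"
  proof -
    have "(norm v)\<^sup>2 \<le> R\<^sup>2" using assms by (intro power_mono) auto
    then have "a + b * (norm v)\<^sup>2 \<le> a + b * R\<^sup>2" using ab by simp
    moreover have "\<bar>a + b * (norm v)\<^sup>2\<bar> = a + b * (norm v)\<^sup>2" using ab by (simp add: add_pos_nonneg)
    ultimately show ?thesis by (simp add: mult_right_mono)
  qed
  also have "norm ((b * ((norm v)\<^sup>2 - (norm w)\<^sup>2)) *\<^sub>R w) \<le> 2 * b * R\<^sup>2 * norm (v - w)"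
  proof -
    have "\<bar>(norm v)\<^sup>2 - (norm w)\<^sup>2\<bar> = \<bar>norm v - norm w\<bar> * (norm v + norm w)"
      by (simp add: power2_eq_square abs_mult[symmetric] square_diff_square_factored) (simp add: abs_mult)
    also have "\<dots> \<le> norm (v - w) * (R + R)"
      using assms by (intro mult_mono norm_triangle_ineq3) auto
    finally have "\<bar>(norm v)\<^sup>2 - (norm w)\<^sup>2\<bar> * norm w \<le> norm (v - w) * (R + R) * R"
      using assms R by (intro mult_mono) auto
    then have "b * (\<bar>(norm v)\<^sup>2 - (norm w)\<^sup>2\<bar> * norm w) \<le> b * (norm (v - w) * (R + R) * R)"
      using ab by (intro mult_left_mono) auto
    moreover have "norm ((b * ((norm v)\<^sup>2 - (norm w)\<^sup>2)) *\<^sub>R w) = b * (\<bar>(norm v)\<^sup>2 - (norm w)\<^sup>2\<bar> * norm w)"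
      using ab unfolding norm_scaleR abs_mult by simp
    ultimately have "norm ((b * ((norm v)\<^sup>2 - (norm w)\<^sup>2)) *\<^sub>R w) \<le> b * (norm (v - w) * (R + R) * R)"
      by (simp only:)
    also have "\<dots> = 2 * b * R\<^sup>2 * norm (v - w)" by (simp add: power2_eq_square)
    finally show ?thesis .
  qed
  finally show ?thesis by (simp add: algebra_simps)
qed

text \<open>The difference of the derivatives is tested on its own normalized direction. The
  Kirchhoff term is Lipschitz on bounded sets, the critical part is controlled by the norm of
  \<open>U n - W n\<close> alone, and for the subcritical part a subsequence is taken on which both
  sequences converge almost everywhere to the same limit.\<close>

lemma D_diff_tendsto_0_subseq:
  assumes U: "\<And>n. U n \<in> h01 \<Omega>" "\<And>n. norm (U n) \<le> R"
    and W: "\<And>n. W n \<in> h01 \<Omega>" "\<And>n. norm (W n) \<le> R"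
    and UW: "(\<lambda>n. U n - W n) \<longlonglongrightarrow> 0"
  shows "\<exists>r. strict_mono (r :: nat \<Rightarrow> nat) \<and> (\<lambda>n. norm (D (U (r n)) - D (W (r n)))) \<longlonglongrightarrow> 0"
proof -
  obtain r Z where r: "strict_mono (r :: nat \<Rightarrow> nat)" and Z: "Z \<in> h01 \<Omega>"
    and s: "(\<lambda>n. snd (U (r n))) \<longlonglongrightarrow> snd Z"
    and ae: "AE x in lebesgue. (\<lambda>n. fn (U (r n)) x) \<longlonglongrightarrow> fn Z x"
    using h01_weak_AE_subseq[of U R, OF U] by blast
  have UWr: "(\<lambda>n. U (r n) - W (r n)) \<longlonglongrightarrow> 0" using LIMSEQ_subseq_LIMSEQ[OF UW r] by (simp add: o_def)
  have "(\<lambda>n. snd (U (r n)) - snd (U (r n) - W (r n))) \<longlonglongrightarrow> snd Z - snd (0 :: 'a h1)"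
    by (intro tendsto_diff s tendsto_snd UWr)
  then have "(\<lambda>n. snd (W (r n))) \<longlonglongrightarrow> snd Z" by simp
  from l2_convergent_AE_subseq[OF this] obtain r' where r': "strict_mono r'"
    and ae': "AE x in lebesgue. (\<lambda>n. fn (W (r (r' n))) x) \<longlonglongrightarrow> fn Z x" by blast
  define u where "u n = U (r (r' n))" for n
  define w where "w n = W (r (r' n))" for n
  have u: "u n \<in> h01 \<Omega>" "norm (u n) \<le> R" and w: "w n \<in> h01 \<Omega>" "norm (w n) \<le> R" for n
    using U W by (auto simp: u_def w_def)
  have uw: "(\<lambda>n. norm (u n - w n)) \<longlonglongrightarrow> 0"
    using LIMSEQ_subseq_LIMSEQ[OF UWr r'] by (auto simp: o_def u_def w_def intro: tendsto_norm_zero)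
  have R: "R \<ge> 0" using U(2)[of 0] norm_ge_zero order_trans by blast
  define p where "p = q / (q - 1)"
  have p: "p > 0" using conjugate_exponent by (simp add: p_def)
  \<comment> \<open>\<open>I1\<close> and \<open>I2\<close> measure the critical and the subcritical
    change in the conjugate exponent \<open>p = q / (q - 1)\<close>.\<close>
  define I1 where "I1 n = (LINT x|M. \<bar>crit_pow q (fn (u n) x) - crit_pow q (fn (w n) x)\<bar> powr p)" for n
  define I2 where "I2 n = (LINT x|M. \<bar>k x (fn (u n) x) - k x (fn (w n) x)\<bar> powr p)" for n
  have fstle: "norm (fst (u n - w n)) powr q \<le> norm (u n - w n) powr q" for n
    using norm_fst[of "u n - w n"] q by (intro powr_mono2) auto
  have I1: "I1 \<longlonglongrightarrow> 0"
  proof (rule tendsto_0_eps_bound[where d="\<lambda>n. norm (u n - w n) powr q" and B="\<sigma> * R powr q"])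
    show "0 \<le> I1 n" for n by (simp add: I1_def)
    show "(\<lambda>n. norm (u n - w n) powr q) \<longlonglongrightarrow> 0"
      using tendsto_powr'[OF uw tendsto_const[of q]] q by auto
    show "\<sigma> * R powr q \<ge> 0" using \<sigma> by simp
    fix e :: real assume "e > 0"
    from crit_diff_bound[OF this] obtain C where C: "C \<ge> 0" "\<And>n. I1 n \<le> e * \<sigma> * norm (fst (w n)) powr q + C * norm (fst (u n - w n)) powr q"
      using u w unfolding I1_def p_def by blast
    have "I1 n \<le> e * (\<sigma> * R powr q) + C * norm (u n - w n) powr q" for n
    proof -
      have "norm (fst (w n)) powr q \<le> R powr q"
        using norm_fst[of "w n"] w(2)[of n] q by (intro powr_mono2) auto
      then have "e * \<sigma> * norm (fst (w n)) powr q \<le> e * \<sigma> * R powr q" using \<open>e > 0\<close> \<sigma> by (intro mult_left_mono) auto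
      moreover have "C * norm (fst (u n - w n)) powr q \<le> C * norm (u n - w n) powr q"
        using C fstle by (intro mult_left_mono) auto
      ultimately show ?thesis using C(2)[of n] by (simp add: mult.assoc)
    qed
    then show "\<exists>C. \<forall>n. I1 n \<le> e * (\<sigma> * R powr q) + C * norm (u n - w n) powr q" by blast
  qed
  have km: "(\<lambda>x. \<bar>k x (fn (u n) x) - k x (fn (w n) x)\<bar> powr p) \<in> borel_measurable M" for n
    using k_meas'[of "fn (u n)"] k_meas'[of "fn (w n)"] by measurable
  have I2: "I2 \<longlonglongrightarrow> 0"
    unfolding I2_def
  proof (rule integral_tendsto_0_eps_dominated[where Y="\<lambda>n x. \<bar>fn (u n) x\<bar> powr q + \<bar>fn (w n) x\<bar> powr q" and B="2 * (\<sigma> * R powr q)"])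
    show "AE x in M. (\<lambda>n. \<bar>k x (fn (u n) x) - k x (fn (w n) x)\<bar> powr p) \<longlonglongrightarrow> 0"
      using AE_M[OF ae] AE_M[OF ae'] AE_space[of M]
    proof eventually_elim
      case (elim x)
      have c: "continuous_on UNIV (k x)" using elim(3) by (intro k_cont) simp
      have "(\<lambda>n. fn (u n) x) \<longlonglongrightarrow> fn Z x" using LIMSEQ_subseq_LIMSEQ[OF elim(1) r'] by (simp add: o_def u_def)
      from continuous_on_tendsto_compose[OF c this]
      have 1: "(\<lambda>n. k x (fn (u n) x)) \<longlonglongrightarrow> k x (fn Z x)" by simp
      have "(\<lambda>n. fn (w n) x) \<longlonglongrightarrow> fn Z x" using elim(2) by (simp add: w_def)
      from continuous_on_tendsto_compose[OF c this]
      have 2: "(\<lambda>n. k x (fn (w n) x)) \<longlonglongrightarrow> k x (fn Z x)" by simp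
      have "(\<lambda>n. \<bar>k x (fn (u n) x) - k x (fn (w n) x)\<bar>) \<longlonglongrightarrow> 0"
        using tendsto_rabs[OF tendsto_diff[OF 1 2]] by simp
      from tendsto_powr'[OF this tendsto_const[of p]] p show ?case by auto
    qed
    show "integrable M (\<lambda>x. \<bar>fn (u n) x\<bar> powr q + \<bar>fn (w n) x\<bar> powr q)" for n
      using fn_int[OF u(1)] fn_int[OF w(1)] by simp
    show "(LINT x|M. \<bar>fn (u n) x\<bar> powr q + \<bar>fn (w n) x\<bar> powr q) \<le> 2 * (\<sigma> * R powr q)" for n
      using fn_int[OF u(1), of n] fn_int[OF w(1), of n] fn_powr_le[OF u, of n] fn_powr_le[OF w, of n] by simp
    fix e :: real assume "e > 0"
    then obtain C where C: "\<And>x s t. x \<in> \<Omega> \<Longrightarrow> \<bar>k x s - k x t\<bar> powr (q / (q - 1)) \<le> e * (\<bar>s\<bar> powr q + \<bar>t\<bar> powr q) + C"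
      using k_powr_bound by metis
    then show "\<exists>W. integrable M W \<and> (\<forall>n. AE x in M. \<bar>k x (fn (u n) x) - k x (fn (w n) x)\<bar> powr p \<le> e * (\<bar>fn (u n) x\<bar> powr q + \<bar>fn (w n) x\<bar> powr q) + W x)"
      by (intro exI[of _ "\<lambda>x. C"] conjI allI AE_I2) (auto simp: p_def)
  qed (use km in auto)
  define c where "c n = (a + 3 * b * R\<^sup>2) * norm (u n - w n)" for n
  have c: "c \<longlonglongrightarrow> 0" unfolding c_def using tendsto_mult[OF tendsto_const uw] by simp
  have "(\<lambda>n. norm (D (u n) - D (w n))) \<longlonglongrightarrow> 0"
  proof (rule tendsto_0_eps_bound[where d="\<lambda>n. c n + 2 powr p * (I1 n + I2 n)" and B="\<sigma>"])
    have "(\<lambda>n. c n + 2 powr p * (I1 n + I2 n)) \<longlonglongrightarrow> 0 + 2 powr p * (0 + 0)"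
      by (intro tendsto_intros c I1 I2)
    then show "(\<lambda>n. c n + 2 powr p * (I1 n + I2 n)) \<longlonglongrightarrow> 0" by simp
    fix e :: real assume e: "e > 0"
    \<comment> \<open>Young's inequality puts \<open>e\<close> on \<open>|y|^q\<close>, whose
      integral is at most \<open>\<sigma>\<close> for a unit vector \<open>y\<close>, and
      \<open>C\<close> on the integrals \<open>I1 n\<close> and \<open>I2 n\<close>.\<close>
    obtain C where C: "C \<ge> 0" "\<And>x y. \<bar>x * y\<bar> \<le> e * \<bar>y\<bar> powr q + C * \<bar>x\<bar> powr p"
      using young_eps[of q e] q e unfolding p_def by auto
    have "norm (D (u n) - D (w n)) \<le> e * \<sigma> + (C + 1) * (c n + 2 powr p * (I1 n + I2 n))" for n
    proof (cases "D (u n) = D (w n)")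
      case False
      define X where "X = D (u n) - D (w n)"
      have X: "X \<in> h01 \<Omega>" "X \<noteq> 0"
        using False subspace_diff[OF subspace_h01 D_spec(1)[OF u(1)] D_spec(1)[OF w(1)]] by (auto simp: X_def)
      define y where "y = (1 / norm X) *\<^sub>R X"
      have y: "y \<in> h01 \<Omega>" "norm y = 1" using X by (auto simp: y_def intro!: subspace_scale[OF subspace_h01])
      have "norm X = X \<bullet> y" using X by (simp add: y_def power2_norm_eq_inner[symmetric] power2_eq_square)
      also have "\<dots> = L (u n) y - L (w n) y" by (simp add: X_def inner_diff_left D_spec(2) u w y)
      also have "\<dots> = ((a + b * (norm (fst (u n)))\<^sup>2) *\<^sub>R fst (u n) - (a + b * (norm (fst (w n)))\<^sup>2) *\<^sub>R fst (w n)) \<bullet> fst y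
          - ((LINT x|M. f x (fn (u n) x) * fn y x) - (LINT x|M. f x (fn (w n) x) * fn y x))"
        by (simp add: L_def inner_diff_left)
      also have "\<dots> \<le> c n + (e * \<sigma> + C * (2 powr p * (I1 n + I2 n)))"
      proof -
        have "((a + b * (norm (fst (u n)))\<^sup>2) *\<^sub>R fst (u n) - (a + b * (norm (fst (w n)))\<^sup>2) *\<^sub>R fst (w n)) \<bullet> fst y
          \<le> ((a + 3 * b * R\<^sup>2) * norm (fst (u n) - fst (w n))) * 1"
          using norm_fst[of "u n"] norm_fst[of "w n"] norm_fst[of y] u(2)[of n] w(2)[of n] y(2) ab
          by (intro order.trans[OF norm_cauchy_schwarz] mult_mono kirchhoff_term_lipschitz) auto
        also have "\<dots> \<le> c n"
          using norm_fst[of "u n - w n"] ab unfolding c_def by (auto intro!: mult_left_mono add_nonneg_nonneg)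
        finally have 1: "((a + b * (norm (fst (u n)))\<^sup>2) *\<^sub>R fst (u n) - (a + b * (norm (fst (w n)))\<^sup>2) *\<^sub>R fst (w n)) \<bullet> fst y \<le> c n" .
        define \<psi> where "\<psi> x = f x (fn (u n) x) - f x (fn (w n) x)" for x
        have \<psi>_int: "integrable M (\<lambda>x. \<psi> x * fn y x)"
          using f_int[OF u(1) y(1)] f_int[OF w(1) y(1)] by (simp add: \<psi>_def left_diff_distrib)
        have i1: "integrable M (\<lambda>x. \<bar>crit_pow q (fn (u n) x) - crit_pow q (fn (w n) x)\<bar> powr p)"
          using crit_diff_bound[of 1] u(1)[of n] w(1)[of n] unfolding p_def by auto
        have i2: "integrable M (\<lambda>x. \<bar>k x (fn (u n) x) - k x (fn (w n) x)\<bar> powr p)"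
        proof -
          obtain C where C: "\<And>x s t. x \<in> \<Omega> \<Longrightarrow> \<bar>k x s - k x t\<bar> powr (q / (q - 1)) \<le> 1 * (\<bar>s\<bar> powr q + \<bar>t\<bar> powr q) + C"
            using k_powr_bound[of 1] by auto
          show ?thesis
          proof (rule Bochner_Integration.integrable_bound)
            show "integrable M (\<lambda>x. 1 * (\<bar>fn (u n) x\<bar> powr q + \<bar>fn (w n) x\<bar> powr q) + C)"
              using fn_int[OF u(1)] fn_int[OF w(1)] by simp
            show "AE x in M. norm (\<bar>k x (fn (u n) x) - k x (fn (w n) x)\<bar> powr p) \<le> norm (1 * (\<bar>fn (u n) x\<bar> powr q + \<bar>fn (w n) x\<bar> powr q) + C)"
            proof (rule AE_I2)
              fix x assume "x \<in> space M"
              then show "norm (\<bar>k x (fn (u n) x) - k x (fn (w n) x)\<bar> powr p) \<le> norm (1 * (\<bar>fn (u n) x\<bar> powr q + \<bar>fn (w n) x\<bar> powr q) + C)"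
                using C[of x "fn (u n) x" "fn (w n) x"] unfolding p_def real_norm_def by simp
            qed
          qed (rule km)
        qed
        have "(LINT x|M. f x (fn (w n) x) * fn y x) - (LINT x|M. f x (fn (u n) x) * fn y x) = - (LINT x|M. \<psi> x * fn y x)"
          using f_int[OF u(1) y(1)] f_int[OF w(1) y(1)] by (simp add: \<psi>_def left_diff_distrib)
        also have "\<dots> \<le> (LINT x|M. \<bar>\<psi> x * fn y x\<bar>)"
          using integral_abs_bound[of M "\<lambda>x. \<psi> x * fn y x"] by linarith
        also have "\<dots> \<le> (LINT x|M. e * \<bar>fn y x\<bar> powr q + C * (2 powr p *
            (\<bar>crit_pow q (fn (u n) x) - crit_pow q (fn (w n) x)\<bar> powr p + \<bar>k x (fn (u n) x) - k x (fn (w n) x)\<bar> powr p)))"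
        proof (intro integral_mono integrable_abs \<psi>_int)
          show "integrable M (\<lambda>x. e * \<bar>fn y x\<bar> powr q + C * (2 powr p *
            (\<bar>crit_pow q (fn (u n) x) - crit_pow q (fn (w n) x)\<bar> powr p + \<bar>k x (fn (u n) x) - k x (fn (w n) x)\<bar> powr p)))"
            using fn_int[OF y(1)] i1 i2 by simp
          fix x
          have "\<bar>\<psi> x\<bar> \<le> \<bar>crit_pow q (fn (u n) x) - crit_pow q (fn (w n) x)\<bar> + \<bar>k x (fn (u n) x) - k x (fn (w n) x)\<bar>"
            by (simp add: \<psi>_def f_def)
          then have "\<bar>\<psi> x\<bar> powr p \<le> (\<bar>crit_pow q (fn (u n) x) - crit_pow q (fn (w n) x)\<bar> + \<bar>k x (fn (u n) x) - k x (fn (w n) x)\<bar>) powr p"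
            using p by (intro powr_mono2) auto
          also have "\<dots> \<le> 2 powr p * (\<bar>crit_pow q (fn (u n) x) - crit_pow q (fn (w n) x)\<bar> powr p + \<bar>k x (fn (u n) x) - k x (fn (w n) x)\<bar> powr p)"
            using p by (intro powr_add_le) auto
          finally have "C * \<bar>\<psi> x\<bar> powr p \<le> C * (2 powr p * (\<bar>crit_pow q (fn (u n) x) - crit_pow q (fn (w n) x)\<bar> powr p + \<bar>k x (fn (u n) x) - k x (fn (w n) x)\<bar> powr p))"
            using C(1) by (intro mult_left_mono)
          then show "\<bar>\<psi> x * fn y x\<bar> \<le> e * \<bar>fn y x\<bar> powr q + C * (2 powr p *
            (\<bar>crit_pow q (fn (u n) x) - crit_pow q (fn (w n) x)\<bar> powr p + \<bar>k x (fn (u n) x) - k x (fn (w n) x)\<bar> powr p))"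
            using C(2)[of "\<psi> x" "fn y x"] by linarith
        qed
        also have "\<dots> = e * (LINT x|M. \<bar>fn y x\<bar> powr q) + C * (2 powr p * (I1 n + I2 n))"
          using fn_int[OF y(1)] i1 i2 by (simp add: I1_def I2_def)
        also have "(LINT x|M. \<bar>fn y x\<bar> powr q) \<le> \<sigma> * 1 powr q"
          using y by (intro fn_powr_le) auto
        finally have 2: "(LINT x|M. f x (fn (w n) x) * fn y x) - (LINT x|M. f x (fn (u n) x) * fn y x) \<le> e * \<sigma> + C * (2 powr p * (I1 n + I2 n))"
          using e by simp
        show ?thesis using 1 2 by linarith
      qed
      also have "\<dots> \<le> e * \<sigma> + (C + 1) * (c n + 2 powr p * (I1 n + I2 n))"
      proof -
        have "0 \<le> c n" "0 \<le> I1 n" "0 \<le> I2 n"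
          using ab by (auto simp: c_def I1_def I2_def intro!: mult_nonneg_nonneg add_nonneg_nonneg)
        then have "0 \<le> C * c n" "0 \<le> 2 powr p * (I1 n + I2 n)" using C(1) by auto
        then show ?thesis by (simp add: algebra_simps)
      qed
      finally show ?thesis by (simp add: X_def)
    next
      case True
      have "0 \<le> c n" "0 \<le> I1 n" "0 \<le> I2 n"
        using ab by (auto simp: c_def I1_def I2_def intro!: mult_nonneg_nonneg add_nonneg_nonneg)
      then show ?thesis using True C(1) e \<sigma> by simp
    qed
    then show "\<exists>C. \<forall>n. norm (D (u n) - D (w n)) \<le> e * \<sigma> + C * (c n + 2 powr p * (I1 n + I2 n))" by blast
  qed (use \<sigma> in auto)
  then show ?thesis
    using r r' unfolding u_def w_def by (intro exI[of _ "r \<circ> r'"]) (auto simp: strict_mono_o)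
qed

text \<open>A failing sequence of pairs at distance below \<open>1 / (n + 1)\<close> would have a
  subsequence along which the derivatives approach each other.\<close>

lemma D_unif:
  assumes "e > 0"
  shows "\<exists>d>0. \<forall>u\<in>h01 \<Omega>. \<forall>w\<in>h01 \<Omega>. norm u \<le> R \<longrightarrow> norm w \<le> R \<longrightarrow> norm (u - w) < d \<longrightarrow> norm (D u - D w) < e"
proof (rule ccontr)
  assume neg: "\<not> ?thesis"
  have "\<exists>u w. u \<in> h01 \<Omega> \<and> w \<in> h01 \<Omega> \<and> norm u \<le> R \<and> norm w \<le> R \<and> norm (u - w) < 1 / real (Suc n) \<and> e \<le> norm (D u - D w)" for n
  proof -
    have "1 / real (Suc n) > 0" by simp
    with neg show ?thesis by (meson not_le)
  qed
  then obtain U W where UW: "\<And>n. U n \<in> h01 \<Omega>" "\<And>n. W n \<in> h01 \<Omega>" "\<And>n. norm (U n) \<le> R" "\<And>n. norm (W n) \<le> R"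
    "\<And>n. norm (U n - W n) < 1 / real (Suc n)" "\<And>n. e \<le> norm (D (U n) - D (W n))" by metis
  have "(\<lambda>n. U n - W n) \<longlonglongrightarrow> 0"
    by (rule Lim_null_comparison[OF _ LIMSEQ_inverse_real_of_nat])
      (use UW(5) in \<open>auto simp: inverse_eq_divide intro!: always_eventually less_imp_le\<close>)
  from D_diff_tendsto_0_subseq[of U R W, OF UW(1,3,2,4) this] obtain r where "(\<lambda>n. norm (D (U (r n)) - D (W (r n)))) \<longlonglongrightarrow> 0" by blast
  then have "e \<le> 0" using UW(6) by (intro LIMSEQ_le_const) auto
  then show False using assms by simp
qed

lemma uniform_C1: "uniform_C1_functional (h01 \<Omega>) J D"
  by unfold_locales (use subspace_h01 D_spec(1) J_deriv D_unif in auto)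

section \<open>The Palais--Smale condition\<close>

text \<open>Boundedness of the sequence comes from the bounded sublevel sets. The inequality
  \<open>key\<close> for the squared gradient norm \<open>x n\<close> of the difference from the
  weak limit makes no reference to \<open>c\<close>, so every level is admissible; strong
  convergence then passes \<open>J\<close> and \<open>D\<close> to the limit.\<close>

lemma palais_smale:
  assumes c0: "c0 > 0" "\<And>x. x \<ge> 0 \<Longrightarrow> c0 \<le> a + b * x - \<sigma> * x powr ((q - 2) / 2)"
    and bdd: "\<And>l. \<exists>R. \<forall>u\<in>h01 \<Omega>. J u \<le> l \<longrightarrow> norm u \<le> R"
    and PS: "\<And>e. e > 0 \<Longrightarrow> \<exists>u\<in>h01 \<Omega>. \<bar>J u - c\<bar> < e \<and> norm (D u) < e"
  shows "\<exists>u\<in>h01 \<Omega>. J u = c \<and> D u = 0"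
proof -
  interpret C1: uniform_C1_functional "h01 \<Omega>" J D by (rule uniform_C1)
  have "\<exists>u\<in>h01 \<Omega>. \<bar>J u - c\<bar> < 1 / real (Suc n) \<and> norm (D u) < 1 / real (Suc n)" for n by (rule PS) simp
  then obtain U where U: "\<And>n. U n \<in> h01 \<Omega>" "\<And>n. \<bar>J (U n) - c\<bar> < 1 / real (Suc n)" "\<And>n. norm (D (U n)) < 1 / real (Suc n)"
    by metis
  obtain R where R: "\<And>u. u \<in> h01 \<Omega> \<Longrightarrow> J u \<le> c + 1 \<Longrightarrow> norm u \<le> R" using bdd by blast
  have UR: "norm (U n) \<le> R" for n
  proof -
    have "1 / real (Suc n) \<le> 1" by simp
    then have "J (U n) \<le> c + 1" using U(2)[of n] by linarith
    then show ?thesis by (rule R[OF U(1)])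
  qed
  have J_lim: "(\<lambda>n. J (U n)) \<longlonglongrightarrow> c"
    by (rule LIM_zero_cancel, rule Lim_null_comparison[OF _ LIMSEQ_inverse_real_of_nat])
      (use U(2) in \<open>auto simp: inverse_eq_divide intro!: always_eventually less_imp_le\<close>)
  have D_lim: "(\<lambda>n. D (U n)) \<longlonglongrightarrow> 0"
    by (rule Lim_null_comparison[OF _ LIMSEQ_inverse_real_of_nat])
      (use U(3) in \<open>auto simp: inverse_eq_divide intro!: always_eventually less_imp_le\<close>)
  obtain r Z where r: "strict_mono (r :: nat \<Rightarrow> nat)" and Z: "Z \<in> h01 \<Omega>"
    and weak: "\<And>z. (\<lambda>n. U (r n) \<bullet> z) \<longlonglongrightarrow> Z \<bullet> z"
    and strong: "(\<lambda>n. snd (U (r n))) \<longlonglongrightarrow> snd Z"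
    and ae: "AE x in lebesgue. (\<lambda>n. fn (U (r n)) x) \<longlonglongrightarrow> fn Z x"
    using h01_weak_AE_subseq[of U R, OF U(1) UR] by blast
  define u where "u n = U (r n)" for n
  define v where "v n = u n - Z" for n
  have u: "u n \<in> h01 \<Omega>" "norm (u n) \<le> R" for n by (auto simp: u_def U UR)
  have v: "v n \<in> h01 \<Omega>" for n unfolding v_def by (rule subspace_diff[OF subspace_h01 u(1) Z])
  define R' where "R' = R + norm Z"
  have vR: "norm (v n) \<le> R'" for n
    using norm_triangle_ineq4[of "u n" Z] u(2)[of n] by (simp add: v_def R'_def)
  have uR': "norm (u n) \<le> R'" for n using u(2)[of n] by (simp add: R'_def add_increasing2)
  have R'0: "R' \<ge> 0" using vR[of 0] norm_ge_zero order_trans by blast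
  have Jr: "(\<lambda>n. J (u n)) \<longlonglongrightarrow> c" using LIMSEQ_subseq_LIMSEQ[OF J_lim r] by (simp add: o_def u_def)
  have Dr: "(\<lambda>n. D (u n)) \<longlonglongrightarrow> 0" using LIMSEQ_subseq_LIMSEQ[OF D_lim r] by (simp add: o_def u_def)
  have ae_u: "AE x in M. (\<lambda>n. fn (u n) x) \<longlonglongrightarrow> fn Z x" using AE_M[OF ae] by (simp add: u_def)
  have fn_v: "AE x in M. \<forall>n. fn (v n) x = fn (u n) x - fn Z x"
    unfolding AE_all_countable v_def by (intro allI fn_diff)
  have ae_v: "AE x in M. (\<lambda>n. fn (v n) x) \<longlonglongrightarrow> 0"
    using ae_u fn_v
  proof eventually_elim
    case (elim x)
    then show ?case using LIM_zero[OF elim(1)] by simp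
  qed
  \<comment> \<open>\<open>x n\<close> measures the defect of strong convergence;
    \<open>\<epsilon> n\<close> is the mixed term, which vanishes in the limit by weak convergence
    tested with \<open>(fst Z, 0)\<close>.\<close>
  define x where "x n = (norm (fst (v n)))\<^sup>2" for n
  define \<epsilon> where "\<epsilon> n = fst Z \<bullet> fst (v n)" for n
  have \<epsilon>: "\<epsilon> \<longlonglongrightarrow> 0"
  proof -
    have "(\<lambda>n. U (r n) \<bullet> (fst Z, 0) - Z \<bullet> (fst Z, 0)) \<longlonglongrightarrow> Z \<bullet> (fst Z, 0) - Z \<bullet> (fst Z, 0)"
      by (intro tendsto_diff weak tendsto_const)
    moreover have "U (r n) \<bullet> (fst Z, 0) - Z \<bullet> (fst Z, 0) = \<epsilon> n" for n
      by (simp add: \<epsilon>_def v_def u_def inner_prod_def inner_diff_right inner_commute)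
    ultimately show ?thesis by simp
  qed
  have uv: "fst (u n) \<bullet> fst (v n) = x n + \<epsilon> n" for n
  proof -
    have "fst (u n) = fst (v n) + fst Z" by (simp add: v_def)
    then show ?thesis by (simp add: x_def \<epsilon>_def inner_add_left power2_norm_eq_inner)
  qed
  have uu: "(norm (fst (u n)))\<^sup>2 = x n + 2 * \<epsilon> n + (norm (fst Z))\<^sup>2" for n
  proof -
    have "fst (u n) = fst (v n) + fst Z" by (simp add: v_def)
    then show ?thesis
      by (simp add: x_def \<epsilon>_def inner_add_left inner_add_right power2_norm_eq_inner inner_commute)
  qed
  have x0: "x n \<ge> 0" for n by (simp add: x_def)
  have xR: "x n \<le> R'\<^sup>2" for n
    unfolding x_def using norm_fst[of "v n"] vR[of n] by (intro power_mono) auto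
  have \<epsilon>R: "\<bar>\<epsilon> n\<bar> \<le> R'\<^sup>2" for n
  proof -
    have "\<bar>\<epsilon> n\<bar> \<le> norm (fst Z) * norm (fst (v n))" unfolding \<epsilon>_def by (rule Cauchy_Schwarz_ineq2)
    also have "\<dots> \<le> R' * R'"
    proof (intro mult_mono)
      have "R \<ge> 0" using u(2)[of 0] norm_ge_zero order_trans by blast
      then show "norm (fst Z) \<le> R'" using norm_fst[of Z] unfolding R'_def by linarith
      show "norm (fst (v n)) \<le> R'" using norm_fst[of "v n"] vR[of n] by linarith
    qed (use R'0 in auto)
    finally show ?thesis by (simp add: power2_eq_square)
  qed
  \<comment> \<open>The critical and the subcritical part of the nonlinearity paired with
    \<open>v n\<close>; \<open>Q n\<close> is what is left of \<open>E1 n\<close> in the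
    limit.\<close>
  define E1 where "E1 n = (LINT x|M. crit_pow q (fn (u n) x) * fn (v n) x)" for n
  define E2 where "E2 n = (LINT x|M. k x (fn (u n) x) * fn (v n) x)" for n
  define Q where "Q n = (LINT x|M. \<bar>fn (v n) x\<bar> powr q)" for n
  have [measurable]: "crit_pow q \<in> borel_measurable borel"
    by (intro borel_measurable_continuous_onI continuous_crit_pow q)
  have vq: "(LINT x|M. \<bar>fn (v n) x\<bar> powr q) \<le> \<sigma> * R' powr q" for n by (rule fn_powr_le[OF v vR])
  have uq: "(LINT x|M. \<bar>fn (u n) x\<bar> powr q) \<le> \<sigma> * R' powr q" for n by (rule fn_powr_le[OF u(1) uR'])
  have km: "(\<lambda>x. k x (fn (u n) x) * fn (v n) x) \<in> borel_measurable M" for n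
    by (intro borel_measurable_times k_meas') auto
  have E2_int: "integrable M (\<lambda>x. k x (fn (u n) x) * fn (v n) x)" for n
  proof -
    obtain C where C: "\<And>x s t. x \<in> \<Omega> \<Longrightarrow> \<bar>k x s * t\<bar> \<le> 1 * (\<bar>s\<bar> powr q + \<bar>t\<bar> powr q) + C"
      using k_times_bound[of 1] by auto
    show ?thesis
    proof (rule Bochner_Integration.integrable_bound)
      show "integrable M (\<lambda>x. 1 * (\<bar>fn (u n) x\<bar> powr q + \<bar>fn (v n) x\<bar> powr q) + C)"
        using fn_int[OF u(1)] fn_int[OF v] by simp
      show "AE x in M. norm (k x (fn (u n) x) * fn (v n) x) \<le> norm (1 * (\<bar>fn (u n) x\<bar> powr q + \<bar>fn (v n) x\<bar> powr q) + C)"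
      proof (rule AE_I2)
        fix x assume "x \<in> space M"
        then show "norm (k x (fn (u n) x) * fn (v n) x) \<le> norm (1 * (\<bar>fn (u n) x\<bar> powr q + \<bar>fn (v n) x\<bar> powr q) + C)"
          using C[of x "fn (u n) x" "fn (v n) x"] unfolding real_norm_def by simp
      qed
    qed (rule km)
  qed
  have E2: "E2 \<longlonglongrightarrow> 0"
  proof (rule Lim_null_comparison)
    show "\<forall>\<^sub>F n in sequentially. norm (E2 n) \<le> (LINT x|M. \<bar>k x (fn (u n) x) * fn (v n) x\<bar>)"
      unfolding E2_def real_norm_def by (intro always_eventually allI integral_abs_bound)
    show "(\<lambda>n. LINT x|M. \<bar>k x (fn (u n) x) * fn (v n) x\<bar>) \<longlonglongrightarrow> 0"
    proof (rule integral_tendsto_0_eps_dominated[where Y="\<lambda>n x. \<bar>fn (u n) x\<bar> powr q + \<bar>fn (v n) x\<bar> powr q" and B="2 * (\<sigma> * R' powr q)"])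
      show "AE x in M. (\<lambda>n. \<bar>k x (fn (u n) x) * fn (v n) x\<bar>) \<longlonglongrightarrow> 0"
        using ae_u ae_v AE_space[of M]
      proof eventually_elim
        case (elim x)
        have "continuous_on UNIV (k x)" using elim(3) by (intro k_cont) simp
        from continuous_on_tendsto_compose[OF this elim(1)]
        have "(\<lambda>n. k x (fn (u n) x)) \<longlonglongrightarrow> k x (fn Z x)" by simp
        from tendsto_rabs[OF tendsto_mult[OF this elim(2)]] show ?case by simp
      qed
      show "integrable M (\<lambda>x. \<bar>fn (u n) x\<bar> powr q + \<bar>fn (v n) x\<bar> powr q)" for n
        using fn_int[OF u(1)] fn_int[OF v] by simp
      show "(LINT x|M. \<bar>fn (u n) x\<bar> powr q + \<bar>fn (v n) x\<bar> powr q) \<le> 2 * (\<sigma> * R' powr q)" for n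
        using fn_int[OF u(1), of n] fn_int[OF v, of n] uq[of n] vq[of n] by simp
      fix e :: real assume "e > 0"
      then obtain C where C: "\<And>x s t. x \<in> \<Omega> \<Longrightarrow> \<bar>k x s * t\<bar> \<le> e * (\<bar>s\<bar> powr q + \<bar>t\<bar> powr q) + C"
        using k_times_bound by metis
      then show "\<exists>W. integrable M W \<and> (\<forall>n. AE x in M. \<bar>k x (fn (u n) x) * fn (v n) x\<bar> \<le> e * (\<bar>fn (u n) x\<bar> powr q + \<bar>fn (v n) x\<bar> powr q) + W x)"
        by (intro exI[of _ "\<lambda>x. C"] conjI allI AE_I2) auto
    qed (use km in auto)
  qed
  have bl_m: "(\<lambda>x. \<bar>crit_pow q (fn Z x + fn (v n) x) * fn (v n) x - \<bar>fn (v n) x\<bar> powr q\<bar>) \<in> borel_measurable M" for n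
    by measurable
  \<comment> \<open>Brezis--Lieb: with \<open>u n = Z + v n\<close> the error is bounded by a small
    multiple of \<open>|v n|^q\<close> plus a fixed integrable function of \<open>Z\<close>, and it
    tends to \<open>0\<close> almost everywhere.\<close>
  have BL: "(\<lambda>n. LINT x|M. \<bar>crit_pow q (fn Z x + fn (v n) x) * fn (v n) x - \<bar>fn (v n) x\<bar> powr q\<bar>) \<longlonglongrightarrow> 0"
  proof (rule integral_tendsto_0_eps_dominated[where Y="\<lambda>n x. \<bar>fn (v n) x\<bar> powr q" and B="\<sigma> * R' powr q"])
    show "AE x in M. (\<lambda>n. \<bar>crit_pow q (fn Z x + fn (v n) x) * fn (v n) x - \<bar>fn (v n) x\<bar> powr q\<bar>) \<longlonglongrightarrow> 0"
      using ae_v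
    proof eventually_elim
      case (elim x)
      have "(\<lambda>n. crit_pow q (fn Z x + fn (v n) x)) \<longlonglongrightarrow> crit_pow q (fn Z x + 0)"
        using continuous_on_tendsto_compose[OF continuous_crit_pow[OF q(2), of UNIV] tendsto_add[OF tendsto_const elim]] by simp
      from tendsto_rabs[OF tendsto_diff[OF tendsto_mult[OF this elim] tendsto_powr'[OF tendsto_rabs[OF elim] tendsto_const[of q]]]] q
      show ?case by (auto intro: always_eventually)
    qed
    fix e :: real assume "e > 0"
    then obtain C where C: "C \<ge> 0" "\<And>u v. \<bar>crit_pow q (u + v) * v - \<bar>v\<bar> powr q\<bar> \<le> e * \<bar>v\<bar> powr q + C * \<bar>u\<bar> powr q"
      using brezis_lieb_pointwise[OF q(2)] by blast
    show "\<exists>W. integrable M W \<and> (\<forall>n. AE x in M. \<bar>crit_pow q (fn Z x + fn (v n) x) * fn (v n) x - \<bar>fn (v n) x\<bar> powr q\<bar> \<le> e * \<bar>fn (v n) x\<bar> powr q + W x)"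
      using fn_int[OF Z] by (intro exI[of _ "\<lambda>x. C * \<bar>fn Z x\<bar> powr q"] conjI allI AE_I2 C(2)) simp
  qed (use bl_m fn_int[OF v] vq in auto)
  have E1_int: "integrable M (\<lambda>x. crit_pow q (fn (u n) x) * fn (v n) x)" for n
    using Bochner_Integration.integrable_diff[OF f_int[OF u(1)[of n] v[of n]] E2_int[of n]]
    by (simp add: f_def distrib_right)
  have E1: "(\<lambda>n. E1 n - Q n) \<longlonglongrightarrow> 0"
  proof (rule Lim_null_comparison[OF _ BL], intro always_eventually allI)
    fix n
    have "E1 n - Q n = (LINT x|M. crit_pow q (fn (u n) x) * fn (v n) x - \<bar>fn (v n) x\<bar> powr q)"
      unfolding E1_def Q_def using E1_int fn_int[OF v] by simp
    also have "\<dots> = (LINT x|M. crit_pow q (fn Z x + fn (v n) x) * fn (v n) x - \<bar>fn (v n) x\<bar> powr q)"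
    proof (rule integral_cong_AE)
      show "AE x in M. crit_pow q (fn (u n) x) * fn (v n) x - \<bar>fn (v n) x\<bar> powr q = crit_pow q (fn Z x + fn (v n) x) * fn (v n) x - \<bar>fn (v n) x\<bar> powr q"
        using fn_v by eventually_elim simp
    qed measurable
    finally have eq: "E1 n - Q n = \<dots>" .
    show "norm (E1 n - Q n) \<le> (LINT x|M. \<bar>crit_pow q (fn Z x + fn (v n) x) * fn (v n) x - \<bar>fn (v n) x\<bar> powr q\<bar>)"
      unfolding eq real_norm_def by (rule integral_abs_bound)
  qed
  have Q_le: "Q n \<le> \<sigma> * x n powr (q / 2)" for n
  proof -
    have "x n powr (q / 2) = norm (fst (v n)) powr q"
      unfolding x_def by (cases "norm (fst (v n)) = 0") (auto simp: powr_powr simp flip: powr_numeral)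
    then show ?thesis unfolding Q_def using sobolev[OF v[of n]] by simp
  qed
  \<comment> \<open>The derivative at \<open>u n\<close> in the direction \<open>v n\<close>; small,
    since \<open>D (u n)\<close> tends to \<open>0\<close> and \<open>v n\<close> is
    bounded.\<close>
  define \<delta> where "\<delta> n = L (u n) (v n)" for n
  have \<delta>: "\<delta> \<longlonglongrightarrow> 0"
  proof (rule Lim_null_comparison)
    show "\<forall>\<^sub>F n in sequentially. norm (\<delta> n) \<le> norm (D (u n)) * R'"
    proof (intro always_eventually allI)
      fix n
      have "norm (\<delta> n) = \<bar>D (u n) \<bullet> v n\<bar>" by (simp add: \<delta>_def D_spec(2)[OF u(1) v])
      also have "\<dots> \<le> norm (D (u n)) * norm (v n)" by (rule Cauchy_Schwarz_ineq2)
      also have "\<dots> \<le> norm (D (u n)) * R'" using vR by (intro mult_left_mono) auto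
      finally show "norm (\<delta> n) \<le> norm (D (u n)) * R'" .
    qed
    show "(\<lambda>n. norm (D (u n)) * R') \<longlonglongrightarrow> 0" using tendsto_mult[OF tendsto_norm_zero[OF Dr] tendsto_const[of R']] by simp
  qed
  have \<delta>_eq: "\<delta> n = (a + b * (x n + 2 * \<epsilon> n + (norm (fst Z))\<^sup>2)) * (x n + \<epsilon> n) - E1 n - E2 n" for n
  proof -
    have "(LINT x|M. f x (fn (u n) x) * fn (v n) x) = E1 n + E2 n"
      unfolding E1_def E2_def f_def using E1_int E2_int by (simp add: distrib_right)
    then show ?thesis by (simp add: \<delta>_def L_def uv uu)
  qed
  \<comment> \<open>The total coefficient of \<open>\<epsilon> n\<close> after expanding the
    Kirchhoff term in \<open>\<delta>_eq\<close>. It is bounded, so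
    \<open>G n * \<epsilon> n\<close> vanishes in the limit.\<close>
  define G where "G n = a + b * (3 * x n + 2 * \<epsilon> n + (norm (fst Z))\<^sup>2)" for n
  have GR: "\<bar>G n\<bar> \<le> a + b * (5 * R'\<^sup>2 + (norm (fst Z))\<^sup>2)" for n
  proof -
    have "\<bar>3 * x n + 2 * \<epsilon> n + (norm (fst Z))\<^sup>2\<bar> \<le> 5 * R'\<^sup>2 + (norm (fst Z))\<^sup>2"
    proof -
      have "0 \<le> (norm (fst Z))\<^sup>2" "0 \<le> R'\<^sup>2" by simp_all
      then show ?thesis using x0[of n] xR[of n] \<epsilon>R[of n] by linarith
    qed
    then have "\<bar>b * (3 * x n + 2 * \<epsilon> n + (norm (fst Z))\<^sup>2)\<bar> \<le> b * (5 * R'\<^sup>2 + (norm (fst Z))\<^sup>2)"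
      using ab by (simp add: abs_mult)
    then show ?thesis unfolding G_def using ab by linarith
  qed
  have G\<epsilon>: "(\<lambda>n. G n * \<epsilon> n) \<longlonglongrightarrow> 0"
  proof (rule Lim_null_comparison)
    show "\<forall>\<^sub>F n in sequentially. norm (G n * \<epsilon> n) \<le> (a + b * (5 * R'\<^sup>2 + (norm (fst Z))\<^sup>2)) * \<bar>\<epsilon> n\<bar>"
      using GR by (intro always_eventually allI) (auto simp: abs_mult intro!: mult_right_mono)
    show "(\<lambda>n. (a + b * (5 * R'\<^sup>2 + (norm (fst Z))\<^sup>2)) * \<bar>\<epsilon> n\<bar>) \<longlonglongrightarrow> 0"
      using tendsto_mult[OF tendsto_const tendsto_rabs_zero[OF \<epsilon>]] by simp
  qed
  have key: "c0 * x n \<le> \<delta> n + (E1 n - Q n) + E2 n - G n * \<epsilon> n" for n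
  proof -
    have "c0 * x n \<le> (a + b * x n - \<sigma> * x n powr ((q - 2) / 2)) * x n"
      using c0(2)[OF x0[of n]] x0[of n] by (intro mult_right_mono)
    also have "x n powr ((q - 2) / 2) * x n = x n powr (q / 2)"
    proof -
      have e: "q / 2 = (q - 2) / 2 + 1" by (simp add: field_simps)
      show ?thesis unfolding e powr_add using x0[of n] by simp
    qed
    then have "(a + b * x n - \<sigma> * x n powr ((q - 2) / 2)) * x n = (a + b * x n) * x n - \<sigma> * x n powr (q / 2)"
      by (simp add: left_diff_distrib mult.assoc)
    also have "\<dots> \<le> (a + b * x n) * x n - Q n" using Q_le[of n] by simp
    \<comment> \<open>The nonlocal coefficient contains the energy of \<open>Z\<close> too, but this
      contributes a nonnegative term only.\<close>
    also have "\<dots> \<le> (a + b * (x n + (norm (fst Z))\<^sup>2)) * x n - Q n"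
      using ab x0[of n] by (intro diff_right_mono mult_right_mono) auto
    also have "\<dots> = \<delta> n + (E1 n - Q n) + E2 n - (G n * \<epsilon> n)"
      unfolding \<delta>_eq G_def by (simp add: algebra_simps)
    finally show ?thesis .
  qed
  have "(\<lambda>n. \<delta> n + (E1 n - Q n) + E2 n - G n * \<epsilon> n) \<longlonglongrightarrow> 0 + 0 + 0 - 0"
    by (intro tendsto_intros \<delta> E1 E2 G\<epsilon>)
  then have lim: "(\<lambda>n. (\<delta> n + (E1 n - Q n) + E2 n - G n * \<epsilon> n) / c0) \<longlonglongrightarrow> 0"
    by (intro tendsto_divide_zero) simp
  have "x n \<le> (\<delta> n + (E1 n - Q n) + E2 n - G n * \<epsilon> n) / c0" for n
    using key[of n] c0(1) by (simp add: pos_le_divide_eq mult.commute)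
  then have ev: "\<forall>\<^sub>F n in sequentially. norm (x n) \<le> (\<delta> n + (E1 n - Q n) + E2 n - G n * \<epsilon> n) / c0"
    using x0 by (intro always_eventually allI) simp
  have "x \<longlonglongrightarrow> 0" by (rule Lim_null_comparison[OF ev lim])
  then have "(\<lambda>n. sqrt (x n)) \<longlonglongrightarrow> sqrt 0" by (rule tendsto_real_sqrt)
  then have fv: "(\<lambda>n. fst (v n)) \<longlonglongrightarrow> 0" by (simp add: x_def tendsto_norm_zero_iff)
  have "(\<lambda>n. fst (v n) + fst Z) \<longlonglongrightarrow> 0 + fst Z" by (intro tendsto_intros fv)
  then have "(\<lambda>n. fst (u n)) \<longlonglongrightarrow> fst Z" by (simp add: v_def)
  moreover have "(\<lambda>n. snd (u n)) \<longlonglongrightarrow> snd Z" using strong by (simp add: u_def)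
  ultimately have "(\<lambda>n. (fst (u n), snd (u n))) \<longlonglongrightarrow> (fst Z, snd Z)" by (rule tendsto_Pair)
  then have uZ: "u \<longlonglongrightarrow> Z" by simp
  have "(\<lambda>n. D (u n)) \<longlonglongrightarrow> D Z"
    using continuous_on_tendsto_compose[OF C1.continuous_D uZ Z] u(1) by simp
  then have "D Z = 0" using Dr LIMSEQ_unique by blast
  moreover have "(\<lambda>n. J (u n)) \<longlonglongrightarrow> J Z"
    using continuous_on_tendsto_compose[OF C1.continuous_J uZ Z] u(1) by simp
  then have "J Z = c" using Jr LIMSEQ_unique by blast
  ultimately show ?thesis using Z by blast
qed

end

section \<open>The threshold \<open>PS_const\<close> and the sharp Sobolev constant\<close>

text \<open>Let \<open>\<theta> = (q - 2) / 2 = 2 / (d - 2)\<close>. For \<open>d > 4\<close>, AM-GM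
  with weights \<open>1 - \<theta>\<close> and \<open>\<theta>\<close> gives
  \<open>\<kappa> * x powr \<theta> \<le> a + b * x\<close> with \<open>\<kappa> = (a / (1 -
  \<theta>)) powr (1 - \<theta>) * (b / \<theta>) powr \<theta>\<close>, and \<open>PS\<close> is
  the inequality \<open>\<sigma> < \<kappa>\<close> raised to the power \<open>1 / \<theta>\<close>.
  For \<open>d = 4\<close> the expression is affine and the condition reads
  \<open>\<sigma> < b\<close>. The second conclusion is kept for the coercivity.\<close>

lemma ps_condition_imp_gap:
  fixes a b S d :: real
  defines "q \<equiv> 2 * d / (d - 2)"
  assumes ab: "a > 0" "b > 0" and S: "S > 0" and d: "d \<ge> 4"
    and PS: "a powr ((d - 4) / 2) * b >
      (if d = 4 then 1 / S\<^sup>2 else 2 * (d - 4) powr ((d - 4) / 2) / ((d - 2) powr ((d - 2) / 2) * S powr (d / 2)))"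
  shows "\<exists>c0>0. \<forall>x\<ge>0. c0 \<le> a + b * x - S powr (- q / 2) * x powr ((q - 2) / 2)"
    and "q < 4 \<or> (q = 4 \<and> S powr (- q / 2) < b)"
proof -
  define \<sigma> where "\<sigma> = S powr (- q / 2)"
  have \<sigma>: "\<sigma> > 0" using S by (simp add: \<sigma>_def)
  define \<theta> where "\<theta> = 2 / (d - 2)"
  have \<theta>q: "(q - 2) / 2 = \<theta>" using d by (simp add: q_def \<theta>_def field_simps)
  have "\<exists>c0>0. \<forall>x\<ge>0. c0 \<le> a + b * x - \<sigma> * x powr \<theta>" and "q < 4 \<or> (q = 4 \<and> \<sigma> < b)"
  proof -
    have "d = 4 \<or> d > 4" using d by auto
    then have "(\<exists>c0>0. \<forall>x\<ge>0. c0 \<le> a + b * x - \<sigma> * x powr \<theta>) \<and> (q < 4 \<or> (q = 4 \<and> \<sigma> < b))"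
    proof
      assume d4: "d = 4"
      have q4: "q = 4" "\<theta> = 1" by (simp_all add: q_def \<theta>_def d4)
      have "\<sigma> = 1 / S\<^sup>2" using S by (simp add: \<sigma>_def q4 powr_minus_divide)
      then have \<sigma>b: "\<sigma> < b" using PS ab by (simp add: d4)
      have "a \<le> a + b * x - \<sigma> * x powr \<theta>" if "x \<ge> 0" for x
        using \<sigma>b that by (simp add: q4 mult_right_mono)
      then show ?thesis using ab q4 \<sigma>b by blast
    next
      assume d4: "d > 4"
      have q4: "q < 4" using d4 by (simp add: q_def field_simps)
      have \<theta>: "0 < \<theta>" "\<theta> < 1" using d4 by (auto simp: \<theta>_def field_simps)
      \<comment> \<open>\<open>u\<close> and \<open>w\<close> are chosen so that
        \<open>(1 - \<theta>) * u + \<theta> * (w * x) = a + b * x\<close>.\<close>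
      define u where "u = a / (1 - \<theta>)"
      define w where "w = b / \<theta>"
      have uw: "u > 0" "w > 0" using ab \<theta> by (auto simp: u_def w_def)
      define \<kappa> where "\<kappa> = u powr (1 - \<theta>) * w powr \<theta>"
      have \<kappa>: "\<kappa> > 0" using uw by (simp add: \<kappa>_def)
      have amgm: "\<kappa> * x powr \<theta> \<le> a + b * x" if "x \<ge> 0" for x
      proof (cases "x = 0")
        case False
        then have x: "x > 0" using that by simp
        have "u powr (1 - \<theta>) * (w * x) powr \<theta> \<le> (1 - \<theta>) * u + \<theta> * (w * x)"
          using Youngs_inequality_0[of "1 - \<theta>" \<theta> u "w * x"] uw x \<theta> by simp
        also have "\<dots> = a + b * x" using \<theta> by (simp add: u_def w_def)
        finally show ?thesis using uw x by (simp add: \<kappa>_def powr_mult mult.assoc)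
      qed (use ab in simp)
      have "\<sigma> < \<kappa>"
      proof (rule ccontr)
        assume "\<not> \<sigma> < \<kappa>"
        then have "\<kappa> powr (1 / \<theta>) \<le> \<sigma> powr (1 / \<theta>)" using \<kappa> \<theta> by (intro powr_mono2) auto
        moreover have "\<sigma> powr (1 / \<theta>) = S powr (- (d / 2))"
        proof -
          have "- q / 2 * (1 / \<theta>) = - (d / 2)" using d4 by (simp add: q_def \<theta>_def field_simps)
          then show ?thesis by (simp only: \<sigma>_def powr_powr)
        qed
        \<comment> \<open>Raising to \<open>1 / \<theta> = (d - 2) / 2\<close> gives
          \<open>a\<close> the exponent \<open>(d - 4) / 2\<close> and \<open>b\<close> the exponent
          \<open>1\<close>, as in the hypothesis.\<close>
        moreover have "\<kappa> powr (1 / \<theta>) = a powr ((d - 4) / 2) * b * ((d - 2) powr ((d - 2) / 2) / (2 * (d - 4) powr ((d - 4) / 2)))"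
        proof -
          have e1: "(1 - \<theta>) * (1 / \<theta>) = (d - 4) / 2" using d4 by (simp add: \<theta>_def field_simps)
          have "\<kappa> powr (1 / \<theta>) = u powr ((1 - \<theta>) * (1 / \<theta>)) * w powr (\<theta> * (1 / \<theta>))"
            using uw by (simp only: \<kappa>_def powr_mult powr_powr)
          also have "\<dots> = u powr ((d - 4) / 2) * w" using \<theta> uw by (simp only: e1) simp
          also have "u = a * (d - 2) / (d - 4)"
          proof -
            have "1 - \<theta> = (d - 4) / (d - 2)" using d4 by (simp add: \<theta>_def field_simps)
            then show ?thesis using d4 by (simp add: u_def)
          qed
          also have "w = b * (d - 2) / 2" using d4 by (simp add: w_def \<theta>_def)
          also have "(a * (d - 2) / (d - 4)) powr ((d - 4) / 2) =
            a powr ((d - 4) / 2) * (d - 2) powr ((d - 4) / 2) / (d - 4) powr ((d - 4) / 2)"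
            using ab d4 by (simp add: powr_mult powr_divide)
          also have "a powr ((d - 4) / 2) * (d - 2) powr ((d - 4) / 2) / (d - 4) powr ((d - 4) / 2) * (b * (d - 2) / 2)
            = a powr ((d - 4) / 2) * b * ((d - 2) powr ((d - 4) / 2) * (d - 2) / (2 * (d - 4) powr ((d - 4) / 2)))"
            by (simp add: mult_ac)
          also have "(d - 2) powr ((d - 4) / 2) * (d - 2) = (d - 2) powr ((d - 2) / 2)"
          proof -
            have e: "(d - 2) / 2 = (d - 4) / 2 + 1" by (simp add: field_simps)
            show ?thesis unfolding e powr_add using d4 by simp
          qed
          finally show ?thesis .
        qed
        ultimately have le: "a powr ((d - 4) / 2) * b * ((d - 2) powr ((d - 2) / 2) / (2 * (d - 4) powr ((d - 4) / 2))) \<le> S powr (- (d / 2))"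
          by simp
        have P: "(d - 2) powr ((d - 2) / 2) > 0" "(d - 4) powr ((d - 4) / 2) > 0" "S powr (d / 2) > 0" using d4 S by auto
        have "a powr ((d - 4) / 2) * b \<le> S powr (- (d / 2)) * (2 * (d - 4) powr ((d - 4) / 2)) / (d - 2) powr ((d - 2) / 2)"
        proof -
          have "x \<le> y * (2 * B) / A" if "x * (A / (2 * B)) \<le> y" "A > 0" "B > 0" for x y A B :: real
            using that by (simp add: field_simps)
          from this[OF le P(1,2)] show ?thesis .
        qed
        also have "\<dots> = 2 * (d - 4) powr ((d - 4) / 2) / ((d - 2) powr ((d - 2) / 2) * S powr (d / 2))"
          by (simp add: powr_minus_divide)
        finally show False using PS d4 by simp
      qed
      \<comment> \<open>The fraction \<open>\<sigma> / \<kappa>\<close> of \<open>a + b * x\<close>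
        absorbs the power; the remaining fraction is smallest at \<open>x = 0\<close>.\<close>
      define c0 where "c0 = a * (1 - \<sigma> / \<kappa>)"
      have r: "1 - \<sigma> / \<kappa> > 0" using \<open>\<sigma> < \<kappa>\<close> \<kappa> by (simp add: pos_divide_less_eq)
      have "c0 \<le> a + b * x - \<sigma> * x powr \<theta>" if x: "x \<ge> 0" for x
      proof -
        have "c0 \<le> (a + b * x) * (1 - \<sigma> / \<kappa>)"
          unfolding c0_def using r ab x by (intro mult_right_mono) auto
        also have "\<dots> = a + b * x - (\<sigma> / \<kappa>) * (a + b * x)" by (simp add: algebra_simps)
        also have "\<dots> \<le> a + b * x - (\<sigma> / \<kappa>) * (\<kappa> * x powr \<theta>)"
          using amgm[OF x] \<sigma> \<kappa> by (intro diff_left_mono mult_left_mono) auto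
        finally show ?thesis using \<kappa> by simp
      qed
      moreover have "c0 > 0" using ab r by (simp add: c0_def)
      ultimately show ?thesis using q4 by blast
    qed
    then show "\<exists>c0>0. \<forall>x\<ge>0. c0 \<le> a + b * x - \<sigma> * x powr \<theta>" and "q < 4 \<or> (q = 4 \<and> \<sigma> < b)" by auto
  qed
  then show "\<exists>c0>0. \<forall>x\<ge>0. c0 \<le> a + b * x - S powr (- q / 2) * x powr ((q - 2) / 2)"
    and "q < 4 \<or> (q = 4 \<and> S powr (- q / 2) < b)" by (auto simp: \<theta>q \<sigma>_def)
qed

context bounded_domain begin

text \<open>A box bump supported in \<open>\<Omega>\<close> is positive on an open box, which is not
  negligible.\<close>

lemma exists_nonzero_h01:
  assumes "\<Omega> \<noteq> {}"
  shows "\<exists>E\<in>h01 \<Omega>. \<not> ae_eq \<Omega> (rep_l2 (snd E)) (\<lambda>x. 0)"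
proof -
  obtain x0 where "x0 \<in> \<Omega>" using assms by blast
  then obtain c d where cd: "x0 \<in> box c d" "cbox c d \<subseteq> \<Omega>"
    using open_contains_cbox[OF open_\<Omega>] by metis
  define g where "g = box_bump 1 c d"
  have g: "g \<in> test_functions \<Omega>" unfolding g_def by (intro box_bump_test_function cd) simp
  have "test_pair g \<in> h01 \<Omega>" 
    unfolding h01_def using imageI[OF g] closure_subset by (rule subsetD[rotated])
  moreover have "\<not> ae_eq \<Omega> (rep_l2 (snd (test_pair g))) (\<lambda>x. 0)"
  proof
    assume "ae_eq \<Omega> (rep_l2 (snd (test_pair g))) (\<lambda>x. 0)"
    then have "AE x in lebesgue. x \<in> \<Omega> \<longrightarrow> rep_l2 (snd (test_pair g)) x = 0" unfolding ae_eq_def AE_\<Omega> .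
    moreover have "AE x in lebesgue. rep_l2 (snd (test_pair g)) x = g x"
      unfolding test_pair_def snd_conv by (rule rep_abs_l2[OF C1c_square_integrable(1)[OF test_function_C1c[OF g]]])
    ultimately have "AE x in lebesgue. x \<notin> box c d"
    proof eventually_elim
      case (elim x)
      show ?case
      proof
        assume x: "x \<in> box c d"
        then have "x \<in> \<Omega>" using cd(2) box_subset_cbox by blast
        then have "g x = 0" using elim by simp
        then show False using box_bump_pos[OF x, of 1] by (simp add: g_def)
      qed
    qed
    then have "negligible (box c d)" unfolding negligible_iff_null_sets by (subst AE_iff_null_sets) auto
    then show False using cd(1) by (auto simp: negligible_interval)
  qed
  ultimately show ?thesis by blast
qed

lemma powr_norm: "x \<ge> 0 \<Longrightarrow> (x powr (1 / q))\<^sup>2 = x powr (2 / q)" for x q :: real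
  by (cases "x = 0") (simp_all add: powr_powr flip: powr_numeral)

text \<open>The crude Sobolev inequality bounds every quotient from below by
  \<open>1 / C powr (2 / q)\<close>, and the set of quotients is nonempty, so the infimum is
  positive. The inequality with the sharp constant is then the lower bound property of the infimum;
  functions that vanish almost everywhere are excluded from it and treated apart.\<close>

lemma sobolev_const_h01:
  assumes ne: "\<Omega> \<noteq> {}" and dim: "DIM('a) \<ge> 3"
  shows "sobolev_const \<Omega> > 0"
    and "U \<in> h01 \<Omega> \<Longrightarrow> (LINT x|lebesgue_on \<Omega>. \<bar>rep_l2 (snd U) x\<bar> powr crit_exp DIM('a))
      \<le> sobolev_const \<Omega> powr (- crit_exp DIM('a) / 2) * norm (fst U) powr crit_exp DIM('a)"
proof -
  define q where "q = crit_exp DIM('a)"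
  have q: "q > 0" using dim by (simp add: q_def crit_exp_def)
  define S where "S = sobolev_const \<Omega>"
  define I where "I u = (LINT x|lebesgue_on \<Omega>. \<bar>u x\<bar> powr q)" for u :: "'a \<Rightarrow> real"
  define X where "X = {u \<in> H01 \<Omega>. \<not> ae_eq \<Omega> u (\<lambda>x. 0)}"
  define ratio where "ratio u = (H01_norm \<Omega> u)\<^sup>2 / (Lq_norm \<Omega> q u)\<^sup>2" for u
  have S_eq: "S = (INF u\<in>X. ratio u)" by (simp add: S_def X_def ratio_def sobolev_const_def q_def)
  have I0: "I u \<ge> 0" for u unfolding I_def by (intro integral_nonneg_AE AE_I2) simp
  have Lq: "(Lq_norm \<Omega> q u)\<^sup>2 = I u powr (2 / q)" for u
    unfolding Lq_norm_def I_def[symmetric] by (rule powr_norm[OF I0])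
  have bb: "bdd_below (ratio ` X)" by (intro bdd_belowI[of _ 0]) (auto simp: ratio_def)
  obtain C where C: "C > 0" "\<And>U. U \<in> h01 \<Omega> \<Longrightarrow> integrable lebesgue (\<lambda>x. \<bar>rep_l2 (snd U) x\<bar> powr q)"
    "\<And>U. U \<in> h01 \<Omega> \<Longrightarrow> (LINT x|lebesgue. \<bar>rep_l2 (snd U) x\<bar> powr q) \<le> C * norm (fst U) powr q"
    using sobolev_h01[OF dim] unfolding q_def by blast
  have Iint: "integrable (lebesgue_on \<Omega>) (\<lambda>x. \<bar>rep_l2 (snd U) x\<bar> powr q)" if "U \<in> h01 \<Omega>" for U
  proof -
    have "integrable lebesgue (\<lambda>x. indicator \<Omega> x *\<^sub>R \<bar>rep_l2 (snd U) x\<bar> powr q)"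
      by (rule integrable_mult_indicator[rotated, OF C(2)[OF that]]) simp
    then show ?thesis by (subst integrable_restrict_space) simp_all
  qed
  have IC: "I (rep_l2 (snd U)) \<le> C * norm (fst U) powr q" if U: "U \<in> h01 \<Omega>" for U
  proof -
    have "I (rep_l2 (snd U)) \<le> (LINT x|lebesgue. \<bar>rep_l2 (snd U) x\<bar> powr q)"
      unfolding I_def integral_\<Omega> using C(2)[OF U]
      by (intro integral_mono integrable_mult_indicator[of \<Omega> lebesgue "\<lambda>x. \<bar>rep_l2 (snd U) x\<bar> powr q", simplified])
        (auto simp: indicator_def)
    then show ?thesis using C(3)[OF U] by linarith
  qed
  have Ipos: "I (rep_l2 (snd U)) > 0" if U: "U \<in> h01 \<Omega>" "\<not> ae_eq \<Omega> (rep_l2 (snd U)) (\<lambda>x. 0)" for U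
  proof (rule ccontr)
    assume "\<not> ?thesis"
    then have "I (rep_l2 (snd U)) = 0" using I0[of "rep_l2 (snd U)"] by simp
    then have "AE x in lebesgue_on \<Omega>. \<bar>rep_l2 (snd U) x\<bar> powr q = 0"
      unfolding I_def using Iint[OF U(1)] by (subst (asm) integral_nonneg_eq_0_iff_AE) auto
    then show False using U(2) unfolding ae_eq_def by (auto elim: eventually_mono)
  qed
  have lower: "(1 / C powr (2 / q)) \<le> ratio u" if u: "u \<in> X" for u
  proof -
    obtain U where U: "U \<in> h01 \<Omega>" "AE x in lebesgue_on \<Omega>. rep_l2 (snd U) x = u x"
      "AE x in lebesgue_on \<Omega>. rep_l2 (fst U) x = weak_gradient \<Omega> u x"
      using H01_imp_h01[of u] u by (auto simp: X_def)
    have uH: "u \<in> H1 \<Omega>" using u by (simp add: X_def H01_def)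
    have nn: "H01_norm \<Omega> u = norm (fst U)"
      by (rule H01_norm_h01[OF U(1,3) weak_gradient_spec(1)[OF uH]])
    have "\<not> ae_eq \<Omega> (rep_l2 (snd U)) (\<lambda>x. 0)"
    proof
      assume "ae_eq \<Omega> (rep_l2 (snd U)) (\<lambda>x. 0)"
      then have "AE x in lebesgue_on \<Omega>. u x = 0" using U(2) unfolding ae_eq_def by eventually_elim simp
      then show False using u by (simp add: X_def ae_eq_def)
    qed
    then have pos: "I (rep_l2 (snd U)) > 0" by (rule Ipos[OF U(1)])
    have Iu: "I u = I (rep_l2 (snd U))"
      unfolding I_def
    proof (rule integral_cong_AE)
      show "AE x in lebesgue_on \<Omega>. \<bar>u x\<bar> powr q = \<bar>rep_l2 (snd U) x\<bar> powr q"
        using U(2) by eventually_elim simp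
      have [measurable]: "u \<in> borel_measurable (lebesgue_on \<Omega>)" using uH by (simp add: H1_def L2_def)
      show "(\<lambda>x. \<bar>u x\<bar> powr q) \<in> borel_measurable (lebesgue_on \<Omega>)" by measurable
    qed (use Iint[OF U(1)] in auto)
    have "I u powr (2 / q) \<le> (C * norm (fst U) powr q) powr (2 / q)"
      using IC[OF U(1)] I0 q unfolding Iu by (intro powr_mono2) auto
    also have "\<dots> = C powr (2 / q) * (norm (fst U))\<^sup>2"
      using C q by (cases "norm (fst U) = 0") (auto simp: powr_mult powr_powr simp flip: powr_numeral)
    finally have "I u powr (2 / q) \<le> C powr (2 / q) * (norm (fst U))\<^sup>2" .
    then show ?thesis unfolding ratio_def Lq nn using pos C by (simp add: Iu field_simps)
  qed
  have X_ne: "X \<noteq> {}" using exists_nonzero_h01[OF ne] h01_imp_H01 unfolding X_def by blast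
  have "1 / C powr (2 / q) \<le> S" unfolding S_eq by (rule cINF_greatest[OF X_ne lower])
  moreover have "1 / C powr (2 / q) > 0" using C by simp
  ultimately have S: "S > 0" by linarith
  then show "sobolev_const \<Omega> > 0" by (simp add: S_def)
  assume U: "U \<in> h01 \<Omega>"
  have "I (rep_l2 (snd U)) \<le> S powr (- q / 2) * norm (fst U) powr q"
  proof (cases "ae_eq \<Omega> (rep_l2 (snd U)) (\<lambda>x. 0)")
    case True
    have "I (rep_l2 (snd U)) = (LINT x|lebesgue_on \<Omega>. 0)"
      unfolding I_def
    proof (rule integral_cong_AE)
      show "AE x in lebesgue_on \<Omega>. \<bar>rep_l2 (snd U) x\<bar> powr q = 0"
        using True unfolding ae_eq_def by eventually_elim simp
    qed (use Iint[OF U] in auto)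
    then show ?thesis by simp
  next
    case False
    then have pos: "I (rep_l2 (snd U)) > 0" by (rule Ipos[OF U])
    have "S \<le> ratio (rep_l2 (snd U))"
      unfolding S_eq using False h01_imp_H01[OF U] by (intro cINF_lower bb) (auto simp: X_def)
    also have "\<dots> = (norm (fst U))\<^sup>2 / I (rep_l2 (snd U)) powr (2 / q)"
      by (simp add: ratio_def Lq H01_norm_rep[OF U])
    finally have "I (rep_l2 (snd U)) powr (2 / q) \<le> (norm (fst U))\<^sup>2 / S" using pos S by (simp add: field_simps)
    then have "(I (rep_l2 (snd U)) powr (2 / q)) powr (q / 2) \<le> ((norm (fst U))\<^sup>2 / S) powr (q / 2)"
      using q by (intro powr_mono2) auto
    moreover have "(I (rep_l2 (snd U)) powr (2 / q)) powr (q / 2) = I (rep_l2 (snd U))"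
      using pos q by (simp add: powr_powr)
    moreover have "((norm (fst U))\<^sup>2 / S) powr (q / 2) = S powr (- q / 2) * norm (fst U) powr q"
    proof (cases "norm (fst U) = 0")
      case False
      then have "((norm (fst U))\<^sup>2) powr (q / 2) = norm (fst U) powr q" by (simp add: powr_powr flip: powr_numeral)
      then show ?thesis using S by (simp add: powr_divide powr_minus_divide)
    qed simp
    ultimately show ?thesis by simp
  qed
  then show "(LINT x|lebesgue_on \<Omega>. \<bar>rep_l2 (snd U) x\<bar> powr crit_exp DIM('a))
      \<le> sobolev_const \<Omega> powr (- crit_exp DIM('a) / 2) * norm (fst U) powr crit_exp DIM('a)"
    by (simp add: I_def q_def S_def)
qed

end

section \<open>Multiplicity\<close>

text \<open>Preimages under \<open>f\<close> and \<open>g\<close> agree up to a null set, and the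
  completed measure makes both measurable.\<close>

lemma borel_measurable_lebesgue_AE:
  fixes f g :: "'a::euclidean_space \<Rightarrow> real"
  assumes f: "f \<in> borel_measurable lebesgue" and eq: "AE x in lebesgue. f x = g x"
  shows "g \<in> borel_measurable lebesgue"
proof (rule measurableI)
  fix B :: "real set" assume B: "B \<in> sets borel"
  show "g -` B \<inter> space lebesgue \<in> sets lebesgue"
  proof (rule completion.in_sets_AE)
    show "f -` B \<inter> space lebesgue \<in> sets lebesgue" using f B by (rule measurable_sets)
    show "AE x in lebesgue. x \<in> f -` B \<inter> space lebesgue \<longleftrightarrow> x \<in> g -` B \<inter> space lebesgue"
      using eq by eventually_elim simp
  qed simp
qed simp

text \<open>A function continuous in \<open>s\<close> and measurable in \<open>x\<close> is jointly
  measurable, by composing with \<open>snd\<close> on the product space; integration over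
  \<open>s\<close> then leaves a measurable function of \<open>x\<close>. The derivative is the
  fundamental theorem of calculus.\<close>

lemma primitive_properties:
  fixes g :: "'x \<Rightarrow> real \<Rightarrow> real"
  assumes meas: "\<And>t. (\<lambda>x. g x t) \<in> borel_measurable M"
    and cont: "\<And>x. x \<in> space M \<Longrightarrow> continuous_on UNIV (g x)"
  shows "\<And>t. (\<lambda>x. LBINT s=0..ereal t. g x s) \<in> borel_measurable M"
    and "\<And>x (t :: real). x \<in> space M \<Longrightarrow> ((\<lambda>t. LBINT s=0..ereal t. g x s) has_real_derivative g x t) (at t)"
proof -
  have joint: "(\<lambda>z. g (fst z) (snd z)) \<in> borel_measurable (M \<Otimes>\<^sub>M lborel)"
  proof (rule caratheodory_measurable[where k="\<lambda>z. g (fst z)" and u=snd])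
    show "(\<lambda>z. g (fst z) t) \<in> borel_measurable (M \<Otimes>\<^sub>M lborel)" for t
      using meas by (rule measurable_compose[OF measurable_fst])
    show "continuous_on UNIV (g (fst z))" if "z \<in> space (M \<Otimes>\<^sub>M lborel)" for z :: "'x \<times> real"
      using that by (intro cont) (auto simp: space_pair_measure)
  qed simp
  have m: "(\<lambda>x. LINT s:S|lborel. g x s) \<in> borel_measurable M" if S: "S \<in> sets borel" for S
    unfolding set_lebesgue_integral_def
  proof (rule lborel.borel_measurable_lebesgue_integral)
    have [measurable]: "S \<in> sets borel" by fact
    have "(\<lambda>z. indicator S (snd z) *\<^sub>R g (fst z) (snd z)) \<in> borel_measurable (M \<Otimes>\<^sub>M lborel)"
      using joint by measurable
    then show "(\<lambda>(x, s). indicator S s *\<^sub>R g x s) \<in> borel_measurable (M \<Otimes>\<^sub>M lborel)"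
      by (simp add: case_prod_beta')
  qed
  show "(\<lambda>x. LBINT s=0..ereal t. g x s) \<in> borel_measurable M" for t
    unfolding interval_lebesgue_integral_def using m[of "einterval 0 (ereal t)"] m[of "einterval (ereal t) 0"]
    by (cases "0 \<le> ereal t") (auto intro: borel_measurable_uminus)
  fix x and t :: real assume x: "x \<in> space M"
  define R where "R = \<bar>t\<bar> + 1"
  have "((\<lambda>u. LBINT y=ereal 0..ereal u. g x y) has_vector_derivative (g x t)) (at t within {-R..R})"
    using cont[OF x] continuous_on_subset by (intro interval_integral_FTC2) (auto simp: R_def)
  moreover have "at t within {-R..R} = at t" by (rule at_within_Icc_at) (auto simp: R_def)
  ultimately show "((\<lambda>t. LBINT s=0..ereal t. g x s) has_real_derivative g x t) (at t)"
    by (simp add: has_real_derivative_iff_has_vector_derivative zero_ereal_def)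
qed

lemma powr_le_one_plus: "0 \<le> i \<Longrightarrow> i \<le> j \<Longrightarrow> \<bar>t\<bar> powr i \<le> 1 + \<bar>t\<bar> powr j" for t i j :: real
proof -
  assume ij: "0 \<le> i" "i \<le> j"
  show ?thesis
  proof (cases "\<bar>t\<bar> \<le> 1")
    case True
    then have "\<bar>t\<bar> powr i \<le> 1 powr i" using ij by (intro powr_mono2) auto
    then show ?thesis by (simp add: add_increasing2)
  next
    case False
    then have "\<bar>t\<bar> powr i \<le> \<bar>t\<bar> powr j" using ij by (intro powr_mono) auto
    then show ?thesis by simp
  qed
qed

text \<open>Setting \<open>g\<close> to \<open>0\<close> on the null set where continuity may fail
  preserves measurability and the growth bound, and provides the continuity at every point of
  \<open>\<Omega>\<close> that \<open>kirchhoff\<close> assumes.\<close>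

lemma (in bounded_domain) class_A_representative:
  assumes g: "g \<in> class_A \<Omega>"
  shows "\<exists>g' C s. 1 < s \<and> s < crit_exp DIM('a) \<and> C \<ge> 0 \<and>
    (\<forall>t. (\<lambda>x. g' x t) \<in> borel_measurable (lebesgue_on \<Omega>)) \<and>
    (\<forall>x\<in>\<Omega>. continuous_on UNIV (g' x)) \<and>
    (\<forall>x\<in>\<Omega>. \<forall>t. \<bar>g' x t\<bar> \<le> C * (1 + \<bar>t\<bar> powr (s - 1))) \<and>
    (AE x in lebesgue_on \<Omega>. g' x = g x)"
proof -
  obtain s where meas: "\<And>t. (\<lambda>x. g x t) \<in> borel_measurable (lebesgue_on \<Omega>)"
    and cont: "AE x in lebesgue_on \<Omega>. continuous_on UNIV (g x)"
    and s: "1 < s" "s < crit_exp DIM('a)"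
    and bdd: "bdd_above ((\<lambda>(x, t). \<bar>g x t\<bar> / (1 + \<bar>t\<bar> powr (s - 1))) ` (\<Omega> \<times> UNIV))"
    using g unfolding class_A_def caratheodory_def by blast
  obtain C0 where C0: "\<And>y. y \<in> (\<lambda>(x, t). \<bar>g x t\<bar> / (1 + \<bar>t\<bar> powr (s - 1))) ` (\<Omega> \<times> UNIV) \<Longrightarrow> y \<le> C0"
    using bdd unfolding bdd_above_def by blast
  define C where "C = max C0 0"
  have bound: "\<bar>g x t\<bar> \<le> C * (1 + \<bar>t\<bar> powr (s - 1))" if x: "x \<in> \<Omega>" for x t
  proof -
    have "\<bar>g x t\<bar> / (1 + \<bar>t\<bar> powr (s - 1)) \<le> C0" using x by (intro C0) force
    then have "\<bar>g x t\<bar> / (1 + \<bar>t\<bar> powr (s - 1)) \<le> C" by (simp add: C_def)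
    moreover have "1 + \<bar>t\<bar> powr (s - 1) > 0" by (simp add: add_pos_nonneg)
    ultimately show ?thesis by (simp add: pos_divide_le_eq)
  qed
  obtain N where N: "{x \<in> space (lebesgue_on \<Omega>). \<not> continuous_on UNIV (g x)} \<subseteq> N" "emeasure (lebesgue_on \<Omega>) N = 0" "N \<in> sets (lebesgue_on \<Omega>)"
    using AE_E[OF cont] by metis
  define g' where "g' x t = (if x \<in> N then 0 else g x t)" for x t
  have "(\<lambda>x. g' x t) \<in> borel_measurable (lebesgue_on \<Omega>)" for t
    unfolding g'_def using N(3) meas[of t] by (intro measurable_If_set) auto
  moreover have "continuous_on UNIV (g' x)" if "x \<in> \<Omega>" for x
  proof (cases "x \<in> N")
    case False
    then have "continuous_on UNIV (g x)" using N(1) that by (auto simp: space_restrict_space)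
    then show ?thesis using False by (simp add: g'_def[abs_def])
  qed (simp add: g'_def[abs_def])
  moreover have C: "C \<ge> 0" by (simp add: C_def)
  moreover have "\<bar>g' x t\<bar> \<le> C * (1 + \<bar>t\<bar> powr (s - 1))" if "x \<in> \<Omega>" for x t
    using bound[OF that, of t] C by (auto simp: g'_def)
  moreover have "AE x in lebesgue_on \<Omega>. x \<notin> N" using N by (intro AE_not_in null_setsI)
  then have "AE x in lebesgue_on \<Omega>. g' x = g x" by eventually_elim (simp add: g'_def[abs_def] fun_eq_iff)
  ultimately show ?thesis using s by (intro exI[of _ g'] exI[of _ C] exI[of _ s]) auto
qed

text \<open>Measurability of \<open>h'\<close> follows from completeness. In the application
  \<open>h'\<close> is a composition with the original \<open>g\<close>, for which it is not
  evident.\<close>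

lemma (in bounded_domain) integral_cong_AE':
  fixes h h' :: "'a \<Rightarrow> real"
  assumes h: "h \<in> borel_measurable (lebesgue_on \<Omega>)" and eq: "AE x in lebesgue_on \<Omega>. h x = h' x"
  shows "(LINT x|lebesgue_on \<Omega>. h x) = (LINT x|lebesgue_on \<Omega>. h' x)"
proof (rule integral_cong_AE[OF h _ eq])
  have "(\<lambda>x. if x \<in> \<Omega> then h x else 0) \<in> borel_measurable lebesgue"
    by (rule borel_measurable_if_I[OF h]) simp
  moreover have "AE x in lebesgue. (if x \<in> \<Omega> then h x else 0) = (if x \<in> \<Omega> then h' x else 0)"
    using eq unfolding AE_\<Omega> by eventually_elim auto
  ultimately have "(\<lambda>x. if x \<in> \<Omega> then h' x else 0) \<in> borel_measurable lebesgue"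
    by (rule borel_measurable_lebesgue_AE)
  then show "h' \<in> borel_measurable (lebesgue_on \<Omega>)" by (rule borel_measurable_if_D)
qed

lemma power4_ge:
  fixes x :: real
  assumes "x \<ge> 1"
  shows "x \<le> x ^ 4"
  using power_increasing[of 1 4 x] assms by simp

context kirchhoff begin

lemma J_0: "J 0 = 0"
proof -
  have "rep_l2 (0 :: ('a, real) l2) \<in> borel_measurable lebesgue" by simp
  have z: "abs_l2 (\<lambda>x. 0 :: real) = (0 :: ('a, real) l2)" by (simp add: zero_l2.abs_eq)
  have "AE x in lebesgue. rep_l2 (0 :: ('a, real) l2) x = 0"
    using rep_abs_l2[OF square_integrable_0, where 'a='a and 'b=real] unfolding z .
  then have "AE x in M. fn 0 x = 0" by (simp add: AE_M)
  then have "(LINT x|M. F x (fn 0 x)) = (LINT x|M. 0)"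
  proof (intro integral_cong_AE)
    assume "AE x in M. fn 0 x = 0"
    then show "AE x in M. F x (fn 0 x) = 0"
      using AE_space[of M] by eventually_elim (simp add: F_def K_0)
  qed (rule F_meas, rule fn_meas, simp)
  then show ?thesis by (simp add: J_def)
qed

text \<open>The abstract theorem for \<open>e0 = 0\<close> and \<open>e1 = E\<close>, with the
  gradient norm as barrier function \<open>\<nu>\<close>. The quartic lower bound supplies both the
  bounded sublevel sets and the lower bound of \<open>J\<close>.\<close>

lemma three_solutions:
  assumes c0: "c0 > 0" "\<And>x. x \<ge> 0 \<Longrightarrow> c0 \<le> a + b * x - \<sigma> * x powr ((q - 2) / 2)"
    and coercive: "e > 0" "\<And>U. U \<in> h01 \<Omega> \<Longrightarrow> e * norm (fst U) ^ 4 - K0 \<le> J U"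
    and E: "E \<in> h01 \<Omega>" "\<rho> < norm (fst E)" and \<rho>: "\<rho> > 0"
    and barrier: "\<kappa> > 0" "\<And>U. U \<in> h01 \<Omega> \<Longrightarrow> norm (fst U) = \<rho> \<Longrightarrow> \<kappa> \<le> J U"
    and low: "J E < m1" "\<And>U. U \<in> h01 \<Omega> \<Longrightarrow> norm (fst U) \<le> \<rho> \<Longrightarrow> m1 \<le> J U"
    and path: "\<And>t. t \<in> {0..1} \<Longrightarrow> J (t *\<^sub>R E) \<le> T"
  shows "\<exists>U1\<in>h01 \<Omega>. \<exists>U2\<in>h01 \<Omega>. \<exists>U3\<in>h01 \<Omega>. D U1 = 0 \<and> D U2 = 0 \<and> D U3 = 0 \<and>
    J U1 < J U2 \<and> J U2 < J U3 \<and> J U3 \<le> T"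
proof -
  interpret C1: uniform_C1_functional "h01 \<Omega>" J D by (rule uniform_C1)
  obtain P where P: "P > 0" "\<And>U. U \<in> h01 \<Omega> \<Longrightarrow> norm U \<le> P * norm (fst U)" using norm_equiv by blast
  have bdd: "\<exists>R. \<forall>u\<in>h01 \<Omega>. J u \<le> l \<longrightarrow> norm u \<le> R" for l
  proof (intro exI[of _ "P * max 1 ((l + K0) / e)"] ballI impI)
    fix u assume u: "u \<in> h01 \<Omega>" "J u \<le> l"
    have "norm (fst u) \<le> max 1 ((l + K0) / e)"
    proof (cases "norm (fst u) \<le> 1")
      case False
      then have "norm (fst u) \<le> norm (fst u) ^ 4" by (intro power4_ge) simp
      also have "\<dots> \<le> (l + K0) / e" using coercive(2)[OF u(1)] u(2) coercive(1) by (simp add: pos_le_divide_eq mult.commute)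
      finally show ?thesis by simp
    qed simp
    then show "norm u \<le> P * max 1 ((l + K0) / e)"
      using P(2)[OF u(1)] P(1) by (meson mult_left_mono order_trans less_imp_le)
  qed
  show ?thesis
  proof (rule C1.three_critical_points[where ?e0.0=0 and ?e1.0=E and \<nu>="\<lambda>U. norm (fst U)" and \<rho>=\<rho> and \<kappa>=\<kappa> and ?m1.0=m1 and ?m0.0="- K0"])
    show "\<exists>R. \<forall>u\<in>h01 \<Omega>. J u \<le> l \<longrightarrow> norm u \<le> R" for l by (rule bdd)
    show "- K0 \<le> J u" if "u \<in> h01 \<Omega>" for u
    proof -
      have "0 \<le> e * norm (fst u) ^ 4" using coercive(1) by simp
      then show ?thesis using coercive(2)[OF that] by linarith
    qed
    show "\<exists>u\<in>h01 \<Omega>. J u = c \<and> D u = 0"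
      if "\<And>e. e > 0 \<Longrightarrow> \<exists>u\<in>h01 \<Omega>. \<bar>J u - c\<bar> < e \<and> norm (D u) < e" for c
      by (rule palais_smale[OF c0 bdd that])
    show "0 \<in> h01 \<Omega>" by (rule subspace_0[OF subspace_h01])
    show "continuous_on (h01 \<Omega>) (\<lambda>U. norm (fst U))" by (intro continuous_intros)
    show "J 0 < \<kappa>" using barrier(1) by (simp add: J_0)
    show "J (0 + t *\<^sub>R (E - 0)) \<le> T" if "t \<in> {0..1}" for t using path[OF that] by simp
  qed (use E \<rho> barrier low in auto)
qed

lemma critical_point_weak_form:
  assumes U: "U \<in> h01 \<Omega>" "D U = 0" and v: "v \<in> H01 \<Omega>"
  shows "(a + b * (H01_norm \<Omega> (fn U))\<^sup>2) * (LINT x|M. weak_gradient \<Omega> (fn U) x \<bullet> weak_gradient \<Omega> v x) =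
    (LINT x|M. f x (fn U x) * v x)"
    and "integrable M (\<lambda>x. f x (fn U x) * v x)" and "\<exists>Z\<in>h01 \<Omega>. AE x in M. fn Z x = v x"
proof -
  obtain Z where Z: "Z \<in> h01 \<Omega>" "AE x in M. fn Z x = v x" "AE x in M. rep_l2 (fst Z) x = weak_gradient \<Omega> v x"
    using H01_imp_h01[OF v] by blast
  have vH: "v \<in> H1 \<Omega>" using v by (simp add: H01_def)
  have vm: "v \<in> borel_measurable M" using vH by (simp add: H1_def L2_def)
  have ae: "AE x in M. f x (fn U x) * fn Z x = f x (fn U x) * v x" using Z(2) by eventually_elim simp
  have m: "(\<lambda>x. f x (fn U x) * v x) \<in> borel_measurable M"
    using vm by (intro borel_measurable_times f_meas) auto
  show "integrable M (\<lambda>x. f x (fn U x) * v x)"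
    by (rule integrable_cong_AE_imp[OF f_int[OF U(1) Z(1)] m]) (rule ae)
  have "(LINT x|M. f x (fn U x) * v x) = (LINT x|M. f x (fn U x) * fn Z x)"
    using ae m f_int[OF U(1) Z(1)] by (intro integral_cong_AE) (auto elim: eventually_mono)
  also have "\<dots> = (a + b * (norm (fst U))\<^sup>2) * (fst U \<bullet> fst Z)"
    using D_spec(2)[OF U(1) Z(1)] U(2) by (simp add: L_def)
  also have "fst U \<bullet> fst Z = (LINT x|M. weak_gradient \<Omega> (fn U) x \<bullet> weak_gradient \<Omega> v x)"
    using weak_gradient_rep[OF U(1)] weak_gradient_spec(1)[OF rep_H1[OF U(1)]] Z(3) weak_gradient_spec(1)[OF vH]
    by (intro inner_fst_h01[symmetric] U Z) (auto elim: eventually_mono)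
  finally show "(a + b * (H01_norm \<Omega> (fn U))\<^sup>2) * (LINT x|M. weak_gradient \<Omega> (fn U) x \<bullet> weak_gradient \<Omega> v x) =
    (LINT x|M. f x (fn U x) * v x)" by (simp add: H01_norm_rep[OF U(1)])
  show "\<exists>Z\<in>h01 \<Omega>. AE x in M. fn Z x = v x" using Z by blast
qed

end

text \<open>The function determines its weak gradient, and both vanish off \<open>\<Omega>\<close>.
  Thus different critical points are solutions that are not equal almost everywhere.\<close>

lemma (in bounded_domain) h01_eqI:
  assumes U: "U \<in> h01 \<Omega>" "W \<in> h01 \<Omega>" and eq: "ae_eq \<Omega> (rep_l2 (snd U)) (rep_l2 (snd W))"
  shows "U = W"
proof -
  have "AE x in lebesgue. rep_l2 (snd U) x = rep_l2 (snd W) x"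
    using eq[unfolded ae_eq_def AE_\<Omega>] h01_zero_off(2)[OF open_\<Omega> U(1)] h01_zero_off(2)[OF open_\<Omega> U(2)]
    by eventually_elim auto
  then have "snd U = snd W"
    using abs_l2_eq_iff[OF square_integrable_rep square_integrable_rep, of "snd U" "snd W"] by simp
  moreover have "AE x in lebesgue. rep_l2 (fst U) x = rep_l2 (fst W) x"
  proof -
    have eq': "weak_gradient \<Omega> (rep_l2 (snd U)) = weak_gradient \<Omega> (rep_l2 (snd W))"
      using eq by (intro weak_gradient_cong L2_restrict) auto
    have "AE x in lebesgue_on \<Omega>. rep_l2 (fst U) x = rep_l2 (fst W) x"
      using weak_gradient_rep[OF U(1)] weak_gradient_rep[OF U(2)] by eventually_elim (simp add: eq')
    then show ?thesis
      using h01_zero_off(1)[OF open_\<Omega> U(1)] h01_zero_off(1)[OF open_\<Omega> U(2)] unfolding AE_\<Omega>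
      by eventually_elim auto
  qed
  then have "fst U = fst W"
    using abs_l2_eq_iff[OF square_integrable_rep square_integrable_rep, of "fst U" "fst W"] by simp
  ultimately show ?thesis by (simp add: prod_eq_iff)
qed

section \<open>Elementary bounds for the shape of the energy\<close>

lemma powr_four: "(t :: real) \<ge> 0 \<Longrightarrow> t powr 4 = t ^ 4"
  using powr_numeral[of t "num.Bit0 (num.Bit0 num.One)"] by (cases "t = 0") auto

text \<open>Powers below \<open>4\<close> are absorbed by a fraction of \<open>t ^ 4\<close>. For
  \<open>q = 4\<close> the two quartic terms have the positive balance \<open>b / 4 - s\<close>;
  with \<open>s = \<sigma> / q\<close> this is the condition \<open>\<sigma> < b\<close>.\<close>

lemma quartic_coercivity:
  fixes b q p s Q :: real
  assumes b: "b > 0" and s: "s \<ge> 0" and Q: "Q \<ge> 0" and p: "0 \<le> p" "p < q"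
    and q: "0 \<le> q" "q < 4 \<or> (q = 4 \<and> s < b / 4)"
  shows "\<exists>e>0. \<exists>K0. \<forall>t\<ge>0. e * t ^ 4 - K0 \<le> b / 4 * t ^ 4 - s * t powr q - Q * t powr p"
proof -
  have "\<exists>\<delta>>0. \<exists>C1. \<forall>t\<ge>0. \<delta> * t ^ 4 - C1 \<le> b / 4 * t ^ 4 - s * t powr q"
  proof (cases "q < 4")
    case True
    define \<eta> where "\<eta> = b / (8 * (s + 1))"
    have \<eta>: "\<eta> > 0" "s * \<eta> \<le> b / 8" using b s by (auto simp: \<eta>_def field_simps)
    obtain C1 where C1: "\<And>t. t \<ge> 0 \<Longrightarrow> t powr q \<le> \<eta> * t powr 4 + C1"
      using powr_le_eps_powr[OF q(1) True \<eta>(1)] by blast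
    have "b / 8 * t ^ 4 - s * C1 \<le> b / 4 * t ^ 4 - s * t powr q" if t: "t \<ge> 0" for t
    proof -
      have "s * t powr q \<le> s * (\<eta> * t ^ 4 + C1)"
        using C1[OF t] s by (intro mult_left_mono) (simp_all add: powr_four[OF t])
      moreover have "s * \<eta> * t ^ 4 \<le> b / 8 * t ^ 4" using \<eta>(2) by (intro mult_right_mono) simp_all
      ultimately show ?thesis by (simp add: algebra_simps)
    qed
    then show ?thesis using b by (intro exI[of _ "b / 8"] conjI exI[of _ "s * C1"]) auto
  next
    case False
    then have q4: "q = 4" "s < b / 4" using q by auto
    show ?thesis
      by (intro exI[of _ "b / 4 - s"] conjI exI[of _ 0])
        (use q4 in \<open>auto simp: powr_four left_diff_distrib\<close>)
  qed
  then obtain \<delta> C1 where \<delta>: "\<delta> > 0" "\<And>t. t \<ge> 0 \<Longrightarrow> \<delta> * t ^ 4 - C1 \<le> b / 4 * t ^ 4 - s * t powr q" by blast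
  define \<eta> where "\<eta> = \<delta> / (2 * (Q + 1))"
  have \<eta>: "\<eta> > 0" "Q * \<eta> \<le> \<delta> / 2" using \<delta>(1) Q by (auto simp: \<eta>_def field_simps)
  have "p < 4" using p q by auto
  then obtain C2 where C2: "\<And>t. t \<ge> 0 \<Longrightarrow> t powr p \<le> \<eta> * t powr 4 + C2"
    using powr_le_eps_powr[OF p(1) _ \<eta>(1)] by blast
  have "\<delta> / 2 * t ^ 4 - (C1 + Q * C2) \<le> b / 4 * t ^ 4 - s * t powr q - Q * t powr p" if t: "t \<ge> 0" for t
  proof -
    have "Q * t powr p \<le> Q * (\<eta> * t ^ 4 + C2)"
      using C2[OF t] Q by (intro mult_left_mono) (simp_all add: powr_four[OF t])
    moreover have "Q * \<eta> * t ^ 4 \<le> \<delta> / 2 * t ^ 4" using \<eta>(2) by (intro mult_right_mono) simp_all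
    ultimately show ?thesis using \<delta>(2)[OF t] by (simp add: algebra_simps)
  qed
  then show ?thesis using \<delta>(1) by (intro exI[of _ "\<delta> / 2"] conjI exI[of _ "C1 + Q * C2"]) auto
qed

text \<open>Both exponents exceed \<open>2\<close> by at least \<open>e\<close>, so for small
  \<open>t\<close> both powers are at most \<open>y * t^2\<close>, where
  \<open>(s + Q) * y \<le> a\<close>.\<close>

lemma superquadratic_small:
  fixes a p q s Q N :: real
  assumes "a > 0" "p > 2" "q > 2" "s \<ge> 0" "Q \<ge> 0" "N > 0"
  shows "\<exists>\<rho>>0. \<rho> < N \<and> (\<forall>t\<in>{0..\<rho>}. s * t powr q + Q * t powr p \<le> a * t\<^sup>2)"
proof -
  define e where "e = min p q - 2"
  have e: "e > 0" using assms by (simp add: e_def)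
  define y where "y = a / (s + Q + 1)"
  have y: "y > 0" "(s + Q) * y \<le> a" using assms by (auto simp: y_def field_simps)
  define \<rho> where "\<rho> = min (N / 2) (min 1 (y powr (1 / e)))"
  have \<rho>: "\<rho> > 0" "\<rho> < N" "\<rho> \<le> 1" using assms y by (auto simp: \<rho>_def)
  have "s * t powr q + Q * t powr p \<le> a * t\<^sup>2" if t: "0 \<le> t" "t \<le> \<rho>" for t
  proof -
    have "t powr e \<le> (y powr (1 / e)) powr e" using t e by (intro powr_mono2) (auto simp: \<rho>_def)
    then have te: "t powr e \<le> y" using e y by (simp add: powr_powr)
    have pw: "t powr j \<le> y * t\<^sup>2" if j: "j \<ge> e + 2" for j
    proof -
      have "t powr j \<le> t powr (e + 2)" using j t \<rho>(3) by (intro powr_mono') auto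
      also have "\<dots> = t powr e * t\<^sup>2" using t by (cases "t = 0") (simp_all add: powr_add)
      also have "\<dots> \<le> y * t\<^sup>2" using te by (intro mult_right_mono) simp_all
      finally show ?thesis .
    qed
    have "s * t powr q + Q * t powr p \<le> s * (y * t\<^sup>2) + Q * (y * t\<^sup>2)"
      using assms by (intro add_mono mult_left_mono pw) (auto simp: e_def)
    also have "\<dots> = (s + Q) * y * t\<^sup>2" by (simp add: algebra_simps)
    also have "\<dots> \<le> a * t\<^sup>2" using y(2) by (intro mult_right_mono) simp_all
    finally show ?thesis .
  qed
  then show ?thesis using \<rho> by (intro exI[of _ \<rho>]) auto
qed

text \<open>The mean value inequality on the segment from \<open>0\<close> to \<open>t\<close>;
  raising the exponent from \<open>s\<close> to \<open>q\<close> costs the factors \<open>2\<close>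
  that make up \<open>4\<close>.\<close>

lemma primitive_growth:
  fixes G g :: "real \<Rightarrow> real" and q C s :: real
  assumes q: "q > 1" and C: "C \<ge> 0" and s: "1 \<le> s" "s \<le> q"
    and G: "\<And>t. (G has_real_derivative g t) (at t)" "G 0 = 0"
    and bound: "\<And>t. \<bar>g t\<bar> \<le> C * (1 + \<bar>t\<bar> powr (s - 1))"
  shows "\<bar>G t\<bar> \<le> 4 * C * (1 + \<bar>t\<bar> powr q)"
proof -
  have "norm (g y) \<le> 2 * C * (1 + \<bar>t\<bar> powr (q - 1))" if y: "y \<in> closed_segment 0 t" for y
  proof -
    have yt: "\<bar>y\<bar> \<le> \<bar>t\<bar>" using y by (auto simp: closed_segment_eq_real_ivl split: if_splits)
    have "\<bar>y\<bar> powr (s - 1) \<le> \<bar>t\<bar> powr (s - 1)" using yt s by (intro powr_mono2) auto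
    also have "\<dots> \<le> 1 + \<bar>t\<bar> powr (q - 1)" using s by (intro powr_le_one_plus) auto
    finally have "1 + \<bar>y\<bar> powr (s - 1) \<le> 2 * (1 + \<bar>t\<bar> powr (q - 1))"
      using powr_ge_zero[of "\<bar>t\<bar>" "q - 1"] unfolding distrib_left by linarith
    then have "C * (1 + \<bar>y\<bar> powr (s - 1)) \<le> C * (2 * (1 + \<bar>t\<bar> powr (q - 1)))" using C by (rule mult_left_mono)
    then show ?thesis using bound[of y] unfolding real_norm_def mult.assoc[of 2 C] mult.left_commute[of C 2] by linarith
  qed
  then have "norm (G t - G 0) \<le> 2 * C * (1 + \<bar>t\<bar> powr (q - 1)) * norm (t - 0)"
    by (intro field_differentiable_bound[of "closed_segment 0 t"]) (auto intro: has_field_derivative_at_within G)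
  also have "\<dots> = 2 * C * (\<bar>t\<bar> + \<bar>t\<bar> powr (q - 1) * \<bar>t\<bar>)" by (simp add: algebra_simps)
  also have "\<bar>t\<bar> powr (q - 1) * \<bar>t\<bar> = \<bar>t\<bar> powr q"
    using powr_add[of "\<bar>t\<bar>" "q - 1" 1] by (cases "t = 0") simp_all
  also have "2 * C * (\<bar>t\<bar> + \<bar>t\<bar> powr q) \<le> 2 * C * (2 * (1 + \<bar>t\<bar> powr q))"
    using powr_le_one_plus[of 1 q t] q C by (intro mult_left_mono) auto
  finally show ?thesis using G(2) by (simp add: algebra_simps)
qed

context bounded_domain begin

lemma h01_rep_measurable: "rep_l2 (snd U) \<in> borel_measurable (lebesgue_on \<Omega>)"
  by (intro measurable_restrict_space1) simp

text \<open>After division by the gradient norm \<open>n\<close>, the elementary bound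
  \<open>|u / n|^p \<le> 1 + |u / n|^q\<close> and Sobolev's inequality give the homogeneity
  \<open>n^p\<close>, in place of Hoelder's inequality.\<close>

lemma sobolev_h01_subcritical:
  fixes p q \<sigma> :: real
  assumes dim: "DIM('a) \<ge> 3" and q: "q = crit_exp DIM('a)" and \<sigma>: "\<sigma> \<ge> 0"
    and sobolev: "\<And>U. U \<in> h01 \<Omega> \<Longrightarrow> (LINT x|lebesgue_on \<Omega>. \<bar>rep_l2 (snd U) x\<bar> powr q) \<le> \<sigma> * norm (fst U) powr q"
    and p: "0 < p" "p \<le> q"
  shows "\<exists>C\<ge>0. \<forall>U\<in>h01 \<Omega>. integrable (lebesgue_on \<Omega>) (\<lambda>x. \<bar>rep_l2 (snd U) x\<bar> powr p) \<and>
    (LINT x|lebesgue_on \<Omega>. \<bar>rep_l2 (snd U) x\<bar> powr p) \<le> C * norm (fst U) powr p"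
proof -
  interpret finite_measure "lebesgue_on \<Omega>" using bounded_\<Omega> by (intro finite_measure_lebesgue_on) (simp add: bounded_set_imp_lmeasurable)
  define C where "C = measure (lebesgue_on \<Omega>) \<Omega> + \<sigma>"
  have sp: "space (lebesgue_on \<Omega>) = \<Omega>" by (simp add: space_restrict_space)
  have C: "C \<ge> 0" using \<sigma> by (simp add: C_def)
  have int: "integrable (lebesgue_on \<Omega>) (\<lambda>x. \<bar>rep_l2 (snd U) x\<bar> powr p)"
    and bound: "(LINT x|lebesgue_on \<Omega>. \<bar>rep_l2 (snd U) x\<bar> powr p) \<le> C * norm (fst U) powr p"
    if U: "U \<in> h01 \<Omega>" for U
  proof -
    define u where "u = rep_l2 (snd U)"
    define n where "n = norm (fst U)"
    have um: "u \<in> borel_measurable (lebesgue_on \<Omega>)" unfolding u_def by (rule h01_rep_measurable)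
    have qi: "integrable (lebesgue_on \<Omega>) (\<lambda>x. \<bar>u x\<bar> powr q)"
      using h01_powr_crit_int[OF dim U] by (simp add: u_def q)
    have pi: "integrable (lebesgue_on \<Omega>) (\<lambda>x. \<bar>u x\<bar> powr p)"
    proof (rule Bochner_Integration.integrable_bound)
      show "integrable (lebesgue_on \<Omega>) (\<lambda>x. 1 + \<bar>u x\<bar> powr q)" using qi by simp
      show "AE x in lebesgue_on \<Omega>. norm (\<bar>u x\<bar> powr p) \<le> norm (1 + \<bar>u x\<bar> powr q)"
        using powr_le_one_plus[of p q] p by simp
    qed (use um in measurable)
    then show "integrable (lebesgue_on \<Omega>) (\<lambda>x. \<bar>rep_l2 (snd U) x\<bar> powr p)" by (simp add: u_def)
    have sob: "(LINT x|lebesgue_on \<Omega>. \<bar>u x\<bar> powr q) \<le> \<sigma> * n powr q" using sobolev[OF U] by (simp add: u_def n_def)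
    have "(LINT x|lebesgue_on \<Omega>. \<bar>u x\<bar> powr p) \<le> C * n powr p"
    proof (cases "n = 0")
      \<comment> \<open>Division by \<open>n\<close> is impossible here, but then the function
        vanishes almost everywhere.\<close>
      case True
      then have "(LINT x|lebesgue_on \<Omega>. \<bar>u x\<bar> powr q) = 0"
        using sob by (intro antisym integral_nonneg_AE) simp_all
      then have "AE x in lebesgue_on \<Omega>. \<bar>u x\<bar> powr q = 0"
        using integral_nonneg_eq_0_iff_AE[OF qi] by simp
      then have "AE x in lebesgue_on \<Omega>. \<bar>u x\<bar> powr p = 0" by eventually_elim simp
      then have "(LINT x|lebesgue_on \<Omega>. \<bar>u x\<bar> powr p) = 0"
        using integral_nonneg_eq_0_iff_AE[OF pi] by simp
      then show ?thesis using C by simp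
    next
      case False
      then have n: "n > 0" by (simp add: n_def)
      have "\<bar>u x\<bar> powr p \<le> n powr p + n powr (p - q) * \<bar>u x\<bar> powr q" for x
      proof -
        have "\<bar>u x\<bar> powr p = n powr p * \<bar>u x / n\<bar> powr p"
          using n by (simp add: powr_divide abs_divide)
        also have "\<dots> \<le> n powr p * (1 + \<bar>u x / n\<bar> powr q)"
          using powr_le_one_plus[of p q "u x / n"] p by (intro mult_left_mono) auto
        also have "\<dots> = n powr p + n powr (p - q) * \<bar>u x\<bar> powr q"
          using n by (simp add: powr_divide abs_divide powr_diff algebra_simps)
        finally show ?thesis .
      qed
      then have "(LINT x|lebesgue_on \<Omega>. \<bar>u x\<bar> powr p) \<le> (LINT x|lebesgue_on \<Omega>. n powr p + n powr (p - q) * \<bar>u x\<bar> powr q)"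
        using pi qi by (intro integral_mono) auto
      also have "\<dots> = n powr p * measure (lebesgue_on \<Omega>) \<Omega> + n powr (p - q) * (LINT x|lebesgue_on \<Omega>. \<bar>u x\<bar> powr q)"
        using qi by (simp add: sp)
      also have "\<dots> \<le> n powr p * measure (lebesgue_on \<Omega>) \<Omega> + n powr (p - q) * (\<sigma> * n powr q)"
        using sob by (intro add_left_mono mult_left_mono) auto
      also have "\<dots> = C * n powr p" using n by (simp add: C_def powr_diff field_simps)
      finally show ?thesis .
    qed
    then show "(LINT x|lebesgue_on \<Omega>. \<bar>rep_l2 (snd U) x\<bar> powr p) \<le> C * norm (fst U) powr p"
      by (simp add: u_def n_def)
  qed
  show ?thesis using C int bound by blast
qed

lemma subcritical_growth_integrable:
  fixes q C :: real and h u v :: "'a \<Rightarrow> real"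
  assumes q: "q > 1" and C: "C \<ge> 0"
    and hm: "h \<in> borel_measurable (lebesgue_on \<Omega>)" and vm: "v \<in> borel_measurable (lebesgue_on \<Omega>)"
    and ui: "integrable (lebesgue_on \<Omega>) (\<lambda>x. \<bar>u x\<bar> powr q)" and vi: "integrable (lebesgue_on \<Omega>) (\<lambda>x. \<bar>v x\<bar> powr q)"
    and bound: "\<And>x. x \<in> \<Omega> \<Longrightarrow> \<bar>h x\<bar> \<le> C * (1 + \<bar>u x\<bar> powr (q - 1))"
  shows "integrable (lebesgue_on \<Omega>) (\<lambda>x. h x * v x)"
proof -
  interpret finite_measure "lebesgue_on \<Omega>" using bounded_\<Omega> by (intro finite_measure_lebesgue_on) (simp add: bounded_set_imp_lmeasurable)
  show ?thesis
  proof (rule Bochner_Integration.integrable_bound)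
    show "integrable (lebesgue_on \<Omega>) (\<lambda>x. C * (1 + 2 * (\<bar>u x\<bar> powr q + \<bar>v x\<bar> powr q)))" using ui vi by simp
    show "AE x in lebesgue_on \<Omega>. norm (h x * v x) \<le> norm (C * (1 + 2 * (\<bar>u x\<bar> powr q + \<bar>v x\<bar> powr q)))"
    proof (rule AE_I2)
      fix x assume "x \<in> space (lebesgue_on \<Omega>)"
      then have x: "x \<in> \<Omega>" by (simp add: space_restrict_space)
      have "\<bar>h x * v x\<bar> \<le> C * (1 + \<bar>u x\<bar> powr (q - 1)) * \<bar>v x\<bar>"
        unfolding abs_mult using bound[OF x] by (intro mult_right_mono) auto
      also have "\<dots> \<le> C * (1 + 2 * (\<bar>u x\<bar> powr q + \<bar>v x\<bar> powr q))"
        unfolding mult.assoc using q C by (intro mult_left_mono growth_times_le) auto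
      finally show "norm (h x * v x) \<le> norm (C * (1 + 2 * (\<bar>u x\<bar> powr q + \<bar>v x\<bar> powr q)))"
        unfolding real_norm_def by linarith
    qed
  qed (use hm vm in measurable)
qed

end

section \<open>Transfer from the unperturbed to the perturbed energy\<close>

locale unperturbed_problem = bounded_domain \<Omega> for \<Omega> :: "'a::euclidean_space set" +
  fixes a b p q \<sigma> c0 :: real
  assumes q: "q = crit_exp DIM('a)" "q > 2" and dim: "DIM('a) \<ge> 3"
    and ab: "a > 0" "b > 0" and \<sigma>: "\<sigma> \<ge> 0"
    and sobolev: "\<And>U. U \<in> h01 \<Omega> \<Longrightarrow> (LINT x|lebesgue_on \<Omega>. \<bar>rep_l2 (snd U) x\<bar> powr q) \<le> \<sigma> * norm (fst U) powr q"
    and p: "2 < p" "p < q"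
    and q4: "q < 4 \<or> (q = 4 \<and> \<sigma> < b)"
    and gap: "c0 > 0" "\<And>x. x \<ge> 0 \<Longrightarrow> c0 \<le> a + b * x - \<sigma> * x powr ((q - 2) / 2)"
begin

definition I :: "real \<Rightarrow> 'a h1 \<Rightarrow> real" where
  "I s U = (LINT x|lebesgue_on \<Omega>. \<bar>rep_l2 (snd U) x\<bar> powr s)"

text \<open>The energy for \<mu> = 0, for which the geometric conditions are verified before they
  are carried over to small \<mu>.\<close>

definition J0 :: "real \<Rightarrow> 'a h1 \<Rightarrow> real" where
  "J0 lam U = a / 2 * (norm (fst U))\<^sup>2 + b / 4 * norm (fst U) ^ 4 - I q U / q - lam * (I p U / p)"

lemma I_nonneg: "0 \<le> I s U"
  unfolding I_def by (intro integral_nonneg_AE) simp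

text \<open>Rests on \<open>q \<le> 4\<close> and makes the perturbation comparable with the quartic
  term of the energy.\<close>

lemma powr_q_le: "t \<ge> 0 \<Longrightarrow> t powr q \<le> 1 + t ^ 4"
  using powr_le_one_plus[of q 4 t] q4 q(2) powr_four[of t] by auto

end

text \<open>The conditions on \<open>g\<close> hold at every point of \<open>\<Omega>\<close>; the
  locale is applied to the representative of a member of \<open>class_A\<close>.\<close>

locale perturbed_problem = unperturbed_problem +
  fixes lam mu C s :: real and g :: "'a \<Rightarrow> real \<Rightarrow> real"
  assumes lam: "lam \<ge> 0" and mu: "mu \<ge> 0"
    and C: "C \<ge> 0" and s: "1 < s" "s < q"
    and g_meas: "\<And>t. (\<lambda>x. g x t) \<in> borel_measurable (lebesgue_on \<Omega>)"
    and g_cont: "\<And>x. x \<in> \<Omega> \<Longrightarrow> continuous_on UNIV (g x)"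
    and g_bound: "\<And>x t. x \<in> \<Omega> \<Longrightarrow> \<bar>g x t\<bar> \<le> C * (1 + \<bar>t\<bar> powr (s - 1))"
begin

definition G :: "'a \<Rightarrow> real \<Rightarrow> real" where "G x t = (LBINT y=0..ereal t. g x y)"

definition k :: "'a \<Rightarrow> real \<Rightarrow> real" where "k x t = lam * crit_pow p t + mu * g x t"

definition K :: "'a \<Rightarrow> real \<Rightarrow> real" where "K x t = lam * (\<bar>t\<bar> powr p / p) + mu * G x t"

lemma G_meas: "(\<lambda>x. G x t) \<in> borel_measurable (lebesgue_on \<Omega>)"
  unfolding G_def by (rule primitive_properties(1)) (auto simp: space_restrict_space intro: g_meas g_cont)

lemma G_deriv: "x \<in> \<Omega> \<Longrightarrow> (G x has_real_derivative g x t) (at t)"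
  unfolding G_def using primitive_properties(2)[of g "lebesgue_on \<Omega>" x t]
  by (simp add: space_restrict_space g_meas g_cont)

lemma G_0: "G x 0 = 0"
  by (simp add: G_def flip: zero_ereal_def)

lemma G_bound: "x \<in> \<Omega> \<Longrightarrow> \<bar>G x t\<bar> \<le> 4 * C * (1 + \<bar>t\<bar> powr q)"
  using q(2) s by (intro primitive_growth[where g="g x" and s=s] C G_deriv G_0 g_bound) auto

text \<open>Both exponents \<open>p\<close> and \<open>s\<close> are raised to their maximum. The
  factor in \<open>2 * mu * C\<close> comes from
  \<open>1 + |t| powr (s - 1) \<le> 2 * (1 + |t| powr (max p s - 1))\<close>.\<close>

sublocale kir: kirchhoff \<Omega> a b q \<sigma> "max p s" "lam + 2 * mu * C" k K
proof
  show "q = crit_exp DIM('a)" "q > 2" "DIM('a) \<ge> 3" "a > 0" "b > 0" "\<sigma> \<ge> 0" by (fact q dim ab \<sigma>)+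
  show "1 < max p s" "max p s < q" using p s by auto
  show "0 \<le> lam + 2 * mu * C" using lam mu C by simp
  show "(\<lambda>x. k x t) \<in> borel_measurable (lebesgue_on \<Omega>)" for t
    unfolding k_def using g_meas[of t] by measurable
  show "continuous_on UNIV (k x)" if "x \<in> \<Omega>" for x
    unfolding k_def using p continuous_crit_pow[of p UNIV] g_cont[OF that] by (intro continuous_intros) auto
  show "\<bar>k x t\<bar> \<le> (lam + 2 * mu * C) * (1 + \<bar>t\<bar> powr (max p s - 1))" if x: "x \<in> \<Omega>" for x t
  proof -
    define y where "y = \<bar>t\<bar> powr (max p s - 1)"
    have y: "y \<ge> 0" by (simp add: y_def)
    have "\<bar>crit_pow p t\<bar> \<le> 1 + y"
      unfolding abs_crit_pow y_def using p by (intro powr_le_one_plus) auto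
    then have 1: "lam * \<bar>crit_pow p t\<bar> \<le> lam * (1 + y)" using lam by (rule mult_left_mono)
    have "\<bar>t\<bar> powr (s - 1) \<le> 1 + y"
      unfolding y_def using s by (intro powr_le_one_plus) auto
    then have "1 + \<bar>t\<bar> powr (s - 1) \<le> 2 * (1 + y)" using y by simp
    then have "C * (1 + \<bar>t\<bar> powr (s - 1)) \<le> C * (2 * (1 + y))" using C by (rule mult_left_mono)
    then have "\<bar>g x t\<bar> \<le> C * (2 * (1 + y))" using g_bound[OF x, of t] by linarith
    then have 2: "mu * \<bar>g x t\<bar> \<le> mu * (C * (2 * (1 + y)))" using mu by (rule mult_left_mono)
    have "\<bar>k x t\<bar> \<le> lam * \<bar>crit_pow p t\<bar> + mu * \<bar>g x t\<bar>"
      unfolding k_def using abs_triangle_ineq[of "lam * crit_pow p t" "mu * g x t"] lam mu by (simp add: abs_mult)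
    also have "\<dots> \<le> lam * (1 + y) + mu * (C * (2 * (1 + y)))" using 1 2 by (rule add_mono)
    also have "\<dots> = (lam + 2 * mu * C) * (1 + y)" by (simp add: algebra_simps)
    finally show ?thesis unfolding y_def .
  qed
  show "(\<lambda>x. K x t) \<in> borel_measurable (lebesgue_on \<Omega>)" for t
    unfolding K_def using G_meas[of t] by measurable
  show "(K x has_real_derivative k x t) (at t)" if "x \<in> \<Omega>" for x t
    unfolding K_def k_def using p by (intro DERIV_add DERIV_cmult crit_pow_primitive G_deriv that) auto
  show "K x 0 = 0" for x using p by (simp add: K_def G_0)
qed (rule sobolev)

lemma G_comp_integrable:
  assumes U: "U \<in> h01 \<Omega>"
  shows "integrable kir.M (\<lambda>x. G x (kir.fn U x))"
    and "\<bar>LINT x|kir.M. G x (kir.fn U x)\<bar> \<le> 4 * C * (measure kir.M \<Omega> + \<sigma>) * (1 + norm (fst U) ^ 4)"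
proof -
  have bi: "integrable kir.M (\<lambda>x. 4 * C * (1 + \<bar>kir.fn U x\<bar> powr q))" using kir.fn_int[OF U] by simp
  have G_cont: "continuous_on UNIV (G x)" if "x \<in> \<Omega>" for x
    using G_deriv[OF that] by (intro DERIV_continuous_on) (auto intro: has_field_derivative_at_within)
  have bound: "AE x in kir.M. norm (G x (kir.fn U x)) \<le> 4 * C * (1 + \<bar>kir.fn U x\<bar> powr q)"
    using G_bound by (intro AE_I2) simp
  have m: "(\<lambda>x. G x (kir.fn U x)) \<in> borel_measurable kir.M"
    by (rule caratheodory_measurable[where k=G, OF G_meas]) (simp_all add: G_cont)
  show "integrable kir.M (\<lambda>x. G x (kir.fn U x))"
    by (rule Bochner_Integration.integrable_bound[OF bi m]) (rule eventually_mono[OF bound], unfold real_norm_def, linarith)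
  have "\<bar>LINT x|kir.M. G x (kir.fn U x)\<bar> \<le> (LINT x|kir.M. 4 * C * (1 + \<bar>kir.fn U x\<bar> powr q))"
    using Bochner_Integration.integral_norm_bound_integral[OF \<open>integrable kir.M (\<lambda>x. G x (kir.fn U x))\<close> bi] G_bound by simp
  also have "\<dots> = 4 * C * (measure kir.M \<Omega> + I q U)" using kir.fn_int[OF U] by (simp add: I_def)
  also have "\<dots> \<le> 4 * C * ((measure kir.M \<Omega> + \<sigma>) * (1 + norm (fst U) ^ 4))"
  proof (rule mult_left_mono)
    have "I q U \<le> \<sigma> * (1 + norm (fst U) ^ 4)"
      using sobolev[OF U] mult_left_mono[OF powr_q_le[OF norm_ge_zero] \<sigma>] unfolding I_def by (rule order_trans)
    moreover have "measure kir.M \<Omega> \<le> measure kir.M \<Omega> * (1 + norm (fst U) ^ 4)"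
      by (simp add: mult_le_cancel_left1 distrib_left)
    ultimately show "measure kir.M \<Omega> + I q U \<le> (measure kir.M \<Omega> + \<sigma>) * (1 + norm (fst U) ^ 4)"
      unfolding distrib_right by (rule add_mono[rotated])
  qed (use C in simp)
  finally show "\<bar>LINT x|kir.M. G x (kir.fn U x)\<bar> \<le> 4 * C * (measure kir.M \<Omega> + \<sigma>) * (1 + norm (fst U) ^ 4)"
    by (simp only: mult.assoc)
qed

text \<open>The energies differ by \<open>mu\<close> times the integral of \<open>G\<close>, whose
  growth of order \<open>q\<close> becomes \<open>1 + norm (fst U) ^ 4\<close> through Sobolev's
  inequality.\<close>

lemma J_perturbation:
  assumes U: "U \<in> h01 \<Omega>"
  shows "\<bar>kir.J U - J0 lam U\<bar> \<le> mu * (4 * C * (measure kir.M \<Omega> + \<sigma>)) * (1 + norm (fst U) ^ 4)"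
proof -
  obtain Cp where "integrable kir.M (\<lambda>x. \<bar>kir.fn U x\<bar> powr p)"
    using sobolev_h01_subcritical[OF dim q(1) \<sigma> sobolev, of p] p U by auto
  then have "(LINT x|kir.M. kir.F x (kir.fn U x)) = I q U / q + lam * (I p U / p) + mu * (LINT x|kir.M. G x (kir.fn U x))"
    using G_comp_integrable(1)[OF U] kir.fn_int[OF U] by (simp add: kir.F_def K_def I_def)
  then have "kir.J U - J0 lam U = - mu * (LINT x|kir.M. G x (kir.fn U x))"
    by (simp add: kir.J_def J0_def)
  then have "\<bar>kir.J U - J0 lam U\<bar> = mu * \<bar>LINT x|kir.M. G x (kir.fn U x)\<bar>" using mu by (simp add: abs_mult)
  also have "\<dots> \<le> mu * (4 * C * (measure kir.M \<Omega> + \<sigma>) * (1 + norm (fst U) ^ 4))"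
    using G_comp_integrable(2)[OF U] mu by (rule mult_left_mono)
  finally show ?thesis by (simp only: mult.assoc)
qed

text \<open>The pairing with the whole nonlinearity splits into three integrals because each
  integrand is integrable by itself under its growth bound.\<close>

lemma critical_point_weak_solution:
  assumes U: "U \<in> h01 \<Omega>" "kir.D U = 0"
  shows "weak_solution \<Omega> a b p lam mu g (kir.fn U)"
  unfolding weak_solution_def
proof (intro conjI ballI)
  show "kir.fn U \<in> H01 \<Omega>" by (rule h01_imp_H01[OF U(1)])
  fix v assume v: "v \<in> H01 \<Omega>"
  have vm: "v \<in> borel_measurable kir.M" using v by (simp add: H01_def H1_def L2_def)
  obtain Z where Z: "Z \<in> h01 \<Omega>" "AE x in kir.M. kir.fn Z x = v x" using kir.critical_point_weak_form(3)[OF U v] by blast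
  have vi: "integrable kir.M (\<lambda>x. \<bar>v x\<bar> powr q)"
    by (rule integrable_cong_AE_imp[OF kir.fn_int[OF Z(1)]]) (use vm Z(2) in \<open>auto elim: eventually_mono\<close>)
  have cm: "(\<lambda>x. crit_pow r (kir.fn U x)) \<in> borel_measurable kir.M" if "r > 2" for r
    using measurable_compose[OF kir.fn_meas borel_measurable_continuous_onI[OF continuous_crit_pow[OF that]]] .
  have q1: "q > 1" using q by simp
  have "integrable kir.M (\<lambda>x. crit_pow q (kir.fn U x) * v x)"
    by (rule subcritical_growth_integrable[OF q1 _ cm[OF q(2)] vm kir.fn_int[OF U(1)] vi, where C=1])
      (simp_all add: abs_crit_pow)
  moreover have "integrable kir.M (\<lambda>x. crit_pow p (kir.fn U x) * v x)"
    by (rule subcritical_growth_integrable[OF q1 _ cm[OF p(1)] vm kir.fn_int[OF U(1)] vi, where C=1])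
      (use p in \<open>auto simp: abs_crit_pow intro: powr_le_one_plus\<close>)
  moreover have "integrable kir.M (\<lambda>x. g x (kir.fn U x) * v x)"
  proof (rule subcritical_growth_integrable[OF q1 _ _ vm kir.fn_int[OF U(1)] vi, where C="2 * C"])
    show "(\<lambda>x. g x (kir.fn U x)) \<in> borel_measurable kir.M"
      by (rule caratheodory_measurable[where k=g, OF g_meas]) (simp_all add: g_cont)
    fix x assume x: "x \<in> \<Omega>"
    have "\<bar>kir.fn U x\<bar> powr (s - 1) \<le> 1 + \<bar>kir.fn U x\<bar> powr (q - 1)" using s by (intro powr_le_one_plus) auto
    then have "1 + \<bar>kir.fn U x\<bar> powr (s - 1) \<le> 2 * (1 + \<bar>kir.fn U x\<bar> powr (q - 1))"
      using powr_ge_zero[of "\<bar>kir.fn U x\<bar>" "q - 1"] unfolding distrib_left by linarith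
    then have "C * (1 + \<bar>kir.fn U x\<bar> powr (s - 1)) \<le> C * (2 * (1 + \<bar>kir.fn U x\<bar> powr (q - 1)))" using C by (rule mult_left_mono)
    then show "\<bar>g x (kir.fn U x)\<bar> \<le> 2 * C * (1 + \<bar>kir.fn U x\<bar> powr (q - 1))"
      using g_bound[OF x, of "kir.fn U x"] unfolding mult.assoc[of 2 C] mult.left_commute[of C 2] by linarith
  qed (use C in simp)
  ultimately have "(LINT x|kir.M. kir.f x (kir.fn U x) * v x) = (LINT x|kir.M. crit_pow q (kir.fn U x) * v x) +
      lam * (LINT x|kir.M. crit_pow p (kir.fn U x) * v x) + mu * (LINT x|kir.M. g x (kir.fn U x) * v x)"
    by (simp add: kir.f_def k_def distrib_right mult.assoc)
  then show "(a + b * (H01_norm \<Omega> (kir.fn U))\<^sup>2) * (LINT x|kir.M. weak_gradient \<Omega> (kir.fn U) x \<bullet> weak_gradient \<Omega> v x) =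
      (LINT x|kir.M. \<bar>kir.fn U x\<bar> powr (crit_exp DIM('a) - 2) * kir.fn U x * v x) +
      lam * (LINT x|kir.M. \<bar>kir.fn U x\<bar> powr (p - 2) * kir.fn U x * v x) +
      mu * (LINT x|kir.M. g x (kir.fn U x) * v x)"
    using kir.critical_point_weak_form(1)[OF U v] by (simp add: crit_pow_def q(1))
qed

end

context unperturbed_problem begin

text \<open>For small \<open>mu\<close> the energy stays within \<open>\<delta> * W\<close> of
  \<open>J0\<close> on the ball of radius \<open>norm (fst E)\<close>, and its coercivity constant
  drops from \<open>e\<close> to \<open>e / 2\<close> at most. The final norm bound involves
  \<open>e\<close>, \<open>K0\<close> and \<open>T\<close> only and hence not \<open>g\<close>, on
  which the threshold \<open>mstar\<close> depends.\<close>

lemma three_weak_solutions: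
  assumes g: "g \<in> class_A \<Omega>" and lam: "lam \<ge> 0"
    and coercive: "e > 0" "\<And>U. U \<in> h01 \<Omega> \<Longrightarrow> e * norm (fst U) ^ 4 - K0 \<le> J0 lam U"
    and \<rho>: "\<rho> > 0" "\<kappa> > 0" "\<And>U. U \<in> h01 \<Omega> \<Longrightarrow> norm (fst U) \<le> \<rho> \<Longrightarrow> \<kappa> * (norm (fst U))\<^sup>2 \<le> J0 lam U"
    and E: "E \<in> h01 \<Omega>" "\<rho> < norm (fst E)" "J0 lam E < 0" "\<And>t. t \<in> {0..1} \<Longrightarrow> J0 lam (t *\<^sub>R E) \<le> T"
  shows "\<exists>mstar>0. \<forall>mu\<in>{0..mstar}. \<exists>U1\<in>h01 \<Omega>. \<exists>U2\<in>h01 \<Omega>. \<exists>U3\<in>h01 \<Omega>. U1 \<noteq> U2 \<and> U1 \<noteq> U3 \<and> U2 \<noteq> U3 \<and>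
    (\<forall>U\<in>{U1, U2, U3}. weak_solution \<Omega> a b p lam mu g (rep_l2 (snd U)) \<and> e / 2 * norm (fst U) ^ 4 \<le> K0 + T + 2)"
proof -
  obtain g' C s where s: "1 < s" "s < q" and C: "C \<ge> 0"
    and g': "\<And>t. (\<lambda>x. g' x t) \<in> borel_measurable (lebesgue_on \<Omega>)"
      "\<And>x. x \<in> \<Omega> \<Longrightarrow> continuous_on UNIV (g' x)"
      "\<And>x t. x \<in> \<Omega> \<Longrightarrow> \<bar>g' x t\<bar> \<le> C * (1 + \<bar>t\<bar> powr (s - 1))"
    and gg': "AE x in lebesgue_on \<Omega>. g' x = g x"
    using class_A_representative[OF g] unfolding q(1) by blast
  define W where "W = 1 + norm (fst E) ^ 4"
  define Cg where "Cg = 4 * C * (measure (lebesgue_on \<Omega>) \<Omega> + \<sigma>)"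
  \<comment> \<open>The four bounds serve, in turn, the additive constants, the coercivity, the
    barrier on the sphere and the gap between \<open>E\<close> and the ball inside.\<close>
  define \<delta>0 where "\<delta>0 = min (min 1 (e / 2)) (min (\<kappa> * \<rho>\<^sup>2 / 2) (- J0 lam E / 3))"
  have W: "W \<ge> 1" by (simp add: W_def)
  have Cg: "Cg \<ge> 0" using C \<sigma> by (simp add: Cg_def)
  have \<delta>0: "\<delta>0 > 0" using coercive(1) \<rho> E(3) by (simp add: \<delta>0_def)
  \<comment> \<open>Ensures \<open>mu * Cg * W \<le> \<delta>0\<close>; the summand \<open>1\<close>
    keeps the denominator positive.\<close>
  define mstar where "mstar = \<delta>0 / (W * (Cg + 1))"
  have "mstar > 0" using \<delta>0 W Cg by (simp add: mstar_def)
  moreover have "\<exists>U1\<in>h01 \<Omega>. \<exists>U2\<in>h01 \<Omega>. \<exists>U3\<in>h01 \<Omega>. U1 \<noteq> U2 \<and> U1 \<noteq> U3 \<and> U2 \<noteq> U3 \<and>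
    (\<forall>U\<in>{U1, U2, U3}. weak_solution \<Omega> a b p lam mu g (rep_l2 (snd U)) \<and> e / 2 * norm (fst U) ^ 4 \<le> K0 + T + 2)"
    if mu: "mu \<in> {0..mstar}" for mu
  proof -
    interpret P: perturbed_problem \<Omega> a b p q \<sigma> c0 lam mu C s g'
      by unfold_locales (use mu lam s C g' in auto)
    define \<delta> where "\<delta> = mu * Cg"
    have \<delta>: "0 \<le> \<delta>" using mu Cg by (simp add: \<delta>_def)
    have "mu * (W * (Cg + 1)) \<le> \<delta>0" using mu W Cg by (simp add: mstar_def pos_le_divide_eq)
    moreover have "mu * (W * Cg) \<le> mu * (W * (Cg + 1))" using mu W by (intro mult_left_mono) auto
    ultimately have \<delta>W: "\<delta> * W \<le> \<delta>0" by (simp add: \<delta>_def mult.commute mult.left_commute)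
    have \<delta>1: "\<delta> \<le> \<delta> * W" using \<delta> W by (simp add: mult_le_cancel_left1)
    have J: "\<bar>P.kir.J U - J0 lam U\<bar> \<le> \<delta> * (1 + norm (fst U) ^ 4)" if "U \<in> h01 \<Omega>" for U
      using P.J_perturbation[OF that] by (simp add: \<delta>_def Cg_def)
    have JW: "\<bar>P.kir.J U - J0 lam U\<bar> \<le> \<delta> * W" if U: "U \<in> h01 \<Omega>" "norm (fst U) \<le> norm (fst E)" for U
    proof -
      have "1 + norm (fst U) ^ 4 \<le> W" unfolding W_def using U(2) by (intro add_left_mono power_mono) auto
      then have "\<delta> * (1 + norm (fst U) ^ 4) \<le> \<delta> * W" using \<delta> by (rule mult_left_mono)
      then show ?thesis using J[OF U(1)] by linarith
    qed
    have b: "\<delta> * W \<le> 1" "\<delta> * W \<le> e / 2" "\<delta> * W \<le> \<kappa> * \<rho>\<^sup>2 / 2" "\<delta> * W \<le> - J0 lam E / 3"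
      using \<delta>W by (auto simp: \<delta>0_def)
    have coer: "e / 2 * norm (fst U) ^ 4 - (K0 + 1) \<le> P.kir.J U" if U: "U \<in> h01 \<Omega>" for U
    proof -
      have "\<delta> * norm (fst U) ^ 4 \<le> e / 2 * norm (fst U) ^ 4" using b(2) \<delta>1 by (intro mult_right_mono) auto
      moreover have "\<delta> * (1 + norm (fst U) ^ 4) = \<delta> + \<delta> * norm (fst U) ^ 4" by (simp add: distrib_left)
      moreover have "e * norm (fst U) ^ 4 = e / 2 * norm (fst U) ^ 4 + e / 2 * norm (fst U) ^ 4" by simp
      ultimately show ?thesis using J[OF U] coercive(2)[OF U] b(1) \<delta>1 by linarith
    qed
    have path: "P.kir.J (t *\<^sub>R E) \<le> T + 1" if t: "t \<in> {0..1}" for t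
    proof -
      have "t *\<^sub>R E \<in> h01 \<Omega>" by (rule subspace_scale[OF subspace_h01 E(1)])
      moreover have "norm (fst (t *\<^sub>R E)) \<le> norm (fst E)" using t by (simp add: mult_left_le_one_le)
      ultimately have "\<bar>P.kir.J (t *\<^sub>R E) - J0 lam (t *\<^sub>R E)\<bar> \<le> \<delta> * W" by (rule JW)
      then show ?thesis using E(4)[OF t] b(1) by linarith
    qed
    have "\<exists>U1\<in>h01 \<Omega>. \<exists>U2\<in>h01 \<Omega>. \<exists>U3\<in>h01 \<Omega>. P.kir.D U1 = 0 \<and> P.kir.D U2 = 0 \<and> P.kir.D U3 = 0 \<and>
      P.kir.J U1 < P.kir.J U2 \<and> P.kir.J U2 < P.kir.J U3 \<and> P.kir.J U3 \<le> T + 1"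
    proof (rule P.kir.three_solutions[OF gap half_gt_zero[OF coercive(1)] coer E(1,2) \<rho>(1) _ _ _ _ path])
      show "0 < \<kappa> * \<rho>\<^sup>2 / 2" using \<rho> by simp
      show "\<kappa> * \<rho>\<^sup>2 / 2 \<le> P.kir.J U" if U: "U \<in> h01 \<Omega>" "norm (fst U) = \<rho>" for U
        using JW[OF U(1)] \<rho>(3)[OF U(1)] U(2) E(2) b(3) by simp
      \<comment> \<open>The separating level is \<open>- (\<delta> * W)\<close>: inside the sphere
        \<open>J0\<close> is nonnegative, so the energy is at least this, while at \<open>E\<close>
        it is at most two thirds of \<open>J0 lam E\<close> and \<open>- (\<delta> * W)\<close> is
        at least one third of it.\<close>
      show "P.kir.J E < - (\<delta> * W)" using JW[OF E(1)] E(3) b(4) by simp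
      show "- (\<delta> * W) \<le> P.kir.J U" if U: "U \<in> h01 \<Omega>" "norm (fst U) \<le> \<rho>" for U
      proof -
        have "0 \<le> \<kappa> * (norm (fst U))\<^sup>2" using \<rho>(2) by simp
        then show ?thesis using JW[OF U(1)] \<rho>(3)[OF U] U(2) E(2) by linarith
      qed
    qed
    then obtain U1 U2 U3 where U: "U1 \<in> h01 \<Omega>" "U2 \<in> h01 \<Omega>" "U3 \<in> h01 \<Omega>"
      and D: "P.kir.D U1 = 0" "P.kir.D U2 = 0" "P.kir.D U3 = 0"
      and lt: "P.kir.J U1 < P.kir.J U2" "P.kir.J U2 < P.kir.J U3" "P.kir.J U3 \<le> T + 1" by blast
    have sol: "weak_solution \<Omega> a b p lam mu g (rep_l2 (snd V)) \<and> e / 2 * norm (fst V) ^ 4 \<le> K0 + T + 2"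
      if V: "V \<in> h01 \<Omega>" "P.kir.D V = 0" "P.kir.J V \<le> T + 1" for V
    proof
      show "e / 2 * norm (fst V) ^ 4 \<le> K0 + T + 2" using coer[OF V(1)] V(3) by linarith
      \<comment> \<open>Return from the representative to the original \<open>g\<close>, with which
        it agrees for almost every \<open>x\<close>.\<close>
      have eq: "(LINT x|lebesgue_on \<Omega>. g' x (rep_l2 (snd V) x) * v x) = (LINT x|lebesgue_on \<Omega>. g x (rep_l2 (snd V) x) * v x)"
        if v: "v \<in> H01 \<Omega>" for v
      proof (rule integral_cong_AE')
        have "(\<lambda>x. g' x (rep_l2 (snd V) x)) \<in> borel_measurable (lebesgue_on \<Omega>)"
          by (rule caratheodory_measurable[where k=g', OF g'(1)]) (simp_all add: g'(2))
        moreover have "v \<in> borel_measurable (lebesgue_on \<Omega>)" using v by (simp add: H01_def H1_def L2_def)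
        ultimately show "(\<lambda>x. g' x (rep_l2 (snd V) x) * v x) \<in> borel_measurable (lebesgue_on \<Omega>)"
          by (rule borel_measurable_times)
        show "AE x in lebesgue_on \<Omega>. g' x (rep_l2 (snd V) x) * v x = g x (rep_l2 (snd V) x) * v x"
          using gg' by eventually_elim simp
      qed
      show "weak_solution \<Omega> a b p lam mu g (rep_l2 (snd V))"
        using P.critical_point_weak_solution[OF V(1,2)] eq unfolding weak_solution_def by simp
    qed
    have "sol3": "\<forall>V\<in>{U1, U2, U3}. weak_solution \<Omega> a b p lam mu g (rep_l2 (snd V)) \<and> e / 2 * norm (fst V) ^ 4 \<le> K0 + T + 2"
      using sol[OF U(1) D(1)] sol[OF U(2) D(2)] sol[OF U(3) D(3)] lt by simp
    have "U1 \<noteq> U2 \<and> U1 \<noteq> U3 \<and> U2 \<noteq> U3" using lt by auto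
    then show ?thesis using U sol3 by blast
  qed
  ultimately show ?thesis by (intro exI[of _ mstar] conjI ballI)
qed

end

theorem theorem1p3:
  fixes \<Omega> :: "'a::euclidean_space set" and a b p :: real
  assumes "DIM('a) \<ge> 4"
    and "open \<Omega>" and "bounded \<Omega>" and "connected \<Omega>" and "\<Omega> \<noteq> {}"
    and "a > 0" and "b > 0"
    and "a powr ((real DIM('a) - 4) / 2) * b > PS_const \<Omega>"
    and "2 < p" and "p < crit_exp DIM('a)"
  shows "\<exists>lstar>0. \<forall>\<alpha> \<beta>. \<alpha> \<le> \<beta> \<and> {\<alpha>..\<beta>} \<subseteq> {lstar<..} \<longrightarrow>
    (\<exists>r>0. \<forall>lam\<in>{\<alpha>..\<beta>}. \<forall>g\<in>class_A \<Omega>. \<exists>mstar>0. \<forall>mu\<in>{0..mstar}.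
      \<exists>u1 u2 u3.
        \<not> ae_eq \<Omega> u1 u2 \<and> \<not> ae_eq \<Omega> u1 u3 \<and> \<not> ae_eq \<Omega> u2 u3 \<and>
        (\<forall>u\<in>{u1, u2, u3}. weak_solution \<Omega> a b p lam mu g u \<and> H01_norm \<Omega> u < r))"
proof -
  interpret bounded_domain \<Omega> by unfold_locales fact+
  define q where "q = crit_exp DIM('a)"
  define S where "S = sobolev_const \<Omega>"
  define \<sigma> where "\<sigma> = S powr (- q / 2)"
  have dim: "DIM('a) \<ge> 3" "real DIM('a) \<ge> 4" using assms(1) by auto
  have q2: "q > 2" using dim(2) by (simp add: q_def crit_exp_def field_simps)
  have S: "S > 0" unfolding S_def by (rule sobolev_const_h01(1)[OF assms(5) dim(1)])
  have PS: "a powr ((real DIM('a) - 4) / 2) * b >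
      (if real DIM('a) = 4 then 1 / S\<^sup>2
       else 2 * (real DIM('a) - 4) powr ((real DIM('a) - 4) / 2) /
         ((real DIM('a) - 2) powr ((real DIM('a) - 2) / 2) * S powr (real DIM('a) / 2)))"
    using assms(6,8) by (simp add: PS_const_def Let_def S_def split: if_splits)
  note gap = ps_condition_imp_gap[OF assms(6,7) S dim(2) PS, folded crit_exp_def q_def, folded \<sigma>_def]
  obtain c0 where c0: "c0 > 0" "\<And>x. x \<ge> 0 \<Longrightarrow> c0 \<le> a + b * x - \<sigma> * x powr ((q - 2) / 2)"
    using gap(1) by (elim exE conjE) simp
  have sob: "(LINT x|lebesgue_on \<Omega>. \<bar>rep_l2 (snd U) x\<bar> powr q) \<le> \<sigma> * norm (fst U) powr q" if "U \<in> h01 \<Omega>" for U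
    using sobolev_const_h01(2)[OF assms(5) dim(1) that] by (simp add: \<sigma>_def S_def q_def)
  have \<sigma>: "\<sigma> \<ge> 0" by (simp add: \<sigma>_def)
  interpret P: unperturbed_problem \<Omega> a b p q \<sigma> c0
    by unfold_locales (use q_def q2 dim assms(6,7,9,10) \<sigma> sob gap(2) c0 in auto)
  obtain Cp where Cp: "Cp \<ge> 0" "\<And>U. U \<in> h01 \<Omega> \<Longrightarrow> integrable (lebesgue_on \<Omega>) (\<lambda>x. \<bar>rep_l2 (snd U) x\<bar> powr p)"
      "\<And>U. U \<in> h01 \<Omega> \<Longrightarrow> P.I p U \<le> Cp * norm (fst U) powr p"
    using sobolev_h01_subcritical[OF dim(1) q_def \<sigma> sob, of p] P.p unfolding P.I_def by auto
  obtain E where E: "E \<in> h01 \<Omega>" "\<not> ae_eq \<Omega> (rep_l2 (snd E)) (\<lambda>x. 0)"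
    using exists_nonzero_h01[OF assms(5)] by blast
  define N where "N = norm (fst E)"
  have Ip: "P.I p E > 0"
  proof (rule ccontr)
    assume "\<not> P.I p E > 0"
    then have "P.I p E = 0" using P.I_nonneg[of p E] by simp
    then have "AE x in lebesgue_on \<Omega>. \<bar>rep_l2 (snd E) x\<bar> powr p = 0"
      using integral_nonneg_eq_0_iff_AE[OF Cp(2)[OF E(1)]] by (simp add: P.I_def)
    then show False using E(2) by (simp add: ae_eq_def)
  qed
  have N: "N > 0"
  proof (rule ccontr)
    assume "\<not> N > 0"
    then have "norm (fst E) = 0" by (simp add: N_def)
    then show False using Cp(3)[OF E(1)] Ip by simp
  qed
  \<comment> \<open>The Kirchhoff part of the energy at \<open>E\<close>. The power terms only lower
    the energy, so this bounds \<open>J0\<close> on the segment from \<open>0\<close> to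
    \<open>E\<close> for every nonnegative \<lambda>.\<close>
  define M0 where "M0 = a / 2 * N\<^sup>2 + b / 4 * N ^ 4"
  have M0: "M0 > 0" using N assms(6,7) by (simp add: M0_def add_pos_pos)
  \<comment> \<open>The value of \<lambda> at which \<open>lam * (P.I p E / p)\<close> equals
    \<open>M0\<close>; beyond it \<open>J0 lam E\<close> is negative even before the critical term
    is subtracted.\<close>
  define lstar where "lstar = p * M0 / P.I p E"
  have lstar: "lstar > 0" using M0 Ip assms(9) by (simp add: lstar_def)
  have main: "\<exists>r>0. \<forall>lam\<in>{\<alpha>..\<beta>}. \<forall>g\<in>class_A \<Omega>. \<exists>mstar>0. \<forall>mu\<in>{0..mstar}.
      \<exists>u1 u2 u3.
        \<not> ae_eq \<Omega> u1 u2 \<and> \<not> ae_eq \<Omega> u1 u3 \<and> \<not> ae_eq \<Omega> u2 u3 \<and>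
        (\<forall>u\<in>{u1, u2, u3}. weak_solution \<Omega> a b p lam mu g u \<and> H01_norm \<Omega> u < r)"
    if \<alpha>\<beta>: "\<alpha> \<le> \<beta> \<and> {\<alpha>..\<beta>} \<subseteq> {lstar<..}" for \<alpha> \<beta>
  proof -
    have \<alpha>: "\<alpha> > lstar" using \<alpha>\<beta> by auto
    have \<beta>: "\<beta> > 0" using \<alpha> \<alpha>\<beta> lstar by linarith
    \<comment> \<open>Since \<open>lam \<le> \<beta>\<close>, this coefficient bounds the
      subcritical term on the whole interval, so \<open>e\<close>, \<open>K0\<close> and
      \<open>\<rho>\<close> are uniform in \<lambda>.\<close>
    define Q where "Q = \<beta> * Cp / p"
    have Q: "Q \<ge> 0" using \<beta> Cp(1) assms(9) by (simp add: Q_def)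
    have sq: "\<sigma> / q \<ge> 0" using \<sigma> q2 by simp
    obtain e K0 where e: "e > 0"
      and K0: "\<And>t. t \<ge> 0 \<Longrightarrow> e * t ^ 4 - K0 \<le> b / 4 * t ^ 4 - \<sigma> / q * t powr q - Q * t powr p"
    proof -
      have "\<exists>e>0. \<exists>K0. \<forall>t\<ge>0. e * t ^ 4 - K0 \<le> b / 4 * t ^ 4 - \<sigma> / q * t powr q - Q * t powr p"
        by (rule quartic_coercivity[OF assms(7) sq Q]) (use P.p P.q4 q2 in auto)
      then show ?thesis using that by blast
    qed
    \<comment> \<open>Near \<open>0\<close> half of the quadratic term \<open>a / 2\<close> absorbs
      both powers and leaves \<open>a / 4\<close>; \<open>\<rho> < N\<close> puts \<open>E\<close>
      outside the sphere.\<close>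
    obtain \<rho> where \<rho>: "\<rho> > 0" "\<rho> < N" "\<And>t. t \<in> {0..\<rho>} \<Longrightarrow> \<sigma> / q * t powr q + Q * t powr p \<le> a / 4 * t\<^sup>2"
      using superquadratic_small[of "a / 4" p q "\<sigma> / q" Q N] assms(6) P.p q2 sq Q N by auto
    \<comment> \<open>If \<open>e / 2 * t^4 \<le> K0 + M0 + 2\<close>, then \<open>t \<le> 1\<close>
      or \<open>t \<le> t^4 \<le> 2 / e * |K0 + M0 + 2|\<close>; both bounds are below
      \<open>r\<close>.\<close>
    define r where "r = 2 + 2 / e * \<bar>K0 + M0 + 2\<bar>"
    have r: "r > 0" using e by (simp add: r_def add_pos_nonneg)
    have below: "a / 2 * (norm (fst U))\<^sup>2 + b / 4 * norm (fst U) ^ 4 - \<sigma> / q * norm (fst U) powr q - Q * norm (fst U) powr p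
        \<le> P.J0 lam U" if U: "U \<in> h01 \<Omega>" and lam: "lam \<in> {\<alpha>..\<beta>}" for U lam
    proof -
      have "P.I q U / q \<le> \<sigma> * norm (fst U) powr q / q"
        using sob[OF U] q2 unfolding P.I_def by (intro divide_right_mono) auto
      moreover have "lam * (P.I p U / p) \<le> \<beta> * (Cp * norm (fst U) powr p / p)"
        using Cp(3)[OF U] lam \<beta> P.I_nonneg[of p U] assms(9) by (intro mult_mono divide_right_mono) auto
      ultimately show ?thesis unfolding P.J0_def Q_def by simp
    qed
    have solutions: "\<exists>mstar>0. \<forall>mu\<in>{0..mstar}. \<exists>u1 u2 u3.
        \<not> ae_eq \<Omega> u1 u2 \<and> \<not> ae_eq \<Omega> u1 u3 \<and> \<not> ae_eq \<Omega> u2 u3 \<and>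
        (\<forall>u\<in>{u1, u2, u3}. weak_solution \<Omega> a b p lam mu g u \<and> H01_norm \<Omega> u < r)"
      if lam: "lam \<in> {\<alpha>..\<beta>}" and g: "g \<in> class_A \<Omega>" for lam g
    proof -
      have lam0: "lam \<ge> 0" and lam_gt: "lam > lstar" using lam \<alpha> lstar by auto
      have "\<exists>mstar>0. \<forall>mu\<in>{0..mstar}. \<exists>U1\<in>h01 \<Omega>. \<exists>U2\<in>h01 \<Omega>. \<exists>U3\<in>h01 \<Omega>. U1 \<noteq> U2 \<and> U1 \<noteq> U3 \<and> U2 \<noteq> U3 \<and>
        (\<forall>U\<in>{U1, U2, U3}. weak_solution \<Omega> a b p lam mu g (rep_l2 (snd U)) \<and> e / 2 * norm (fst U) ^ 4 \<le> K0 + M0 + 2)"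
      proof (rule P.three_weak_solutions[OF g lam0 e _ \<rho>(1) _ _ E(1)])
        show "e * norm (fst U) ^ 4 - K0 \<le> P.J0 lam U" if U: "U \<in> h01 \<Omega>" for U
        proof -
          have "0 \<le> a / 2 * (norm (fst U))\<^sup>2" using assms(6) by simp
          then show ?thesis using below[OF U lam] K0[of "norm (fst U)"] by simp
        qed
        show "0 < a / 4" using assms(6) by simp
        show "a / 4 * (norm (fst U))\<^sup>2 \<le> P.J0 lam U" if U: "U \<in> h01 \<Omega>" "norm (fst U) \<le> \<rho>" for U
        proof -
          have "0 \<le> b / 4 * norm (fst U) ^ 4" using assms(7) by simp
          then show ?thesis using below[OF U(1) lam] \<rho>(3)[of "norm (fst U)"] U(2) by simp
        qed
        show "\<rho> < norm (fst E)" using \<rho>(2) by (simp add: N_def)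
        have Iq: "P.I q V / q \<ge> 0" for V using P.I_nonneg[of q V] q2 by simp
        have "lstar * (P.I p E / p) < lam * (P.I p E / p)"
          using lam_gt Ip assms(9) by (intro mult_strict_right_mono) auto
        moreover have "lstar * (P.I p E / p) = M0" using Ip assms(9) by (simp add: lstar_def)
        ultimately show "P.J0 lam E < 0" using Iq[of E] unfolding P.J0_def M0_def N_def by linarith
        show "P.J0 lam (t *\<^sub>R E) \<le> M0" if t: "t \<in> {0..1}" for t
        proof -
          have tN: "norm (fst (t *\<^sub>R E)) \<le> N" using t by (simp add: N_def mult_left_le_one_le)
          have "a / 2 * (norm (fst (t *\<^sub>R E)))\<^sup>2 \<le> a / 2 * N\<^sup>2"
            using tN assms(6) by (intro mult_left_mono power_mono) auto
          moreover have "b / 4 * norm (fst (t *\<^sub>R E)) ^ 4 \<le> b / 4 * N ^ 4"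
            using tN assms(7) by (intro mult_left_mono power_mono) auto
          moreover have "lam * (P.I p (t *\<^sub>R E) / p) \<ge> 0" using lam0 P.I_nonneg[of p "t *\<^sub>R E"] assms(9) by simp
          ultimately show ?thesis using Iq[of "t *\<^sub>R E"] unfolding P.J0_def M0_def by linarith
        qed
      qed
      then obtain mstar where mstar: "mstar > 0" "\<forall>mu\<in>{0..mstar}. \<exists>U1\<in>h01 \<Omega>. \<exists>U2\<in>h01 \<Omega>. \<exists>U3\<in>h01 \<Omega>. U1 \<noteq> U2 \<and> U1 \<noteq> U3 \<and> U2 \<noteq> U3 \<and>
        (\<forall>U\<in>{U1, U2, U3}. weak_solution \<Omega> a b p lam mu g (rep_l2 (snd U)) \<and> e / 2 * norm (fst U) ^ 4 \<le> K0 + M0 + 2)"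
        by (elim exE conjE) (rule that)
      have norm_lt: "H01_norm \<Omega> (rep_l2 (snd U)) < r"
        if U: "U \<in> h01 \<Omega>" "e / 2 * norm (fst U) ^ 4 \<le> K0 + M0 + 2" for U
      proof (cases "norm (fst U) \<le> 1")
        case True
        have "0 \<le> 2 / e * \<bar>K0 + M0 + 2\<bar>" using e by simp
        then show ?thesis using True unfolding H01_norm_rep[OF U(1)] r_def by linarith
      next
        case False
        then have "norm (fst U) \<le> norm (fst U) ^ 4" by (intro power4_ge) simp
        also have "\<dots> = 2 / e * (e / 2 * norm (fst U) ^ 4)" using e by simp
        also have "\<dots> \<le> 2 / e * \<bar>K0 + M0 + 2\<bar>"
        proof (rule mult_left_mono)
          show "e / 2 * norm (fst U) ^ 4 \<le> \<bar>K0 + M0 + 2\<bar>" using U(2) by linarith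
        qed (use e in simp)
        finally show ?thesis unfolding H01_norm_rep[OF U(1)] r_def by linarith
      qed
      have three: "\<exists>u1 u2 u3. \<not> ae_eq \<Omega> u1 u2 \<and> \<not> ae_eq \<Omega> u1 u3 \<and> \<not> ae_eq \<Omega> u2 u3 \<and>
        (\<forall>u\<in>{u1, u2, u3}. weak_solution \<Omega> a b p lam mu g u \<and> H01_norm \<Omega> u < r)" if mu: "mu \<in> {0..mstar}" for mu
      proof -
        obtain U1 U2 U3 where U: "U1 \<in> h01 \<Omega>" "U2 \<in> h01 \<Omega>" "U3 \<in> h01 \<Omega>" "U1 \<noteq> U2" "U1 \<noteq> U3" "U2 \<noteq> U3"
          and sol: "\<forall>U\<in>{U1, U2, U3}. weak_solution \<Omega> a b p lam mu g (rep_l2 (snd U)) \<and> e / 2 * norm (fst U) ^ 4 \<le> K0 + M0 + 2"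
          using mstar(2)[rule_format, OF mu] by (elim bexE conjE) (rule that)
        show ?thesis
        proof (rule exI[of _ "rep_l2 (snd U1)"], rule exI[of _ "rep_l2 (snd U2)"], rule exI[of _ "rep_l2 (snd U3)"], intro conjI)
          show "\<not> ae_eq \<Omega> (rep_l2 (snd U1)) (rep_l2 (snd U2))" using h01_eqI[OF U(1,2)] U(4) by blast
          show "\<not> ae_eq \<Omega> (rep_l2 (snd U1)) (rep_l2 (snd U3))" using h01_eqI[OF U(1,3)] U(5) by blast
          show "\<not> ae_eq \<Omega> (rep_l2 (snd U2)) (rep_l2 (snd U3))" using h01_eqI[OF U(2,3)] U(6) by blast
          show "\<forall>u\<in>{rep_l2 (snd U1), rep_l2 (snd U2), rep_l2 (snd U3)}.
              weak_solution \<Omega> a b p lam mu g u \<and> H01_norm \<Omega> u < r"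
            using sol norm_lt[OF U(1)] norm_lt[OF U(2)] norm_lt[OF U(3)] by simp
        qed
      qed
      show ?thesis by (rule exI[of _ mstar], intro conjI ballI mstar(1)) (rule three)
    qed
    show ?thesis by (rule exI[of _ r], intro conjI ballI r) (rule solutions)
  qed
  show ?thesis
    by (rule exI[of _ lstar], intro conjI allI impI lstar) (rule main)
qed

end
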